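(* Let $N\ge3$, let $V:\mathbb{R}^N\to\mathbb{R}$ and $W(x):=V(x)|x|$ satisfy $V\in L^{r_1}(\mathbb{R}^N)$, $W\in L^{r_2}(\mathbb{R}^N)$ with $\frac N2<r_1<+\infty$ and $N<r_2<+\infty$, and assume $$\inf\Big\{\int_{\mathbb{R}^N}(|\nabla\varphi|^2+V\varphi^2)\,dx:\ \varphi\in H^1(\mathbb{R}^N),\ \int_{\mathbb{R}^N}\varphi^2\,dx=1\Big\}<0.$$ Then there exists $\rho^*>0$ such that, if $0<\rho<\rho^*$, the problem $$-\Delta U+V(x)U=\lambda U+|U|^{2^*-2}U\ \text{ in }\mathbb{R}^N,\qquad \int_{\mathbb{R}^N}U^2\,dx=\rho^2,$$ has a solution $(U,\lambda)\in H^1(\mathbb{R}^N)\times\mathbb{R}$ such that $U$ is a local minimizer of $E$ on $\mathcal{M}_\rho$, with $E(U)<0$ and $\lambda<0$, and $U$ can be chosen to be strictly positive almost everywhere in $\mathbb{R}^N$. Moreover, for a possibly smaller threshold $\rho^*>0$, such local minimizer is a normalized ground state.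
   Context: $2^*:=\frac{2N}{N-2}$. The energy $E:H^1(\mathbb{R}^N)\to\mathbb{R}$ is $$E(U)=\frac12\int_{\mathbb{R}^N}|\nabla U|^2dx+\frac12\int_{\mathbb{R}^N}V(x)U^2dx-\frac1{2^*}\int_{\mathbb{R}^N}|U|^{2^*}dx,$$ and $\mathcal{M}_\rho=\{U\in H^1(\mathbb{R}^N):\int_{\mathbb{R}^N}U^2\,dx=\rho^2\}$. Solutions are understood in the weak sense; they correspond to critical points of $E$ constrained to $\mathcal{M}_\rho$, with $\lambda$ the Lagrange multiplier. A normalized ground state is a critical point $U_0$ of $E$ constrained to $\mathcal{M}_\rho$ such that $E(U_0)=\inf\{E(U):U\in\mathcal{M}_\rho,\ \nabla_{\mathcal{M}_\rho}E(U)=0\}$. *)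

theory Defs
  imports "HOL-Analysis.Analysis"
begin

text \<open>
  $\mathbb{R}^N$ is a Euclidean space \<open>'a\<close> with \<open>N = DIM('a)\<close>. Elements of
  $L^p$ and $H^1$ are represented by functions rather than by almost-everywhere classes; all
  integrals and norms below are invariant under changes on null sets.
\<close>

definition Lp :: "real \<Rightarrow> ('a::euclidean_space \<Rightarrow> 'b::euclidean_space) set" where
  "Lp p = {f \<in> borel_measurable lebesgue. integrable lebesgue (\<lambda>x. norm (f x) powr p)}"

primrec C_k :: "nat \<Rightarrow> ('a::euclidean_space \<Rightarrow> real) \<Rightarrow> bool" where
  "C_k 0 f \<longleftrightarrow> continuous_on UNIV f"
| "C_k (Suc k) f \<longleftrightarrow>
     (\<forall>x. f differentiable at x) \<and> (\<forall>b\<in>Basis. C_k k (\<lambda>x. frechet_derivative f (at x) b))"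

definition test_functions :: "('a::euclidean_space \<Rightarrow> real) set" where
  "test_functions = {\<phi>. (\<forall>k. C_k k \<phi>) \<and> compact (closure {x. \<phi> x \<noteq> 0})}"

definition has_weak_gradient :: "('a::euclidean_space \<Rightarrow> real) \<Rightarrow> ('a \<Rightarrow> 'a) \<Rightarrow> bool" where
  "has_weak_gradient u G \<longleftrightarrow>
     (\<forall>K. compact K \<longrightarrow> u absolutely_integrable_on K \<and> G absolutely_integrable_on K) \<and>
     (\<forall>\<phi>\<in>test_functions. \<forall>b\<in>Basis.
        (LINT x|lebesgue. u x * frechet_derivative \<phi> (at x) b) =
        - (LINT x|lebesgue. (G x \<bullet> b) * \<phi> x))"

definition H1 :: "('a::euclidean_space \<Rightarrow> real) set" where
  "H1 = {u \<in> Lp 2. \<exists>G\<in>Lp 2. has_weak_gradient u G}"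

text \<open>The weak gradient is unique only up to null sets; some representative is chosen.\<close>

definition weak_gradient :: "('a::euclidean_space \<Rightarrow> real) \<Rightarrow> 'a \<Rightarrow> 'a" where
  "weak_gradient u = (SOME G. has_weak_gradient u G)"

definition H1_norm :: "('a::euclidean_space \<Rightarrow> real) \<Rightarrow> real" where
  "H1_norm u = sqrt ((LINT x|lebesgue. (norm (weak_gradient u x))\<^sup>2) + (LINT x|lebesgue. (u x)\<^sup>2))"

definition sobolev_exponent :: "nat \<Rightarrow> real" where
  "sobolev_exponent N = 2 * real N / (real N - 2)"

definition energy :: "('a::euclidean_space \<Rightarrow> real) \<Rightarrow> ('a \<Rightarrow> real) \<Rightarrow> real" where
  "energy V U =
     1 / 2 * (LINT x|lebesgue. (norm (weak_gradient U x))\<^sup>2)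
     + 1 / 2 * (LINT x|lebesgue. V x * (U x)\<^sup>2)
     - 1 / sobolev_exponent DIM('a) * (LINT x|lebesgue. \<bar>U x\<bar> powr sobolev_exponent DIM('a))"

definition mass_sphere :: "real \<Rightarrow> ('a::euclidean_space \<Rightarrow> real) set" where
  "mass_sphere \<rho> = {U \<in> H1. (LINT x|lebesgue. (U x)\<^sup>2) = \<rho>\<^sup>2}"

text \<open>
  Weak solutions of $-\Delta U + V U = \lambda U + |U|^{2^*-2} U$, tested against all of $H^1$.
\<close>

definition weak_solution ::
  "('a::euclidean_space \<Rightarrow> real) \<Rightarrow> real \<Rightarrow> ('a \<Rightarrow> real) \<Rightarrow> bool" where
  "weak_solution V lam U \<longleftrightarrow> U \<in> H1 \<and>
     (\<forall>\<phi>\<in>H1.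
        (LINT x|lebesgue. weak_gradient U x \<bullet> weak_gradient \<phi> x)
        + (LINT x|lebesgue. V x * U x * \<phi> x) =
        lam * (LINT x|lebesgue. U x * \<phi> x)
        + (LINT x|lebesgue. \<bar>U x\<bar> powr (sobolev_exponent DIM('a) - 2) * U x * \<phi> x))"

definition local_minimizer ::
  "('a::euclidean_space \<Rightarrow> real) \<Rightarrow> real \<Rightarrow> ('a \<Rightarrow> real) \<Rightarrow> bool" where
  "local_minimizer V \<rho> U \<longleftrightarrow> U \<in> mass_sphere \<rho> \<and>
     (\<exists>\<delta>>0. \<forall>Z\<in>mass_sphere \<rho>. H1_norm (\<lambda>x. Z x - U x) < \<delta> \<longrightarrow> energy V U \<le> energy V Z)"

text \<open>
  \<open>L\<close> is the Frechet derivative at \<open>U\<close> of the energy on $H^1$. As $H^1$ is not a type here,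
  \<open>has_derivative\<close> is written out relative to the set \<open>H1\<close>.
\<close>

definition energy_has_derivative ::
  "('a::euclidean_space \<Rightarrow> real) \<Rightarrow> ('a \<Rightarrow> real) \<Rightarrow> (('a \<Rightarrow> real) \<Rightarrow> real) \<Rightarrow> bool" where
  "energy_has_derivative V U L \<longleftrightarrow>
     (\<forall>\<phi>\<in>H1. \<forall>\<psi>\<in>H1. L (\<lambda>x. \<phi> x + \<psi> x) = L \<phi> + L \<psi>) \<and>
     (\<forall>\<phi>\<in>H1. \<forall>c. L (\<lambda>x. c * \<phi> x) = c * L \<phi>) \<and>
     (\<exists>C. \<forall>\<phi>\<in>H1. \<bar>L \<phi>\<bar> \<le> C * H1_norm \<phi>) \<and>
     (\<forall>\<epsilon>>0. \<exists>\<delta>>0. \<forall>\<phi>\<in>H1. H1_norm \<phi> < \<delta> \<longrightarrow>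
        \<bar>energy V (\<lambda>x. U x + \<phi> x) - energy V U - L \<phi>\<bar> \<le> \<epsilon> * H1_norm \<phi>)"

text \<open>
  The constrained gradient vanishes at \<open>U\<close> iff the derivative vanishes on the tangent space
  of the mass sphere at \<open>U\<close>, i.e. on the $\phi \in H^1$ with $\int U \phi = 0$.
\<close>

definition constrained_critical_point ::
  "('a::euclidean_space \<Rightarrow> real) \<Rightarrow> real \<Rightarrow> ('a \<Rightarrow> real) \<Rightarrow> bool" where
  "constrained_critical_point V \<rho> U \<longleftrightarrow> U \<in> mass_sphere \<rho> \<and>
     (\<exists>L. energy_has_derivative V U L \<and>
          (\<forall>\<phi>\<in>H1. (LINT x|lebesgue. U x * \<phi> x) = 0 \<longrightarrow> L \<phi> = 0))"

text \<open>
  The infimum is taken in the extended reals, so that it is the true infimum even if the set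
  of critical values were not bounded below.
\<close>

definition normalized_ground_state ::
  "('a::euclidean_space \<Rightarrow> real) \<Rightarrow> real \<Rightarrow> ('a \<Rightarrow> real) \<Rightarrow> bool" where
  "normalized_ground_state V \<rho> U \<longleftrightarrow> constrained_critical_point V \<rho> U \<and>
     ereal (energy V U) = (INF Z\<in>{Z. constrained_critical_point V \<rho> Z}. ereal (energy V Z))"

end

theory Submission
  imports Defs
begin

text \<open>
  Write \<open>A\<close> for the Dirichlet integral and \<open>B\<close> for the squared mass. By the Sobolev inequality and
  the form boundedness of \<open>V\<close>, there are \<open>R\<^sub>0\<close> and \<open>C\<^sub>0\<close> with \<open>E \<ge> (A - C\<^sub>0 B) / 4\<close> wherever
  \<open>A \<le> R\<^sub>0\<close>. States of negative energy in this region satisfy \<open>A < C\<^sub>0 B\<close> and so stay away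
  from its boundary when \<open>B = \<rho>\<^sup>2\<close> is small. Scaling gives \<open>E w \<ge> m B(w) / \<rho>\<^sup>2\<close> for
  \<open>B(w) \<le> \<rho>\<^sup>2\<close>, where \<open>m < 0\<close> is the infimum over the region. Applied to midpoints, this makes
  minimizing sequences Cauchy in \<open>H\<^sup>1\<close>, once the potential term is controlled by local compactness.
  The minimum is interior, hence a constrained critical point, and it may be replaced by its
  modulus. A one-sided Pohozaev identity shows that every critical point of negative energy
  satisfies \<open>A \<le> C B\<close>; for small \<open>\<rho>\<close> it lies in the region, so the minimizer is a ground state.

  Weak gradients are handled without mollification. Pushing test functions forward along the flow
  of an affine vector field expresses \<open>u((1 + \<kappa>) x + h) - u(x)\<close> as an integral of the weak
  gradient along line segments. Translations yield difference quotients and the Sobolev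
  inequality, and dilations enter the Pohozaev argument.
\<close>

section \<open>Test functions\<close>

text \<open>The exponent 2^* is critical: bounded sequences in H^1 need not converge along
  subsequences in the power term, and \<open>V\<close> has neither a sign nor derivatives. Only the
  quadratic form of \<open>V\<close> needs compactness, and there a bounded piece on a ball carries
  everything up to an absorbable error. As the infimum is negative, mass lost at a midpoint raises
  the lower bound for its energy; this stands in for any argument that excludes vanishing or
  splitting. The integrability of W allows a Pohozaev argument without a derivative of
  \<open>V\<close>: in the product of \<open>V\<close>, a solution and its dilation difference, a
  factor |x| is moved to the potential, and the difference divided by |x| is small in L^2. The
  exponents r_1 and r_2 enter only through one property: the parts of |V| and of W^2 above any
  positive height lie in L^{N/2}.\<close>

definition flat :: "real \<Rightarrow> nat \<Rightarrow> real \<Rightarrow> real" where "flat c m s = (if s > 0 then exp (- c / s) / s ^ m else 0)"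

lemma exp_ge_power_over_fact:
  fixes x :: real assumes "x \<ge> 0" shows "x ^ n / fact n \<le> exp x"
proof -
  have s: "summable (\<lambda>k. x ^ k /\<^sub>R fact k)" by (rule summable_exp_generic)
  have "(\<Sum>k\<in>{n}. x ^ k /\<^sub>R fact k) \<le> (\<Sum>k. x ^ k /\<^sub>R fact k)" by (rule sum_le_suminf[OF s]) (use assms in auto)
  then show ?thesis by (simp add: exp_def divide_inverse mult.commute)
qed

lemma flat_nonneg: "0 \<le> flat c m s"
  by (simp add: flat_def)

text \<open>The exponential beats every power of 1/s, so \<open>flat\<close> vanishes to second
  order at 0. This yields the derivative 0 at the junction of its two branches.\<close>

lemma flat_le_square:
  assumes "c > 0" shows "flat c m s \<le> fact (m + 2) / c ^ (m + 2) * s\<^sup>2"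
proof (cases "s > 0")
  case True
  have "(c / s) ^ (m + 2) / fact (m + 2) \<le> exp (c / s)" by (rule exp_ge_power_over_fact) (use assms True in auto)
  then have "c ^ (m + 2) / (s ^ (m + 2) * fact (m + 2)) \<le> exp (c / s)" by (simp only: power_divide divide_divide_eq_left)
  then have "1 / exp (c / s) \<le> 1 / (c ^ (m + 2) / (s ^ (m + 2) * fact (m + 2)))"
    using assms True by (intro divide_left_mono) (auto simp del: power_Suc power_add fact_Suc)
  also have "... = fact (m + 2) / c ^ (m + 2) * s\<^sup>2 * s ^ m" by (simp add: power_add power2_eq_square)
  finally show ?thesis using True by (simp add: flat_def exp_minus field_simps del: fact_Suc)
qed (use assms in \<open>simp add: flat_def\<close>)

text \<open>Differentiation only shifts the index \<open>m\<close>. The power of s is built into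
  \<open>flat\<close> for this reason: the family is closed under derivatives, so a single rule
  yields all orders.\<close>

lemma DERIV_flat:
  assumes "c > 0"
  shows "DERIV (flat c m) s :> c * flat c (m + 2) s - real m * flat c (m + 1) s"
proof -
  consider "s > 0" | "s < 0" | "s = 0" by linarith
  then show ?thesis
  proof cases
    case 1
    have "DERIV (\<lambda>s. exp (- c / s) / s ^ m) s :> c * flat c (m + 2) s - real m * flat c (m + 1) s"
    proof -
      have "DERIV (\<lambda>s. exp (- c / s) * inverse s ^ m) s :>
          exp (- c / s) * (c * inverse s ^ 2) * inverse s ^ m + exp (- c / s) * (real m * inverse s ^ (m - 1) * (- (inverse s ^ 2)))"
      proof -
        have D1: "DERIV (\<lambda>s. exp (- c / s)) s :> exp (- c / s) * (c * inverse s ^ 2)"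
          using 1 by (auto intro!: derivative_eq_intros simp: field_simps power2_eq_square)
        have "DERIV inverse s :> - (inverse s ^ 2)" using 1 by (auto intro!: derivative_eq_intros simp: power2_eq_square)
        from DERIV_power[OF this, of m]
        have D2: "DERIV (\<lambda>s. inverse s ^ m) s :> real m * inverse s ^ (m - 1) * (- (inverse s ^ 2))" by (simp add: mult_ac)
        show ?thesis by (rule DERIV_cong[OF DERIV_mult[OF D1 D2]]) (simp add: mult_ac)
      qed
      moreover have "exp (- c / s) * (c * inverse s ^ 2) * inverse s ^ m + exp (- c / s) * (real m * inverse s ^ (m - 1) * (- (inverse s ^ 2)))
          = c * flat c (m + 2) s - real m * flat c (m + 1) s"
        using 1 by (cases m) (simp_all add: flat_def divide_inverse power_inverse power_add algebra_simps power2_eq_square)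
      ultimately show ?thesis by (simp add: divide_inverse power_inverse)
    qed
    then show ?thesis
    proof (rule DERIV_cong_ev[THEN iffD1, rotated -1])
      show "\<forall>\<^sub>F x in nhds s. exp (- c / x) / x ^ m = flat c m x"
        using eventually_nhds_in_open[of "{0<..}" s] 1 by (auto elim!: eventually_mono simp: flat_def)
    qed auto
  next
    case 2
    have "DERIV (\<lambda>s. 0) s :> c * flat c (m + 2) s - real m * flat c (m + 1) s" using 2 by (auto simp: flat_def)
    then show ?thesis
    proof (rule DERIV_cong_ev[THEN iffD1, rotated -1])
      show "\<forall>\<^sub>F x in nhds s. 0 = flat c m x"
        using eventually_nhds_in_open[of "{..<0}" s] 2 by (auto elim!: eventually_mono simp: flat_def)
    qed auto
  next
    case 3
    define K where "K = fact (m + 2) / c ^ (m + 2)"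
    have K: "flat c m h \<le> K * h\<^sup>2" for h unfolding K_def by (rule flat_le_square[OF assms])
    have "((\<lambda>h. (flat c m (0 + h) - flat c m 0) / h) \<longlongrightarrow> 0) (at 0)"
    proof (rule Lim_null_comparison)
      show "\<forall>\<^sub>F h in at 0. norm ((flat c m (0 + h) - flat c m 0) / h) \<le> K * \<bar>h\<bar>" unfolding eventually_at_filter
      proof (rule always_eventually, intro allI impI)
        fix h :: real assume h: "h \<noteq> 0"
        have "flat c m h \<le> (K * \<bar>h\<bar>) * \<bar>h\<bar>" using K[of h] by (simp add: power2_eq_square mult.assoc abs_mult_self_eq)
        then show "norm ((flat c m (0 + h) - flat c m 0) / h) \<le> K * \<bar>h\<bar>"
          using h flat_nonneg[of c m h] by (simp add: flat_def[of c m 0] pos_divide_le_eq)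
      qed
      show "((\<lambda>h. K * \<bar>h\<bar>) \<longlongrightarrow> 0) (at 0)" by (auto intro!: tendsto_eq_intros)
    qed
    then show ?thesis using 3 by (simp add: DERIV_def flat_def)
  qed
qed

text \<open>A syntactic class of smooth functions: closure under partial derivatives follows by rule
  induction, and with it every \<open>C_k\<close>. It still contains cutoffs of boxes and is stable
  under the affine substitutions of the flow.\<close>

inductive_set smooth_class :: "('a::euclidean_space \<Rightarrow> real) set" where
  const: "(\<lambda>x. a) \<in> smooth_class"
| coord: "(\<lambda>x. x \<bullet> b) \<in> smooth_class"
| add: "f \<in> smooth_class \<Longrightarrow> g \<in> smooth_class \<Longrightarrow> (\<lambda>x. f x + g x) \<in> smooth_class"
| mult: "f \<in> smooth_class \<Longrightarrow> g \<in> smooth_class \<Longrightarrow> (\<lambda>x. f x * g x) \<in> smooth_class"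
| flat: "f \<in> smooth_class \<Longrightarrow> c > 0 \<Longrightarrow> (\<lambda>x. flat c m (f x)) \<in> smooth_class"

lemma smooth_class_has_derivative:
  fixes f :: "'a::euclidean_space \<Rightarrow> real"
  assumes "f \<in> smooth_class"
  shows "\<exists>D. (\<forall>x. (f has_derivative D x) (at x)) \<and> (\<forall>v. (\<lambda>x. D x v) \<in> smooth_class)"
  using assms
proof induction
  case (const a)
  show ?case by (rule exI[of _ "\<lambda>x v. 0"]) (auto intro: smooth_class.const)
next
  case (coord b)
  show ?case by (rule exI[of _ "\<lambda>x v. v \<bullet> b"]) (auto intro!: smooth_class.const derivative_eq_intros)
next
  case (add f g)
  then obtain D E where "\<And>x. (f has_derivative D x) (at x)" "\<And>v. (\<lambda>x. D x v) \<in> smooth_class"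
    "\<And>x. (g has_derivative E x) (at x)" "\<And>v. (\<lambda>x. E x v) \<in> smooth_class" by blast
  then show ?case by (intro exI[of _ "\<lambda>x v. D x v + E x v"]) (auto intro!: has_derivative_add smooth_class.add)
next
  case (mult f g)
  then obtain D E where "\<And>x. (f has_derivative D x) (at x)" "\<And>v. (\<lambda>x. D x v) \<in> smooth_class"
    "\<And>x. (g has_derivative E x) (at x)" "\<And>v. (\<lambda>x. E x v) \<in> smooth_class" by blast
  then show ?case by (intro exI[of _ "\<lambda>x v. f x * E x v + D x v * g x"])
      (auto intro!: has_derivative_mult smooth_class.add smooth_class.mult mult.hyps)
next
  case (flat f c m)
  then obtain D where D: "\<And>x. (f has_derivative D x) (at x)" "\<And>v. (\<lambda>x. D x v) \<in> smooth_class" by blast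
  define F where "F = (\<lambda>s. c * flat c (m + 2) s - real m * flat c (m + 1) s)"
  have F: "(\<lambda>x. F (f x)) \<in> smooth_class" unfolding F_def diff_conv_add_uminus minus_mult_left by (intro smooth_class.intros flat.hyps)
  have 1: "((\<lambda>x. flat c m (f x)) has_derivative (\<lambda>v. F (f x) * D x v)) (at x)" for x
    using DERIV_compose_FDERIV[OF DERIV_flat[OF flat.hyps(2)] D(1), of m x] by (simp add: F_def mult.commute)
  show ?case by (rule exI[of _ "\<lambda>x v. F (f x) * D x v"]) (auto intro!: 1 smooth_class.mult F D)
qed

abbreviation pdiff :: "('a::euclidean_space \<Rightarrow> real) \<Rightarrow> 'a \<Rightarrow> 'a \<Rightarrow> real" where
  "pdiff f x v \<equiv> frechet_derivative f (at x) v"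

lemma
  fixes f :: "'a::euclidean_space \<Rightarrow> real"
  assumes "f \<in> smooth_class"
  shows has_derivative_pdiff: "(f has_derivative pdiff f x) (at x)"
    and pdiff_smooth: "(\<lambda>x. pdiff f x v) \<in> smooth_class"
proof -
  obtain D where D: "\<And>x. (f has_derivative D x) (at x)" "\<And>v. (\<lambda>x. D x v) \<in> smooth_class"
    using smooth_class_has_derivative[OF assms] by blast
  have "pdiff f x = D x" for x using frechet_derivative_at[OF D(1)] by simp
  then show "(f has_derivative pdiff f x) (at x)" "(\<lambda>x. pdiff f x v) \<in> smooth_class" using D by auto
qed

lemma smooth_class_continuous:
  fixes f :: "'a::euclidean_space \<Rightarrow> real"
  assumes "f \<in> smooth_class" shows "continuous_on S f"
  using has_derivative_continuous[OF has_derivative_pdiff[OF assms]] by (simp add: continuous_at_imp_continuous_on)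

lemma smooth_class_C_k:
  fixes f :: "'a::euclidean_space \<Rightarrow> real"
  assumes "f \<in> smooth_class" shows "C_k k f"
  using assms
proof (induction k arbitrary: f)
  case (Suc k)
  then show ?case using has_derivative_pdiff[OF Suc.prems] by (auto simp: differentiable_def intro!: Suc.IH pdiff_smooth)
qed (simp add: smooth_class_continuous)

lemma smooth_class_affine:
  fixes f :: "'a::euclidean_space \<Rightarrow> real"
  assumes "f \<in> smooth_class" shows "(\<lambda>x. f (c *\<^sub>R x + d)) \<in> smooth_class"
  using assms
proof induction
  case (coord b)
  have "(\<lambda>x. c * (x \<bullet> b) + d \<bullet> b) \<in> (smooth_class :: ('a \<Rightarrow> real) set)" by (intro smooth_class.intros)
  then show ?case by (simp add: inner_add_left)
qed (auto intro: smooth_class.intros)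

lemma smooth_class_prod:
  "finite I \<Longrightarrow> (\<And>i. i \<in> I \<Longrightarrow> f i \<in> smooth_class) \<Longrightarrow> (\<lambda>x. \<Prod>i\<in>I. f i x) \<in> smooth_class"
  by (induction I rule: finite_induct) (auto intro!: smooth_class.intros)

lemma smooth_class_sum:
  "finite I \<Longrightarrow> (\<And>i. i \<in> I \<Longrightarrow> f i \<in> smooth_class) \<Longrightarrow> (\<lambda>x. \<Sum>i\<in>I. f i x) \<in> smooth_class"
  by (induction I rule: finite_induct) (auto intro!: smooth_class.intros)

section \<open>Smooth functions with bounded support\<close>

definition bumps :: "('a::euclidean_space \<Rightarrow> real) set" where "bumps = {f \<in> smooth_class. bounded {x. f x \<noteq> 0}}"

lemma bumps_mult_left: "f \<in> smooth_class \<Longrightarrow> g \<in> bumps \<Longrightarrow> (\<lambda>x. f x * g x) \<in> bumps"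
  unfolding bumps_def by (auto intro: smooth_class.mult bounded_subset)

lemma bumps_test_functions: "bumps \<subseteq> test_functions"
  by (auto simp: bumps_def test_functions_def smooth_class_C_k)

lemma pdiff_outside_support:
  fixes f :: "'a::euclidean_space \<Rightarrow> real"
  assumes "x \<notin> closure {x. f x \<noteq> 0}" shows "pdiff f x v = 0"
proof -
  have "((\<lambda>x. 0) has_derivative (\<lambda>v. 0)) (at x)" by auto
  then have "(f has_derivative (\<lambda>v. 0)) (at x)"
  proof (rule has_derivative_transform_within_open)
    show "open (- closure {x. f x \<noteq> 0})" by auto
    fix y assume "y \<in> - closure {x. f x \<noteq> 0}"
    then show "0 = f y" using closure_subset[of "{x. f x \<noteq> 0}"] by auto
  qed (use assms in auto)
  from frechet_derivative_at[OF this] show ?thesis by metis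
qed

lemma pdiff_bumps:
  fixes f :: "'a::euclidean_space \<Rightarrow> real"
  assumes "f \<in> bumps" shows "(\<lambda>x. pdiff f x v) \<in> bumps"
proof -
  have "{x. pdiff f x v \<noteq> 0} \<subseteq> closure {x. f x \<noteq> 0}" using pdiff_outside_support by blast
  then show ?thesis using assms unfolding bumps_def by (auto intro: pdiff_smooth bounded_subset)
qed

lemma bumps_affine:
  fixes f :: "'a::euclidean_space \<Rightarrow> real"
  assumes "f \<in> bumps" "c \<noteq> 0" shows "(\<lambda>x. f (c *\<^sub>R x + d)) \<in> bumps"
proof -
  have "{x. f (c *\<^sub>R x + d) \<noteq> 0} \<subseteq> (\<lambda>y. (1/c) *\<^sub>R y + (- (1/c) *\<^sub>R d)) ` {x. f x \<noteq> 0}"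
  proof
    fix x assume "x \<in> {x. f (c *\<^sub>R x + d) \<noteq> 0}"
    then show "x \<in> (\<lambda>y. (1/c) *\<^sub>R y + (- (1/c) *\<^sub>R d)) ` {x. f x \<noteq> 0}"
      using assms(2) by (intro image_eqI[of _ _ "c *\<^sub>R x + d"]) (auto simp: algebra_simps)
  qed
  moreover have "bounded ((\<lambda>y. (1/c) *\<^sub>R y + (- (1/c) *\<^sub>R d)) ` {x. f x \<noteq> 0})"
    using assms bounded_translation[OF bounded_scaling[of "{x. f x \<noteq> 0}" "1/c"], of "- (1/c) *\<^sub>R d"]
    by (auto simp: bumps_def image_image add.commute)
  ultimately show ?thesis using assms smooth_class_affine[of f c d] by (auto simp: bumps_def intro: bounded_subset)
qed

lemma bumps_bounded:
  fixes f :: "'a::euclidean_space \<Rightarrow> real"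
  assumes "f \<in> bumps" obtains B R where "B > 0" "R > 0" "\<And>x. \<bar>f x\<bar> \<le> B" "\<And>x. norm x > R \<Longrightarrow> f x = 0"
proof -
  obtain R where R: "R > 0" "\<And>x. f x \<noteq> 0 \<Longrightarrow> norm x \<le> R" using assms unfolding bumps_def bounded_pos by auto
  have "continuous_on (cball 0 R) f" using assms smooth_class_continuous by (auto simp: bumps_def)
  then have "bounded (f ` cball 0 R)" by (intro compact_imp_bounded compact_continuous_image) auto
  then obtain B where B: "B > 0" "\<And>x. norm x \<le> R \<Longrightarrow> \<bar>f x\<bar> \<le> B" unfolding bounded_pos by (auto simp: dist_norm)
  have "\<bar>f x\<bar> \<le> B" for x using B R(2)[of x] by (cases "f x = 0") auto
  moreover have "f x = 0" if "norm x > R" for x using R(2)[of x] that by auto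
  ultimately show ?thesis using that B(1) R(1) by blast
qed

text \<open>A smooth approximation of the indicator of an open box. It is nonzero exactly on the box
  for every \<open>n\<close>, while 1/(n+1) tends to 0 in the exponent, so that the values on the
  box tend to 1.\<close>

definition box_bump :: "nat \<Rightarrow> 'a::euclidean_space \<Rightarrow> 'a \<Rightarrow> 'a \<Rightarrow> real" where "box_bump n a c x =
     (\<Prod>b\<in>Basis. flat (1 / Suc n) 0 ((x - a) \<bullet> b) * flat (1 / Suc n) 0 ((c - x) \<bullet> b))"

lemma flat_le_1: "c > 0 \<Longrightarrow> flat c 0 s \<le> 1"
  by (auto simp: flat_def)

lemma box_bump_nonzero_iff: "box_bump n a c x \<noteq> 0 \<longleftrightarrow> x \<in> box a c"
  by (auto simp: box_bump_def flat_def mem_box inner_diff_left)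

lemma box_bump_nonneg: "0 \<le> box_bump n a c x"
  unfolding box_bump_def by (intro prod_nonneg mult_nonneg_nonneg ballI) (auto simp: flat_nonneg)

lemma box_bump_le_1: "box_bump n a c x \<le> 1"
proof -
  have "flat (1 / Suc n) 0 s * flat (1 / Suc n) 0 t \<le> 1" for s t
    using mult_mono[OF flat_le_1[of "1 / Suc n" s] flat_le_1[of "1 / Suc n" t]] flat_nonneg by (auto simp: flat_nonneg)
  then show ?thesis unfolding box_bump_def by (intro prod_le_1) (auto simp: flat_nonneg)
qed

lemma box_bump_tendsto: "(\<lambda>n. box_bump n a c x) \<longlonglongrightarrow> indicator (box a c) x"
proof (cases "x \<in> box a c")
  case True
  have *: "(\<lambda>n. flat (1 / Suc n) 0 s) \<longlonglongrightarrow> 1" if "s > 0" for s :: real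
  proof -
    have "(\<lambda>n. exp (- (1 / real (Suc n)) / s)) \<longlonglongrightarrow> exp (- 0 / s)"
      by (intro tendsto_intros LIMSEQ_Suc[OF lim_1_over_n]) (use that in auto)
    then show ?thesis using that by (simp add: flat_def)
  qed
  have "(\<lambda>n. box_bump n a c x) \<longlonglongrightarrow> (\<Prod>b\<in>(Basis::'a set). 1 * 1)" unfolding box_bump_def
    by (intro tendsto_prod tendsto_mult *) (use True in \<open>auto simp: mem_box inner_diff_left\<close>)
  then show ?thesis using True by simp
next
  case False
  then have "box_bump n a c x = 0" for n using box_bump_nonzero_iff by blast
  then show ?thesis using False by simp
qed

lemma box_bump_bumps: "box_bump n a c \<in> bumps"
proof -
  have "(\<lambda>x. \<Prod>b\<in>Basis. flat (1 / Suc n) 0 (x \<bullet> b + - (a \<bullet> b)) * flat (1 / Suc n) 0 (c \<bullet> b + (-1) * (x \<bullet> b)))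
      \<in> (smooth_class :: ('a \<Rightarrow> real) set)" by (intro smooth_class_prod finite_Basis smooth_class.intros) auto
  then have "box_bump n a c \<in> smooth_class" by (simp add: box_bump_def[abs_def] inner_diff_left)
  then show ?thesis by (simp add: bumps_def box_bump_nonzero_iff)
qed

section \<open>Affine changes of variables and the fundamental lemma\<close>

lemma
  fixes c :: real and t :: "'a::euclidean_space"
  assumes c: "c \<noteq> 0"
  shows nn_integral_lborel_affine: "f \<in> borel_measurable borel \<Longrightarrow>
      (\<integral>\<^sup>+x. f x \<partial>lborel) = ennreal (\<bar>c\<bar> ^ DIM('a)) * (\<integral>\<^sup>+x. f (c *\<^sub>R x + t) \<partial>lborel)"
    and integral_lborel_affine: "g \<in> borel_measurable borel \<Longrightarrow>
      (LBINT x. g x) = \<bar>c\<bar> ^ DIM('a) * (LBINT x. (g (c *\<^sub>R x + t) :: real))"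
    and integrable_lborel_affine_iff: "k \<in> borel_measurable borel \<Longrightarrow>
      integrable lborel (\<lambda>x. k (c *\<^sub>R x + t) :: 'b::euclidean_space) \<longleftrightarrow> integrable lborel k"
proof -
  have L: "lborel = density (distr lborel borel (\<lambda>x. t + c *\<^sub>R x)) (\<lambda>_. \<bar>c\<bar>^DIM('a))" by (rule lborel_affine[OF c])
  show 1: "(\<integral>\<^sup>+x. f x \<partial>lborel) = ennreal (\<bar>c\<bar> ^ DIM('a)) * (\<integral>\<^sup>+x. f (c *\<^sub>R x + t) \<partial>lborel)"
    if [measurable]: "f \<in> borel_measurable borel" for f
    by (subst L) (simp add: nn_integral_density nn_integral_distr nn_integral_cmult add.commute)
  show "(LBINT x. g x) = \<bar>c\<bar> ^ DIM('a) * (LBINT x. (g (c *\<^sub>R x + t) :: real))"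
    if [measurable]: "g \<in> borel_measurable borel" for g by (subst L) (simp add: integral_density integral_distr add.commute)
  show "integrable lborel (\<lambda>x. k (c *\<^sub>R x + t)) \<longleftrightarrow> integrable lborel k"
    if [measurable]: "k \<in> borel_measurable borel" for k :: "'a \<Rightarrow> 'b"
  proof -
    have "(\<integral>\<^sup>+x. norm (k x) \<partial>lborel) = ennreal (\<bar>c\<bar> ^ DIM('a)) * (\<integral>\<^sup>+x. norm (k (c *\<^sub>R x + t)) \<partial>lborel)"
      by (rule 1) simp
    then show ?thesis using c by (auto simp: integrable_iff_bounded ennreal_mult_less_top)
  qed
qed

lemma borel_measurable_fst_snd[measurable]:
  "fst \<in> borel_measurable (borel :: ('a::second_countable_topology \<times> 'b::second_countable_topology) measure)"
  "snd \<in> borel_measurable (borel :: ('a::second_countable_topology \<times> 'b::second_countable_topology) measure)"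
  by (auto intro!: borel_measurable_continuous_onI continuous_intros)

lemma bumps_measurable[measurable_dest]: "\<phi> \<in> bumps \<Longrightarrow> \<phi> \<in> borel_measurable borel"
  by (auto simp: bumps_def intro!: borel_measurable_continuous_onI smooth_class_continuous)

text \<open>Dominated convergence along \<open>box_bump\<close> gives integral 0 over every open
  box. Boxes are stable under intersection and generate the Borel sets, so a Dynkin argument extends
  this to all Borel sets, and densities are unique.\<close>

lemma fundamental_lemma:
  fixes g :: "'a::euclidean_space \<Rightarrow> real"
  assumes [measurable]: "g \<in> borel_measurable borel"
    and loc: "\<And>R. integrable lborel (\<lambda>x. indicator (cball 0 R) x * g x)"
    and zero: "\<And>\<phi>. \<phi> \<in> bumps \<Longrightarrow> (LBINT x. g x * \<phi> x) = 0"
  shows "AE x in lborel. g x = 0"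
proof -
  have box0: "(LBINT x. indicator (box a c) x * g x) = 0" for a c
  proof -
    obtain R where R: "box a c \<subseteq> cball 0 R" using bounded_subset_ballD[OF bounded_box, of a c 0] ball_subset_cball by blast
    have "(\<lambda>n. LBINT x. g x * box_bump n a c x) \<longlonglongrightarrow> (LBINT x. g x * indicator (box a c) x)"
    proof (rule integral_dominated_convergence[where w="\<lambda>x. \<bar>indicator (cball 0 R) x * g x\<bar>"])
      show "integrable lborel (\<lambda>x. \<bar>indicator (cball 0 R) x * g x\<bar>)" using loc[of R] by auto
      show "(\<lambda>x. g x * box_bump n a c x) \<in> borel_measurable lborel" for n using bumps_measurable[OF box_bump_bumps[of n a c]] by simp
      show "AE x in lborel. (\<lambda>i. g x * box_bump i a c x) \<longlonglongrightarrow> g x * indicator (box a c) x"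
        by (intro AE_I2 tendsto_intros box_bump_tendsto)
      show "AE x in lborel. norm (g x * box_bump n a c x) \<le> \<bar>indicator (cball 0 R) x * g x\<bar>" for n
      proof (rule AE_I2)
        fix x :: 'a
        show "norm (g x * box_bump n a c x) \<le> \<bar>indicator (cball 0 R) x * g x\<bar>"
        proof (cases "x \<in> box a c")
          case True
          then have "indicator (cball 0 R) x = (1::real)" using R by (auto simp: indicator_def)
          then show ?thesis using mult_left_mono[OF box_bump_le_1[of n a c x], of "\<bar>g x\<bar>"] box_bump_nonneg[of n a c x]
            by (simp add: abs_mult)
        next
          case False
          then show ?thesis using box_bump_nonzero_iff[of n a c x] by auto
        qed
      qed
    qed simp
    moreover have "(LBINT x. g x * box_bump n a c x) = 0" for n by (rule zero[OF box_bump_bumps])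
    ultimately show ?thesis by (simp add: LIMSEQ_const_iff mult.commute)
  qed
  have R0: "AE x in lborel. indicator (box (- R *\<^sub>R One) (R *\<^sub>R One)) x * g x = 0" for R :: real
  proof -
    \<comment> \<open>Inside a bounded box the function is integrable, which the complement and
      union steps of the induction over Borel sets require.\<close>
    define Q :: "'a set" where "Q = box (- R *\<^sub>R One) (R *\<^sub>R One)"
    define h where "h = (\<lambda>x. indicator Q x * g x)"
    have [measurable]: "Q \<in> sets borel" by (simp add: Q_def)
    obtain S where S: "Q \<subseteq> cball 0 S"
      using bounded_subset_ballD[OF bounded_box, of "- R *\<^sub>R One" "R *\<^sub>R One" 0] ball_subset_cball unfolding Q_def by blast
    have int: "integrable lborel h" unfolding h_def
      by (rule Bochner_Integration.integrable_bound[OF loc[of S]]) (use S in \<open>auto simp: indicator_def subset_iff intro!: AE_I2\<close>)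
    have intA: "integrable lborel (\<lambda>x. indicator A x * h x)" if "A \<in> sets borel" for A
      using integrable_mult_indicator[OF _ int, of A] that by simp
    have G: "sets (borel :: 'a measure) = sigma_sets UNIV (range (\<lambda>(a, b). box a b))" by (subst borel_eq_box) simp
    have A0: "(LBINT x. indicator A x * h x) = 0" if "A \<in> sets borel" for A
    proof -
      have IS: "Int_stable (range (\<lambda>(a, b). box a b :: 'a set))" by (force simp: Int_stable_def box_Int_box image_iff)
      moreover have "range (\<lambda>(a, b). box a b :: 'a set) \<subseteq> Pow UNIV" by simp
      moreover note that[unfolded G]
      ultimately show ?thesis
      proof (induction A rule: sigma_sets_induct_disjoint)
        case (basic A)
        then obtain a b where "A = box a b" by auto
        moreover obtain a' b' where "box a b \<inter> Q = box a' b'" unfolding Q_def box_Int_box by blast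
        ultimately have "indicator A x * h x = indicator (box a' b') x * g x" for x
          by (simp add: h_def mult.assoc[symmetric] flip: indicator_inter_arith)
        then show ?case using box0 by simp
      next
        case (compl A)
        have UN: "(LBINT x. h x) = 0" unfolding h_def Q_def by (rule box0)
        have "A \<in> sets borel" using compl G by simp
        have "(LBINT x. indicator (UNIV - A) x * h x) = (LBINT x. h x - indicator A x * h x)"
          by (intro Bochner_Integration.integral_cong) (auto simp: indicator_def)
        also have "... = 0" using compl UN intA[OF \<open>A \<in> sets borel\<close>] int by (subst Bochner_Integration.integral_diff) auto
        finally show ?case .
      next
        case (union A)
        have A: "A i \<in> sets borel" for i using union(2) G by auto
        have "(\<lambda>i. LBINT x. indicator (\<Union>j<i. A j) x * h x) \<longlonglongrightarrow> (LBINT x. indicator (\<Union>i. A i) x * h x)"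
        proof (rule integral_dominated_convergence[where w="\<lambda>x. \<bar>h x\<bar>"])
          show "AE x in lborel. (\<lambda>i. indicator (\<Union>j<i. A j) x * h x) \<longlonglongrightarrow> indicator (\<Union>i. A i) x * h x"
            by (intro AE_I2 tendsto_mult_right LIMSEQ_indicator_UN)
        qed (use int A in \<open>auto simp: indicator_def intro!: AE_I2\<close>)
        moreover have "(LBINT x. indicator (\<Union>j<n. A j) x * h x) = 0" for n
        proof (induction n)
          case (Suc n)
          have "indicator (\<Union>j<Suc n. A j) x * h x =
            indicator (\<Union>j<n. A j) x * h x + indicator (A n) x * h x" for x using union(1) unfolding disjoint_family_on_def
            by (auto simp: indicator_def lessThan_Suc) (metis Int_iff UNIV_I empty_iff less_irrefl)
          then have "(LBINT x. indicator (\<Union>j<Suc n. A j) x * h x) =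
             (LBINT x. indicator (\<Union>j<n. A j) x * h x) + (LBINT x. indicator (A n) x * h x)" using A by (simp add: intA)
          then show ?case using Suc union(3) by simp
        qed simp
        ultimately show ?case by (simp add: LIMSEQ_const_iff)
      qed simp_all
    qed
    have "AE x in lborel. h x = (\<lambda>x. 0) x" by (rule density_unique_real) (use int A0 in \<open>auto simp: set_lebesgue_integral_def\<close>)
    then show ?thesis by (simp add: h_def Q_def)
  qed
  have "AE x in lborel. \<forall>n::nat. indicator (box (- real n *\<^sub>R One) (real n *\<^sub>R One)) x * g x = 0"
    using R0 by (subst AE_all_countable) auto
  then show ?thesis
  proof eventually_elim
    case (elim x)
    obtain n :: nat where "x \<in> box (- real n *\<^sub>R One) (real n *\<^sub>R One)"
      using UN_box_eq_UNIV[where 'a='a] by (auto simp: set_eq_iff simp del: mem_box)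
    then show ?case using elim[THEN spec, of n] by simp
  qed
qed

section \<open>Functions with a square integrable weak gradient\<close>

definition l2 :: "('a::euclidean_space \<Rightarrow> 'b::euclidean_space) \<Rightarrow> bool" where
  "l2 f \<longleftrightarrow> f \<in> borel_measurable borel \<and> integrable lborel (\<lambda>x. (norm (f x))\<^sup>2)"

text \<open>H^1 with Borel representatives and an explicit gradient, so that Fubini applies without
  completions and no choice operator is involved. Testing with \<open>bumps\<close> alone is enough;
  \<open>sob_test_function\<close> recovers all test functions.\<close>

definition sob :: "('a::euclidean_space \<Rightarrow> real) \<Rightarrow> ('a \<Rightarrow> 'a) \<Rightarrow> bool" where
  "sob u G \<longleftrightarrow> l2 u \<and> l2 G \<and> (\<forall>\<phi>\<in>bumps. \<forall>b\<in>Basis.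
     (LBINT x. u x * pdiff \<phi> x b) = - (LBINT x. (G x \<bullet> b) * \<phi> x))"

lemma l2_measurable[measurable_dest]: "l2 f \<Longrightarrow> f \<in> borel_measurable borel"
  by (simp add: l2_def)

lemma l2_square_integrable: "l2 f \<Longrightarrow> integrable lborel (\<lambda>x. (norm (f x))\<^sup>2)"
  by (simp add: l2_def)

lemma l2_affine:
  fixes f :: "'a::euclidean_space \<Rightarrow> 'b::euclidean_space"
  assumes "l2 f" "c \<noteq> 0" shows "l2 (\<lambda>x. f (c *\<^sub>R x + t))"
proof -
  note [measurable] = l2_measurable[OF assms(1)]
  have "integrable lborel (\<lambda>x. (norm (f (c *\<^sub>R x + t)))\<^sup>2)"
    by (subst integrable_lborel_affine_iff[OF assms(2), of "\<lambda>x. (norm (f x))\<^sup>2"]) (use assms(1) in \<open>auto simp: l2_def\<close>)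
  then show ?thesis by (simp add: l2_def)
qed

lemma abs_le_1_plus_square: "\<bar>a\<bar> \<le> 1 + (a::real)\<^sup>2"
proof -
  have "0 \<le> (\<bar>a\<bar> - 1)\<^sup>2" by simp
  then show ?thesis by (simp add: power2_diff)
qed

lemma integrable_indicator_cball: "integrable lborel (indicator (cball 0 R :: 'a::euclidean_space set) :: 'a \<Rightarrow> real)"
  by (rule integrable_real_indicator) (use emeasure_lborel_cball_finite[of "0::'a" R] in simp_all)

lemma l2_locally_integrable:
  fixes f :: "'a::euclidean_space \<Rightarrow> real"
  assumes "l2 f" shows "integrable lborel (\<lambda>x. indicator (cball 0 R) x * f x)"
proof (rule Bochner_Integration.integrable_bound)
  show "integrable lborel (\<lambda>x. indicator (cball 0 R) x + (norm (f x))\<^sup>2)"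
    using integrable_indicator_cball l2_square_integrable[OF assms] by (rule Bochner_Integration.integrable_add)
  show "(\<lambda>x. indicator (cball 0 R) x * f x) \<in> borel_measurable lborel"
    using l2_measurable[OF assms] by simp (intro borel_measurable_times borel_measurable_indicator; simp)
  show "AE x in lborel. norm (indicator (cball 0 R) x * f x) \<le> norm (indicator (cball 0 R) x + (norm (f x))\<^sup>2)"
    using abs_le_1_plus_square[of "f _"] by (auto simp: indicator_def)
qed

lemma integrable_l2_bump:
  fixes f :: "'a::euclidean_space \<Rightarrow> real"
  assumes "l2 f" "\<phi> \<in> bumps" shows "integrable lborel (\<lambda>x. f x * \<phi> x)"
proof -
  note [measurable] = l2_measurable[OF assms(1)] bumps_measurable[OF assms(2)]
  obtain B R where BR: "B > 0" "R > 0" "\<And>x. \<bar>\<phi> x\<bar> \<le> B" "\<And>x. norm x > R \<Longrightarrow> \<phi> x = 0"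
    using bumps_bounded[OF assms(2)] by blast
  show ?thesis
  proof (rule Bochner_Integration.integrable_bound[OF integrable_mult_right[OF l2_locally_integrable[OF assms(1), of R], of B]])
    show "AE x in lborel. norm (f x * \<phi> x) \<le> norm (B * (indicator (cball 0 R) x * f x))"
    proof (rule AE_I2)
      fix x show "norm (f x * \<phi> x) \<le> norm (B * (indicator (cball 0 R) x * f x))"
        using BR(1) mult_right_mono[OF BR(3)[of x], of "\<bar>f x\<bar>"] BR(4)[of x]
        by (cases "norm x > R") (auto simp: abs_mult indicator_def mult.commute)
    qed
  qed simp
qed

lemma l2_inner: "l2 G \<Longrightarrow> l2 (\<lambda>x. G x \<bullet> b)"
  for G :: "'a::euclidean_space \<Rightarrow> 'b::euclidean_space"
proof -
  assume G: "l2 G"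
  have [measurable]: "G \<in> borel_measurable borel" using G by (rule l2_measurable)
  have "integrable lborel (\<lambda>x. (norm (G x \<bullet> b))\<^sup>2)"
  proof (rule Bochner_Integration.integrable_bound[OF integrable_mult_right[OF l2_square_integrable[OF G], of "(norm b)\<^sup>2"]])
    show "AE x in lborel. norm ((norm (G x \<bullet> b))\<^sup>2) \<le> norm ((norm b)\<^sup>2 * (norm (G x))\<^sup>2)"
      using power_mono[OF Cauchy_Schwarz_ineq2[of "G _" b], where n=2] by (auto simp: power_mult_distrib mult.commute)
  qed simp
  then show ?thesis by (simp add: l2_def)
qed

text \<open>The affine map is transferred to the test function: \<open>\<psi>\<close> is
  \<open>\<xi>\<close> composed with the inverse map. The Jacobians on both sides cancel, and the
  derivative of the inverse leaves the factor \<open>c\<close>.\<close>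

lemma sob_affine_weak:
  fixes u :: "'a::euclidean_space \<Rightarrow> real"
  assumes S: "sob u G" and c: "c > 0" and \<xi>: "\<xi> \<in> bumps" and b: "b \<in> Basis"
  shows "(LBINT z. u (c *\<^sub>R z + d) * pdiff \<xi> z b) =
    - (c * (LBINT z. (G (c *\<^sub>R z + d) \<bullet> b) * \<xi> z))"
proof -
  define \<psi> where "\<psi> = (\<lambda>y. \<xi> ((1/c) *\<^sub>R y + (- (1/c) *\<^sub>R d)))"
  have \<psi>: "\<psi> \<in> bumps" unfolding \<psi>_def using \<xi> c by (intro bumps_affine) auto
  have l: "l2 u" "l2 G" using S by (auto simp: sob_def)
  note [measurable] = l2_measurable[OF l(1)] l2_measurable[OF l(2)] bumps_measurable[OF \<psi>]
    bumps_measurable[OF pdiff_bumps[OF \<psi>]]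
  have pd: "pdiff \<psi> y b = (1/c) * pdiff \<xi> ((1/c) *\<^sub>R y + (- (1/c) *\<^sub>R d)) b" for y
  proof -
    have D: "(\<xi> has_derivative pdiff \<xi> ((1/c) *\<^sub>R y + (- (1/c) *\<^sub>R d))) (at ((1/c) *\<^sub>R y + (- (1/c) *\<^sub>R d)))"
      using \<xi> has_derivative_pdiff by (auto simp: bumps_def)
    have "(\<psi> has_derivative (\<lambda>v. pdiff \<xi> ((1/c) *\<^sub>R y + (- (1/c) *\<^sub>R d)) ((1/c) *\<^sub>R v))) (at y)"
      unfolding \<psi>_def by (rule has_derivative_compose[where f="\<lambda>y. (1/c) *\<^sub>R y + (- (1/c) *\<^sub>R d)" and g=\<xi>, OF _ D])
        (auto intro!: derivative_eq_intros)
    from fun_cong[OF frechet_derivative_at[OF this], of b]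
    have "pdiff \<psi> y b = pdiff \<xi> ((1/c) *\<^sub>R y + (- (1/c) *\<^sub>R d)) ((1/c) *\<^sub>R b)" by simp
    then show ?thesis using linear_scale[OF has_derivative_linear[OF D]] by simp
  qed
  have "(LBINT y. u y * pdiff \<psi> y b) = - (LBINT y. (G y \<bullet> b) * \<psi> y)" using S \<psi> b by (auto simp: sob_def)
  then have "\<bar>c\<bar> ^ DIM('a) * (LBINT z. u (c *\<^sub>R z + d) * pdiff \<psi> (c *\<^sub>R z + d) b)
      = - (\<bar>c\<bar> ^ DIM('a) * (LBINT z. (G (c *\<^sub>R z + d) \<bullet> b) * \<psi> (c *\<^sub>R z + d)))"
    using c by (subst (asm) (1 2) integral_lborel_affine[of c _ d]) auto
  then have "\<bar>c\<bar> ^ DIM('a) * ((LBINT z. u (c *\<^sub>R z + d) * pdiff \<psi> (c *\<^sub>R z + d) b)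
      + (LBINT z. (G (c *\<^sub>R z + d) \<bullet> b) * \<psi> (c *\<^sub>R z + d))) = 0" by (simp only: distrib_left)
  then have "(LBINT z. u (c *\<^sub>R z + d) * pdiff \<psi> (c *\<^sub>R z + d) b)
      = - (LBINT z. (G (c *\<^sub>R z + d) \<bullet> b) * \<psi> (c *\<^sub>R z + d))" using c by (simp only: mult_eq_0_iff power_eq_0_iff) linarith
  moreover have arg: "(1/c) *\<^sub>R (c *\<^sub>R z + d) + (- (1/c) *\<^sub>R d) = z" for z using c by (simp add: scaleR_add_right)
  have "\<psi> (c *\<^sub>R z + d) = \<xi> z" "pdiff \<psi> (c *\<^sub>R z + d) b = (1/c) * pdiff \<xi> z b" for z
    by (simp_all only: \<psi>_def arg) (simp only: pd arg flip: \<psi>_def)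
  ultimately have "(LBINT z. (1/c) * (u (c *\<^sub>R z + d) * pdiff \<xi> z b)) = - (LBINT z. (G (c *\<^sub>R z + d) \<bullet> b) * \<xi> z)"
    by (simp add: mult_ac)
  then show ?thesis using c by (simp add: field_simps)
qed

lemma integrable_pairI:
  fixes f :: "real \<times> 'a::euclidean_space \<Rightarrow> real"
  assumes [measurable]: "f \<in> borel_measurable borel"
    and 0: "\<And>s y. s \<notin> {0..1} \<Longrightarrow> f (s, y) = 0"
    and le: "\<And>s. s \<in> {0..1} \<Longrightarrow> (\<integral>\<^sup>+y. ennreal \<bar>f (s, y)\<bar> \<partial>lborel) \<le> ennreal C"
  shows "integrable (lborel \<Otimes>\<^sub>M lborel) f"
proof (rule integrableI_bounded)
  have "(\<integral>\<^sup>+x. ennreal (norm (f x)) \<partial>(lborel \<Otimes>\<^sub>M lborel)) =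
      (\<integral>\<^sup>+s. \<integral>\<^sup>+y. ennreal (norm (f (s, y))) \<partial>lborel \<partial>lborel)"
    by (subst lborel.nn_integral_fst[symmetric]) (simp_all add: lborel_prod)
  also have "... \<le> (\<integral>\<^sup>+s. ennreal C * indicator {0..1::real} s \<partial>lborel)"
    using le 0 by (intro nn_integral_mono) (auto simp: indicator_def)
  also have "... < \<infinity>" by (simp add: nn_integral_cmult)
  finally show "(\<integral>\<^sup>+x. ennreal (norm (f x)) \<partial>(lborel \<Otimes>\<^sub>M lborel)) < \<infinity>" .
qed (simp add: lborel_prod)

section \<open>Increments along the flow of an affine vector field\<close>

locale affine_flow =
  fixes u :: "'a::euclidean_space \<Rightarrow> real" and G :: "'a \<Rightarrow> 'a" and \<kappa> :: real and h :: 'a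
  assumes S: "sob u G" and \<kappa>: "\<kappa> \<ge> 0"
begin

text \<open>The stretching factor of the time-s map, which is x + s v(x) = c(s) x + s h. As \<kappa>
  \<ge> 0, it is at least 1 on [0,1]: the map is invertible and composition with it does not
  increase L^2 norms.\<close>

definition c where "c s = 1 + s * \<kappa>"
definition v where "v x = \<kappa> *\<^sub>R x + h"

lemma lu: "l2 u" and lG: "l2 G" using S by (auto simp: sob_def)

lemma c_ge_1: "s \<in> {0..1} \<Longrightarrow> c s \<ge> 1"
  using \<kappa> by (simp add: c_def)

lemma meas[measurable]: "u \<in> borel_measurable borel" "G \<in> borel_measurable borel"
  "v \<in> borel_measurable borel" "c \<in> borel_measurable borel"
proof -
  have "continuous_on UNIV v" "continuous_on UNIV c" unfolding v_def[abs_def] c_def[abs_def] by (auto intro!: continuous_intros)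
  then show "v \<in> borel_measurable borel" "c \<in> borel_measurable borel" by (auto intro: borel_measurable_continuous_onI)
qed (use lu lG l2_measurable in auto)

definition path_integrand :: "'a \<Rightarrow> real \<Rightarrow> real" where
  "path_integrand x s = indicator {0..1} s * (G (x + s *\<^sub>R v x) \<bullet> v x)"

lemma path_point: "c s *\<^sub>R x + s *\<^sub>R h = x + s *\<^sub>R v x"
  by (simp add: c_def v_def algebra_simps)

lemma meas_path: "(\<lambda>p. path_integrand (snd p) (fst p)) \<in> borel_measurable borel"
proof -
  have "continuous_on UNIV (\<lambda>p::real \<times> 'a. snd p + fst p *\<^sub>R v (snd p))" unfolding v_def by (auto intro!: continuous_intros)
  then have [measurable]: "(\<lambda>p::real \<times> 'a. snd p + fst p *\<^sub>R v (snd p)) \<in> borel_measurable borel"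
    by (rule borel_measurable_continuous_onI)
  show ?thesis unfolding path_integrand_def by measurable
qed

text \<open>This licenses the exchanges of integrals in \<open>flow\<close>. On the support of
  \<open>\<phi>\<close> the field \<open>v\<close> is bounded, and the L^2 norm of \<open>G\<close>
  along the flow is bounded uniformly in \<open>s\<close>.\<close>

lemma path_integrable_pair:
  assumes [measurable]: "\<phi> \<in> borel_measurable borel" and \<phi>: "\<And>x. \<bar>\<phi> x\<bar> \<le> B" "\<And>x. norm x > R \<Longrightarrow> \<phi> x = 0"
  shows "integrable (lborel \<Otimes>\<^sub>M lborel) (\<lambda>(s, x). path_integrand x s * \<phi> x)"
proof (rule integrable_pairI)
  define M where "M = (\<bar>\<kappa>\<bar> * R + norm h) * B"
  have B: "B \<ge> 0" using \<phi>(1)[of 0] by simp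
  define C where "C = (LBINT x. \<bar>M\<bar> * (indicator (cball (0::'a) R) x)) + \<bar>M\<bar> * (LBINT x. (norm (G x))\<^sup>2)"
  have meas': "(\<lambda>p::real \<times> 'a. \<phi> (snd p)) \<in> borel_measurable borel"
    by (rule measurable_compose[OF _ assms(1)]) (auto intro!: borel_measurable_continuous_onI continuous_intros)
  show "(\<lambda>(s, x). path_integrand x s * \<phi> x) \<in> borel_measurable borel"
    using borel_measurable_times[OF meas_path meas'] by (simp add: case_prod_beta')
  show "(case (s, y) of (s, x) \<Rightarrow> path_integrand x s * \<phi> x) = 0" if "s \<notin> {0..1}" for s y
    using that by (simp add: path_integrand_def)
  show "(\<integral>\<^sup>+y. ennreal \<bar>case (s, y) of (s, x) \<Rightarrow> path_integrand x s * \<phi> x\<bar> \<partial>lborel) \<le> ennreal C"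
    if s: "s \<in> {0..1}" for s
  proof -
    define g where "g = (\<lambda>x. G (c s *\<^sub>R x + s *\<^sub>R h))"
    have c1: "c s \<ge> 1" using c_ge_1[OF s] .
    have lg: "l2 g" unfolding g_def using lG c1 by (intro l2_affine) auto
    have [measurable]: "g \<in> borel_measurable borel" using lg by (rule l2_measurable)
    have "(\<integral>\<^sup>+y. ennreal \<bar>case (s, y) of (s, x) \<Rightarrow> path_integrand x s * \<phi> x\<bar> \<partial>lborel)
        \<le> (\<integral>\<^sup>+x. ennreal (\<bar>M\<bar> * indicator (cball 0 R) x + \<bar>M\<bar> * (norm (g x))\<^sup>2) \<partial>lborel)"
    proof (intro nn_integral_mono ennreal_leI)
      fix x
      show "\<bar>case (s, x) of (s, x) \<Rightarrow> path_integrand x s * \<phi> x\<bar>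
        \<le> \<bar>M\<bar> * indicator (cball 0 R) x + \<bar>M\<bar> * (norm (g x))\<^sup>2"
      proof (cases "norm x > R")
        case False
        have vx: "norm (v x) \<le> \<bar>\<kappa>\<bar> * R + norm h"
          unfolding v_def using False norm_triangle_ineq[of "\<kappa> *\<^sub>R x" h] mult_left_mono[of "norm x" R "\<bar>\<kappa>\<bar>"] by simp
        have "\<bar>path_integrand x s * \<phi> x\<bar> = \<bar>g x \<bullet> v x\<bar> * \<bar>\<phi> x\<bar>"
          using s by (simp add: path_integrand_def g_def path_point abs_mult)
        also have "... \<le> (norm (g x) * norm (v x)) * B" using \<phi>(1) Cauchy_Schwarz_ineq2 by (intro mult_mono) auto
        also have "... \<le> (norm (g x) * (\<bar>\<kappa>\<bar> * R + norm h)) * B" using vx B by (intro mult_right_mono mult_left_mono) auto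
        also have "... = M * norm (g x)" by (simp add: M_def)
        also have "... \<le> \<bar>M\<bar> * norm (g x)" by (intro mult_right_mono) auto
        also have "... \<le> \<bar>M\<bar> * (1 + (norm (g x))\<^sup>2)" using abs_le_1_plus_square[of "norm (g x)"] by (intro mult_left_mono) auto
        finally show ?thesis using False by (simp add: distrib_left)
      qed (simp add: \<phi>)
    qed
    also have "... = ennreal (LBINT x. \<bar>M\<bar> * indicator (cball 0 R) x + \<bar>M\<bar> * (norm (g x))\<^sup>2)"
      using l2_square_integrable[OF lg] integrable_indicator_cball
      by (intro nn_integral_eq_integral Bochner_Integration.integrable_add integrable_mult_right AE_I2) auto
    also have "... \<le> ennreal C"
    proof (rule ennreal_leI)
      have "(LBINT x. (norm (g x))\<^sup>2) \<le> (LBINT x. (norm (G x))\<^sup>2)"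
      proof -
        have "1 * (LBINT x. (norm (g x))\<^sup>2) \<le> \<bar>c s\<bar> ^ DIM('a) * (LBINT x. (norm (g x))\<^sup>2)"
          using c1 by (intro mult_right_mono) auto
        also have "... = (LBINT x. (norm (G x))\<^sup>2)"
          unfolding g_def using c1 by (subst (2) integral_lborel_affine[of "c s" _ "s *\<^sub>R h"]) auto
        finally show ?thesis by simp
      qed
      then show "(LBINT x. \<bar>M\<bar> * indicator (cball 0 R) x + \<bar>M\<bar> * (norm (g x))\<^sup>2) \<le> C"
        unfolding C_def using l2_square_integrable[OF lg] integrable_indicator_cball
        by (subst Bochner_Integration.integral_add) (auto intro!: mult_left_mono)
    qed
    finally show ?thesis .
  qed
qed

text \<open>The divergence of the field \<open>v \<phi>\<close>. Each summand is a partial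
  derivative of a bump, which is the form that the definition of the weak gradient accepts.\<close>

definition \<Psi> :: "('a \<Rightarrow> real) \<Rightarrow> 'a \<Rightarrow> real" where
  "\<Psi> \<phi> x = (\<Sum>b\<in>Basis. pdiff (\<lambda>x. (v x \<bullet> b) * \<phi> x) x b)"

lemma v_component_smooth: "(\<lambda>x. v x \<bullet> b) \<in> smooth_class"
proof -
  have "(\<lambda>x. \<kappa> * (x \<bullet> b) + h \<bullet> b) \<in> (smooth_class :: ('a \<Rightarrow> real) set)" by (intro smooth_class.intros)
  then show ?thesis by (simp add: v_def inner_add_left)
qed

lemma \<Psi>_eq:
  assumes "\<phi> \<in> bumps" shows "\<Psi> \<phi> x = DIM('a) * \<kappa> * \<phi> x + pdiff \<phi> x (v x)"
proof -
  have D: "(\<phi> has_derivative pdiff \<phi> x) (at x)" using assms has_derivative_pdiff by (auto simp: bumps_def)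
  have "pdiff (\<lambda>x. (v x \<bullet> b) * \<phi> x) x b = \<kappa> * \<phi> x + (v x \<bullet> b) * pdiff \<phi> x b" if "b \<in> Basis" for b
  proof -
    have "((\<lambda>x. (v x \<bullet> b) * \<phi> x) has_derivative (\<lambda>w. (v x \<bullet> b) * pdiff \<phi> x w + (\<kappa> *\<^sub>R w \<bullet> b) * \<phi> x)) (at x)"
      unfolding v_def by (auto intro!: derivative_eq_intros D)
    from fun_cong[OF frechet_derivative_at[OF this], of b] show ?thesis using that by simp
  qed
  then have "\<Psi> \<phi> x = (\<Sum>b\<in>(Basis::'a set). \<kappa> * \<phi> x) + (\<Sum>b\<in>Basis. (v x \<bullet> b) * pdiff \<phi> x b)"
    by (simp add: \<Psi>_def sum.distrib)
  also have "(\<Sum>b\<in>Basis. (v x \<bullet> b) * pdiff \<phi> x b) = pdiff \<phi> x (\<Sum>b\<in>Basis. (v x \<bullet> b) *\<^sub>R b)"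
    using has_derivative_linear[OF D] by (simp add: linear_sum linear_scale)
  finally show ?thesis by (simp add: euclidean_representation)
qed

lemma \<Psi>_bumps: "\<phi> \<in> bumps \<Longrightarrow> \<Psi> \<phi> \<in> bumps"
proof -
  assume \<phi>: "\<phi> \<in> bumps"
  have 1: "(\<lambda>x. pdiff (\<lambda>x. (v x \<bullet> b) * \<phi> x) x b) \<in> bumps" for b
    by (intro pdiff_bumps bumps_mult_left v_component_smooth \<phi>)
  have "\<Psi> \<phi> \<in> smooth_class" unfolding \<Psi>_def[abs_def] using 1 by (intro smooth_class_sum) (auto simp: bumps_def)
  moreover have "{x. \<Psi> \<phi> x \<noteq> 0} \<subseteq> (\<Union>b\<in>Basis. {x. pdiff (\<lambda>x. (v x \<bullet> b) * \<phi> x) x b \<noteq> 0})"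
    unfolding \<Psi>_def by (auto dest: sum.not_neutral_contains_not_neutral)
  moreover have "bounded (\<Union>b\<in>Basis. {x. pdiff (\<lambda>x. (v x \<bullet> b) * \<phi> x) x b \<noteq> 0})"
    using 1 by (intro bounded_UN) (auto simp: bumps_def)
  ultimately show ?thesis by (auto simp: bumps_def intro: bounded_subset)
qed

text \<open>The push-forward of \<open>\<phi>\<close> under the flow; its time derivative is minus the divergence of
  the push-forward of \<open>v \<phi>\<close>.\<close>

definition pushed :: "('a \<Rightarrow> real) \<Rightarrow> real \<Rightarrow> 'a \<Rightarrow> real" where
  "pushed \<phi> s y = \<phi> ((1 / c s) *\<^sub>R (y - s *\<^sub>R h)) / c s ^ DIM('a)"

text \<open>The continuity equation for a density carried by the flow. The additional division by
  \<open>c s\<close> turns the divergence in the initial variable into the divergence in the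
  variable at time \<open>s\<close>.\<close>

lemma DERIV_pushed:
  assumes \<phi>: "\<phi> \<in> bumps" and s: "s \<in> {0..1}"
  shows "((\<lambda>s. pushed \<phi> s y) has_vector_derivative - pushed (\<Psi> \<phi>) s y / c s) (at s within {0..1})"
proof -
  define z where "z = (\<lambda>s. (1 / c s) *\<^sub>R (y - s *\<^sub>R h))"
  have c0: "c s > 0" using c_ge_1[OF s] by simp
  have Dc: "(c has_real_derivative \<kappa>) (at s)" unfolding c_def[abs_def] by (auto intro!: derivative_eq_intros)
  have Di: "((\<lambda>s. 1 / c s) has_real_derivative - \<kappa> / (c s)\<^sup>2) (at s)"
    using c0 by (auto intro!: derivative_eq_intros Dc simp: power2_eq_square)
  have Dz: "(z has_vector_derivative - (1 / c s) *\<^sub>R v (z s)) (at s)"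
  proof -
    have "(z has_vector_derivative (1 / c s) *\<^sub>R (- h) + (- \<kappa> / (c s)\<^sup>2) *\<^sub>R (y - s *\<^sub>R h)) (at s)" unfolding z_def
      by (rule has_vector_derivative_scaleR[OF Di]) (auto intro!: derivative_eq_intros)
    moreover have "(1 / c s) *\<^sub>R (- h) + (- \<kappa> / (c s)\<^sup>2) *\<^sub>R (y - s *\<^sub>R h) = - (1 / c s) *\<^sub>R v (z s)"
      by (simp add: v_def z_def scaleR_add_right power2_eq_square)
    ultimately show ?thesis by simp
  qed
  have D\<phi>: "(\<phi> has_derivative pdiff \<phi> (z s)) (at (z s))" using \<phi> has_derivative_pdiff by (auto simp: bumps_def)
  have "((\<lambda>s. \<phi> (z s)) has_derivative (\<lambda>t. pdiff \<phi> (z s) (t *\<^sub>R (- (1 / c s) *\<^sub>R v (z s))))) (at s)"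
    by (rule has_derivative_compose[OF Dz[unfolded has_vector_derivative_def] D\<phi>])
  moreover have "pdiff \<phi> (z s) (t *\<^sub>R (- (1 / c s) *\<^sub>R v (z s))) = (- (1 / c s) * pdiff \<phi> (z s) (v (z s))) * t" for t
    using has_derivative_linear[OF D\<phi>] by (simp add: linear_scale linear_neg)
  ultimately have 1: "((\<lambda>s. \<phi> (z s)) has_real_derivative - (1 / c s) * pdiff \<phi> (z s) (v (z s))) (at s)"
    unfolding has_field_derivative_def by (simp only:)
  have N: "DIM('a) > 0" by simp
  have 2: "((\<lambda>s. \<phi> (z s) / c s ^ DIM('a)) has_real_derivative
     (- (1 / c s) * pdiff \<phi> (z s) (v (z s)) * c s ^ DIM('a) - \<phi> (z s) * (DIM('a) * c s ^ (DIM('a) - 1) * \<kappa>))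
       / (c s ^ DIM('a) * c s ^ DIM('a))) (at s)" by (rule DERIV_divide[OF 1]) (use c0 in \<open>auto intro!: derivative_eq_intros Dc\<close>)
  obtain k where k: "DIM('a) = Suc k" using N by (metis Suc_pred)
  have alg: "(- (1 / C) * P * C ^ DIM('a) - A * (DIM('a) * C ^ (DIM('a) - 1) * \<kappa>)) / (C ^ DIM('a) * C ^ DIM('a))
      = - ((DIM('a) * \<kappa> * A + P) / C ^ DIM('a)) / C" if "C > 0" for A P C :: real using that by (simp add: field_simps k)
  have "pushed (\<Psi> \<phi>) s y = (DIM('a) * \<kappa> * \<phi> (z s) + pdiff \<phi> (z s) (v (z s))) / c s ^ DIM('a)"
    unfolding pushed_def \<Psi>_eq[OF \<phi>] z_def ..
  with alg[OF c0, of "pdiff \<phi> (z s) (v (z s))" "\<phi> (z s)"]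
  have "(- (1 / c s) * pdiff \<phi> (z s) (v (z s)) * c s ^ DIM('a) - \<phi> (z s) * (DIM('a) * c s ^ (DIM('a) - 1) * \<kappa>))
       / (c s ^ DIM('a) * c s ^ DIM('a)) = - pushed (\<Psi> \<phi>) s y / c s" by simp
  with 2 show ?thesis by (simp add: has_real_derivative_iff_has_vector_derivative has_vector_derivative_at_within pushed_def[abs_def] z_def)
qed

end

context affine_flow
begin

lemma pushed_integral:
  assumes s: "s \<in> {0..1}" and [measurable]: "f \<in> borel_measurable borel" "\<xi> \<in> borel_measurable borel"
  shows "(LBINT y. f y * pushed \<xi> s y) = (LBINT x. f (x + s *\<^sub>R v x) * \<xi> x)"
proof -
  have c0: "c s > 0" using c_ge_1[OF s] by simp
  have "(LBINT y. f y * pushed \<xi> s y) =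
     \<bar>c s\<bar> ^ DIM('a) * (LBINT x. f (c s *\<^sub>R x + s *\<^sub>R h) * pushed \<xi> s (c s *\<^sub>R x + s *\<^sub>R h))"
    using c0 by (intro integral_lborel_affine) (auto simp: pushed_def)
  also have "... = (LBINT x. \<bar>c s\<bar> ^ DIM('a) * (f (c s *\<^sub>R x + s *\<^sub>R h) * pushed \<xi> s (c s *\<^sub>R x + s *\<^sub>R h)))"
    by simp
  also have "... = (LBINT x. f (x + s *\<^sub>R v x) * \<xi> x)"
  proof (intro Bochner_Integration.integral_cong refl)
    fix x
    have "pushed \<xi> s (c s *\<^sub>R x + s *\<^sub>R h) = \<xi> x / c s ^ DIM('a)" using c0 by (simp add: pushed_def)
    then show "\<bar>c s\<bar> ^ DIM('a) * (f (c s *\<^sub>R x + s *\<^sub>R h) * pushed \<xi> s (c s *\<^sub>R x + s *\<^sub>R h)) = f (x + s *\<^sub>R v x) * \<xi> x"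
      using c0 by (simp add: path_point)
  qed
  finally show ?thesis .
qed

lemma pushed_increment:
  assumes \<phi>: "\<phi> \<in> bumps"
  shows "(LBINT s. indicator {0..1} s * (- pushed (\<Psi> \<phi>) s y / c s)) = pushed \<phi> 1 y - pushed \<phi> 0 y"
proof -
  have "continuous_on {0..1} (\<lambda>s. pushed (\<Psi> \<phi>) s y)"
    by (rule continuous_on_vector_derivative[OF DERIV_pushed[OF \<Psi>_bumps[OF \<phi>]]])
  then have "continuous_on {0..1} (\<lambda>s. - pushed (\<Psi> \<phi>) s y / c s)"
    using c_ge_1 by (intro continuous_intros) (force simp: c_def intro!: continuous_intros)+
  then have "has_bochner_integral lborel (\<lambda>s. indicator {0..1} s *\<^sub>R (- pushed (\<Psi> \<phi>) s y / c s))
      (pushed \<phi> 1 y - pushed \<phi> 0 y)" using DERIV_pushed[OF \<phi>] by (intro has_bochner_integral_FTC_Icc) auto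
  then show ?thesis using has_bochner_integral_integral_eq by fastforce
qed

lemma pushed_bounds:
  assumes \<xi>: "\<xi> \<in> bumps"
  obtains B R where "B > 0" "\<And>s y. s \<in> {0..1} \<Longrightarrow> \<bar>pushed \<xi> s y / c s\<bar> \<le> B"
    "\<And>s y. s \<in> {0..1} \<Longrightarrow> norm y > R \<Longrightarrow> pushed \<xi> s y = 0"
proof -
  obtain B R where BR: "B > 0" "R > 0" "\<And>x. \<bar>\<xi> x\<bar> \<le> B" "\<And>x. norm x > R \<Longrightarrow> \<xi> x = 0"
    using bumps_bounded[OF \<xi>] by blast
  have 1: "\<bar>pushed \<xi> s y / c s\<bar> \<le> B" if s: "s \<in> {0..1}" for s y
  proof -
    have c1: "c s \<ge> 1" "c s ^ DIM('a) \<ge> 1" using c_ge_1[OF s] by auto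
    have "\<bar>pushed \<xi> s y / c s\<bar> = \<bar>\<xi> ((1 / c s) *\<^sub>R (y - s *\<^sub>R h))\<bar> / (c s ^ DIM('a) * c s)"
      using c1 by (simp add: pushed_def abs_mult)
    also have "... \<le> \<bar>\<xi> ((1 / c s) *\<^sub>R (y - s *\<^sub>R h))\<bar> / 1"
      using c1 mult_mono[of 1 "c s ^ DIM('a)" 1 "c s"] by (intro divide_left_mono) auto
    also have "... \<le> B" using BR(3) by simp
    finally show ?thesis .
  qed
  have 2: "pushed \<xi> s y = 0" if s: "s \<in> {0..1}" and y: "norm y > c 1 * R + norm h" for s y
  proof -
    have c1: "c s \<ge> 1" "c s \<le> c 1" using c_ge_1[OF s] s \<kappa> by (auto simp: c_def mult_left_le_one_le)
    have "norm (s *\<^sub>R h) \<le> norm h" using s by (simp add: mult_left_le_one_le)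
    then have "c 1 * R < norm (y - s *\<^sub>R h)" using y norm_triangle_ineq2[of y "s *\<^sub>R h"] by linarith
    then have "c s * R < norm (y - s *\<^sub>R h)" using mult_right_mono[OF c1(2), of R] BR(2) by linarith
    then have "norm ((1 / c s) *\<^sub>R (y - s *\<^sub>R h)) > R" using c1 by (simp add: pos_less_divide_eq mult.commute)
    then show ?thesis using BR(4) by (simp add: pushed_def)
  qed
  show ?thesis using that[OF BR(1) 1 2] .
qed

lemma meas_pushed:
  assumes \<xi>: "\<xi> \<in> borel_measurable borel"
  shows "(\<lambda>(s, y). pushed \<xi> s y / c s) \<in> borel_measurable borel"
proof -
  note [measurable] = \<xi>
  show ?thesis unfolding pushed_def case_prod_beta' by measurable
qed

text \<open>At a fixed time, \<open>u\<close> composed with the flow map is tested with the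
  components of \<open>v \<phi>\<close>. The factor \<open>c s\<close> that the gradient of the
  composition brings cancels the division by \<open>c s\<close>.\<close>

lemma weak_path:
  assumes \<phi>: "\<phi> \<in> bumps" and s: "s \<in> {0..1}"
  shows "(LBINT y. u y * (- pushed (\<Psi> \<phi>) s y / c s)) = (LBINT x. path_integrand x s * \<phi> x)"
proof -
  have c0: "c s > 0" using c_ge_1[OF s] by simp
  define w where "w = (\<lambda>b x. (v x \<bullet> b) * \<phi> x)"
  have w: "w b \<in> bumps" for b unfolding w_def by (intro bumps_mult_left v_component_smooth \<phi>)
  note [measurable] = bumps_measurable[OF \<Psi>_bumps[OF \<phi>]] bumps_measurable[OF \<phi>]
  define g where "g = (\<lambda>x. G (c s *\<^sub>R x + s *\<^sub>R h))"
  have lg: "l2 g" unfolding g_def using lG c0 by (intro l2_affine) auto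
  have lu': "l2 (\<lambda>x. u (c s *\<^sub>R x + s *\<^sub>R h))" using lu c0 by (intro l2_affine) auto
  have "(LBINT y. u y * (- pushed (\<Psi> \<phi>) s y / c s)) = - (1 / c s) * (LBINT y. u y * pushed (\<Psi> \<phi>) s y)"
    by (simp flip: integral_mult_right_zero)
  also have "(LBINT y. u y * pushed (\<Psi> \<phi>) s y) = (LBINT x. u (c s *\<^sub>R x + s *\<^sub>R h) * \<Psi> \<phi> x)"
    by (subst pushed_integral[OF s]) (auto simp: path_point)
  also have "... = (LBINT x. (\<Sum>b\<in>Basis. u (c s *\<^sub>R x + s *\<^sub>R h) * pdiff (w b) x b))"
    by (simp add: \<Psi>_def w_def sum_distrib_left)
  also have "... = (\<Sum>b\<in>Basis. LBINT x. u (c s *\<^sub>R x + s *\<^sub>R h) * pdiff (w b) x b)"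
    by (intro Bochner_Integration.integral_sum integrable_l2_bump[OF lu'] pdiff_bumps w)
  also have "... = (\<Sum>b\<in>Basis. - (c s * (LBINT x. (g x \<bullet> b) * w b x)))"
    unfolding g_def by (intro sum.cong refl sob_affine_weak[OF S c0 w])
  also have "- (1 / c s) * ... = (\<Sum>b\<in>Basis. LBINT x. (g x \<bullet> b) * w b x)" using c0 by (simp add: sum_negf flip: sum_distrib_left)
  also have "... = (LBINT x. (\<Sum>b\<in>Basis. (g x \<bullet> b) * w b x))"
    by (intro Bochner_Integration.integral_sum[symmetric] integrable_l2_bump[OF l2_inner[OF lg]] w)
  also have "... = (LBINT x. path_integrand x s * \<phi> x)"
  proof (intro Bochner_Integration.integral_cong refl)
    fix x
    have "(\<Sum>b\<in>Basis. (g x \<bullet> b) * w b x) = (\<Sum>b\<in>Basis. (g x \<bullet> b) * (v x \<bullet> b)) * \<phi> x"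
      by (simp add: w_def sum_distrib_right mult.assoc)
    also have "... = (g x \<bullet> v x) * \<phi> x" by (simp add: euclidean_inner[of "g x" "v x"])
    finally show "(\<Sum>b\<in>Basis. (g x \<bullet> b) * w b x) = path_integrand x s * \<phi> x"
      using s by (simp add: path_integrand_def g_def path_point)
  qed
  finally show ?thesis .
qed

text \<open>By duality: the increment of \<open>u\<close> tested with \<open>\<phi>\<close> is
  \<open>u\<close> tested with the increment of the pushed density. Writing the latter as a time
  integral, exchanging integrals and applying \<open>weak_path\<close> gives the tested identity for
  every bump, and \<open>fundamental_lemma\<close> removes the test.\<close>

theorem flow:
  "AE x in lborel. integrable lborel (path_integrand x) \<and> u (x + v x) - u x = (LBINT s. path_integrand x s)"
proof -
  define I where "I x = (LBINT s. path_integrand x s)" for x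
  have pair: "integrable (lborel \<Otimes>\<^sub>M lborel) (\<lambda>(s, x). path_integrand x s * indicator (cball 0 R) x)" for R
    by (rule path_integrable_pair[of _ 1 R]) (auto simp: indicator_def)
  have Iloc: "integrable lborel (\<lambda>x. indicator (cball 0 R) x * I x)" for R
    using lborel_pair.integrable_snd[OF pair[of R]] by (simp add: I_def mult.commute)
  \<comment> \<open>Integrability was obtained after truncation to a ball; countably many balls
    exhaust the space.\<close>
  have "AE x in lborel. \<forall>n::nat. integrable lborel (\<lambda>s. path_integrand x s * indicator (cball 0 (real n)) x)"
    using lborel_pair.AE_integrable_snd[OF pair] by (subst AE_all_countable) auto
  then have int: "AE x in lborel. integrable lborel (path_integrand x)"
  proof eventually_elim
    case (elim x)
    obtain n :: nat where "norm x \<le> n" using real_arch_simple by blast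
    then show ?case using elim[THEN spec, of n] by simp
  qed
  have "(\<lambda>p. path_integrand (fst p) (snd p)) \<in> borel_measurable (lborel \<Otimes>\<^sub>M lborel)" using meas_path
    by (subst measurable_pair_swap_iff) (simp add: lborel_prod case_prod_beta')
  then have mI[measurable]: "I \<in> borel_measurable borel" using lborel.borel_measurable_lebesgue_integral[of path_integrand lborel]
    by (simp add: I_def[abs_def] case_prod_beta')
  define g where "g x = u (x + v x) - u x - I x" for x
  have xv: "x + v x = c 1 *\<^sub>R x + h" for x by (simp add: c_def v_def algebra_simps)
  have lu1: "l2 (\<lambda>x. u (x + v x))" unfolding xv using lu c_ge_1[of 1] by (intro l2_affine) auto
  have "AE x in lborel. g x = 0"
  proof (rule fundamental_lemma)
    show [measurable]: "g \<in> borel_measurable borel" unfolding g_def[abs_def] by measurable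
    show "integrable lborel (\<lambda>x. indicator (cball 0 R) x * g x)" for R
      using l2_locally_integrable[OF lu, of R] l2_locally_integrable[OF lu1, of R] Iloc[of R] by (simp add: g_def right_diff_distrib)
    fix \<phi> assume \<phi>: "(\<phi> :: 'a \<Rightarrow> real) \<in> bumps"
    note [measurable] = bumps_measurable[OF \<Psi>_bumps[OF \<phi>]] bumps_measurable[OF \<phi>]
    obtain B R where BR: "B > 0" "R > 0" "\<And>x. \<bar>\<phi> x\<bar> \<le> B" "\<And>x. norm x > R \<Longrightarrow> \<phi> x = 0"
      using bumps_bounded[OF \<phi>] by blast
    have pair\<phi>: "integrable (lborel \<Otimes>\<^sub>M lborel) (\<lambda>(s, x). path_integrand x s * \<phi> x)"
      by (rule path_integrable_pair[OF _ BR(3) BR(4)]) auto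
    have I\<phi>: "integrable lborel (\<lambda>x. I x * \<phi> x)" using lborel_pair.integrable_snd[OF pair\<phi>] by (simp add: I_def)
    define F where "F s y = indicator {0..1} s * (u y * (- pushed (\<Psi> \<phi>) s y / c s))" for s y
    have pairF: "integrable (lborel \<Otimes>\<^sub>M lborel) (\<lambda>(s, y). F s y)"
    proof -
      obtain B R where BR: "B > 0" "\<And>s y. s \<in> {0..1} \<Longrightarrow> \<bar>pushed (\<Psi> \<phi>) s y / c s\<bar> \<le> B"
        "\<And>s y. s \<in> {0..1} \<Longrightarrow> norm y > R \<Longrightarrow> pushed (\<Psi> \<phi>) s y = 0"
        using pushed_bounds[OF \<Psi>_bumps[OF \<phi>]] by blast
      have il: "integrable lborel (\<lambda>x. B * \<bar>indicator (cball 0 R) x * u x\<bar>)" using l2_locally_integrable[OF lu, of R] by auto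
      show ?thesis
      proof (rule integrable_pairI)
        have 1: "(\<lambda>p. u (snd p)) \<in> borel_measurable (borel :: (real \<times> 'a) measure)"
          by (rule measurable_compose[OF _ meas(1)]) (auto intro!: borel_measurable_continuous_onI continuous_intros)
        have 2: "(\<lambda>p. indicator {0..1} (fst p) :: real) \<in> borel_measurable (borel :: (real \<times> 'a) measure)"
          by (rule measurable_compose[of _ _ borel]) (auto intro!: borel_measurable_continuous_onI continuous_intros)
        have "(\<lambda>p. - (indicator {0..1} (fst p) * (u (snd p) * (case p of (s, y) \<Rightarrow> pushed (\<Psi> \<phi>) s y / c s))))
            \<in> borel_measurable borel" by (intro borel_measurable_uminus borel_measurable_times 1 2 meas_pushed) simp
        then show "(\<lambda>(s, y). F s y) \<in> borel_measurable borel" by (simp add: F_def case_prod_beta')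
        show "(\<integral>\<^sup>+y. ennreal \<bar>case (s, y) of (s, y) \<Rightarrow> F s y\<bar> \<partial>lborel)
           \<le> ennreal (LBINT x. B * \<bar>indicator (cball 0 R) x * u x\<bar>)" if s: "s \<in> {0..1}" for s
        proof -
          have "(\<integral>\<^sup>+y. ennreal \<bar>case (s, y) of (s, y) \<Rightarrow> F s y\<bar> \<partial>lborel)
            \<le> (\<integral>\<^sup>+y. ennreal (B * \<bar>indicator (cball 0 R) y * u y\<bar>) \<partial>lborel)"
          proof (intro nn_integral_mono ennreal_leI)
            fix y
            show "\<bar>case (s, y) of (s, y) \<Rightarrow> F s y\<bar> \<le> B * \<bar>indicator (cball 0 R) y * u y\<bar>"
              using mult_left_mono[OF BR(2)[OF s, of y], of "\<bar>u y\<bar>"] BR(3)[OF s, of y] s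
              by (cases "norm y > R") (simp_all add: F_def abs_mult mult.commute)
          qed
          also have "... = ennreal (LBINT x. B * \<bar>indicator (cball 0 R) x * u x\<bar>)"
            using BR(1) by (intro nn_integral_eq_integral[OF il]) auto
          finally show ?thesis .
        qed
      qed (simp add: F_def)
    qed
    have "(LBINT x. u (x + v x) * \<phi> x) - (LBINT x. u x * \<phi> x) = (LBINT y. u y * pushed \<phi> 1 y) - (LBINT y. u y * pushed \<phi> 0 y)"
      by (simp add: pushed_integral)
    also have "... = (LBINT y. u y * (pushed \<phi> 1 y - pushed \<phi> 0 y))"
    proof -
      have "integrable lborel (\<lambda>y. u y * pushed \<phi> s y)" if s: "s \<in> {0..1}" for s
      proof -
        have c1: "c s \<ge> 1" using c_ge_1[OF s] .
        have "(\<lambda>y. \<phi> ((1 / c s) *\<^sub>R y + (- (s / c s) *\<^sub>R h))) \<in> bumps" using c1 by (intro bumps_affine \<phi>) auto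
        from integrable_l2_bump[OF lu this]
        have "integrable lborel (\<lambda>y. (u y * \<phi> ((1 / c s) *\<^sub>R y + (- (s / c s) *\<^sub>R h))) / c s ^ DIM('a))" by auto
        then show ?thesis by (simp add: pushed_def scaleR_diff_right)
      qed
      then show ?thesis by (simp add: right_diff_distrib)
    qed
    also have "... = (LBINT y. LBINT s. F s y)"
    proof (intro Bochner_Integration.integral_cong refl)
      fix y
      have "(LBINT s. F s y) = (LBINT s. u y * (indicator {0..1} s * (- pushed (\<Psi> \<phi>) s y / c s)))"
        by (intro Bochner_Integration.integral_cong) (auto simp: F_def)
      then show "u y * (pushed \<phi> 1 y - pushed \<phi> 0 y) = (LBINT s. F s y)"
        by (simp only: integral_mult_right_zero pushed_increment[OF \<phi>])
    qed
    also have "... = (LBINT s. LBINT y. F s y)" by (rule lborel_pair.Fubini_integral[OF pairF])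
    also have "... = (LBINT s. LBINT x. path_integrand x s * \<phi> x)"
    proof (rule Bochner_Integration.integral_cong[OF refl])
      fix s :: real
      show "(LBINT y. F s y) = (LBINT x. path_integrand x s * \<phi> x)"
      proof (cases "s \<in> {0..1}")
        case True
        then show ?thesis using weak_path[OF \<phi> True] by (simp add: F_def)
      qed (simp add: F_def path_integrand_def)
    qed
    also have "... = (LBINT x. LBINT s. path_integrand x s * \<phi> x)" by (rule lborel_pair.Fubini_integral[OF pair\<phi>, symmetric])
    also have "... = (LBINT x. I x * \<phi> x)" by (simp add: I_def)
    finally have "(LBINT x. u (x + v x) * \<phi> x) - (LBINT x. u x * \<phi> x) - (LBINT x. I x * \<phi> x) = 0" by simp
    then show "(LBINT x. g x * \<phi> x) = 0" using integrable_l2_bump[OF lu \<phi>] integrable_l2_bump[OF lu1 \<phi>] I\<phi>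
      by (simp add: g_def left_diff_distrib)
  qed
  with int show ?thesis by eventually_elim (simp add: g_def I_def)
qed

end

section \<open>Square integrable functions\<close>

lemma
  fixes f g :: "'a \<Rightarrow> real"
  assumes [measurable]: "f \<in> borel_measurable M" "g \<in> borel_measurable M"
    and f: "integrable M (\<lambda>x. (f x)\<^sup>2)" and g: "integrable M (\<lambda>x. (g x)\<^sup>2)"
  shows integrable_mult_square: "integrable M (\<lambda>x. f x * g x)"
    and Cauchy_Schwarz_integral: "(LINT x|M. f x * g x)\<^sup>2 \<le> (LINT x|M. (f x)\<^sup>2) * (LINT x|M. (g x)\<^sup>2)"
proof -
  show fg: "integrable M (\<lambda>x. f x * g x)"
  proof (rule Bochner_Integration.integrable_bound[OF Bochner_Integration.integrable_add[OF f g]])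
    have "\<bar>f x * g x\<bar> \<le> (f x)\<^sup>2 + (g x)\<^sup>2" for x
      using sum_squares_bound[of "\<bar>f x\<bar>" "\<bar>g x\<bar>"] mult_nonneg_nonneg[of "\<bar>f x\<bar>" "\<bar>g x\<bar>"]
      unfolding abs_mult power2_abs by linarith
    then show "AE x in M. norm (f x * g x) \<le> norm ((f x)\<^sup>2 + (g x)\<^sup>2)" by (auto intro!: AE_I2 order_trans[OF _ abs_ge_self])
  qed simp
  define A B X where "A = (LINT x|M. (f x)\<^sup>2)" and "B = (LINT x|M. (g x)\<^sup>2)" and "X = (LINT x|M. f x * g x)"
  have A0: "A \<ge> 0" "B \<ge> 0" by (auto simp: A_def B_def)
  have q: "0 \<le> a\<^sup>2 * A - 2 * a * b * X + b\<^sup>2 * B" for a b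
  proof -
    have "0 \<le> (LINT x|M. (a * f x - b * g x)\<^sup>2)" by simp
    also have "... = (LINT x|M. a\<^sup>2 * (f x)\<^sup>2 - (2 * a * b) * (f x * g x) + b\<^sup>2 * (g x)\<^sup>2)"
      by (intro Bochner_Integration.integral_cong) (auto simp: power2_eq_square algebra_simps)
    also have "... = a\<^sup>2 * A - 2 * a * b * X + b\<^sup>2 * B" using f g fg by (simp add: A_def B_def X_def)
    finally show ?thesis .
  qed
  have "X\<^sup>2 \<le> A * B"
  proof (cases "A > 0")
    case True
    have "0 \<le> A * (A * B - X\<^sup>2)" using q[of X A] by (simp add: algebra_simps power2_eq_square)
    then show ?thesis using True by (simp add: zero_le_mult_iff)
  next
    case False
    then have "A = 0" using A0 by simp
    have "X = 0"
    proof (rule ccontr)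
      assume "X \<noteq> 0"
      \<comment> \<open>With A = 0 the quadratic expression is affine in a, and this choice gives it
        the value -1.\<close>
      then show False using q[of "(B + 1) / (2 * X)" 1] \<open>A = 0\<close> by simp
    qed
    then show ?thesis using A0 by simp
  qed
  then show "(LINT x|M. f x * g x)\<^sup>2 \<le> (LINT x|M. (f x)\<^sup>2) * (LINT x|M. (g x)\<^sup>2)" by (simp add: A_def B_def X_def)
qed

definition l2sq :: "('a::euclidean_space \<Rightarrow> 'b::euclidean_space) \<Rightarrow> real" where "l2sq f = (LBINT x. (norm (f x))\<^sup>2)"

lemma l2sq_nonneg[simp]: "0 \<le> l2sq f"
  by (simp add: l2sq_def)

lemma l2_mult_integrable:
  assumes "l2 f" "l2 g" shows "integrable lborel (\<lambda>x. norm (f x) * norm (g x))"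
  using l2_measurable[OF assms(1)] l2_measurable[OF assms(2)] by (intro integrable_mult_square) (use assms in \<open>auto simp: l2_def\<close>)

lemma l2_inner_integrable:
  assumes "l2 f" "l2 g" shows "integrable lborel (\<lambda>x. f x \<bullet> g x)"
proof (rule Bochner_Integration.integrable_bound[OF l2_mult_integrable[OF assms]])
  note [measurable] = l2_measurable[OF assms(1)] l2_measurable[OF assms(2)]
  show "(\<lambda>x. f x \<bullet> g x) \<in> borel_measurable lborel" by simp
  show "AE x in lborel. norm (f x \<bullet> g x) \<le> norm (norm (f x) * norm (g x))"
    using Cauchy_Schwarz_ineq2 by (intro AE_I2) (auto simp: abs_mult)
qed

lemma l2_mult_bound:
  assumes "l2 f" "l2 g"
  shows "(LBINT x. norm (f x) * norm (g x)) \<le> sqrt (l2sq f) * sqrt (l2sq g)"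
proof -
  have "(LBINT x. norm (f x) * norm (g x))\<^sup>2 \<le> l2sq f * l2sq g" unfolding l2sq_def
    using l2_measurable[OF assms(1)] l2_measurable[OF assms(2)] by (intro Cauchy_Schwarz_integral) (use assms in \<open>auto simp: l2_def\<close>)
  then show ?thesis by (simp add: real_le_rsqrt flip: real_sqrt_mult)
qed

lemma l2_inner_bound:
  assumes "l2 f" "l2 g"
  shows "\<bar>LBINT x. f x \<bullet> g x\<bar> \<le> sqrt (l2sq f) * sqrt (l2sq g)"
proof -
  have "\<bar>LBINT x. f x \<bullet> g x\<bar> \<le> (LBINT x. \<bar>f x \<bullet> g x\<bar>)" by (rule integral_abs_bound)
  also have "... \<le> (LBINT x. norm (f x) * norm (g x))" using l2_inner_integrable[OF assms] l2_mult_integrable[OF assms] Cauchy_Schwarz_ineq2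
    by (intro integral_mono) auto
  finally show ?thesis using l2_mult_bound[OF assms] by simp
qed

lemma norm_add_square_le:
  fixes a b :: "'a::real_normed_vector"
  shows "(norm (a + b))\<^sup>2 \<le> (norm a)\<^sup>2 + 2 * (norm a * norm b) + (norm b)\<^sup>2"
  using power_mono[OF norm_triangle_ineq[of a b], where n=2] by (simp add: power2_sum mult.assoc)

lemma
  assumes "l2 f" "l2 g"
  shows l2_add: "l2 (\<lambda>x. f x + g x)"
    and l2sq_add: "sqrt (l2sq (\<lambda>x. f x + g x)) \<le> sqrt (l2sq f) + sqrt (l2sq g)"
proof -
  note [measurable] = l2_measurable[OF assms(1)] l2_measurable[OF assms(2)]
  define b where "b = (\<lambda>x. (norm (f x))\<^sup>2 + 2 * (norm (f x) * norm (g x)) + (norm (g x))\<^sup>2)"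
  have ib: "integrable lborel b" unfolding b_def using l2_mult_integrable[OF assms] assms by (auto simp: l2_def)
  have i: "integrable lborel (\<lambda>x. (norm (f x + g x))\<^sup>2)" by (rule Bochner_Integration.integrable_bound[OF ib])
      (auto simp: b_def norm_add_square_le intro!: AE_I2 order_trans[OF _ abs_ge_self])
  then show "l2 (\<lambda>x. f x + g x)" by (simp add: l2_def)
  have "l2sq (\<lambda>x. f x + g x) \<le> (LBINT x. b x)" unfolding l2sq_def b_def by (intro integral_mono i ib[unfolded b_def] norm_add_square_le)
  also have "... = l2sq f + 2 * (LBINT x. norm (f x) * norm (g x)) + l2sq g"
    unfolding b_def l2sq_def using l2_mult_integrable[OF assms] assms by (simp add: l2_def)
  also have "... \<le> l2sq f + 2 * (sqrt (l2sq f) * sqrt (l2sq g)) + l2sq g" using l2_mult_bound[OF assms] by simp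
  also have "... = (sqrt (l2sq f) + sqrt (l2sq g))\<^sup>2" by (simp add: power2_sum)
  finally show "sqrt (l2sq (\<lambda>x. f x + g x)) \<le> sqrt (l2sq f) + sqrt (l2sq g)" by (intro real_le_lsqrt) auto
qed

lemma l2_scale: "l2 f \<Longrightarrow> l2 (\<lambda>x. c *\<^sub>R f x)"
  and l2sq_scale: "l2sq (\<lambda>x. c *\<^sub>R f x) = c\<^sup>2 * l2sq f"
  by (auto simp: l2_def l2sq_def power_mult_distrib)

lemma l2sq_cmult: "l2sq (\<lambda>x. c * f x) = c\<^sup>2 * l2sq f" for f :: "'a::euclidean_space \<Rightarrow> real"
  using l2sq_scale[of c f] by simp

lemma l2_cmult: "l2 f \<Longrightarrow> l2 (\<lambda>x. c * f x)" for f :: "'a::euclidean_space \<Rightarrow> real"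
  using l2_scale[of f c] by simp

lemma l2_minus: "l2 f \<Longrightarrow> l2 (\<lambda>x. - f x)"
  and l2sq_minus: "l2sq (\<lambda>x. - f x) = l2sq f"
  by (auto simp: l2_def l2sq_def)

lemma l2_diff: "l2 f \<Longrightarrow> l2 g \<Longrightarrow> l2 (\<lambda>x. f x - g x)"
  using l2_add[OF _ l2_minus, of f g] by simp

lemma l2sq_commute: "l2sq (\<lambda>x. f x - g x) = l2sq (\<lambda>x. g x - f x)"
  by (simp add: l2sq_def norm_minus_commute)

lemma l2sq_diff_triangle:
  assumes "l2 f" "l2 g" "l2 h"
  shows "sqrt (l2sq (\<lambda>x. f x - h x)) \<le> sqrt (l2sq (\<lambda>x. f x - g x)) + sqrt (l2sq (\<lambda>x. g x - h x))"
  using l2sq_add[OF l2_diff[OF assms(1,2)] l2_diff[OF assms(2,3)]] by simp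

lemma l2sq_diff_le2: "l2 f \<Longrightarrow> l2 g \<Longrightarrow> l2sq (\<lambda>x. f x + g x) \<le> 2 * l2sq f + 2 * l2sq g"
proof -
  assume fg: "l2 f" "l2 g"
  have "l2sq (\<lambda>x. f x + g x) \<le> (LBINT x. 2 * (norm (f x))\<^sup>2 + 2 * (norm (g x))\<^sup>2)" unfolding l2sq_def
  proof (rule integral_mono)
    show "(norm (f x + g x))\<^sup>2 \<le> 2 * (norm (f x))\<^sup>2 + 2 * (norm (g x))\<^sup>2" for x
      using norm_add_square_le[of "f x" "g x"] sum_squares_bound[of "norm (f x)" "norm (g x)"] by simp
  qed (use l2_add[OF fg] fg in \<open>auto simp: l2_def\<close>)
  then show ?thesis using fg by (simp add: l2_def l2sq_def)
qed

lemma l2sq_translate: "l2 f \<Longrightarrow> l2sq (\<lambda>x. f (x + h)) = l2sq f"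
  unfolding l2sq_def l2_def by (subst (2) integral_lborel_affine[of 1 _ h]) auto

lemma l2_translate: "l2 f \<Longrightarrow> l2 (\<lambda>x. f (x + h))"
  using l2_affine[of f 1 h] by simp

section \<open>Continuity of translations and completeness\<close>

text \<open>The property passes to L^1 limits (\<open>approx\<close>). Outer regularity reduces
  indicators of Borel sets to those of open sets, where the shifted point eventually stays in the
  set and dominated convergence applies.\<close>

lemma L1_translation_continuous:
  fixes f :: "'a::euclidean_space \<Rightarrow> real"
  assumes "integrable lborel f" "t \<longlonglongrightarrow> 0"
  shows "(\<lambda>n. LBINT x. \<bar>f (x + t n) - f x\<bar>) \<longlonglongrightarrow> 0"
  using assms(1)
proof (induction rule: integrable_induct)
  have tr: "integrable lborel (\<lambda>x. f (x + h))" "(LBINT x. f (x + h)) = (LBINT x. f x)"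
    if "integrable lborel f" for f :: "'a \<Rightarrow> real" and h using that integrable_lborel_affine_iff[of 1 f h] integral_lborel_affine[of 1 f h]
    by (auto dest: borel_measurable_integrable)
  have approx: "(\<lambda>n. LBINT x. \<bar>f (x + t n) - f x\<bar>) \<longlonglongrightarrow> 0"
    if f: "integrable lborel f" and ap: "\<And>e. e > 0 \<Longrightarrow> \<exists>g. integrable lborel g \<and> (LBINT x. \<bar>f x - g x\<bar>) < e \<and>
      (\<lambda>n. LBINT x. \<bar>g (x + t n) - g x\<bar>) \<longlonglongrightarrow> 0" for f :: "'a \<Rightarrow> real"
  proof (rule LIMSEQ_I)
    fix e :: real assume e: "e > 0"
    obtain g where g: "integrable lborel g" "(LBINT x. \<bar>f x - g x\<bar>) < e / 4"
      "(\<lambda>n. LBINT x. \<bar>g (x + t n) - g x\<bar>) \<longlonglongrightarrow> 0" using ap[of "e/4"] e by auto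
    have "e / 2 > 0" using e by simp
    from LIMSEQ_D[OF g(3) this] obtain n0 where
      n0: "\<And>n. n \<ge> n0 \<Longrightarrow> (LBINT x. \<bar>g (x + t n) - g x\<bar>) < e / 2" by auto
    have "norm ((LBINT x. \<bar>f (x + t n) - f x\<bar>) - 0) < e" if "n \<ge> n0" for n
    proof -
      have d: "integrable lborel (\<lambda>x. \<bar>f x - g x\<bar>)" using f g by auto
      have "(LBINT x. \<bar>f (x + t n) - f x\<bar>) \<le>
         (LBINT x. \<bar>f (x + t n) - g (x + t n)\<bar> + \<bar>g (x + t n) - g x\<bar> + \<bar>f x - g x\<bar>)"
        using tr(1)[OF f, of "t n"] tr(1)[OF g(1), of "t n"] f g(1) by (intro integral_mono) auto
      also have "... = (LBINT x. \<bar>f x - g x\<bar>) + (LBINT x. \<bar>g (x + t n) - g x\<bar>) + (LBINT x. \<bar>f x - g x\<bar>)"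
        using tr(1)[OF f, of "t n"] tr(1)[OF g(1), of "t n"] f g(1) tr(2)[OF d, of "t n"] by simp
      also have "... < e" using n0[OF that] g(2) by simp
      finally show ?thesis by simp
    qed
    then show "\<exists>n0. \<forall>n\<ge>n0. norm ((LBINT x. \<bar>f (x + t n) - f x\<bar>) - 0) < e" by blast
  qed
  {
    case (base A c)
    have [measurable]: "A \<in> sets borel" using base by simp
    have openU: "(\<lambda>n. LBINT x. \<bar>indicator U (x + t n) *\<^sub>R c - indicator U x *\<^sub>R c\<bar>) \<longlonglongrightarrow> 0"
      if U: "open U" "emeasure lborel U < \<infinity>" for U :: "'a set"
    proof -
      have [measurable]: "U \<in> sets borel" using U by simp
      have iU: "integrable lborel (indicator U :: 'a \<Rightarrow> real)" using U by (intro integrable_real_indicator) auto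
      \<comment> \<open>The part of U that the shift carries out of U. Translation preserves
        measure, so as much enters as leaves, and the symmetric difference is twice this
        part.\<close>
      define p where "p n x = indicator U x * (1 - indicator U (x + t n) :: real)" for n x
      have p0: "(\<lambda>n. LBINT x. p n x) \<longlonglongrightarrow> (LINT x|(lborel::'a measure). 0 :: real)"
      proof (rule integral_dominated_convergence[where w="indicator U"])
        show "AE x in lborel. (\<lambda>n. p n x) \<longlonglongrightarrow> 0"
        proof (rule AE_I2)
          fix x
          show "(\<lambda>n. p n x) \<longlonglongrightarrow> 0"
          proof (cases "x \<in> U")
            case True
            have "(\<lambda>n. x + t n) \<longlonglongrightarrow> x + 0" by (intro tendsto_intros assms)
            then have "\<forall>\<^sub>F n in sequentially. x + t n \<in> U"
              using topological_tendstoD[OF _ U(1), of "\<lambda>n. x + t n" "x + 0"] True by simp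
            then have "\<forall>\<^sub>F n in sequentially. p n x = 0" by eventually_elim (simp add: p_def)
            then show ?thesis by (simp add: tendsto_eventually)
          qed (simp add: p_def)
        qed
        show "AE x in lborel. norm (p n x) \<le> indicator U x" for n by (auto simp: p_def indicator_def)
        show "p n \<in> borel_measurable lborel" for n unfolding p_def[abs_def] by measurable
      qed (use iU in simp_all)
      have "(LBINT x. \<bar>indicator U (x + t n) *\<^sub>R c - indicator U x *\<^sub>R c\<bar>) = 2 * \<bar>c\<bar> * (LBINT x. p n x)" for n
      proof -
        have ip: "integrable lborel (p n)" unfolding p_def[abs_def] by (rule Bochner_Integration.integrable_bound[OF iU]) (auto simp: indicator_def)
        have "(LBINT x. \<bar>indicator U (x + t n) *\<^sub>R c - indicator U x *\<^sub>R c\<bar>)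
          = (LBINT x. \<bar>c\<bar> * ((indicator U (x + t n) - indicator U x) + 2 * p n x))"
          by (intro Bochner_Integration.integral_cong) (auto simp: p_def indicator_def)
        also have "... = \<bar>c\<bar> * ((LBINT x. indicator U (x + t n)) - (LBINT x. indicator U x) + 2 * (LBINT x. p n x))"
          using ip tr(1)[OF iU, of "t n"] iU by simp
        also have "... = 2 * \<bar>c\<bar> * (LBINT x. p n x)" using tr(2)[OF iU, of "t n"] by simp
        finally show ?thesis .
      qed
      then show ?thesis using tendsto_mult_right_zero[OF p0[simplified], of "2 * \<bar>c\<bar>"] by simp
    qed
    show ?case
    proof (rule approx)
      show "integrable lborel (\<lambda>x. indicator A x *\<^sub>R c)" using base by auto
      fix e :: real assume e: "e > 0"
      obtain U where U: "open U" "A \<subseteq> U" "emeasure lborel (U - A) < ennreal (e / (\<bar>c\<bar> + 1))"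
        using outer_regular_lborel[of A "e / (\<bar>c\<bar> + 1)"] e by auto
      have [measurable]: "U \<in> sets borel" using U by simp
      have "emeasure lborel U \<le> emeasure lborel (U - A) + emeasure lborel A"
        by (rule order_trans[OF _ emeasure_subadditive]) (auto intro!: emeasure_mono)
      then have fU: "emeasure lborel U < \<infinity>" using U(3) base(2) by (auto simp: less_top[symmetric] top_unique)
      have fUA: "emeasure lborel (U - A) < \<infinity>" using U(3) by (auto simp: less_top[symmetric])
      have "(LBINT x. \<bar>indicator A x *\<^sub>R c - indicator U x *\<^sub>R c\<bar>) = (LBINT x. \<bar>c\<bar> * indicator (U - A) x)"
        using U(2) by (intro Bochner_Integration.integral_cong) (auto simp: indicator_def)
      also have "... = \<bar>c\<bar> * measure lborel (U - A)" by simp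
      also have "... < e"
      proof -
        have "measure lborel (U - A) < e / (\<bar>c\<bar> + 1)" using U(3) fUA e by (simp add: emeasure_eq_ennreal_measure ennreal_less_iff)
        then have "measure lborel (U - A) * (\<bar>c\<bar> + 1) < e" by (simp add: pos_less_divide_eq)
        then show ?thesis using measure_nonneg[of lborel "U - A"] by (simp only: algebra_simps)
      qed
      finally show "\<exists>g. integrable lborel g \<and> (LBINT x. \<bar>indicator A x *\<^sub>R c - g x\<bar>) < e \<and>
         (\<lambda>n. LBINT x. \<bar>g (x + t n) - g x\<bar>) \<longlonglongrightarrow> 0" using openU[OF U(1) fU] fU
        by (intro exI[of _ "\<lambda>x. indicator U x *\<^sub>R c"]) (auto intro!: integrable_mult_left integrable_real_indicator)
    qed
  next
    case (add f g)
    have lim: "(\<lambda>n. (LBINT x. \<bar>f (x + t n) - f x\<bar>) + (LBINT x. \<bar>g (x + t n) - g x\<bar>)) \<longlonglongrightarrow> 0"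
      using tendsto_add[OF add.IH] by simp
    show ?case
    proof (rule Lim_null_comparison[OF _ lim], intro always_eventually allI)
      fix n
      have "(LBINT x. \<bar>f (x + t n) + g (x + t n) - (f x + g x)\<bar>) \<le>
         (LBINT x. \<bar>f (x + t n) - f x\<bar> + \<bar>g (x + t n) - g x\<bar>)"
        using tr(1)[OF add.hyps(1), of "t n"] tr(1)[OF add.hyps(2), of "t n"] add.hyps by (intro integral_mono) auto
      then show "norm (LBINT x. \<bar>f (x + t n) + g (x + t n) - (f x + g x)\<bar>) \<le>
        (LBINT x. \<bar>f (x + t n) - f x\<bar>) + (LBINT x. \<bar>g (x + t n) - g x\<bar>)"
        using tr(1)[OF add.hyps(1), of "t n"] tr(1)[OF add.hyps(2), of "t n"] add.hyps by simp
    qed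
  next
    case (lim f s)
    show ?case
    proof (rule approx[OF lim.hyps(4)])
      fix e :: real assume e: "e > 0"
      have "(\<lambda>i. LBINT x. \<bar>f x - s i x\<bar>) \<longlonglongrightarrow> (LINT x|(lborel::'a measure). (0::real))"
      proof (rule integral_dominated_convergence[where w="\<lambda>x. 3 * \<bar>f x\<bar>"])
        show "AE x in lborel. (\<lambda>i. \<bar>f x - s i x\<bar>) \<longlonglongrightarrow> 0"
          using lim.hyps(2) by (intro AE_I2 tendsto_rabs_zero) (auto intro!: tendsto_eq_intros)
        show "AE x in lborel. norm \<bar>f x - s i x\<bar> \<le> 3 * \<bar>f x\<bar>" for i
        proof (rule AE_I2)
          fix x :: 'a assume "x \<in> space lborel"
          from lim.hyps(3)[OF this, of i] show "norm \<bar>f x - s i x\<bar> \<le> 3 * \<bar>f x\<bar>" unfolding real_norm_def by linarith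
        qed
      qed (use lim.hyps in auto)
      from order_tendstoD(2)[OF this[simplified] e] obtain i where "(LBINT x. \<bar>f x - s i x\<bar>) < e" by (auto simp: eventually_sequentially)
      then show "\<exists>g. integrable lborel g \<and> (LBINT x. \<bar>f x - g x\<bar>) < e \<and>
         (\<lambda>n. LBINT x. \<bar>g (x + t n) - g x\<bar>) \<longlonglongrightarrow> 0" using lim.hyps(1) lim.IH by blast
    qed
  }
qed

lemma l2_component_sum:
  fixes f :: "'a::euclidean_space \<Rightarrow> 'b::euclidean_space"
  assumes "l2 f" shows "l2sq f = (\<Sum>b\<in>Basis. l2sq (\<lambda>x. f x \<bullet> b))"
proof -
  have "l2sq f = (LBINT x. (\<Sum>b\<in>Basis. (norm (f x \<bullet> b))\<^sup>2))" unfolding l2sq_def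
  proof (rule Bochner_Integration.integral_cong[OF refl])
    show "(norm (f x))\<^sup>2 = (\<Sum>b\<in>Basis. (norm (f x \<bullet> b))\<^sup>2)" for x
      unfolding power2_norm_eq_inner[of "f x"] by (subst euclidean_inner) (simp add: power2_eq_square)
  qed
  also have "... = (\<Sum>b\<in>Basis. l2sq (\<lambda>x. f x \<bullet> b))" unfolding l2sq_def using l2_inner[OF assms]
    by (intro Bochner_Integration.integral_sum) (auto simp: l2_def)
  finally show ?thesis .
qed

text \<open>For nonnegative values (a - b)^2 \<le> |a^2 - b^2|, which reduces the claim to L^1
  continuity for the square. Positive and negative parts and then the components give the general
  case.\<close>

lemma L2_translation_continuous:
  fixes f :: "'a::euclidean_space \<Rightarrow> 'b::euclidean_space"
  assumes "l2 f"
  shows "((\<lambda>h. l2sq (\<lambda>x. f (x + h) - f x)) \<longlongrightarrow> 0) (at 0)"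
proof -
  have nonneg: "(\<lambda>n. l2sq (\<lambda>x. g (x + t n) - g x)) \<longlonglongrightarrow> 0"
    if g: "l2 g" "\<And>x. g x \<ge> 0" and t: "t \<longlonglongrightarrow> 0" for g :: "'a \<Rightarrow> real" and t
  proof (rule Lim_null_comparison)
    show "(\<lambda>n. LBINT x. \<bar>(g (x + t n))\<^sup>2 - (g x)\<^sup>2\<bar>) \<longlonglongrightarrow> 0"
      using L1_translation_continuous[OF _ t, of "\<lambda>x. (g x)\<^sup>2"] g by (simp add: l2_def)
    show "\<forall>\<^sub>F n in sequentially. norm (l2sq (\<lambda>x. g (x + t n) - g x)) \<le> (LBINT x. \<bar>(g (x + t n))\<^sup>2 - (g x)\<^sup>2\<bar>)"
    proof (intro always_eventually allI)
      fix n
      have "l2sq (\<lambda>x. g (x + t n) - g x) \<le> (LBINT x. \<bar>(g (x + t n))\<^sup>2 - (g x)\<^sup>2\<bar>)" unfolding l2sq_def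
      proof (rule integral_mono)
        show "integrable lborel (\<lambda>x. (norm (g (x + t n) - g x))\<^sup>2)"
          using l2_diff[OF l2_translate[OF g(1)] g(1)] by (rule l2_square_integrable)
        show "integrable lborel (\<lambda>x. \<bar>(g (x + t n))\<^sup>2 - (g x)\<^sup>2\<bar>)"
          using l2_translate[OF g(1), of "t n"] g(1) by (auto simp: l2_def)
        fix x
        have "\<bar>a - b\<bar> * \<bar>a - b\<bar> \<le> \<bar>a - b\<bar> * \<bar>a + b\<bar>" if "a \<ge> 0" "b \<ge> 0" for a b :: real
          using that by (intro mult_left_mono) auto
        from this[OF g(2)[of "x + t n"] g(2)[of x]]
        show "(norm (g (x + t n) - g x))\<^sup>2 \<le> \<bar>(g (x + t n))\<^sup>2 - (g x)\<^sup>2\<bar>"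
          by (simp add: power2_eq_square algebra_simps flip: abs_mult)
      qed
      then show "norm (l2sq (\<lambda>x. g (x + t n) - g x)) \<le> (LBINT x. \<bar>(g (x + t n))\<^sup>2 - (g x)\<^sup>2\<bar>)" by simp
    qed
  qed
  have real: "(\<lambda>n. l2sq (\<lambda>x. g (x + t n) - g x)) \<longlonglongrightarrow> 0"
    if g: "l2 g" and t: "t \<longlonglongrightarrow> 0" for g :: "'a \<Rightarrow> real" and t
  proof -
    note [measurable] = l2_measurable[OF g]
    have p: "l2 (\<lambda>x. max 0 (g x))" "l2 (\<lambda>x. max 0 (- g x))" unfolding l2_def using g
      by (auto intro!: Bochner_Integration.integrable_bound[OF l2_square_integrable[OF g]] AE_I2 power_mono simp: max_def)
    have d: "l2 (\<lambda>x. max 0 (g (x + h)) - max 0 (g x))" "l2 (\<lambda>x. max 0 (- g (x + h)) - max 0 (- g x))" for h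
      using l2_diff[OF l2_translate[OF p(1)] p(1), of h] l2_diff[OF l2_translate[OF p(2)] p(2), of h] by auto
    show ?thesis
    proof (rule Lim_null_comparison)
      show "(\<lambda>n. 2 * l2sq (\<lambda>x. max 0 (g (x + t n)) - max 0 (g x)) + 2 * l2sq (\<lambda>x. max 0 (- g (x + t n)) - max 0 (- g x))) \<longlonglongrightarrow> 0"
        using nonneg[OF p(1) _ t] nonneg[OF p(2) _ t] by (auto intro!: tendsto_eq_intros)
      show "\<forall>\<^sub>F n in sequentially. norm (l2sq (\<lambda>x. g (x + t n) - g x)) \<le>
         2 * l2sq (\<lambda>x. max 0 (g (x + t n)) - max 0 (g x)) + 2 * l2sq (\<lambda>x. max 0 (- g (x + t n)) - max 0 (- g x))"
      proof (intro always_eventually allI)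
        fix n
        have eq: "(max 0 (g (x + t n)) - max 0 (g x)) + - (max 0 (- g (x + t n)) - max 0 (- g x)) = g (x + t n) - g x" for x by (simp add: max_def)
        show "norm (l2sq (\<lambda>x. g (x + t n) - g x)) \<le>
         2 * l2sq (\<lambda>x. max 0 (g (x + t n)) - max 0 (g x)) + 2 * l2sq (\<lambda>x. max 0 (- g (x + t n)) - max 0 (- g x))"
          using l2sq_diff_le2[OF d(1)[of "t n"] l2_minus[OF d(2)[of "t n"]]] unfolding eq l2sq_minus by simp
      qed
    qed
  qed
  show ?thesis unfolding tendsto_at_iff_sequentially
  proof (intro allI impI)
    fix t :: "nat \<Rightarrow> 'a" assume t: "t \<longlonglongrightarrow> 0"
    have "l2sq (\<lambda>x. f (x + t n) - f x) = (\<Sum>b\<in>Basis. l2sq (\<lambda>x. f (x + t n) \<bullet> b - f x \<bullet> b))" for n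
      using l2_component_sum[OF l2_diff[OF l2_translate[OF assms] assms], of "t n"] by (simp add: inner_diff_left)
    moreover have "(\<lambda>n. \<Sum>b\<in>Basis. l2sq (\<lambda>x. f (x + t n) \<bullet> b - f x \<bullet> b)) \<longlonglongrightarrow> 0"
      using real[OF l2_inner[OF assms] t] by (auto intro!: tendsto_null_sum)
    ultimately show "((\<lambda>h. l2sq (\<lambda>x. f (x + h) - f x)) \<circ> t) \<longlonglongrightarrow> 0" by (simp add: comp_def)
  qed
qed

lemma ennreal_l2sq: "l2 f \<Longrightarrow> ennreal (l2sq f) = (\<integral>\<^sup>+x. ennreal ((norm (f x))\<^sup>2) \<partial>lborel)"
  unfolding l2sq_def l2_def by (subst nn_integral_eq_integral) auto

text \<open>A subsequence with geometrically small increments converges almost everywhere. Fatou's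
  lemma then controls the distance of the full sequence to that limit, and also shows that the limit
  is in L^2.\<close>

lemma L2_complete:
  fixes f :: "nat \<Rightarrow> 'a::euclidean_space \<Rightarrow> 'b::euclidean_space"
  assumes f: "\<And>n. l2 (f n)"
    and cauchy: "\<And>e. e > 0 \<Longrightarrow> \<exists>N. \<forall>m\<ge>N. \<forall>n\<ge>N. l2sq (\<lambda>x. f m x - f n x) < e"
  obtains g where "l2 g" "(\<lambda>n. l2sq (\<lambda>x. f n x - g x)) \<longlonglongrightarrow> 0"
proof -
  have "\<exists>N. \<forall>m\<ge>N. \<forall>n\<ge>N. l2sq (\<lambda>x. f m x - f n x) < (1/16) ^ k" for k :: nat by (rule cauchy) simp
  then obtain N where N: "\<And>k m n. m \<ge> N k \<Longrightarrow> n \<ge> N k \<Longrightarrow> l2sq (\<lambda>x. f m x - f n x) < (1/16) ^ k"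
    by metis
  define r where "r k = (\<Sum>j\<le>k. N j) + k" for k
  have rN: "r k \<ge> N k" for k unfolding r_def by (simp add: member_le_sum trans_le_add1)
  have rS: "r k \<le> r (Suc k)" for k by (simp add: r_def)
  have rk: "r k \<ge> k" for k by (simp add: r_def)
  define d where "d k x = f (r (Suc k)) x - f (r k) x" for k x
  have dl: "l2 (d k)" for k unfolding d_def[abs_def] by (intro l2_diff f)
  have mf[measurable]: "f n \<in> borel_measurable borel" for n using f l2_measurable by blast
  have md[measurable]: "d k \<in> borel_measurable borel" for k using dl l2_measurable by blast
  have dk: "l2sq (d k) \<le> (1/16) ^ k" for k unfolding d_def[abs_def] by (rule less_imp_le[OF N]) (use rN[of k] rS[of k] in auto)
  \<comment> \<open>The weight 4^k is small against the bound 16^(-k), yet its presence forces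
    |d_k(x)| \<le> C 2^(-k) at almost every x, so that the increments are summable
    pointwise.\<close>
  have "(\<integral>\<^sup>+x. (\<Sum>k. ennreal (4 ^ k * (norm (d k x))\<^sup>2)) \<partial>lborel) = (\<Sum>k. \<integral>\<^sup>+x. ennreal (4 ^ k * (norm (d k x))\<^sup>2) \<partial>lborel)"
    by (intro nn_integral_suminf) auto
  also have "... = (\<Sum>k. ennreal (4 ^ k * l2sq (d k)))" by (intro suminf_cong) (simp add: ennreal_mult nn_integral_cmult ennreal_l2sq[OF dl])
  also have "... \<le> (\<Sum>k. ennreal ((1/4) ^ k))"
  proof (intro suminf_le ennreal_leI)
    fix k :: nat
    have "4 ^ k * l2sq (d k) \<le> 4 ^ k * (1/16) ^ k" using dk[of k] by (intro mult_left_mono) auto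
    then show "4 ^ k * l2sq (d k) \<le> (1/4) ^ k" by (simp flip: power_mult_distrib)
  qed auto
  also have "... = ennreal (\<Sum>k. (1/4) ^ k)" by (intro suminf_ennreal2) (auto intro: summable_geometric)
  also have "... < \<infinity>" by simp
  finally have "AE x in lborel. (\<Sum>k. ennreal (4 ^ k * (norm (d k x))\<^sup>2)) \<noteq> \<infinity>" by (intro nn_integral_PInf_AE) auto
  then have "AE x in lborel. convergent (\<lambda>k. f (r k) x)"
  proof eventually_elim
    case (elim x)
    define t where "t k = ennreal (4 ^ k * (norm (d k x))\<^sup>2)" for k
    define C where "C = enn2real (\<Sum>k. t k)"
    have fin: "(\<Sum>k. t k) = ennreal C" using elim unfolding t_def[symmetric] by (simp add: C_def less_top)
    have C0: "C \<ge> 0" by (simp add: C_def)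
    have le: "4 ^ k * (norm (d k x))\<^sup>2 \<le> C" for k
    proof -
      have "sum t {k} \<le> suminf t" by (rule sum_le_suminf) auto
      then have "ennreal (4 ^ k * (norm (d k x))\<^sup>2) \<le> ennreal C" by (simp add: fin) (simp add: t_def)
      then show ?thesis using C0 by simp
    qed
    have nd: "norm (d k x) \<le> sqrt C * (1/2) ^ k" for k
    proof -
      have "(2 ^ k)\<^sup>2 = (4 ^ k :: real)" by (simp add: power2_eq_square flip: power_mult_distrib)
      then have "(2 ^ k * norm (d k x))\<^sup>2 \<le> C" using le[of k] by (simp only: power_mult_distrib)
      then have "2 ^ k * norm (d k x) \<le> sqrt C" by (rule real_le_rsqrt)
      then show ?thesis by (simp add: power_one_over field_simps)
    qed
    have "summable (\<lambda>k. sqrt C * (1/2) ^ k)" by (intro summable_mult) (simp add: summable_geometric)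
    then have "summable (\<lambda>k. d k x)" by (rule summable_comparison_test'[where N=0]) (rule nd)
    then have "convergent (\<lambda>k. \<Sum>j<k. d j x)" by (simp add: summable_iff_convergent)
    then have "convergent (\<lambda>k. f (r 0) x + (\<Sum>j<k. d j x))" by (intro convergent_add convergent_const)
    moreover have "f (r 0) x + (\<Sum>j<k. d j x) = f (r k) x" for k unfolding d_def by (simp add: sum_lessThan_telescope[of "\<lambda>k. f (r k) x"])
    ultimately show ?case by simp
  qed
  then have AE_lim: "AE x in lborel. (\<lambda>k. f (r k) x) \<longlonglongrightarrow> lim (\<lambda>k. f (r k) x)"
    by eventually_elim (simp add: convergent_LIMSEQ_iff)
  define g where "g x = lim (\<lambda>k. f (r k) x)" for x
  have [measurable]: "g \<in> borel_measurable borel" unfolding g_def[abs_def] by (rule borel_measurable_lim_metric) simp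
  have close: "(\<integral>\<^sup>+x. ennreal ((norm (f n x - g x))\<^sup>2) \<partial>lborel) \<le> ennreal ((1/16) ^ j)" if n: "n \<ge> N j" for n j
  proof -
    have "(\<integral>\<^sup>+x. ennreal ((norm (f n x - g x))\<^sup>2) \<partial>lborel) =
        (\<integral>\<^sup>+x. liminf (\<lambda>k. ennreal ((norm (f n x - f (r k) x))\<^sup>2)) \<partial>lborel)"
    proof (rule nn_integral_cong_AE)
      show "AE x in lborel. ennreal ((norm (f n x - g x))\<^sup>2) = liminf (\<lambda>k. ennreal ((norm (f n x - f (r k) x))\<^sup>2))" using AE_lim
      proof eventually_elim
        case (elim x)
        then have "(\<lambda>k. ennreal ((norm (f n x - f (r k) x))\<^sup>2)) \<longlonglongrightarrow> ennreal ((norm (f n x - g x))\<^sup>2)"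
          by (intro tendsto_intros) (simp add: g_def)
        from lim_imp_Liminf[OF _ this] show ?case by simp
      qed
    qed
    also have "... \<le> liminf (\<lambda>k. \<integral>\<^sup>+x. ennreal ((norm (f n x - f (r k) x))\<^sup>2) \<partial>lborel)"
      by (rule nn_integral_liminf) simp
    also have "... = liminf (\<lambda>k. ennreal (l2sq (\<lambda>x. f n x - f (r k) x)))" using ennreal_l2sq[OF l2_diff[OF f f]] by simp
    also have "... \<le> ennreal ((1/16) ^ j)"
    proof (rule Liminf_le)
      show "\<forall>\<^sub>F k in sequentially. ennreal (l2sq (\<lambda>x. f n x - f (r k) x)) \<le> ennreal ((1/16) ^ j)"
        using eventually_ge_at_top[of "N j"]
      proof eventually_elim
        case (elim k)
        then show ?case using less_imp_le[OF N[OF n, of "r k"]] rk[of k] by (intro ennreal_leI) auto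
      qed
    qed simp
    finally show ?thesis .
  qed
  have ld: "l2 (\<lambda>x. f n x - g x)" if "n \<ge> N j" for n j unfolding l2_def using close[OF that]
    by (auto simp: integrable_iff_bounded intro: le_less_trans)
  have lg: "l2 g" using l2_diff[OF f[of "N 0"] ld[of 0 "N 0"]] by simp
  have "(\<lambda>n. l2sq (\<lambda>x. f n x - g x)) \<longlonglongrightarrow> 0"
  proof (rule LIMSEQ_I)
    fix e :: real assume "e > 0"
    then obtain j where j: "(1/16) ^ j < e" using real_arch_pow_inv[of e "1/16"] by auto
    have "norm (l2sq (\<lambda>x. f n x - g x) - 0) < e" if n: "n \<ge> N j" for n
    proof -
      have "ennreal (l2sq (\<lambda>x. f n x - g x)) \<le> ennreal ((1/16) ^ j)" using close[OF n] ennreal_l2sq[OF ld[OF n]] by simp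
      then show ?thesis using j by simp
    qed
    then show "\<exists>no. \<forall>n\<ge>no. norm (l2sq (\<lambda>x. f n x - g x) - 0) < e" by blast
  qed
  then show ?thesis using that lg by blast
qed

section \<open>Consequences of the flow formula\<close>

text \<open>Cauchy-Schwarz on an interval of length 1. The right side is a nonnegative integral so
  that the case in which it is infinite is included.\<close>

lemma unit_interval_Jensen:
  fixes p :: "real \<Rightarrow> real"
  assumes p: "integrable lborel (\<lambda>s. indicator {0..1} s * p s)" and [measurable]: "p \<in> borel_measurable borel"
  shows "ennreal (((LBINT s. indicator {0..1} s * p s) - a)\<^sup>2) \<le>
    (\<integral>\<^sup>+s. indicator {0..1} s * ennreal ((p s - a)\<^sup>2) \<partial>lborel)"
proof -
  define q where "q s = indicator {0..1} s * (p s - a)" for s :: real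
  have [measurable]: "q \<in> borel_measurable borel" unfolding q_def[abs_def] by measurable
  have i1: "integrable lborel (\<lambda>s. indicator {0..1::real} s * a)" by simp
  have q: "integrable lborel q" "(LBINT s. q s) = (LBINT s. indicator {0..1} s * p s) - a"
    using Bochner_Integration.integrable_diff[OF p i1] Bochner_Integration.integral_diff[OF p i1] by (simp_all add: q_def[abs_def] right_diff_distrib)
  have e: "(\<integral>\<^sup>+s. indicator {0..1} s * ennreal ((p s - a)\<^sup>2) \<partial>lborel) = (\<integral>\<^sup>+s. ennreal ((q s)\<^sup>2) \<partial>lborel)"
    by (intro nn_integral_cong) (auto simp: q_def indicator_def)
  show ?thesis
  proof (cases "integrable lborel (\<lambda>s. (q s)\<^sup>2)")
    case True
    have sq: "(\<lambda>s. (indicator {0..1} s)\<^sup>2) = (indicator {0..1} :: real \<Rightarrow> real)" by (auto simp: indicator_def fun_eq_iff)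
    have "(LBINT s. indicator {0..1} s * q s)\<^sup>2 \<le> (LBINT s. (indicator {0..1::real} s)\<^sup>2) * (LBINT s. (q s)\<^sup>2)"
      by (rule Cauchy_Schwarz_integral) (use True in \<open>auto simp: sq\<close>)
    moreover have "indicator {0..1} s * q s = q s" for s by (simp add: q_def indicator_def)
    moreover have "(LBINT s. (indicator {0..1::real} s)\<^sup>2) = (1::real)" by (simp add: sq)
    ultimately have "(LBINT s. q s)\<^sup>2 \<le> (LBINT s. (q s)\<^sup>2)" by simp
    then show ?thesis unfolding e q(2)[symmetric] using True by (subst nn_integral_eq_integral) (auto intro: ennreal_leI)
  next
    case False
    then have "(\<integral>\<^sup>+s. ennreal ((q s)\<^sup>2) \<partial>lborel) = \<infinity>"
      by (auto simp: integrable_iff_bounded less_top[symmetric])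
    then show ?thesis unfolding e by simp
  qed
qed

text \<open>The common source of all quantitative estimates. The weight \<open>w\<close> localises
  or compensates the growth of the field; the comparison function \<open>a\<close> is 0 for size
  estimates and the expected first-order term for difference quotients.\<close>

lemma (in affine_flow) flow_weighted:
  assumes [measurable]: "w \<in> borel_measurable borel" "a \<in> borel_measurable borel"
  shows "(\<integral>\<^sup>+x. w x * ennreal ((u (x + v x) - u x - a x)\<^sup>2) \<partial>lborel) \<le>
    (\<integral>\<^sup>+s. indicator {0..1} s * (\<integral>\<^sup>+x. w x * ennreal ((G (x + s *\<^sub>R v x) \<bullet> v x - a x)\<^sup>2) \<partial>lborel) \<partial>lborel)"
proof -
  have [measurable]: "(\<lambda>p. snd p + fst p *\<^sub>R v (snd p)) \<in> borel_measurable (borel :: (real \<times> 'a) measure)"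
    unfolding v_def by (intro borel_measurable_continuous_onI continuous_intros)
  have m: "(\<lambda>(s, x). w x * (indicator {0..1} s * ennreal ((G (x + s *\<^sub>R v x) \<bullet> v x - a x)\<^sup>2)))
      \<in> borel_measurable (lborel \<Otimes>\<^sub>M lborel)" unfolding lborel_prod case_prod_beta' by simp
  have "(\<integral>\<^sup>+x. w x * ennreal ((u (x + v x) - u x - a x)\<^sup>2) \<partial>lborel) \<le>
     (\<integral>\<^sup>+x. \<integral>\<^sup>+s. w x * (indicator {0..1} s * ennreal ((G (x + s *\<^sub>R v x) \<bullet> v x - a x)\<^sup>2)) \<partial>lborel \<partial>lborel)"
  proof (rule nn_integral_mono_AE)
    show "AE x in lborel. w x * ennreal ((u (x + v x) - u x - a x)\<^sup>2) \<le>
       (\<integral>\<^sup>+s. w x * (indicator {0..1} s * ennreal ((G (x + s *\<^sub>R v x) \<bullet> v x - a x)\<^sup>2)) \<partial>lborel)"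
      using flow
    proof eventually_elim
      case (elim x)
      have "ennreal ((u (x + v x) - u x - a x)\<^sup>2) \<le>
          (\<integral>\<^sup>+s. indicator {0..1} s * ennreal ((G (x + s *\<^sub>R v x) \<bullet> v x - a x)\<^sup>2) \<partial>lborel)"
        using elim unfolding path_integrand_def[abs_def] by (auto intro!: unit_interval_Jensen)
      then show ?case by (subst nn_integral_cmult) (auto intro: mult_left_mono)
    qed
  qed
  also have "... = (\<integral>\<^sup>+s. \<integral>\<^sup>+x. w x * (indicator {0..1} s * ennreal ((G (x + s *\<^sub>R v x) \<bullet> v x - a x)\<^sup>2)) \<partial>lborel \<partial>lborel)"
    using lborel_pair.Fubini'[OF m] by simp
  also have "... = (\<integral>\<^sup>+s. indicator {0..1} s * (\<integral>\<^sup>+x. w x * ennreal ((G (x + s *\<^sub>R v x) \<bullet> v x - a x)\<^sup>2) \<partial>lborel) \<partial>lborel)"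
    by (intro nn_integral_cong) (auto simp: indicator_def)
  finally show ?thesis .
qed

lemma nn_integral_unit_interval_le:
  assumes "\<And>s. s \<in> {0..1} \<Longrightarrow> f s \<le> C"
  shows "(\<integral>\<^sup>+s. indicator {0..1} s * f s \<partial>(lborel :: real measure)) \<le> C"
proof -
  have "(\<integral>\<^sup>+s. indicator {0..1} s * f s \<partial>(lborel :: real measure)) \<le> (\<integral>\<^sup>+s. C * indicator {0..1::real} s \<partial>lborel)"
    using assms by (intro nn_integral_mono) (auto simp: indicator_def)
  then show ?thesis by (simp add: nn_integral_cmult)
qed

lemma inner_square_le: "(a \<bullet> b)\<^sup>2 \<le> (norm b)\<^sup>2 * (norm a)\<^sup>2" for a b :: "'a::real_inner"
  using power_mono[OF Cauchy_Schwarz_ineq2[of a b], where n=2] by (simp add: power_mult_distrib mult.commute)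

lemma sob_l2: "sob u G \<Longrightarrow> l2 u" "sob u G \<Longrightarrow> l2 G"
  by (auto simp: sob_def)

text \<open>Kept local because it is applied to a logarithm of a solution, whose gradient is
  controlled on balls only.\<close>

lemma translation_estimate_on:
  assumes S: "sob u G" and [measurable]: "A \<in> sets borel" "D \<in> sets borel"
    and AD: "\<And>x s. x \<in> A \<Longrightarrow> s \<in> {0..1} \<Longrightarrow> x + s *\<^sub>R h \<in> D"
  shows "(\<integral>\<^sup>+x. indicator A x * ennreal ((u (x + h) - u x)\<^sup>2) \<partial>lborel) \<le>
    ennreal ((norm h)\<^sup>2) * (\<integral>\<^sup>+x. indicator D x * ennreal ((norm (G x))\<^sup>2) \<partial>lborel)"
proof -
  interpret F: affine_flow u G 0 h by standard (use S in auto)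
  note [measurable] = F.meas
  have "(\<integral>\<^sup>+x. indicator A x * ennreal ((u (x + F.v x) - u x - 0)\<^sup>2) \<partial>lborel) \<le>
    (\<integral>\<^sup>+s. indicator {0..1} s * (\<integral>\<^sup>+x. indicator A x * ennreal ((G (x + s *\<^sub>R F.v x) \<bullet> F.v x - 0)\<^sup>2) \<partial>lborel) \<partial>lborel)"
    by (rule F.flow_weighted) auto
  also have "... \<le> ennreal ((norm h)\<^sup>2) * (\<integral>\<^sup>+x. indicator D x * ennreal ((norm (G x))\<^sup>2) \<partial>lborel)"
  proof (rule nn_integral_unit_interval_le)
    fix s :: real assume s: "s \<in> {0..1}"
    have "(\<integral>\<^sup>+x. indicator A x * ennreal ((G (x + s *\<^sub>R F.v x) \<bullet> F.v x - 0)\<^sup>2) \<partial>lborel) \<le>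
      (\<integral>\<^sup>+x. ennreal ((norm h)\<^sup>2) * (indicator D (1 *\<^sub>R x + s *\<^sub>R h) * ennreal ((norm (G (1 *\<^sub>R x + s *\<^sub>R h)))\<^sup>2)) \<partial>lborel)"
    proof (intro nn_integral_mono)
      fix x
      show "indicator A x * ennreal ((G (x + s *\<^sub>R F.v x) \<bullet> F.v x - 0)\<^sup>2) \<le>
        ennreal ((norm h)\<^sup>2) * (indicator D (1 *\<^sub>R x + s *\<^sub>R h) * ennreal ((norm (G (1 *\<^sub>R x + s *\<^sub>R h)))\<^sup>2))"
        using AD[of x s] s inner_square_le[of "G (x + s *\<^sub>R h)" h]
        by (cases "x \<in> A") (auto simp: F.v_def ennreal_mult[symmetric] intro!: ennreal_leI)
    qed
    also have "... = ennreal ((norm h)\<^sup>2) * (\<integral>\<^sup>+x. indicator D x * ennreal ((norm (G x))\<^sup>2) \<partial>lborel)"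
      using nn_integral_lborel_affine[of 1 "\<lambda>x. indicator D x * ennreal ((norm (G x))\<^sup>2)" "s *\<^sub>R h"]
      by (subst nn_integral_cmult) auto
    finally show "(\<integral>\<^sup>+x. indicator A x * ennreal ((G (x + s *\<^sub>R F.v x) \<bullet> F.v x - 0)\<^sup>2) \<partial>lborel) \<le>
        ennreal ((norm h)\<^sup>2) * (\<integral>\<^sup>+x. indicator D x * ennreal ((norm (G x))\<^sup>2) \<partial>lborel)" .
  qed
  finally show ?thesis by (simp add: F.v_def)
qed

lemma translation_estimate:
  assumes S: "sob u G" shows "l2sq (\<lambda>x. u (x + h) - u x) \<le> (norm h)\<^sup>2 * l2sq G"
proof -
  have "ennreal (l2sq (\<lambda>x. u (x + h) - u x)) \<le> ennreal ((norm h)\<^sup>2 * l2sq G)"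
    using translation_estimate_on[OF S, of UNIV UNIV h] ennreal_l2sq[OF sob_l2(2)[OF S]]
      ennreal_l2sq[OF l2_diff[OF l2_translate[OF sob_l2(1)[OF S]] sob_l2(1)[OF S]], of h] by (simp add: ennreal_mult)
  then show ?thesis by simp
qed

text \<open>The field of a dilation grows like |x|, and the weight 1/|x|^2 cancels exactly this
  growth. The Jacobian of the intermediate dilations is at least 1 and may be dropped.\<close>

lemma dilation_estimate:
  fixes u :: "'a::euclidean_space \<Rightarrow> real"
  assumes S: "sob u G" and t: "t \<ge> 1"
  shows "(\<integral>\<^sup>+x. ennreal ((u (t *\<^sub>R x) - u x)\<^sup>2 / (norm x)\<^sup>2) \<partial>lborel) \<le> ennreal ((t - 1)\<^sup>2 * l2sq G)"
proof -
  interpret F: affine_flow u G "t - 1" 0 by standard (use S t in auto)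
  note [measurable] = F.meas
  have "(\<integral>\<^sup>+x. ennreal (1 / (norm x)\<^sup>2) * ennreal ((u (x + F.v x) - u x - 0)\<^sup>2) \<partial>lborel) \<le>
    (\<integral>\<^sup>+s. indicator {0..1} s * (\<integral>\<^sup>+x. ennreal (1 / (norm x)\<^sup>2) * ennreal ((G (x + s *\<^sub>R F.v x) \<bullet> F.v x - 0)\<^sup>2) \<partial>lborel) \<partial>lborel)"
    by (rule F.flow_weighted) auto
  also have "... \<le> ennreal ((t - 1)\<^sup>2 * l2sq G)"
  proof (rule nn_integral_unit_interval_le)
    fix s :: real assume s: "s \<in> {0..1}"
    have c1: "F.c s \<ge> 1" by (rule F.c_ge_1[OF s])
    have lg: "l2 (\<lambda>x. G (F.c s *\<^sub>R x + 0))" using c1 by (intro l2_affine F.lG) auto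
    have "(\<integral>\<^sup>+x. ennreal (1 / (norm x)\<^sup>2) * ennreal ((G (x + s *\<^sub>R F.v x) \<bullet> F.v x - 0)\<^sup>2) \<partial>lborel) \<le>
      (\<integral>\<^sup>+x. ennreal ((t - 1)\<^sup>2) * ennreal ((norm (G (F.c s *\<^sub>R x + 0)))\<^sup>2) \<partial>lborel)"
    proof (intro nn_integral_mono)
      fix x
      have e: "x + s *\<^sub>R F.v x = F.c s *\<^sub>R x" by (simp add: F.v_def F.c_def algebra_simps)
      have "1 / (norm x)\<^sup>2 * (G (F.c s *\<^sub>R x) \<bullet> F.v x)\<^sup>2 \<le> 1 / (norm x)\<^sup>2 * ((norm (F.v x))\<^sup>2 * (norm (G (F.c s *\<^sub>R x)))\<^sup>2)"
        by (intro mult_left_mono inner_square_le) auto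
      also have "... \<le> (t - 1)\<^sup>2 * (norm (G (F.c s *\<^sub>R x)))\<^sup>2" by (cases "x = 0") (auto simp: F.v_def power_mult_distrib)
      finally show "ennreal (1 / (norm x)\<^sup>2) * ennreal ((G (x + s *\<^sub>R F.v x) \<bullet> F.v x - 0)\<^sup>2) \<le>
         ennreal ((t - 1)\<^sup>2) * ennreal ((norm (G (F.c s *\<^sub>R x + 0)))\<^sup>2)" by (simp add: e ennreal_mult[symmetric] ennreal_leI)
    qed
    also have "... = ennreal ((t - 1)\<^sup>2 * l2sq (\<lambda>x. G (F.c s *\<^sub>R x + 0)))"
      by (subst nn_integral_cmult) (auto simp: ennreal_l2sq[OF lg, simplified] ennreal_mult)
    also have "... \<le> ennreal ((t - 1)\<^sup>2 * l2sq G)"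
    proof (intro ennreal_leI mult_left_mono)
      have "1 * l2sq (\<lambda>x. G (F.c s *\<^sub>R x + 0)) \<le> \<bar>F.c s\<bar> ^ DIM('a) * l2sq (\<lambda>x. G (F.c s *\<^sub>R x + 0))"
        using c1 by (intro mult_right_mono) auto
      also have "... = l2sq G" unfolding l2sq_def using c1 by (subst (2) integral_lborel_affine[of "F.c s" _ 0]) auto
      finally show "l2sq (\<lambda>x. G (F.c s *\<^sub>R x + 0)) \<le> l2sq G" by simp
    qed auto
    finally show "(\<integral>\<^sup>+x. ennreal (1 / (norm x)\<^sup>2) * ennreal ((G (x + s *\<^sub>R F.v x) \<bullet> F.v x - 0)\<^sup>2) \<partial>lborel)
      \<le> ennreal ((t - 1)\<^sup>2 * l2sq G)" .
  qed
  finally show ?thesis by (simp add: F.v_def ennreal_mult[symmetric] algebra_simps)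
qed

text \<open>Comparing the increment with \<tau> G(x).b in \<open>flow_weighted\<close> leaves only
  differences of translates of \<open>G\<close>, which are small by continuity of translations in
  L^2.\<close>

lemma difference_quotient_tendsto:
  assumes S: "sob u G"
  shows "((\<lambda>\<tau>. l2sq (\<lambda>x. (u (x + \<tau> *\<^sub>R b) - u x) / \<tau> - G x \<bullet> b)) \<longlongrightarrow> 0) (at 0)"
proof (rule tendstoI)
  fix e :: real assume e: "e > 0"
  \<comment> \<open>The summand 1 admits b = 0, and the factor 2 makes the final inequality
    strict.\<close>
  define e' where "e' = e / (2 * ((norm b)\<^sup>2 + 1))"
  have nb: "(norm b)\<^sup>2 + 1 > 0" using zero_le_power2[of "norm b"] by linarith
  have e': "e' > 0" using e nb by (simp add: e'_def)
  note lu = sob_l2(1)[OF S] and lG = sob_l2(2)[OF S]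
  note [measurable] = l2_measurable[OF lu] l2_measurable[OF lG]
  from tendstoD[OF L2_translation_continuous[OF lG] e'] obtain d where d: "d > 0"
    "\<And>h. h \<noteq> 0 \<Longrightarrow> norm h < d \<Longrightarrow> l2sq (\<lambda>x. G (x + h) - G x) < e'"
    by (auto simp: eventually_at dist_norm)
  have d': "l2sq (\<lambda>x. G (x + h) - G x) \<le> e'" if "norm h < d" for h using d(2)[of h] that e' by (cases "h = 0") (auto simp: l2sq_def)
  have "l2sq (\<lambda>x. (u (x + \<tau> *\<^sub>R b) - u x) / \<tau> - G x \<bullet> b) < e" if \<tau>: "\<tau> \<noteq> 0" "\<bar>\<tau>\<bar> * norm b < d" for \<tau>
  proof -
    interpret F: affine_flow u G 0 "\<tau> *\<^sub>R b" by standard (use S in auto)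
    have ld: "l2 (\<lambda>x. (1/\<tau>) *\<^sub>R (u (x + \<tau> *\<^sub>R b) - u x - \<tau> * (G x \<bullet> b)))"
      by (intro l2_scale l2_diff l2_translate lu l2_cmult l2_inner lG)
    have "(\<integral>\<^sup>+x. 1 * ennreal ((u (x + F.v x) - u x - \<tau> * (G x \<bullet> b))\<^sup>2) \<partial>lborel) \<le>
      (\<integral>\<^sup>+s. indicator {0..1} s * (\<integral>\<^sup>+x. 1 * ennreal ((G (x + s *\<^sub>R F.v x) \<bullet> F.v x - \<tau> * (G x \<bullet> b))\<^sup>2) \<partial>lborel) \<partial>lborel)"
      by (rule F.flow_weighted) auto
    also have "... \<le> ennreal (\<tau>\<^sup>2 * (norm b)\<^sup>2 * e')"
    proof (rule nn_integral_unit_interval_le)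
      fix s :: real assume s: "s \<in> {0..1}"
      have lt: "l2 (\<lambda>x. G (x + (s * \<tau>) *\<^sub>R b) - G x)" by (intro l2_diff l2_translate lG)
      have "(\<integral>\<^sup>+x. 1 * ennreal ((G (x + s *\<^sub>R F.v x) \<bullet> F.v x - \<tau> * (G x \<bullet> b))\<^sup>2) \<partial>lborel) \<le>
        (\<integral>\<^sup>+x. ennreal (\<tau>\<^sup>2 * (norm b)\<^sup>2) * ennreal ((norm (G (x + (s * \<tau>) *\<^sub>R b) - G x))\<^sup>2) \<partial>lborel)"
      proof (intro nn_integral_mono)
        fix x
        have "(\<tau> * ((G (x + (s * \<tau>) *\<^sub>R b) - G x) \<bullet> b))\<^sup>2 \<le> \<tau>\<^sup>2 * ((norm b)\<^sup>2 * (norm (G (x + (s * \<tau>) *\<^sub>R b) - G x))\<^sup>2)"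
          unfolding power_mult_distrib by (intro mult_left_mono inner_square_le) auto
        moreover have "G (x + s *\<^sub>R F.v x) \<bullet> F.v x - \<tau> * (G x \<bullet> b) = \<tau> * ((G (x + (s * \<tau>) *\<^sub>R b) - G x) \<bullet> b)"
          by (simp add: F.v_def inner_diff_left right_diff_distrib)
        ultimately show "1 * ennreal ((G (x + s *\<^sub>R F.v x) \<bullet> F.v x - \<tau> * (G x \<bullet> b))\<^sup>2) \<le>
          ennreal (\<tau>\<^sup>2 * (norm b)\<^sup>2) * ennreal ((norm (G (x + (s * \<tau>) *\<^sub>R b) - G x))\<^sup>2)"
          by (simp add: ennreal_mult[symmetric] ennreal_leI mult.assoc)
      qed
      also have "... = ennreal (\<tau>\<^sup>2 * (norm b)\<^sup>2 * l2sq (\<lambda>x. G (x + (s * \<tau>) *\<^sub>R b) - G x))"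
        by (subst nn_integral_cmult) (auto simp: ennreal_l2sq[OF lt] ennreal_mult)
      also have "... \<le> ennreal (\<tau>\<^sup>2 * (norm b)\<^sup>2 * e')"
      proof (intro ennreal_leI mult_left_mono d')
        have "\<bar>s * \<tau>\<bar> * norm b \<le> \<bar>\<tau>\<bar> * norm b"
          using s by (intro mult_right_mono) (auto simp: abs_mult mult_left_le_one_le)
        then show "norm ((s * \<tau>) *\<^sub>R b) < d" using \<tau>(2) by simp
      qed auto
      finally show "(\<integral>\<^sup>+x. 1 * ennreal ((G (x + s *\<^sub>R F.v x) \<bullet> F.v x - \<tau> * (G x \<bullet> b))\<^sup>2) \<partial>lborel)
        \<le> ennreal (\<tau>\<^sup>2 * (norm b)\<^sup>2 * e')" .
    qed
    finally have 1: "ennreal (l2sq (\<lambda>x. u (x + \<tau> *\<^sub>R b) - u x - \<tau> * (G x \<bullet> b))) \<le> ennreal (\<tau>\<^sup>2 * (norm b)\<^sup>2 * e')"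
      using ennreal_l2sq[OF l2_diff[OF l2_diff[OF l2_translate[OF lu] lu] l2_cmult[OF l2_inner[OF lG]]], of "\<tau> *\<^sub>R b" \<tau> b]
      by (simp add: F.v_def)
    have "l2sq (\<lambda>x. (u (x + \<tau> *\<^sub>R b) - u x) / \<tau> - G x \<bullet> b) = l2sq (\<lambda>x. (1/\<tau>) * (u (x + \<tau> *\<^sub>R b) - u x - \<tau> * (G x \<bullet> b)))"
      using \<tau>(1) by (intro arg_cong[where f=l2sq] ext) (simp add: field_simps)
    also have "... = (1/\<tau>)\<^sup>2 * l2sq (\<lambda>x. u (x + \<tau> *\<^sub>R b) - u x - \<tau> * (G x \<bullet> b))" by (rule l2sq_cmult)
    also have "... \<le> (1/\<tau>)\<^sup>2 * (\<tau>\<^sup>2 * (norm b)\<^sup>2 * e')"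
      using 1 e' by (intro mult_left_mono) (auto simp: ennreal_le_iff)
    also have "... = (norm b)\<^sup>2 * e'" using \<tau>(1) by (simp add: power_divide)
    also have "... < ((norm b)\<^sup>2 + 1) * (2 * e')" using e' by (simp add: algebra_simps add_pos_nonneg)
    also have "... = e"
    proof -
      have "X * (2 * (e / (2 * X))) = e" if "X > 0" for X :: real using that by simp
      from this[OF nb] show ?thesis by (simp only: e'_def)
    qed
    finally show ?thesis .
  qed
  moreover have "\<forall>\<^sub>F \<tau> in at 0. \<tau> \<noteq> 0 \<and> \<bar>\<tau>\<bar> * norm b < d"
  proof -
    have "((\<lambda>\<tau>. \<bar>\<tau>\<bar> * norm b) \<longlongrightarrow> 0) (at (0::real))" by (auto intro!: tendsto_eq_intros)
    from order_tendstoD(2)[OF this d(1)] show ?thesis by (auto simp: eventually_conj_iff eventually_at_filter elim: eventually_mono)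
  qed
  ultimately show "\<forall>\<^sub>F \<tau> in at 0. dist (l2sq (\<lambda>x. (u (x + \<tau> *\<^sub>R b) - u x) / \<tau> - G x \<bullet> b)) 0 < e"
    by (auto elim!: eventually_mono)
qed

section \<open>Difference quotients and arbitrary test functions\<close>

lemma test_function_facts:
  fixes \<phi> :: "'a::euclidean_space \<Rightarrow> real"
  assumes "\<phi> \<in> test_functions"
  obtains R where "R > 0" "\<And>x. norm x > R \<Longrightarrow> \<phi> x = 0" "\<And>x v. norm x > R \<Longrightarrow> pdiff \<phi> x v = 0"
proof -
  have "bounded (closure {x. \<phi> x \<noteq> 0})" using assms by (auto simp: test_functions_def compact_imp_bounded)
  then obtain R where R: "R > 0" "\<And>x. x \<in> closure {x. \<phi> x \<noteq> 0} \<Longrightarrow> norm x \<le> R" unfolding bounded_pos by auto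
  have 1: "x \<notin> closure {x. \<phi> x \<noteq> 0}" if "norm x > R" for x using R(2)[of x] that by auto
  show ?thesis
  proof (rule that[OF R(1)])
    show "\<phi> x = 0" if "norm x > R" for x using 1[OF that] closure_subset[of "{x. \<phi> x \<noteq> 0}"] by auto
    show "pdiff \<phi> x v = 0" if "norm x > R" for x v by (rule pdiff_outside_support[OF 1[OF that]])
  qed
qed

lemma
  fixes \<phi> :: "'a::euclidean_space \<Rightarrow> real"
  assumes "\<phi> \<in> test_functions"
  shows test_function_derivative: "(\<phi> has_derivative pdiff \<phi> x) (at x)"
    and test_function_continuous: "continuous_on UNIV \<phi>"
    and pdiff_continuous: "b \<in> Basis \<Longrightarrow> continuous_on UNIV (\<lambda>x. pdiff \<phi> x b)"
proof -
  have C: "C_k k \<phi>" for k using assms by (auto simp: test_functions_def)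
  show "(\<phi> has_derivative pdiff \<phi> x) (at x)" using C[of 1] by (auto simp: frechet_derivative_works)
  show "continuous_on UNIV \<phi>" using C[of 0] by simp
  show "b \<in> Basis \<Longrightarrow> continuous_on UNIV (\<lambda>x. pdiff \<phi> x b)" using C[of 1] by simp
qed

lemma continuous_compact_support_bounded:
  fixes f :: "'a::euclidean_space \<Rightarrow> real"
  assumes "continuous_on UNIV f" "\<And>x. norm x > R \<Longrightarrow> f x = 0"
  obtains B where "B > 0" "\<And>x. \<bar>f x\<bar> \<le> B"
proof -
  have "bounded (f ` cball 0 R)" using assms(1) by (intro compact_imp_bounded compact_continuous_image) (auto intro: continuous_on_subset)
  then obtain B where B: "B > 0" "\<And>x. norm x \<le> R \<Longrightarrow> \<bar>f x\<bar> \<le> B" unfolding bounded_pos by (auto simp: dist_norm)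
  have "\<bar>f x\<bar> \<le> B" for x using B assms(2)[of x] by (cases "norm x > R") auto
  then show ?thesis using that B(1) by blast
qed

lemma bounded_support_l2:
  fixes f :: "'a::euclidean_space \<Rightarrow> real"
  assumes [measurable]: "f \<in> borel_measurable borel" and B: "\<And>x. \<bar>f x\<bar> \<le> B" and R: "\<And>x. norm x > R \<Longrightarrow> f x = 0"
  shows "l2 f"
proof -
  have "integrable lborel (\<lambda>x. (norm (f x))\<^sup>2)"
  proof (rule Bochner_Integration.integrable_bound[OF integrable_mult_right[OF integrable_indicator_cball[of R], of "B\<^sup>2"]])
    have "(f x)\<^sup>2 \<le> B\<^sup>2" for x using B[of x] power_mono[of "\<bar>f x\<bar>" B 2] by simp
    then show "AE x in lborel. norm ((norm (f x))\<^sup>2) \<le> norm (B\<^sup>2 * indicator (cball 0 R) x)"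
      using R by (intro AE_I2) (auto simp: indicator_def not_le)
  qed simp
  then show ?thesis by (simp add: l2_def)
qed

lemma test_function_l2: "\<phi> \<in> test_functions \<Longrightarrow> l2 \<phi>"
proof -
  assume \<phi>: "\<phi> \<in> test_functions"
  obtain R where R: "\<And>x. norm x > R \<Longrightarrow> \<phi> x = 0" using test_function_facts[OF \<phi>] by metis
  obtain B where B: "\<And>x. \<bar>\<phi> x\<bar> \<le> B"
    using continuous_compact_support_bounded[OF test_function_continuous[OF \<phi>] R] by metis
  show "l2 \<phi>" by (rule bounded_support_l2[OF _ B R]) (auto intro: borel_measurable_continuous_onI test_function_continuous[OF \<phi>])
qed

lemma l2_real_mult_integrable: "l2 f \<Longrightarrow> l2 g \<Longrightarrow> integrable lborel (\<lambda>x. f x * g x)"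
  for f g :: "'a::euclidean_space \<Rightarrow> real" using l2_inner_integrable[of f g] by simp

lemma pdiff_l2: "\<phi> \<in> test_functions \<Longrightarrow> b \<in> Basis \<Longrightarrow> l2 (\<lambda>x. pdiff \<phi> x b)"
proof -
  assume \<phi>: "\<phi> \<in> test_functions" and b: "b \<in> Basis"
  obtain R where R: "\<And>x v. norm x > R \<Longrightarrow> pdiff \<phi> x v = 0" using test_function_facts[OF \<phi>] by metis
  obtain B where B: "\<And>x. \<bar>pdiff \<phi> x b\<bar> \<le> B"
    using continuous_compact_support_bounded[OF pdiff_continuous[OF \<phi> b] R] by metis
  show "l2 (\<lambda>x. pdiff \<phi> x b)"
    by (rule bounded_support_l2[OF _ B R]) (auto intro: borel_measurable_continuous_onI pdiff_continuous[OF \<phi> b])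
qed

text \<open>One fixed sequence in (0,1] tending to 0. It serves for shifts, regularisations, small
  radii and variations alike.\<close>

definition step :: "nat \<Rightarrow> real" where "step n = 1 / real (Suc n)"

lemma step_pos[simp]: "step n > 0" and step_le_1[simp]: "step n \<le> 1" and step_nonzero[simp]: "step n \<noteq> 0"
  by (simp_all add: step_def)

lemma step_tendsto: "step \<longlonglongrightarrow> 0"
  using LIMSEQ_Suc[OF lim_1_over_n] by (simp add: step_def[abs_def])

lemma step_at_0: "filterlim step (at 0) sequentially"
  by (rule filterlim_atI[OF step_tendsto]) simp

text \<open>The shift is moved from \<open>u\<close> to \<open>\<phi>\<close> by a change of
  variables. The quotients of \<open>\<phi>\<close> are bounded by the mean value theorem and live
  in a fixed ball, so dominated convergence needs nothing of \<open>u\<close> beyond L^2.\<close>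

lemma test_function_difference_quotient:
  fixes u \<phi> :: "'a::euclidean_space \<Rightarrow> real"
  assumes u: "l2 u" and \<phi>: "\<phi> \<in> test_functions" and b: "b \<in> Basis"
  shows "(\<lambda>n. LBINT x. (u (x + step n *\<^sub>R b) - u x) / step n * \<phi> x) \<longlonglongrightarrow> - (LBINT x. u x * pdiff \<phi> x b)"
proof -
  obtain R where R: "R > 0" "\<And>x. norm x > R \<Longrightarrow> \<phi> x = 0" "\<And>x v. norm x > R \<Longrightarrow> pdiff \<phi> x v = 0"
    using test_function_facts[OF \<phi>] by metis
  obtain B where B: "B > 0" "\<And>x. \<bar>pdiff \<phi> x b\<bar> \<le> B"
    using continuous_compact_support_bounded[OF pdiff_continuous[OF \<phi> b] R(3)] by metis
  note lphi = test_function_l2[OF \<phi>]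
  note [measurable] = l2_measurable[OF u] l2_measurable[OF lphi] l2_measurable[OF pdiff_l2[OF \<phi> b]]
  have nb: "norm b = 1" using b by simp
  define q where "q n x = (\<phi> x - \<phi> (x - step n *\<^sub>R b)) / step n" for n x
  have D: "((\<lambda>s. \<phi> (x - s *\<^sub>R b)) has_real_derivative - pdiff \<phi> (x - s *\<^sub>R b) b) (at s)" for x s
  proof -
    have "((\<lambda>s. \<phi> (x - s *\<^sub>R b)) has_derivative (\<lambda>t. pdiff \<phi> (x - s *\<^sub>R b) (- (t *\<^sub>R b)))) (at s)"
      by (rule has_derivative_compose[where f="\<lambda>s. x - s *\<^sub>R b" and g=\<phi>, OF _ test_function_derivative[OF \<phi>]])
        (auto intro!: derivative_eq_intros)
    moreover have "pdiff \<phi> (x - s *\<^sub>R b) (- (t *\<^sub>R b)) = - pdiff \<phi> (x - s *\<^sub>R b) b * t" for t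
      using has_derivative_linear[OF test_function_derivative[OF \<phi>]] by (simp add: linear_neg linear_scale)
    ultimately show ?thesis unfolding has_field_derivative_def by (simp only:)
  qed
  have qb: "\<bar>q n x\<bar> \<le> B" for n x
  proof -
    obtain z where "\<phi> (x - step n *\<^sub>R b) - \<phi> (x - 0 *\<^sub>R b) = (step n - 0) * (- pdiff \<phi> (x - z *\<^sub>R b) b)"
      using MVT2[of 0 "step n" "\<lambda>s. \<phi> (x - s *\<^sub>R b)" "\<lambda>s. - pdiff \<phi> (x - s *\<^sub>R b) b"] D by auto
    then have "q n x = pdiff \<phi> (x - z *\<^sub>R b) b" unfolding q_def by (simp add: field_simps)
    then show ?thesis using B by simp
  qed
  have qR: "q n x = 0" if x: "norm x > R + 1" for n x
  proof -
    have "norm (step n *\<^sub>R b) \<le> 1" using nb step_pos[of n] by (simp del: step_pos add: abs_of_pos)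
    then have "norm (x - step n *\<^sub>R b) > R" using x norm_triangle_ineq2[of x "step n *\<^sub>R b"] by linarith
    then show ?thesis using R(2) x by (simp add: q_def)
  qed
  have qlim: "(\<lambda>n. q n x) \<longlonglongrightarrow> pdiff \<phi> x b" for x
  proof -
    have "((\<lambda>h. (\<phi> (x - (0 + h) *\<^sub>R b) - \<phi> (x - 0 *\<^sub>R b)) / h) \<longlongrightarrow> - pdiff \<phi> (x - 0 *\<^sub>R b) b) (at 0)"
      using D[of x 0] by (simp add: DERIV_def)
    from filterlim_compose[OF this step_at_0]
    have "(\<lambda>n. (\<phi> (x - (0 + step n) *\<^sub>R b) - \<phi> (x - 0 *\<^sub>R b)) / step n) \<longlonglongrightarrow> - pdiff \<phi> x b"
      by (simp only: scaleR_zero_left diff_zero)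
    from tendsto_minus[OF this] show ?thesis by (simp only: q_def minus_divide_left minus_diff_eq add_0 scaleR_zero_left diff_zero minus_minus)
  qed
  have "(\<lambda>n. LBINT x. u x * q n x) \<longlonglongrightarrow> (LBINT x. u x * pdiff \<phi> x b)"
  proof (rule integral_dominated_convergence[where w="\<lambda>x. B * \<bar>indicator (cball 0 (R + 1)) x * u x\<bar>"])
    show "integrable lborel (\<lambda>x. B * \<bar>indicator (cball 0 (R + 1)) x * u x\<bar>)" using l2_locally_integrable[OF u, of "R + 1"] by auto
    show "AE x in lborel. (\<lambda>n. u x * q n x) \<longlonglongrightarrow> u x * pdiff \<phi> x b" by (intro AE_I2 tendsto_mult_left qlim)
    show "AE x in lborel. norm (u x * q n x) \<le> B * \<bar>indicator (cball 0 (R + 1)) x * u x\<bar>" for n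
    proof (rule AE_I2)
      fix x
      show "norm (u x * q n x) \<le> B * \<bar>indicator (cball 0 (R + 1)) x * u x\<bar>"
        using qR[of x n] mult_right_mono[OF qb[of n x], of "\<bar>u x\<bar>"] B(1) by (cases "norm x > R + 1") (auto simp: abs_mult mult.commute)
    qed
  qed (simp_all add: q_def)
  then have "(\<lambda>n. - (LBINT x. u x * q n x)) \<longlonglongrightarrow> - (LBINT x. u x * pdiff \<phi> x b)" by (rule tendsto_minus)
  moreover have "(LBINT x. (u (x + step n *\<^sub>R b) - u x) / step n * \<phi> x) = - (LBINT x. u x * q n x)" for n
  proof -
    define h where "h = step n *\<^sub>R b"
    have i: "integrable lborel (\<lambda>x. u x * \<phi> x)" "integrable lborel (\<lambda>x. u (x + h) * \<phi> x)" "integrable lborel (\<lambda>x. u x * \<phi> (x - h))"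
      using l2_real_mult_integrable[OF u lphi] l2_real_mult_integrable[OF l2_translate[OF u] lphi, of h]
        l2_real_mult_integrable[OF u l2_translate[OF lphi], of "- h"] by auto
    have "(LBINT x. u x * \<phi> (x - h)) = (LBINT x. u (x + h) * \<phi> x)" by (subst integral_lborel_affine[of 1 _ h]) auto
    moreover have "(LBINT x. (u (x + h) - u x) / step n * \<phi> x) = (LBINT x. u (x + h) * \<phi> x - u x * \<phi> x) / step n"
      by (subst integral_divide_zero[symmetric]) (simp only: times_divide_eq_left left_diff_distrib)
    moreover have "(LBINT x. u x * q n x) = (LBINT x. u x * \<phi> x - u x * \<phi> (x - h)) / step n"
      by (subst integral_divide_zero[symmetric]) (simp only: q_def h_def times_divide_eq_right right_diff_distrib)
    ultimately show ?thesis using i by (simp add: h_def[symmetric] minus_divide_left)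
  qed
  ultimately show ?thesis by simp
qed

lemma l2_weak_limit:
  fixes f :: "nat \<Rightarrow> 'a::euclidean_space \<Rightarrow> 'b::euclidean_space"
  assumes "\<And>n. l2 (f n)" "l2 g" "l2 \<phi>" "(\<lambda>n. l2sq (\<lambda>x. f n x - g x)) \<longlonglongrightarrow> 0"
  shows "(\<lambda>n. LBINT x. f n x \<bullet> \<phi> x) \<longlonglongrightarrow> (LBINT x. g x \<bullet> \<phi> x)"
proof (rule LIM_zero_cancel, rule Lim_null_comparison)
  have "(\<lambda>n. sqrt (l2sq (\<lambda>x. f n x - g x))) \<longlonglongrightarrow> 0" using tendsto_real_sqrt[OF assms(4)] by simp
  then show "(\<lambda>n. sqrt (l2sq (\<lambda>x. f n x - g x)) * sqrt (l2sq \<phi>)) \<longlonglongrightarrow> 0" by (rule tendsto_mult_left_zero)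
  show "\<forall>\<^sub>F n in sequentially. norm ((LBINT x. f n x \<bullet> \<phi> x) - (LBINT x. g x \<bullet> \<phi> x))
     \<le> sqrt (l2sq (\<lambda>x. f n x - g x)) * sqrt (l2sq \<phi>)"
  proof (intro always_eventually allI)
    fix n
    have "(LBINT x. f n x \<bullet> \<phi> x) - (LBINT x. g x \<bullet> \<phi> x) = (LBINT x. (f n x - g x) \<bullet> \<phi> x)"
      using l2_inner_integrable[OF assms(1,3)] l2_inner_integrable[OF assms(2,3)] by (simp add: inner_diff_left)
    then show "norm ((LBINT x. f n x \<bullet> \<phi> x) - (LBINT x. g x \<bullet> \<phi> x))
     \<le> sqrt (l2sq (\<lambda>x. f n x - g x)) * sqrt (l2sq \<phi>)" using l2_inner_bound[OF l2_diff[OF assms(1,2)] assms(3)] by simp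
  qed
qed

lemma difference_quotient_limit:
  assumes S: "sob u G"
  shows "(\<lambda>n. l2sq (\<lambda>x. (u (x + step n *\<^sub>R b) - u x) / step n - G x \<bullet> b)) \<longlonglongrightarrow> 0"
  by (rule filterlim_compose[OF difference_quotient_tendsto[OF S, of b] step_at_0])

lemma difference_quotient_l2: "l2 u \<Longrightarrow> l2 (\<lambda>x. (u (x + \<tau> *\<^sub>R b) - u x) / \<tau>)" for u :: "'a::euclidean_space \<Rightarrow> real"
  using l2_cmult[OF l2_diff[OF l2_translate], of u u "inverse \<tau>"] by (simp add: divide_inverse mult.commute)

text \<open>Both sides are limits of the same pairing of difference quotients with \<phi>: once
  through their convergence in L^2, once by moving the quotient onto \<phi>. No density of
  \<open>bumps\<close> among the test functions is required.\<close>

lemma sob_test_function: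
  assumes S: "sob u G" and \<phi>: "\<phi> \<in> test_functions" and b: "b \<in> Basis"
  shows "(LBINT x. u x * pdiff \<phi> x b) = - (LBINT x. (G x \<bullet> b) * \<phi> x)"
proof -
  have "(\<lambda>n. LBINT x. ((u (x + step n *\<^sub>R b) - u x) / step n) \<bullet> \<phi> x) \<longlonglongrightarrow> (LBINT x. (G x \<bullet> b) \<bullet> \<phi> x)"
    by (intro l2_weak_limit difference_quotient_l2 l2_inner sob_l2[OF S] test_function_l2[OF \<phi>] difference_quotient_limit[OF S])
  from LIMSEQ_unique[OF test_function_difference_quotient[OF sob_l2(1)[OF S] \<phi> b] this[unfolded inner_real_def]]
  show ?thesis by simp
qed

text \<open>A criterion that asks only for weak convergence of the difference quotients, which is
  what the chain rule can supply.\<close>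

lemma sobI_difference_quotient:
  fixes u :: "'a::euclidean_space \<Rightarrow> real"
  assumes "l2 u" "l2 G"
    and "\<And>\<phi> b. \<phi> \<in> test_functions \<Longrightarrow> b \<in> Basis \<Longrightarrow>
      (\<lambda>n. LBINT x. (u (x + step n *\<^sub>R b) - u x) / step n * \<phi> x) \<longlonglongrightarrow> (LBINT x. (G x \<bullet> b) * \<phi> x)"
  shows "sob u G"
  unfolding sob_def
proof (intro conjI ballI assms(1,2))
  fix \<phi> :: "'a \<Rightarrow> real" and b assume "\<phi> \<in> bumps" "b \<in> (Basis :: 'a set)"
  then have \<phi>: "\<phi> \<in> test_functions" "b \<in> Basis" using bumps_test_functions by auto
  from LIMSEQ_unique[OF test_function_difference_quotient[OF assms(1) \<phi>] assms(3)[OF \<phi>]]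
  show "(LBINT x. u x * pdiff \<phi> x b) = - (LBINT x. (G x \<bullet> b) * \<phi> x)" by simp
qed

lemma sob_limit:
  fixes v :: "'a::euclidean_space \<Rightarrow> real"
  assumes "\<And>n. sob (u n) (G n)" "l2 v" "l2 H" "(\<lambda>n. l2sq (\<lambda>x. u n x - v x)) \<longlonglongrightarrow> 0"
    "(\<lambda>n. l2sq (\<lambda>x. G n x - H x)) \<longlonglongrightarrow> 0"
  shows "sob v H"
  unfolding sob_def
proof (intro conjI ballI assms(2,3))
  fix \<phi> :: "'a \<Rightarrow> real" and b assume \<phi>: "\<phi> \<in> bumps" "b \<in> (Basis :: 'a set)"
  then have \<phi>': "\<phi> \<in> test_functions" using bumps_test_functions by auto
  have "(\<lambda>n. LBINT x. u n x \<bullet> pdiff \<phi> x b) \<longlonglongrightarrow> (LBINT x. v x \<bullet> pdiff \<phi> x b)"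
    by (intro l2_weak_limit assms sob_l2[OF assms(1)] pdiff_l2 \<phi>' \<phi>)
  moreover have lb: "l2 (\<lambda>x. \<phi> x *\<^sub>R b)" using test_function_l2[OF \<phi>'] \<phi>(2) by (auto simp: l2_def power_mult_distrib)
  have "(\<lambda>n. LBINT x. G n x \<bullet> (\<phi> x *\<^sub>R b)) \<longlonglongrightarrow> (LBINT x. H x \<bullet> (\<phi> x *\<^sub>R b))"
    by (intro l2_weak_limit assms sob_l2[OF assms(1)] lb)
  moreover have "(LBINT x. u n x \<bullet> pdiff \<phi> x b) = - (LBINT x. G n x \<bullet> (\<phi> x *\<^sub>R b))" for n
    using assms(1)[of n] \<phi> by (simp add: sob_def mult.commute)
  ultimately show "(LBINT x. v x * pdiff \<phi> x b) = - (LBINT x. (H x \<bullet> b) * \<phi> x)"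
    using LIMSEQ_unique[OF _ tendsto_minus] by (fastforce simp: mult.commute)
qed

text \<open>The competitor \<open>g\<close> is only locally integrable, since
  \<open>has_weak_gradient\<close> promises no more about the field that
  \<open>weak_gradient\<close> selects.\<close>

lemma sob_unique_locally:
  fixes u :: "'a::euclidean_space \<Rightarrow> real"
  assumes S: "sob u G" and [measurable]: "g \<in> borel_measurable borel" and b: "b \<in> Basis"
    and loc: "\<And>R. integrable lborel (\<lambda>x. indicator (cball 0 R) x * g x)"
    and g: "\<And>\<phi>. \<phi> \<in> bumps \<Longrightarrow> (LBINT x. u x * pdiff \<phi> x b) = - (LBINT x. g x * \<phi> x)"
  shows "AE x in lborel. g x = G x \<bullet> b"
proof -
  note lG = l2_inner[OF sob_l2(2)[OF S], of b]
  note [measurable] = l2_measurable[OF lG]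
  have "AE x in lborel. g x - G x \<bullet> b = 0"
  proof (rule fundamental_lemma)
    show "integrable lborel (\<lambda>x. indicator (cball 0 R) x * (g x - G x \<bullet> b))" for R
      using loc[of R] l2_locally_integrable[OF lG, of R] by (simp add: right_diff_distrib)
    fix \<phi> assume \<phi>: "(\<phi> :: 'a \<Rightarrow> real) \<in> bumps"
    obtain B R where BR: "B > 0" "R > 0" "\<And>x. \<bar>\<phi> x\<bar> \<le> B" "\<And>x. norm x > R \<Longrightarrow> \<phi> x = 0"
      using bumps_bounded[OF \<phi>] by blast
    note [measurable] = bumps_measurable[OF \<phi>]
    have "integrable lborel (\<lambda>x. g x * \<phi> x)"
    proof (rule Bochner_Integration.integrable_bound[OF integrable_mult_right[OF loc[of R], of B]])
      show "AE x in lborel. norm (g x * \<phi> x) \<le> norm (B * (indicator (cball 0 R) x * g x))"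
      proof (rule AE_I2)
        fix x show "norm (g x * \<phi> x) \<le> norm (B * (indicator (cball 0 R) x * g x))"
          using BR(1) mult_right_mono[OF BR(3)[of x], of "\<bar>g x\<bar>"] BR(4)[of x]
          by (cases "norm x > R") (auto simp: abs_mult indicator_def mult.commute)
      qed
    qed simp
    moreover have "(LBINT x. g x * \<phi> x) = (LBINT x. (G x \<bullet> b) * \<phi> x)" using g[OF \<phi>] S \<phi> b by (simp add: sob_def)
    ultimately show "(LBINT x. (g x - G x \<bullet> b) * \<phi> x) = 0" using integrable_l2_bump[OF lG \<phi>] by (simp add: left_diff_distrib)
  qed simp
  then show ?thesis by eventually_elim simp
qed

section \<open>Borel representatives of elements of $H^1$\<close>

lemma lebesgue_measurable_AE:
  fixes f g :: "'a::euclidean_space \<Rightarrow> 'b::topological_space"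
  assumes f: "f \<in> borel_measurable lebesgue" and ae: "AE x in lebesgue. g x = f x"
  shows "g \<in> borel_measurable lebesgue"
proof (rule measurableI)
  fix A :: "'b set" assume A: "A \<in> sets borel"
  define N where "N = {x. g x \<noteq> f x}"
  have N: "N \<in> null_sets lebesgue"
  proof -
    obtain N0 where "{x \<in> space lebesgue. g x \<noteq> f x} \<subseteq> N0" "emeasure lebesgue N0 = 0" "N0 \<in> sets lebesgue"
      using ae by (rule AE_E)
    then show ?thesis using null_sets_completion_subset[of N N0 "lborel :: 'a measure"] by (auto simp: N_def null_sets_def)
  qed
  have "g -` A \<inter> N \<in> null_sets lebesgue" by (rule null_sets_completion_subset[OF _ N]) auto
  moreover have "f -` A \<inter> space lebesgue \<in> sets lebesgue" using f A by (rule measurable_sets)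
  ultimately have "(f -` A \<inter> space lebesgue - N) \<union> (g -` A \<inter> N) \<in> sets lebesgue" using N by auto
  moreover have "g -` A \<inter> space lebesgue = (f -` A \<inter> space lebesgue - N) \<union> (g -` A \<inter> N)" by (auto simp: N_def)
  ultimately show "g -` A \<inter> space lebesgue \<in> sets lebesgue" by simp
qed simp

lemma borel_lebesgue_measurable: "f \<in> borel_measurable borel \<Longrightarrow> f \<in> borel_measurable lebesgue"
  by (rule measurable_completion) simp

lemma lebesgue_borel_integral:
  fixes f g :: "'a::euclidean_space \<Rightarrow> 'b::{banach,second_countable_topology}"
  assumes f: "f \<in> borel_measurable borel" and ae: "AE x in lebesgue. g x = f x"
  shows "(LINT x|lebesgue. g x) = (LBINT x. f x)" "integrable lebesgue g \<longleftrightarrow> integrable lborel f"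
proof -
  have mf: "f \<in> borel_measurable lebesgue" using f by (rule borel_lebesgue_measurable)
  have mg: "g \<in> borel_measurable lebesgue" by (rule lebesgue_measurable_AE[OF mf ae])
  have "(LINT x|lebesgue. g x) = (LINT x|lebesgue. f x)" by (rule integral_cong_AE[OF mg mf ae])
  also have "... = (LBINT x. f x)" using f by (intro integral_completion) simp
  finally show "(LINT x|lebesgue. g x) = (LBINT x. f x)" .
  have "integrable lebesgue g \<longleftrightarrow> integrable lebesgue f" by (rule integrable_cong_AE[OF mg mf ae])
  also have "... \<longleftrightarrow> integrable lborel f" using f by (intro integrable_completion) simp
  finally show "integrable lebesgue g \<longleftrightarrow> integrable lborel f" .
qed

lemma borel_representative:
  fixes f :: "'a::euclidean_space \<Rightarrow> 'b::euclidean_space"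
  assumes "f \<in> borel_measurable lebesgue"
  obtains g where "g \<in> borel_measurable borel" "AE x in lebesgue. f x = g x"
proof -
  have "\<forall>b. \<exists>g. g \<in> borel_measurable borel \<and> (AE x in lborel. f x \<bullet> b = g x)"
  proof
    fix b :: 'b
    have "\<exists>g\<in>borel_measurable lborel. AE x in lborel. f x \<bullet> b = g x"
      by (rule completion_ex_borel_measurable_real) (use assms in simp)
    then show "\<exists>g. g \<in> borel_measurable borel \<and> (AE x in lborel. f x \<bullet> b = g x)" by auto
  qed
  from choice[OF this] obtain g
    where g: "\<And>b. g b \<in> borel_measurable borel" "\<And>b. AE x in lborel. f x \<bullet> b = g b x" by blast
  define k where "k x = (\<Sum>b\<in>Basis. g b x *\<^sub>R b)" for x
  have "AE x in lborel. \<forall>b\<in>Basis. f x \<bullet> b = g b x" using g(2) by (subst AE_finite_all) auto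
  then have "AE x in lborel. f x = k x"
  proof eventually_elim
    case (elim x)
    have "k x = (\<Sum>b\<in>Basis. (f x \<bullet> b) *\<^sub>R b)" unfolding k_def using elim by (intro sum.cong) auto
    then show ?case by (simp only: euclidean_representation)
  qed
  then have "AE x in lebesgue. f x = k x" by (rule AE_completion)
  moreover have "k \<in> borel_measurable borel" unfolding k_def[abs_def] using g(1) by measurable
  ultimately show ?thesis using that by blast
qed

lemma powr_2_norm: "norm x powr 2 = (norm x)\<^sup>2"
  by (simp add: powr_numeral)

lemma Lp2_iff_l2:
  assumes [measurable]: "g \<in> borel_measurable borel" and ae: "AE x in lebesgue. f x = g x"
  shows "f \<in> Lp 2 \<longleftrightarrow> l2 g"
proof -
  have "AE x in lebesgue. (norm (f x))\<^sup>2 = (norm (g x))\<^sup>2" using ae by eventually_elim simp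
  then have "integrable lebesgue (\<lambda>x. (norm (f x))\<^sup>2) \<longleftrightarrow> integrable lborel (\<lambda>x. (norm (g x))\<^sup>2)"
    by (intro lebesgue_borel_integral) auto
  moreover have "f \<in> borel_measurable lebesgue" by (rule lebesgue_measurable_AE[OF borel_lebesgue_measurable ae]) simp
  ultimately show ?thesis by (simp add: Lp_def l2_def powr_2_norm)
qed

lemma compact_subset_cball0: "compact K \<Longrightarrow> \<exists>R. K \<subseteq> cball (0::'a::euclidean_space) R"
  using bounded_subset_ballD[OF compact_imp_bounded, of K 0] ball_subset_cball by blast

lemma l2_absolutely_integrable_on:
  fixes f g :: "'a::euclidean_space \<Rightarrow> 'b::euclidean_space"
  assumes g: "l2 g" and ae: "AE x in lebesgue. f x = g x" and K: "compact K"
  shows "f absolutely_integrable_on K"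
proof -
  note [measurable] = l2_measurable[OF g]
  obtain R where R: "K \<subseteq> cball 0 R" using compact_subset_cball0[OF K] by blast
  have [measurable]: "K \<in> sets borel" using K by (simp add: compact_imp_closed borel_closed)
  have "l2 (\<lambda>x. norm (g x))" using g by (simp add: l2_def)
  from l2_locally_integrable[OF this, of R]
  have "integrable lborel (\<lambda>x. indicator (cball 0 R) x *\<^sub>R g x)"
    by (rule Bochner_Integration.integrable_bound) (auto simp: indicator_def)
  then have "integrable lborel (\<lambda>x. indicator K x *\<^sub>R g x)"
    by (rule Bochner_Integration.integrable_bound) (use R in \<open>auto simp: indicator_def subset_iff\<close>)
  moreover have "AE x in lebesgue. indicator K x *\<^sub>R f x = indicator K x *\<^sub>R g x" using ae by eventually_elim simp
  ultimately show ?thesis unfolding set_integrable_def by (subst lebesgue_borel_integral(2)) auto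
qed

lemma sob_has_weak_gradient:
  assumes S: "sob u G" and U: "AE x in lebesgue. U x = u x" and H: "AE x in lebesgue. H x = G x"
  shows "has_weak_gradient U H"
  unfolding has_weak_gradient_def
proof (intro conjI allI impI ballI)
  note l = sob_l2[OF S]
  note [measurable] = l2_measurable[OF l(1)] l2_measurable[OF l(2)]
  fix K :: "'a set" assume K: "compact K"
  show "U absolutely_integrable_on K" "H absolutely_integrable_on K"
    using l2_absolutely_integrable_on[OF l(1) U K] l2_absolutely_integrable_on[OF l(2) H K] .
next
  note l = sob_l2[OF S]
  note [measurable] = l2_measurable[OF l(1)] l2_measurable[OF l(2)]
  fix \<phi> :: "'a \<Rightarrow> real" and b :: 'a assume \<phi>: "\<phi> \<in> test_functions" and b: "b \<in> Basis"
  note [measurable] = l2_measurable[OF test_function_l2[OF \<phi>]] l2_measurable[OF pdiff_l2[OF \<phi> b]]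
  have "(LINT x|lebesgue. U x * pdiff \<phi> x b) = (LBINT x. u x * pdiff \<phi> x b)"
    by (rule lebesgue_borel_integral) (use U in \<open>auto elim: eventually_mono\<close>)
  moreover have "(LINT x|lebesgue. (H x \<bullet> b) * \<phi> x) = (LBINT x. (G x \<bullet> b) * \<phi> x)"
    by (rule lebesgue_borel_integral) (use H in \<open>auto elim: eventually_mono\<close>)
  ultimately show "(LINT x|lebesgue. U x * pdiff \<phi> x b) = - (LINT x|lebesgue. (H x \<bullet> b) * \<phi> x)"
    using sob_test_function[OF S \<phi> b] by simp
qed

lemma has_weak_gradient_sob:
  assumes W: "has_weak_gradient U H" and u: "l2 u" "AE x in lebesgue. U x = u x" and G: "l2 G" "AE x in lebesgue. H x = G x"
  shows "sob u G"
  unfolding sob_def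
proof (intro conjI ballI u(1) G(1))
  note [measurable] = l2_measurable[OF u(1)] l2_measurable[OF G(1)]
  fix \<phi> :: "'a \<Rightarrow> real" and b :: 'a assume \<phi>: "\<phi> \<in> bumps" and b: "b \<in> Basis"
  have \<phi>': "\<phi> \<in> test_functions" using \<phi> bumps_test_functions by auto
  note [measurable] = l2_measurable[OF test_function_l2[OF \<phi>']] l2_measurable[OF pdiff_l2[OF \<phi>' b]]
  have "(LINT x|lebesgue. U x * pdiff \<phi> x b) = (LBINT x. u x * pdiff \<phi> x b)"
    by (rule lebesgue_borel_integral) (use u in \<open>auto elim: eventually_mono\<close>)
  moreover have "(LINT x|lebesgue. (H x \<bullet> b) * \<phi> x) = (LBINT x. (G x \<bullet> b) * \<phi> x)"
    by (rule lebesgue_borel_integral) (use G in \<open>auto elim: eventually_mono\<close>)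
  ultimately show "(LBINT x. u x * pdiff \<phi> x b) = - (LBINT x. (G x \<bullet> b) * \<phi> x)"
    using W \<phi>' b by (simp add: has_weak_gradient_def)
qed

text \<open>This makes the choice in \<open>weak_gradient\<close> harmless: on H^1 every admissible
  choice agrees almost everywhere with a Borel gradient in L^2.\<close>

lemma has_weak_gradient_unique:
  fixes u :: "'a::euclidean_space \<Rightarrow> real"
  assumes W: "has_weak_gradient U H" and S: "sob u G" and U: "AE x in lebesgue. U x = u x"
  shows "AE x in lebesgue. H x = G x"
proof -
  have Hloc: "integrable lebesgue (\<lambda>x. indicator (cball 0 R) x *\<^sub>R H x)" for R
    using W by (auto simp: has_weak_gradient_def set_integrable_def)
  have "H \<in> borel_measurable lebesgue"
  \<comment> \<open>Local integrability gives measurability of the truncations to balls, and these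
    converge pointwise.\<close>
  proof (rule borel_measurable_LIMSEQ_metric)
    show "(\<lambda>x. indicator (cball 0 (real n)) x *\<^sub>R H x) \<in> borel_measurable lebesgue" for n
      using Hloc[of n] by (rule borel_measurable_integrable)
    fix x
    have "\<forall>\<^sub>F n in sequentially. indicator (cball 0 (real n)) x *\<^sub>R H x = H x"
      using eventually_ge_at_top[of "nat \<lceil>norm x\<rceil>"] by eventually_elim (auto simp: indicator_def dest: real_nat_ceiling_ge[THEN order_trans] nat_ceiling_le_eq[THEN iffD1])
    then show "(\<lambda>n. indicator (cball 0 (real n)) x *\<^sub>R H x) \<longlonglongrightarrow> H x" by (rule tendsto_eventually)
  qed
  then obtain H' where H': "H' \<in> borel_measurable borel" "AE x in lebesgue. H x = H' x" by (rule borel_representative)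
  note [measurable] = H'(1) l2_measurable[OF sob_l2(1)[OF S]]
  have "AE x in lborel. H' x \<bullet> b = G x \<bullet> b" if b: "b \<in> Basis" for b
  proof (rule sob_unique_locally[OF S _ b])
    fix R :: real
    have ae: "AE x in lebesgue. indicator (cball 0 R) x *\<^sub>R H x = indicator (cball 0 R) x *\<^sub>R H' x" using H'(2) by eventually_elim simp
    have [measurable]: "cball (0::'a) R \<in> sets borel" by simp
    have m: "(\<lambda>x. indicator (cball 0 R) x *\<^sub>R H' x) \<in> borel_measurable borel" by measurable
    have "integrable lborel (\<lambda>x. indicator (cball 0 R) x *\<^sub>R H' x)" using Hloc[of R] lebesgue_borel_integral(2)[OF m ae] by simp
    from integrable_inner_left[OF this, of b]
    show "integrable lborel (\<lambda>x. indicator (cball 0 R) x * (H' x \<bullet> b))" by simp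
  next
    fix \<phi> :: "'a \<Rightarrow> real" assume \<phi>: "\<phi> \<in> bumps"
    have \<phi>': "\<phi> \<in> test_functions" using \<phi> bumps_test_functions by auto
    note [measurable] = l2_measurable[OF test_function_l2[OF \<phi>']] l2_measurable[OF pdiff_l2[OF \<phi>' b]]
    have "(LINT x|lebesgue. U x * pdiff \<phi> x b) = (LBINT x. u x * pdiff \<phi> x b)"
      by (rule lebesgue_borel_integral) (use U in \<open>auto elim: eventually_mono\<close>)
    moreover have "(LINT x|lebesgue. (H x \<bullet> b) * \<phi> x) = (LBINT x. (H' x \<bullet> b) * \<phi> x)"
      by (rule lebesgue_borel_integral) (use H' in \<open>auto elim: eventually_mono\<close>)
    ultimately show "(LBINT x. u x * pdiff \<phi> x b) = - (LBINT x. (H' x \<bullet> b) * \<phi> x)"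
      using W \<phi>' b by (simp add: has_weak_gradient_def)
  qed simp
  then have "AE x in lborel. \<forall>b\<in>Basis. H' x \<bullet> b = G x \<bullet> b" by (subst AE_finite_all) auto
  then have "AE x in lborel. H' x = G x" by eventually_elim (rule euclidean_eqI, blast)
  from AE_completion[OF this] H'(2) show ?thesis by eventually_elim simp
qed

lemma H1_representative:
  fixes U :: "'a::euclidean_space \<Rightarrow> real"
  assumes "U \<in> H1"
  obtains u G where "sob u G" "AE x in lebesgue. U x = u x" "AE x in lebesgue. weak_gradient U x = G x"
proof -
  obtain H where H: "U \<in> Lp 2" "H \<in> Lp 2" "has_weak_gradient U H" using assms by (auto simp: H1_def)
  obtain u where u: "u \<in> borel_measurable borel" "AE x in lebesgue. U x = u x" using H(1) borel_representative[of U] by (auto simp: Lp_def)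
  obtain G where G: "G \<in> borel_measurable borel" "AE x in lebesgue. H x = G x" using H(2) borel_representative[of H] by (auto simp: Lp_def)
  have S: "sob u G" using has_weak_gradient_sob[OF H(3) _ u(2) _ G(2)] H(1,2) Lp2_iff_l2[OF u] Lp2_iff_l2[OF G] by auto
  have "has_weak_gradient U (weak_gradient U)" unfolding weak_gradient_def by (rule someI[of "has_weak_gradient U"]) (rule H(3))
  from has_weak_gradient_unique[OF this S u(2)] show ?thesis using that S u(2) by blast
qed

lemma
  fixes U u :: "'a::euclidean_space \<Rightarrow> real"
  assumes S: "sob u G" and U: "AE x in lebesgue. U x = u x"
  shows sob_H1: "U \<in> H1" and sob_weak_gradient: "AE x in lebesgue. weak_gradient U x = G x"
proof -
  have W: "has_weak_gradient U G" by (rule sob_has_weak_gradient[OF S U]) simp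
  have "U \<in> Lp 2" using Lp2_iff_l2[OF _ U] sob_l2[OF S] l2_measurable by blast
  moreover have "G \<in> Lp 2" using Lp2_iff_l2[of G G] sob_l2[OF S] l2_measurable by auto
  ultimately show "U \<in> H1" using W by (auto simp: H1_def)
  have "has_weak_gradient U (weak_gradient U)" unfolding weak_gradient_def by (rule someI[of "has_weak_gradient U"]) (rule W)
  from has_weak_gradient_unique[OF this S U] show "AE x in lebesgue. weak_gradient U x = G x" .
qed

section \<open>The Sobolev inequality\<close>

text \<open>The squared L^2 modulus of translation. The Sobolev inequality is derived from osc \<le>
  |y|^2 \<Gamma> alone, so truncations of a function can be used without computing their weak
  gradients.\<close>

definition osc :: "('a::euclidean_space \<Rightarrow> real) \<Rightarrow> 'a \<Rightarrow> ennreal" where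
  "osc f y = (\<integral>\<^sup>+x. ennreal ((f (x + y) - f x)\<^sup>2) \<partial>lborel)"

lemma osc_l2: "l2 f \<Longrightarrow> osc f y = ennreal (l2sq (\<lambda>x. f (x + y) - f x))" for f :: "'a::euclidean_space \<Rightarrow> real"
  unfolding osc_def using ennreal_l2sq[OF l2_diff[OF l2_translate], of f f y] by simp

lemma meas_osc_pair:
  fixes f :: "'a::euclidean_space \<Rightarrow> real"
  assumes [measurable]: "f \<in> borel_measurable borel"
  shows "(\<lambda>(y, x). ennreal ((f (x + y) - f x)\<^sup>2)) \<in> borel_measurable (lborel \<Otimes>\<^sub>M lborel)"
proof -
  show ?thesis unfolding lborel_prod case_prod_beta' by simp
qed

lemma meas_osc[measurable]:
  "f \<in> borel_measurable borel \<Longrightarrow> osc f \<in> borel_measurable borel"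
  for f :: "'a::euclidean_space \<Rightarrow> real" using lborel.borel_measurable_nn_integral[OF meas_osc_pair, of f] by (simp add: osc_def[abs_def])

lemma osc_multiple:
  fixes f :: "'a::euclidean_space \<Rightarrow> real"
  assumes f: "l2 f" shows "osc f (real m *\<^sub>R y) \<le> ennreal ((real m)\<^sup>2) * osc f y"
proof -
  have *: "sqrt (l2sq (\<lambda>x. f (x + real m *\<^sub>R y) - f x)) \<le> real m * sqrt (l2sq (\<lambda>x. f (x + y) - f x))" for m
  proof (induction m)
    case (Suc m)
    have "l2sq (\<lambda>x. f (x + real (Suc m) *\<^sub>R y) - f (x + real m *\<^sub>R y)) = l2sq (\<lambda>x. f (x + y) - f x)"
      using l2sq_translate[OF l2_diff[OF l2_translate[OF f, of y] f], of "real m *\<^sub>R y"] by (simp add: algebra_simps)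
    then show ?case using Suc l2sq_diff_triangle[OF l2_translate[OF f, of "real (Suc m) *\<^sub>R y"] l2_translate[OF f, of "real m *\<^sub>R y"] f]
      by (simp add: algebra_simps)
  qed (simp add: l2sq_def)
  have "l2sq (\<lambda>x. f (x + real m *\<^sub>R y) - f x) \<le> (real m)\<^sup>2 * l2sq (\<lambda>x. f (x + y) - f x)"
    using power_mono[OF *[of m], where n=2] by (simp add: power_mult_distrib)
  then show ?thesis by (simp add: osc_l2[OF f] ennreal_mult[symmetric] ennreal_leI)
qed

text \<open>The substitution y -> m y gives the factor m^N, and m successive translations by y give
  m^2. It carries estimates from one small radius common to all levels to the radius adapted to each
  level.\<close>

lemma osc_ball_multiple:
  fixes f :: "'a::euclidean_space \<Rightarrow> real"
  assumes f: "l2 f" and m: "m \<ge> 1"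
  shows "(\<integral>\<^sup>+y. indicator (cball 0 (real m * \<rho>)) y * osc f y \<partial>lborel) \<le>
    ennreal (real m ^ (DIM('a) + 2)) * (\<integral>\<^sup>+y. indicator (cball 0 \<rho>) y * osc f y \<partial>lborel)"
proof -
  note [measurable] = l2_measurable[OF f]
  have i: "indicator (cball 0 (real m * \<rho>)) (real m *\<^sub>R y + 0) = (indicator (cball 0 \<rho>) y :: ennreal)" for y :: 'a
    using m by (auto simp: indicator_def)
  have [measurable]: "cball (0::'a) r \<in> sets borel" for r by simp
  have "(\<integral>\<^sup>+y. indicator (cball 0 (real m * \<rho>)) y * osc f y \<partial>lborel) =
     ennreal (real m ^ DIM('a)) * (\<integral>\<^sup>+y. indicator (cball 0 \<rho>) y * osc f (real m *\<^sub>R y) \<partial>lborel)"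
    using m by (subst nn_integral_lborel_affine[of "real m" _ 0]) (auto simp only: i, auto)
  also have "... \<le> ennreal (real m ^ DIM('a)) * (\<integral>\<^sup>+y. ennreal ((real m)\<^sup>2) * (indicator (cball 0 \<rho>) y * osc f y) \<partial>lborel)"
    using osc_multiple[OF f, of m] by (intro mult_left_mono nn_integral_mono) (auto simp: indicator_def)
  also have "... = ennreal (real m ^ DIM('a) * (real m)\<^sup>2) * (\<integral>\<^sup>+y. indicator (cball 0 \<rho>) y * osc f y \<partial>lborel)"
    by (subst nn_integral_cmult) (auto simp: mult.assoc ennreal_mult)
  also have "real m ^ DIM('a) * (real m)\<^sup>2 = real m ^ (DIM('a) + 2)" by (simp only: power_add)
  finally show ?thesis .
qed

text \<open>If the support of f has at most half the volume of the ball, then from any point where f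
  = t at least half of the displacements lead to zeros of f, and each of them contributes
  t^2.\<close>

lemma osc_lower_bound:
  fixes f :: "'a::euclidean_space \<Rightarrow> real"
  assumes [measurable]: "f \<in> borel_measurable borel" and t: "t \<ge> 0"
    and f0: "emeasure lborel {x. f x \<noteq> 0} \<le> ennreal \<mu>" and \<mu>: "\<mu> \<ge> 0"
    and r: "2 * \<mu> \<le> measure lborel (cball (0::'a) r)"
  shows "ennreal (t\<^sup>2 * (measure lborel (cball (0::'a) r) / 2)) * emeasure lborel {x. f x = t} \<le>
    (\<integral>\<^sup>+y. indicator (cball 0 r) y * osc f y \<partial>lborel)"
proof -
  define B where "B = cball (0::'a) r"
  have [measurable]: "B \<in> sets borel" by (simp add: B_def)
  have eB: "emeasure lborel B = ennreal (measure lborel B)"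
    unfolding B_def using emeasure_lborel_cball_finite[of "0::'a" r] by (simp add: emeasure_eq_ennreal_measure)
  have key: "ennreal (measure lborel B / 2) \<le> emeasure lborel {y \<in> B. f (x + y) = 0}" for x
  proof -
    have [measurable]: "{y. f (x + y) \<noteq> 0} \<in> sets borel" "{y \<in> B. f (x + y) = 0} \<in> sets borel"
      "{z. f z \<noteq> 0} \<in> sets borel" by measurable
    have e1: "emeasure lborel {y. f (x + y) \<noteq> 0} = emeasure lborel {z. f z \<noteq> 0}"
    proof -
      have "emeasure lborel {y. f (x + y) \<noteq> 0} = (\<integral>\<^sup>+y. indicator {z. f z \<noteq> 0} (1 *\<^sub>R y + x) \<partial>lborel)"
      proof -
        have "(\<lambda>y. indicator {z. f z \<noteq> 0} (1 *\<^sub>R y + x)) = (indicator {y. f (x + y) \<noteq> 0} :: 'a \<Rightarrow> ennreal)"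
          by (auto simp: indicator_def fun_eq_iff add.commute)
        then show ?thesis by (simp only:) simp
      qed
      also have "... = (\<integral>\<^sup>+y. indicator {z. f z \<noteq> 0} y \<partial>lborel)"
        by (subst (2) nn_integral_lborel_affine[of 1 _ x]) auto
      finally show ?thesis by simp
    qed
    have "emeasure lborel B \<le> emeasure lborel {y \<in> B. f (x + y) = 0} + emeasure lborel {y. f (x + y) \<noteq> 0}"
      by (rule order_trans[OF _ emeasure_subadditive]) (auto intro!: emeasure_mono)
    also have "... \<le> emeasure lborel {y \<in> B. f (x + y) = 0} + ennreal \<mu>" using f0 e1 by (auto intro: add_left_mono)
    finally have "ennreal (measure lborel B) \<le> emeasure lborel {y \<in> B. f (x + y) = 0} + ennreal \<mu>" by (simp add: eB)
    then have "ennreal (measure lborel B) - ennreal \<mu> \<le> emeasure lborel {y \<in> B. f (x + y) = 0}"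
      by (simp add: ennreal_minus_le_iff add.commute)
    moreover have "ennreal (measure lborel B / 2) \<le> ennreal (measure lborel B) - ennreal \<mu>"
      using r \<mu> by (subst ennreal_minus) (auto simp: B_def intro!: ennreal_leI)
    ultimately show ?thesis by (rule order_trans[rotated])
  qed
  have m2: "(\<lambda>(y, x). indicator B y * ennreal ((f (x + y) - f x)\<^sup>2)) \<in> borel_measurable (lborel \<Otimes>\<^sub>M lborel)"
  proof -
    have ms: "(\<lambda>p. indicator B (fst p) :: ennreal) \<in> borel_measurable (lborel \<Otimes>\<^sub>M (lborel :: 'a measure))" by measurable
    show ?thesis using borel_measurable_times_ennreal[OF ms meas_osc_pair[OF assms(1)]] by (simp add: case_prod_beta')
  qed
  have "ennreal (t\<^sup>2 * (measure lborel B / 2)) * emeasure lborel {x. f x = t} =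
      (\<integral>\<^sup>+x. ennreal (t\<^sup>2 * (measure lborel B / 2)) * indicator {x. f x = t} x \<partial>lborel)"
    by (subst nn_integral_cmult) auto
  also have "... \<le> (\<integral>\<^sup>+x. \<integral>\<^sup>+y. indicator B y * ennreal ((f (x + y) - f x)\<^sup>2) \<partial>lborel \<partial>lborel)"
  proof (rule nn_integral_mono)
    fix x :: 'a
    show "ennreal (t\<^sup>2 * (measure lborel B / 2)) * indicator {x. f x = t} x \<le>
        (\<integral>\<^sup>+y. indicator B y * ennreal ((f (x + y) - f x)\<^sup>2) \<partial>lborel)"
    proof (cases "f x = t")
      case True
      have [measurable]: "{y \<in> B. f (x + y) = 0} \<in> sets borel" by measurable
      have "ennreal (t\<^sup>2 * (measure lborel B / 2)) = ennreal (t\<^sup>2) * ennreal (measure lborel B / 2)"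
        by (subst ennreal_mult[symmetric]) auto
      also have "... \<le> ennreal (t\<^sup>2) * emeasure lborel {y \<in> B. f (x + y) = 0}" by (intro mult_left_mono key) auto
      also have "... = (\<integral>\<^sup>+y. ennreal (t\<^sup>2) * indicator {y \<in> B. f (x + y) = 0} y \<partial>lborel)"
        by (subst nn_integral_cmult) auto
      also have "... \<le> (\<integral>\<^sup>+y. indicator B y * ennreal ((f (x + y) - f x)\<^sup>2) \<partial>lborel)"
        by (intro nn_integral_mono) (auto simp: indicator_def True)
      finally show ?thesis using True by simp
    qed simp
  qed
  also have "... = (\<integral>\<^sup>+y. \<integral>\<^sup>+x. indicator B y * ennreal ((f (x + y) - f x)\<^sup>2) \<partial>lborel \<partial>lborel)"
    using lborel_pair.Fubini'[OF m2] by simp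
  also have "... = (\<integral>\<^sup>+y. indicator B y * osc f y \<partial>lborel)"
    unfolding osc_def by (intro nn_integral_cong) (auto simp: indicator_def)
  finally show ?thesis by (simp add: B_def)
qed

section \<open>Dyadic layers and the level set recursion\<close>

text \<open>The layer of z between the heights t and 2t, lowered by t. The layers at dyadic heights
  telescope.\<close>

definition slice :: "real \<Rightarrow> real \<Rightarrow> real" where "slice t z = min (max (z - t) 0) t"

lemma slice_sum:
  assumes "s > 0" "z \<ge> 0"
  shows "(\<Sum>k<n. slice (s * 2 ^ k) z) = min (max z s) (s * 2 ^ n) - s"
proof (induction n)
  case (Suc n)
  have "min (max z s) T - s + slice T z = min (max z s) (2 * T) - s" if "T \<ge> s" for T using that assms by (auto simp: slice_def min_def max_def)
  from this[of "s * 2 ^ n"] show ?case using Suc assms by (simp add: mult.left_commute)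
qed (use assms in simp)

lemma sum_squares_le_square_sum:
  fixes a :: "nat \<Rightarrow> real"
  assumes "\<And>k. 0 \<le> a k" shows "(\<Sum>k<n. (a k)\<^sup>2) \<le> (\<Sum>k<n. a k)\<^sup>2"
proof (induction n)
  case (Suc n)
  have "0 \<le> 2 * (\<Sum>k<n. a k) * a n" using assms by (simp add: sum_nonneg)
  then show ?case using Suc by (simp only: sum.lessThan_Suc power2_sum)
qed simp

lemma slice_mono: "t \<ge> 0 \<Longrightarrow> x \<le> y \<Longrightarrow> slice t x \<le> slice t y"
  by (auto simp: slice_def)

text \<open>The layers increase in z, so their increments share one sign and telescope to at most
  the full increment. Hence the oscillations of all layers together do not exceed the oscillation of
  the function.\<close>

lemma slice_sum_squares:
  assumes s: "s > 0" and ab: "a \<ge> 0" "b \<ge> 0"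
  shows "(\<Sum>k<n. (slice (s * 2 ^ k) a - slice (s * 2 ^ k) b)\<^sup>2) \<le> (a - b)\<^sup>2"
proof -
  have *: "(\<Sum>k<n. (slice (s * 2 ^ k) a - slice (s * 2 ^ k) b)\<^sup>2) \<le> (a - b)\<^sup>2" if "b \<le> a" "b \<ge> 0" for a b
  proof -
    have nn: "0 \<le> slice (s * 2 ^ k) a - slice (s * 2 ^ k) b" for k using slice_mono[of "s * 2 ^ k" b a] s that by simp
    have "(\<Sum>k<n. (slice (s * 2 ^ k) a - slice (s * 2 ^ k) b)\<^sup>2) \<le> (\<Sum>k<n. slice (s * 2 ^ k) a - slice (s * 2 ^ k) b)\<^sup>2"
      by (rule sum_squares_le_square_sum) (rule nn)
    also have "... \<le> (a - b)\<^sup>2"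
    proof (rule power_mono)
      have "s * 2 ^ n \<ge> s" using s by simp
      then show "(\<Sum>k<n. slice (s * 2 ^ k) a - slice (s * 2 ^ k) b) \<le> a - b"
        using that s by (simp add: sum_subtractf slice_sum min_def max_def)
      show "0 \<le> (\<Sum>k<n. slice (s * 2 ^ k) a - slice (s * 2 ^ k) b)" using nn by (simp add: sum_nonneg)
    qed
    finally show ?thesis .
  qed
  show ?thesis
  proof (cases "b \<le> a")
    case False
    then show ?thesis using *[of a b] ab by (simp add: power2_commute)
  qed (use * ab in auto)
qed

text \<open>The largest of the finitely many terms is either the first one or satisfies S \<le> C
  \<Gamma> S^\<theta>, and then S^(1-\<theta>) \<le> C \<Gamma>. Working with finite sums makes this
  absorption legitimate, and the bound does not depend on n.\<close>

lemma level_set_recursion_sum: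
  fixes a g :: "nat \<Rightarrow> real"
  assumes a: "\<And>k. a k \<ge> 0" and g: "\<And>k. g k \<ge> 0" "(\<Sum>k<n. g k) \<le> \<Gamma>" and C: "C \<ge> 0"
    and \<theta>: "0 < \<theta>" "\<theta> < 1" and rec: "\<And>k. k < n \<Longrightarrow> a (Suc k) \<le> C * a k powr \<theta> * g k"
  shows "(\<Sum>k<Suc n. a k) \<le> a 0 + C * \<Gamma> * a 0 powr \<theta> + (C * \<Gamma>) powr (1 / (1 - \<theta>))"
proof -
  define S where "S = Max (a ` {..n})"
  have S: "a k \<le> S" if "k \<le> n" for k unfolding S_def using that by (intro Max_ge) auto
  have S0: "S \<ge> 0" using S[of 0] a[of 0] by simp
  have \<Gamma>: "\<Gamma> \<ge> 0" using g sum_nonneg[of "{..<n}" g] by simp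
  have le: "a (Suc k) \<le> C * S powr \<theta> * g k" if "k < n" for k
  proof -
    have "C * a k powr \<theta> * g k \<le> C * S powr \<theta> * g k"
      using that C g a \<theta> S by (intro mult_right_mono mult_left_mono powr_mono2) auto
    then show ?thesis using rec[OF that] by simp
  qed
  have "(\<Sum>k<n. a (Suc k)) \<le> (\<Sum>k<n. C * S powr \<theta> * g k)" by (intro sum_mono le) auto
  also have "... = C * S powr \<theta> * (\<Sum>k<n. g k)" by (simp add: sum_distrib_left)
  also have "... \<le> C * S powr \<theta> * \<Gamma>" using g C by (intro mult_left_mono) auto
  finally have 1: "(\<Sum>k<Suc n. a k) \<le> a 0 + C * \<Gamma> * S powr \<theta>" unfolding sum.lessThan_Suc_shift by (simp add: mult_ac)
  have "C * \<Gamma> * S powr \<theta> \<le> C * \<Gamma> * a 0 powr \<theta> + (C * \<Gamma>) powr (1 / (1 - \<theta>))"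
  proof (cases "S = a 0 \<or> S = 0")
    case True
    then have "S powr \<theta> \<le> a 0 powr \<theta>" using a[of 0] by auto
    then have "C * \<Gamma> * S powr \<theta> \<le> C * \<Gamma> * a 0 powr \<theta>" using C \<Gamma> by (intro mult_left_mono) auto
    then show ?thesis by (simp add: add_increasing2)
  next
    case False
    have "S \<in> a ` {..n}" unfolding S_def by (intro Max_in) auto
    then obtain j where "S = a j" "j \<le> n" by auto
    with False obtain k where k: "S = a (Suc k)" "k < n" by (cases j) auto
    have Sp: "S > 0" using S0 False by simp
    have "g k \<le> \<Gamma>" using g member_le_sum[of k "{..<n}" g] k(2) by simp
    then have "C * S powr \<theta> * g k \<le> C * S powr \<theta> * \<Gamma>" using C by (intro mult_left_mono) auto
    with le[OF k(2)] k have S1: "S \<le> C * \<Gamma> * S powr \<theta>" by (simp add: mult_ac)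
    have "S = S powr (1 - \<theta>) * S powr \<theta>" using Sp by (simp flip: powr_add)
    with S1 have "S powr (1 - \<theta>) * S powr \<theta> \<le> C * \<Gamma> * S powr \<theta>" by simp
    then have S2: "S powr (1 - \<theta>) \<le> C * \<Gamma>" using Sp by simp
    have "S powr (1 - \<theta>) > 0" using Sp by simp
    with S2 have CG: "C * \<Gamma> > 0" by linarith
    have "(S powr (1 - \<theta>)) powr (\<theta> / (1 - \<theta>)) \<le> (C * \<Gamma>) powr (\<theta> / (1 - \<theta>))"
      using S2 \<theta> by (intro powr_mono2) auto
    then have "S powr \<theta> \<le> (C * \<Gamma>) powr (\<theta> / (1 - \<theta>))" using \<theta> by (simp add: powr_powr)
    then have "C * \<Gamma> * S powr \<theta> \<le> (C * \<Gamma>) powr 1 * (C * \<Gamma>) powr (\<theta> / (1 - \<theta>))"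
      using CG by (simp add: mult_left_mono)
    also have "... = (C * \<Gamma>) powr (1 / (1 - \<theta>))"
    proof -
      have "1 + \<theta> / (1 - \<theta>) = 1 / (1 - \<theta>)" using \<theta> by (simp add: field_simps)
      then show ?thesis unfolding powr_add[symmetric] by simp
    qed
    finally show ?thesis using C \<Gamma> by (simp add: add_increasing)
  qed
  with 1 show ?thesis by simp
qed

lemma level_set_finite:
  fixes v :: "'a::euclidean_space \<Rightarrow> real"
  assumes v: "l2 v" and t: "t > 0"
  shows "emeasure lborel {x. v x > t} = ennreal (measure lborel {x. v x > t})"
    "t\<^sup>2 * measure lborel {x. v x > t} \<le> l2sq v"
proof -
  note [measurable] = l2_measurable[OF v]
  have [measurable]: "{x. v x > t} \<in> sets borel" by measurable
  have "ennreal (t\<^sup>2) * emeasure lborel {x. v x > t} = (\<integral>\<^sup>+x. ennreal (t\<^sup>2) * indicator {x. v x > t} x \<partial>lborel)"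
    by (subst nn_integral_cmult) auto
  also have "... \<le> (\<integral>\<^sup>+x. ennreal ((norm (v x))\<^sup>2) \<partial>lborel)"
    using t by (intro nn_integral_mono) (auto simp: indicator_def intro!: ennreal_leI power_mono)
  also have "... = ennreal (l2sq v)" by (rule ennreal_l2sq[OF v, symmetric])
  finally have le: "ennreal (t\<^sup>2) * emeasure lborel {x. v x > t} \<le> ennreal (l2sq v)" .
  have "emeasure lborel {x. v x > t} \<noteq> \<infinity>"
  proof
    assume "emeasure lborel {x. v x > t} = \<infinity>"
    with le t show False by (simp add: ennreal_mult_top top_unique)
  qed
  then show e: "emeasure lborel {x. v x > t} = ennreal (measure lborel {x. v x > t})" by (simp add: emeasure_eq_ennreal_measure)
  show "t\<^sup>2 * measure lborel {x. v x > t} \<le> l2sq v" using le unfolding e by (simp add: ennreal_mult[symmetric])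
qed

text \<open>In 8 = 2 * 2^2 the first factor comes from using half of a ball and the square from
  rounding the radius up by at most a factor 2. The remaining power expresses the squared radius of
  a ball through its volume.\<close>

definition sobolev_aux :: "'a::euclidean_space itself \<Rightarrow> real" where
  "sobolev_aux _ = 8 * (2 / unit_ball_vol (real DIM('a))) powr (2 / DIM('a))"

text \<open>A layer is compared with its translates over a ball of twice the volume of its support,
  on which \<open>osc_lower_bound\<close> applies. To let the contributions \<open>g\<close> of all
  levels add up to at most \<Gamma>, they are measured at one common radius first.\<close>

lemma level_set_estimate:
  fixes v :: "'a::euclidean_space \<Rightarrow> real"
  assumes v: "l2 v" "\<And>x. v x \<ge> 0" and \<Gamma>: "\<Gamma> \<ge> 0" "\<And>y. osc v y \<le> ennreal ((norm y)\<^sup>2 * \<Gamma>)" and s: "s > 0"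
  shows "\<exists>g. (\<forall>k. g k \<ge> 0) \<and> (\<Sum>k<n. g k) \<le> \<Gamma> \<and>
    (\<forall>k<n. (s * 2 ^ k)\<^sup>2 * measure lborel {x. v x > s * 2 ^ Suc k} \<le>
       sobolev_aux TYPE('a) * measure lborel {x. v x > s * 2 ^ k} powr (2 / DIM('a)) * g k)"
proof -
  define N where "N = DIM('a)"
  have N: "N > 0" by (simp add: N_def)
  define \<omega> where "\<omega> = unit_ball_vol (real N)"
  have \<omega>: "\<omega> > 0" by (simp add: \<omega>_def)
  define t where "t k = s * 2 ^ k" for k :: nat
  define \<mu> where "\<mu> k = measure lborel {x. v x > t k}" for k
  have t: "t k > 0" for k using s by (simp add: t_def)
  have e\<mu>: "emeasure lborel {x. v x > t k} = ennreal (\<mu> k)" for k unfolding \<mu>_def by (rule level_set_finite[OF v(1) t])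
  note [measurable] = l2_measurable[OF v(1)]
  define w where "w k x = slice (t k) (v x)" for k x
  have mw[measurable]: "w k \<in> borel_measurable borel" for k unfolding w_def[abs_def] slice_def by measurable
  have wb: "0 \<le> w k x" "w k x \<le> v x" for k x using v(2)[of x] t[of k] by (auto simp: w_def slice_def min_def max_def)
  have wl: "l2 (w k)" for k unfolding l2_def
  proof
    show "integrable lborel (\<lambda>x. (norm (w k x))\<^sup>2)" by (rule Bochner_Integration.integrable_bound[OF l2_square_integrable[OF v(1)]])
        (use v(2) wb in \<open>auto intro!: AE_I2 power_mono\<close>)
  qed simp
  \<comment> \<open>The radius at which the ball has volume 2 \<mu>_k.\<close>
  define R where "R k = (2 * \<mu> k / \<omega>) powr (1 / N)" for k
  \<comment> \<open>A radius below all relevant \<open>R k\<close>, so that the multiples used later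
    are at least 1; the element 1 keeps the minimum defined if every level set is null.\<close>
  define \<rho> where "\<rho> = Min (insert 1 (R ` {k\<in>{..<n}. \<mu> k > 0}))"
  have \<rho>R: "\<rho> \<le> R k" if "k < n" "\<mu> k > 0" for k unfolding \<rho>_def using that by (intro Min_le) auto
  have \<rho>: "\<rho> > 0" unfolding \<rho>_def using \<omega> by (subst Min_gr_iff) (auto simp: R_def)
  have cb: "measure lborel (cball (0::'a) r) = \<omega> * r ^ N" if "r \<ge> 0" for r
    using content_cball[OF that, of "0::'a"] by (simp add: \<omega>_def N_def)
  have ecb: "emeasure lborel (cball (0::'a) \<rho>) = ennreal (\<omega> * \<rho> ^ N)"
    using emeasure_lborel_cball_finite[of "0::'a" \<rho>] cb[of \<rho>] \<rho> by (simp add: emeasure_eq_ennreal_measure)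
  define J where "J k = (\<integral>\<^sup>+y. indicator (cball 0 \<rho>) y * osc (w k) y \<partial>lborel)" for k
  define V where "V = \<omega> * \<rho> ^ N"
  have V: "V > 0" using \<omega> \<rho> by (simp add: V_def)
  have sumosc: "(\<Sum>k<n. osc (w k) y) \<le> osc v y" for y
  proof -
    have "(\<Sum>k<n. osc (w k) y) = (\<integral>\<^sup>+x. (\<Sum>k<n. ennreal ((w k (x + y) - w k x)\<^sup>2)) \<partial>lborel)"
      unfolding osc_def by (subst nn_integral_sum) auto
    also have "... \<le> osc v y" unfolding osc_def using slice_sum_squares[OF s v(2) v(2)]
      by (intro nn_integral_mono) (auto simp: w_def t_def sum_ennreal intro!: ennreal_leI)
    finally show ?thesis .
  qed
  have sumJ: "(\<Sum>k<n. J k) \<le> ennreal (\<rho>\<^sup>2 * \<Gamma> * V)"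
  proof -
    have [measurable]: "cball (0::'a) \<rho> \<in> sets borel" by simp
    have "(\<Sum>k<n. J k) = (\<integral>\<^sup>+y. (\<Sum>k<n. indicator (cball 0 \<rho>) y * osc (w k) y) \<partial>lborel)"
      unfolding J_def by (subst nn_integral_sum) auto
    also have "... \<le> (\<integral>\<^sup>+y. ennreal (\<rho>\<^sup>2 * \<Gamma>) * indicator (cball (0::'a) \<rho>) y \<partial>lborel)"
    proof (rule nn_integral_mono)
      fix y :: 'a
      have "(\<Sum>k<n. osc (w k) y) \<le> ennreal ((norm y)\<^sup>2 * \<Gamma>)" using sumosc[of y] \<Gamma>(2)[of y] by simp
      also have "... \<le> ennreal (\<rho>\<^sup>2 * \<Gamma>)" if "norm y \<le> \<rho>"
        using that \<Gamma>(1) by (intro ennreal_leI mult_right_mono power_mono) auto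
      finally show "(\<Sum>k<n. indicator (cball 0 \<rho>) y * osc (w k) y) \<le> ennreal (\<rho>\<^sup>2 * \<Gamma>) * indicator (cball 0 \<rho>) y"
        by (auto simp: indicator_def)
    qed
    also have "... = ennreal (\<rho>\<^sup>2 * \<Gamma> * V)"
      using \<Gamma>(1) V by (subst nn_integral_cmult) (auto simp: ecb V_def[symmetric] ennreal_mult)
    finally show ?thesis .
  qed
  have Jfin: "J k < \<infinity>" if "k < n" for k
  proof -
    have "J k \<le> (\<Sum>k<n. J k)" using that by (intro member_le_sum) auto
    then show ?thesis using sumJ by (simp add: order_le_less_trans[OF order_trans])
  qed
  \<comment> \<open>The mean oscillation of the k-th layer over the small ball, relative to
    \<rho>^2.\<close>
  define g where "g k = enn2real (J k) / (\<rho>\<^sup>2 * V)" for k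
  have g0: "g k \<ge> 0" for k using V by (simp add: g_def)
  have Jg: "J k = ennreal (\<rho>\<^sup>2 * V * g k)" if "k < n" for k using Jfin[OF that] V \<rho> by (simp add: g_def)
  have "(\<Sum>k<n. g k) \<le> \<Gamma>"
  proof -
    have "(\<Sum>k<n. ennreal (\<rho>\<^sup>2 * V * g k)) \<le> ennreal (\<rho>\<^sup>2 * \<Gamma> * V)" using sumJ Jg by simp
    then have "(\<Sum>k<n. \<rho>\<^sup>2 * V * g k) \<le> \<rho>\<^sup>2 * \<Gamma> * V" using V g0 \<Gamma>(1) by (simp add: sum_ennreal)
    moreover have "(\<Sum>k<n. \<rho>\<^sup>2 * V * g k) = \<rho>\<^sup>2 * V * (\<Sum>k<n. g k)" by (simp only: sum_distrib_left)
    moreover have "\<rho>\<^sup>2 * \<Gamma> * V = \<rho>\<^sup>2 * V * \<Gamma>" by simp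
    ultimately have "\<rho>\<^sup>2 * V * (\<Sum>k<n. g k) \<le> \<rho>\<^sup>2 * V * \<Gamma>" by linarith
    then show ?thesis using V \<rho> by simp
  qed
  moreover have "(t k)\<^sup>2 * \<mu> (Suc k) \<le> sobolev_aux TYPE('a) * \<mu> k powr (2 / N) * g k" if k: "k < n" for k
  proof (cases "\<mu> k > 0")
    case False
    have "emeasure lborel {x. v x > t (Suc k)} \<le> emeasure lborel {x. v x > t k}" using t[of k] by (intro emeasure_mono) (auto simp: t_def)
    then have "\<mu> (Suc k) \<le> \<mu> k" unfolding e\<mu> by (simp add: \<mu>_def)
    then have "\<mu> (Suc k) = 0" using False measure_nonneg[of lborel "{x. v x > t (Suc k)}"] unfolding \<mu>_def by linarith
    then show ?thesis using g0[of k] by (simp add: sobolev_aux_def)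
  next
    case True
    have Rpos: "R k > 0" using True \<omega> by (simp add: R_def)
    \<comment> \<open>Rounding up: since \<rho> \<le> R k, the radius m \<rho> lies between R k and
      2 R k.\<close>
    define m where "m = nat \<lceil>R k / \<rho>\<rceil>"
    define r where "r = real m * \<rho>"
    have m1: "real m \<ge> R k / \<rho>" unfolding m_def by (rule real_nat_ceiling_ge)
    have "R k / \<rho> \<ge> 1" using \<rho>R[OF k True] \<rho> by simp
    then have "real m \<ge> 1" using m1 by linarith
    then have m: "m \<ge> 1" by simp
    have "real m \<le> R k / \<rho> + 1" using Rpos \<rho> unfolding m_def by (simp add: of_nat_nat)
    then have r2: "r \<le> 2 * R k" unfolding r_def using \<rho> \<rho>R[OF k True] by (simp add: field_simps)
    have r1: "R k \<le> r" unfolding r_def using m1 \<rho> by (simp add: field_simps)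
    have r0: "r > 0" using r1 Rpos by simp
    have RN: "\<omega> * R k ^ N = 2 * \<mu> k" using True \<omega> N by (simp add: R_def powr_powr flip: powr_realpow)
    have "2 * \<mu> k \<le> measure lborel (cball (0::'a) r)" using r1 Rpos \<omega> r0 by (simp add: cb RN[symmetric] power_mono)
    from osc_lower_bound[OF mw less_imp_le[OF t[of k]] _ _ this, of k]
    have "ennreal ((t k)\<^sup>2 * (\<omega> * r ^ N / 2)) * emeasure lborel {x. w k x = t k} \<le>
        (\<integral>\<^sup>+y. indicator (cball 0 r) y * osc (w k) y \<partial>lborel)"
    proof -
      have "emeasure lborel {x. w k x \<noteq> 0} \<le> emeasure lborel {x. v x > t k}"
        using t[of k] by (intro emeasure_mono) (auto simp: w_def slice_def)
      with osc_lower_bound[OF mw less_imp_le[OF t[of k]] _ _ \<open>2 * \<mu> k \<le> measure lborel (cball (0::'a) r)\<close>, of k] True r0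
      show ?thesis by (simp add: e\<mu> cb)
    qed
    also have "... \<le> ennreal (real m ^ (N + 2)) * J k" unfolding r_def J_def N_def by (rule osc_ball_multiple[OF wl m])
    also have "... = ennreal (r ^ (N + 2) * \<omega> * g k)"
    proof -
      have "real m ^ (N + 2) * (\<rho>\<^sup>2 * V * g k) = r ^ (N + 2) * \<omega> * g k"
        by (simp add: V_def r_def power_mult_distrib power_add mult_ac power2_eq_square)
      moreover have "\<rho>\<^sup>2 * V * g k \<ge> 0" using V g0[of k] by simp
      ultimately show ?thesis unfolding Jg[OF k] by (subst ennreal_mult[symmetric]) (simp_all only: zero_le_power of_nat_0_le_iff)
    qed
    finally have A: "ennreal ((t k)\<^sup>2 * (\<omega> * r ^ N / 2)) * emeasure lborel {x. w k x = t k} \<le> ennreal (r ^ (N + 2) * \<omega> * g k)" .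
    have "ennreal (\<mu> (Suc k)) \<le> emeasure lborel {x. w k x = t k}"
      unfolding e\<mu>[symmetric] using t[of k] by (intro emeasure_mono) (auto simp: w_def slice_def t_def)
    then have "ennreal ((t k)\<^sup>2 * (\<omega> * r ^ N / 2)) * ennreal (\<mu> (Suc k)) \<le> ennreal (r ^ (N + 2) * \<omega> * g k)"
      by (intro order_trans[OF mult_left_mono A]) auto
    then have "ennreal ((t k)\<^sup>2 * (\<omega> * r ^ N / 2) * \<mu> (Suc k)) \<le> ennreal (r ^ (N + 2) * \<omega> * g k)"
      using \<omega> r0 by (subst ennreal_mult) (auto simp: \<mu>_def)
    then have "(t k)\<^sup>2 * (\<omega> * r ^ N / 2) * \<mu> (Suc k) \<le> r ^ (N + 2) * \<omega> * g k"
      using \<omega> r0 g0[of k] by (simp add: ennreal_le_iff)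
    then have "(\<omega> * r ^ N) * ((t k)\<^sup>2 * \<mu> (Suc k)) \<le> (\<omega> * r ^ N) * (2 * r\<^sup>2 * g k)"
      by (simp add: power_add power2_eq_square mult_ac)
    then have "(t k)\<^sup>2 * \<mu> (Suc k) \<le> 2 * r\<^sup>2 * g k" using \<omega> r0 by simp
    also have "... \<le> 2 * (2 * R k)\<^sup>2 * g k" using r2 r0 g0[of k] by (intro mult_right_mono mult_left_mono power_mono) auto
    also have "... = 8 * (R k)\<^sup>2 * g k" by (simp add: power_mult_distrib)
    also have "(R k)\<^sup>2 = (2 / \<omega>) powr (2 / N) * \<mu> k powr (2 / N)"
    proof -
      have "(R k)\<^sup>2 = R k powr 2" using Rpos by (simp add: powr_numeral)
      also have "... = (2 / \<omega> * \<mu> k) powr (2 / N)" by (simp add: R_def powr_powr)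
      also have "... = (2 / \<omega>) powr (2 / N) * \<mu> k powr (2 / N)" using True \<omega> by (intro powr_mult)
      finally show ?thesis .
    qed
    finally show ?thesis by (simp add: sobolev_aux_def \<omega>_def N_def mult_ac)
  qed
  ultimately show ?thesis using g0 unfolding \<mu>_def t_def N_def by blast
qed

text \<open>The integral of v^p above height s is bounded by a dyadic sum of a_k = t_k^p \<mu>_k.
  The level set estimate is a sublinear recursion for a_k whose solution is bounded by \<Gamma> and
  a_0; letting s tend to 0 removes a_0.\<close>

lemma sobolev_nonneg:
  fixes v :: "'a::euclidean_space \<Rightarrow> real" and \<Gamma> :: real
  defines "p \<equiv> sobolev_exponent DIM('a)"
  assumes N3: "DIM('a) \<ge> 3"
    and v: "l2 v" "\<And>x. v x \<ge> 0" and \<Gamma>: "\<Gamma> \<ge> 0" "\<And>y. osc v y \<le> ennreal ((norm y)\<^sup>2 * \<Gamma>)"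
  shows "(\<integral>\<^sup>+x. ennreal (v x powr p) \<partial>lborel) \<le>
    ennreal (2 powr p * (2 powr p * sobolev_aux TYPE('a) * \<Gamma>) powr (p / 2))"
proof -
  define N where "N = real DIM('a)"
  have N: "N \<ge> 3" using N3 by (simp add: N_def)
  have pN: "p = 2 * N / (N - 2)" by (simp add: p_def sobolev_exponent_def N_def)
  have p2: "p > 2" using N by (simp add: pN pos_less_divide_eq)
  define \<theta> where "\<theta> = 2 / N"
  have \<theta>: "0 < \<theta>" "\<theta> < 1" using N by (auto simp: \<theta>_def)
  \<comment> \<open>Here the critical exponent enters: p \<theta> = p - 2 makes the powers of t_k
    match in the recursion, and 1/(1-\<theta>) = p/2 is the power of \<Gamma> in the result.\<close>
  have p\<theta>: "p * \<theta> = p - 2" "1 / (1 - \<theta>) = p / 2" using N by (auto simp: pN \<theta>_def field_simps)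
  define C where "C = 2 powr p * sobolev_aux TYPE('a)"
  have C: "C \<ge> 0" by (simp add: C_def sobolev_aux_def)
  note [measurable] = l2_measurable[OF v(1)]
  define b where "b z = z + C * \<Gamma> * z powr \<theta> + (C * \<Gamma>) powr (p / 2)" for z
  have step1: "(\<integral>\<^sup>+x. ennreal (indicator {s<..} (v x) * v x powr p) \<partial>lborel) \<le> ennreal (2 powr p * b (s powr (p - 2) * l2sq v))"
    if s: "s > 0" for s
  proof -
    define t where "t k = s * 2 ^ k" for k :: nat
    have t: "t k > 0" for k using s by (simp add: t_def)
    have tS: "t (Suc k) = 2 * t k" for k by (simp add: t_def)
    define \<mu> where "\<mu> k = measure lborel {x. v x > t k}" for k
    have e\<mu>: "emeasure lborel {x. v x > t k} = ennreal (\<mu> k)" for k unfolding \<mu>_def by (rule level_set_finite[OF v(1) t])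
    define a where "a k = t k powr p * \<mu> k" for k
    have a: "a k \<ge> 0" for k by (simp add: a_def \<mu>_def)
    define z where "z = s powr (p - 2) * l2sq v"
    have a0: "a 0 \<le> z"
    proof -
      have "(t 0)\<^sup>2 * \<mu> 0 \<le> l2sq v" unfolding \<mu>_def by (rule level_set_finite(2)[OF v(1) t])
      then have "s powr (p - 2) * (s\<^sup>2 * \<mu> 0) \<le> z" unfolding z_def by (intro mult_left_mono) (auto simp: t_def)
      moreover have "s powr p = s powr (p - 2) * s\<^sup>2"
      proof -
        have "s\<^sup>2 = s powr 2" using s by (simp add: powr_numeral)
        moreover have "p = (p - 2) + 2" by simp
        ultimately show ?thesis by (metis powr_add)
      qed
      ultimately show ?thesis by (simp add: a_def t_def mult.assoc)
    qed
    have sum: "(\<Sum>k<Suc n. a k) \<le> b z" for n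
    proof -
      obtain g where g: "\<And>k. g k \<ge> 0" "(\<Sum>k<n. g k) \<le> \<Gamma>"
        "\<And>k. k < n \<Longrightarrow> (t k)\<^sup>2 * \<mu> (Suc k) \<le> sobolev_aux TYPE('a) * \<mu> k powr \<theta> * g k"
        using level_set_estimate[OF v \<Gamma> s, of n] unfolding t_def[symmetric] \<mu>_def[symmetric] \<theta>_def N_def by blast
      have rec: "a (Suc k) \<le> C * a k powr \<theta> * g k" if k: "k < n" for k
      proof -
        have e1: "t (Suc k) powr p = 2 powr p * t k powr (p - 2) * (t k)\<^sup>2"
          unfolding tS using t[of k] by (simp add: powr_mult powr_diff powr_numeral)
        have "a (Suc k) = 2 powr p * t k powr (p - 2) * ((t k)\<^sup>2 * \<mu> (Suc k))" unfolding a_def e1 by simp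
        also have "... \<le> 2 powr p * t k powr (p - 2) * (sobolev_aux TYPE('a) * \<mu> k powr \<theta> * g k)"
          using g(3)[OF k] by (intro mult_left_mono) auto
        also have "... = C * (t k powr (p - 2) * \<mu> k powr \<theta>) * g k" by (simp add: C_def mult_ac)
        also have "t k powr (p - 2) * \<mu> k powr \<theta> = a k powr \<theta>" using t[of k] by (simp add: a_def powr_mult powr_powr p\<theta>)
        finally show ?thesis .
      qed
      have "(\<Sum>k<Suc n. a k) \<le> a 0 + C * \<Gamma> * a 0 powr \<theta> + (C * \<Gamma>) powr (1 / (1 - \<theta>))"
        by (rule level_set_recursion_sum[OF a g(1,2) C \<theta> rec])
      also have "... \<le> b z" unfolding b_def p\<theta> using a0 a[of 0] C \<Gamma>(1) \<theta> p2
        by (intro add_mono mult_left_mono powr_mono2) auto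
      finally show ?thesis .
    qed
    have "(\<integral>\<^sup>+x. ennreal (indicator {s<..} (v x) * v x powr p) \<partial>lborel) \<le>
        (\<integral>\<^sup>+x. (\<Sum>k. ennreal (t (Suc k) powr p) * indicator {x. v x > t k} x) \<partial>lborel)"
    proof (rule nn_integral_mono)
      fix x
      show "ennreal (indicator {s<..} (v x) * v x powr p) \<le> (\<Sum>k. ennreal (t (Suc k) powr p) * indicator {x. v x > t k} x)"
      proof (cases "v x > s")
        case True
        have "\<exists>k. v x \<le> t (Suc k)"
        proof -
          obtain k where "v x / s < 2 ^ k" using real_arch_pow[of 2 "v x / s"] by auto
          then have "v x \<le> t (Suc k)" using s True by (simp add: t_def field_simps)
          then show ?thesis ..
        qed
        define k where "k = (LEAST k. v x \<le> t (Suc k))"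
        have k: "v x \<le> t (Suc k)" unfolding k_def using \<open>\<exists>k. v x \<le> t (Suc k)\<close> by (rule LeastI_ex)
        have k': "v x > t k"
        proof (cases k)
          case 0 then show ?thesis using True by (simp add: t_def)
        next
          case (Suc j)
          then have "\<not> v x \<le> t (Suc j)" using not_less_Least[of j "\<lambda>k. v x \<le> t (Suc k)"] unfolding k_def by simp
          then show ?thesis using Suc by simp
        qed
        have "ennreal (indicator {s<..} (v x) * v x powr p) \<le> ennreal (t (Suc k) powr p)"
          using k v(2)[of x] p2 by (intro ennreal_leI) (auto simp: indicator_def intro!: powr_mono2)
        also have "... = sum (\<lambda>k. ennreal (t (Suc k) powr p) * indicator {x. v x > t k} x) {k}" using k' by simp
        also have "... \<le> (\<Sum>k. ennreal (t (Suc k) powr p) * indicator {x. v x > t k} x)" by (rule sum_le_suminf) auto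
        finally show ?thesis .
      qed simp
    qed
    also have "... = (\<Sum>k. ennreal (2 powr p * a k))" using t by (subst nn_integral_suminf)
        (auto simp: nn_integral_cmult e\<mu> ennreal_mult[symmetric] a_def tS powr_mult \<mu>_def mult.assoc)
    also have "... \<le> ennreal (2 powr p * b z)"
    proof (rule suminf_le_const)
      fix n
      have "(\<Sum>k<n. ennreal (2 powr p * a k)) = ennreal (2 powr p * (\<Sum>k<n. a k))"
        using a by (subst sum_ennreal) (auto simp: sum_distrib_left)
      also have "... \<le> ennreal (2 powr p * b z)"
      proof (intro ennreal_leI mult_left_mono)
        have "(\<Sum>k<n. a k) \<le> (\<Sum>k<Suc n. a k)" using a by simp
        then show "(\<Sum>k<n. a k) \<le> b z" using sum[of n] by simp
      qed auto
      finally show "(\<Sum>k<n. ennreal (2 powr p * a k)) \<le> ennreal (2 powr p * b z)" .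
    qed auto
    finally show ?thesis by (simp add: z_def)
  qed
  \<comment> \<open>Since p > 2, both terms that contain the L^2 norm of v disappear as the starting
    height tends to 0.\<close>
  have lim: "(\<lambda>j. ennreal (2 powr p * b (step j powr (p - 2) * l2sq v))) \<longlonglongrightarrow> ennreal (2 powr p * (0 * l2sq v + C * \<Gamma> * (0 * l2sq v) powr \<theta> + (C * \<Gamma>) powr (p / 2)))"
  proof -
    have "(\<lambda>j. step j powr (p - 2)) \<longlonglongrightarrow> 0 powr (p - 2)"
      by (rule tendsto_powr2[OF step_tendsto tendsto_const]) (use p2 less_imp_le[OF step_pos] in auto)
    then have "(\<lambda>j. step j powr (p - 2)) \<longlonglongrightarrow> 0" by simp
    note l = tendsto_mult_right[OF this, of "l2sq v"]
    have l\<theta>: "(\<lambda>j. (step j powr (p - 2) * l2sq v) powr \<theta>) \<longlonglongrightarrow> (0 * l2sq v) powr \<theta>"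
      by (rule tendsto_powr2[OF l tendsto_const]) (use \<theta> in auto)
    show ?thesis unfolding b_def by (intro tendsto_ennrealI tendsto_mult_left tendsto_add tendsto_const l l\<theta>)
  qed
  have "(\<integral>\<^sup>+x. ennreal (v x powr p) \<partial>lborel) = (\<integral>\<^sup>+x. liminf (\<lambda>j. ennreal (indicator {step j<..} (v x) * v x powr p)) \<partial>lborel)"
  proof (rule nn_integral_cong)
    fix x
    have "(\<lambda>j. ennreal (indicator {step j<..} (v x) * v x powr p)) \<longlonglongrightarrow> ennreal (v x powr p)"
    proof (cases "v x > 0")
      case True
      from order_tendstoD(2)[OF step_tendsto True]
      have "\<forall>\<^sub>F j in sequentially. ennreal (indicator {step j<..} (v x) * v x powr p) = ennreal (v x powr p)" by eventually_elim simp
      then show ?thesis by (rule tendsto_eventually)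
    next
      case False
      then show ?thesis using v(2)[of x] by (simp add: order_antisym)
    qed
    from lim_imp_Liminf[OF _ this] show "ennreal (v x powr p) = liminf (\<lambda>j. ennreal (indicator {step j<..} (v x) * v x powr p))" by simp
  qed
  also have "... \<le> liminf (\<lambda>j. \<integral>\<^sup>+x. ennreal (indicator {step j<..} (v x) * v x powr p) \<partial>lborel)"
    by (rule nn_integral_liminf) simp
  also have "... \<le> liminf (\<lambda>j. ennreal (2 powr p * b (step j powr (p - 2) * l2sq v)))"
    by (intro Liminf_mono always_eventually allI step1) simp
  also have "... = ennreal (2 powr p * (0 * l2sq v + C * \<Gamma> * (0 * l2sq v) powr \<theta> + (C * \<Gamma>) powr (p / 2)))"
    by (rule lim_imp_Liminf[OF _ lim]) simp
  finally show ?thesis by (simp add: C_def)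
qed

definition sobolev_const :: "'a::euclidean_space itself \<Rightarrow> real" where "sobolev_const _ = (let p = sobolev_exponent DIM('a) in
     2 powr p * (2 powr p * sobolev_aux TYPE('a)) powr (p / 2))"

lemma sobolev_const_nonneg: "0 \<le> sobolev_const TYPE('a::euclidean_space)"
  by (simp add: sobolev_const_def Let_def)

theorem
  fixes u :: "'a::euclidean_space \<Rightarrow> real"
  assumes N3: "DIM('a) \<ge> 3" and S: "sob u G"
  shows sobolev_integrable: "integrable lborel (\<lambda>x. \<bar>u x\<bar> powr sobolev_exponent DIM('a))"
    and sobolev_inequality: "(LBINT x. \<bar>u x\<bar> powr sobolev_exponent DIM('a)) \<le>
      sobolev_const TYPE('a) * l2sq G powr (sobolev_exponent DIM('a) / 2)"
proof -
  let ?p = "sobolev_exponent DIM('a)"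
  note lu = sob_l2(1)[OF S]
  note [measurable] = l2_measurable[OF lu]
  have lv: "l2 (\<lambda>x. \<bar>u x\<bar>)" using lu by (simp add: l2_def)
  have "osc (\<lambda>x. \<bar>u x\<bar>) y \<le> ennreal ((norm y)\<^sup>2 * l2sq G)" for y
  proof -
    have "osc (\<lambda>x. \<bar>u x\<bar>) y \<le> osc u y"
      unfolding osc_def by (intro nn_integral_mono ennreal_leI abs_le_square_iff[THEN iffD1]) (simp add: abs_triangle_ineq3)
    also have "... \<le> ennreal ((norm y)\<^sup>2 * l2sq G)" unfolding osc_l2[OF lu] by (intro ennreal_leI translation_estimate[OF S])
    finally show ?thesis .
  qed
  from sobolev_nonneg[OF N3 lv _ _ this]
  have le: "(\<integral>\<^sup>+x. ennreal (\<bar>u x\<bar> powr ?p) \<partial>lborel) \<le> ennreal (sobolev_const TYPE('a) * l2sq G powr (?p / 2))"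
    by (simp add: sobolev_const_def Let_def powr_mult sobolev_aux_def mult.assoc)
  then show i: "integrable lborel (\<lambda>x. \<bar>u x\<bar> powr ?p)" by (auto simp: integrable_iff_bounded intro: le_less_trans)
  show "(LBINT x. \<bar>u x\<bar> powr ?p) \<le> sobolev_const TYPE('a) * l2sq G powr (?p / 2)"
    using le sobolev_const_nonneg[where 'a='a] by (subst (asm) nn_integral_eq_integral[OF i]) (auto simp: ennreal_le_iff)
qed

section \<open>Hoelder's inequality\<close>

lemma
  fixes f g :: "'a \<Rightarrow> real"
  assumes [measurable]: "f \<in> borel_measurable M" "g \<in> borel_measurable M"
    and nn: "\<And>x. f x \<ge> 0" "\<And>x. g x \<ge> 0"
    and ab: "a > 1" "b > 1" "1 / a + 1 / b = 1"
    and i: "integrable M (\<lambda>x. f x powr a)" "integrable M (\<lambda>x. g x powr b)"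
  shows Holder_integrable: "integrable M (\<lambda>x. f x * g x)"
    and Holder_inequality: "(LINT x|M. f x * g x) \<le> (LINT x|M. f x powr a) powr (1 / a) * (LINT x|M. g x powr b) powr (1 / b)"
proof -
  have Y: "x * y \<le> x powr a + y powr b" if "x \<ge> 0" "y \<ge> 0" for x y :: real
  proof -
    have "x * y \<le> x powr a / a + y powr b / b" by (rule Youngs_inequality[OF ab that])
    also have "... \<le> x powr a / 1 + y powr b / 1" using ab by (intro add_mono divide_left_mono) auto
    finally show ?thesis by simp
  qed
  show fg: "integrable M (\<lambda>x. f x * g x)" by (rule Bochner_Integration.integrable_bound[OF Bochner_Integration.integrable_add[OF i]])
      (use nn Y in \<open>auto intro!: AE_I2\<close>)
  define A B where "A = (LINT x|M. f x powr a)" and "B = (LINT x|M. g x powr b)"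
  have AB: "A \<ge> 0" "B \<ge> 0" by (auto simp: A_def B_def)
  show "(LINT x|M. f x * g x) \<le> A powr (1 / a) * B powr (1 / b)"
  proof (cases "A = 0 \<or> B = 0")
    case True
    have "AE x in M. f x * g x = 0"
    proof (cases "A = 0")
      case True
      then have "AE x in M. f x powr a = 0" using integral_nonneg_eq_0_iff_AE[OF i(1)] by (simp add: A_def)
      then show ?thesis by eventually_elim simp
    next
      case False
      then have "AE x in M. g x powr b = 0" using integral_nonneg_eq_0_iff_AE[OF i(2)] True by (simp add: B_def)
      then show ?thesis by eventually_elim simp
    qed
    then have "(LINT x|M. f x * g x) = 0" by (rule integral_eq_zero_AE)
    then show ?thesis by simp
  next
    case False
    then have AB: "A > 0" "B > 0" using AB by auto
    define \<alpha> \<beta> where "\<alpha> = A powr (1 / a)" and "\<beta> = B powr (1 / b)"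
    have \<alpha>: "\<alpha> > 0" "\<beta> > 0" "\<alpha> powr a = A" "\<beta> powr b = B" using AB ab by (auto simp: \<alpha>_def \<beta>_def powr_powr)
    have "(LINT x|M. f x * g x) / (\<alpha> * \<beta>) = (LINT x|M. (f x / \<alpha>) * (g x / \<beta>))" by (simp add: times_divide_times_eq)
    also have "... \<le> (LINT x|M. f x powr a / A / a + g x powr b / B / b)"
    proof (rule integral_mono)
      show "integrable M (\<lambda>x. f x / \<alpha> * (g x / \<beta>))" using fg by (simp add: times_divide_times_eq)
      show "integrable M (\<lambda>x. f x powr a / A / a + g x powr b / B / b)"
        using i by (intro Bochner_Integration.integrable_add integrable_divide)
      fix x
      have "(f x / \<alpha>) * (g x / \<beta>) \<le> (f x / \<alpha>) powr a / a + (g x / \<beta>) powr b / b"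
        using nn \<alpha> by (intro Youngs_inequality[OF ab]) auto
      then show "(f x / \<alpha>) * (g x / \<beta>) \<le> f x powr a / A / a + g x powr b / B / b" using nn \<alpha> by (simp add: powr_divide)
    qed
    also have "... = A / A / a + B / B / b" using i by (simp add: A_def B_def)
    also have "... = 1" using AB ab by simp
    finally have "(LINT x|M. f x * g x) \<le> \<alpha> * \<beta>" using \<alpha> by (simp add: divide_le_eq)
    then show ?thesis by (simp add: \<alpha>_def \<beta>_def)
  qed
qed

section \<open>Quadratic forms of potentials\<close>

definition loc_sq :: "real \<Rightarrow> ('a::euclidean_space \<Rightarrow> real) \<Rightarrow> real" where
  "loc_sq R u = (LBINT x. indicator (cball 0 R) x * (u x)\<^sup>2)"

lemma loc_sq_integrable: "l2 u \<Longrightarrow> integrable lborel (\<lambda>x. indicator (cball 0 R) x * (u x)\<^sup>2)"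
  for u :: "'a::euclidean_space \<Rightarrow> real" using integrable_mult_indicator[OF _ l2_square_integrable, of "cball 0 R" u] by simp

lemma loc_sq_nonneg: "0 \<le> loc_sq R u"
  unfolding loc_sq_def by (intro integral_nonneg_AE AE_I2) simp

lemma loc_sq_le: "l2 u \<Longrightarrow> loc_sq R u \<le> l2sq u"
  unfolding loc_sq_def l2sq_def by (intro integral_mono loc_sq_integrable) (auto simp: l2_def indicator_def)

text \<open>Bounded small values are unrestricted, and only the part above each positive height must
  lie in L^{N/2}. This covers |V|, W^2 and also |Z|^(p-2) for a solution Z, to which the Pohozaev
  argument applies it.\<close>

definition admissible :: "('a::euclidean_space \<Rightarrow> real) \<Rightarrow> bool" where
  "admissible q \<longleftrightarrow> q \<in> borel_measurable borel \<and> (\<forall>x. q x \<ge> 0) \<and>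
     (\<forall>d>0. integrable lborel (\<lambda>x. indicator {d<..} (q x) * q x powr (DIM('a) / 2)))"

lemma admissible_powr:
  fixes q :: "'a::euclidean_space \<Rightarrow> real"
  assumes [measurable]: "q \<in> borel_measurable borel" and q: "\<And>x. q x \<ge> 0"
    and r: "r \<ge> DIM('a) / 2" and i: "integrable lborel (\<lambda>x. q x powr r)"
  shows "admissible q"
  unfolding admissible_def
proof (intro conjI allI impI)
  fix d :: real assume d: "d > 0"
  show "integrable lborel (\<lambda>x. indicator {d<..} (q x) * q x powr (DIM('a) / 2))"
  proof (rule Bochner_Integration.integrable_bound[OF integrable_mult_right[OF i, of "d powr (DIM('a) / 2 - r)"]])
    show "AE x in lborel. norm (indicator {d<..} (q x) * q x powr (DIM('a) / 2)) \<le> norm (d powr (DIM('a) / 2 - r) * q x powr r)"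
    proof (rule AE_I2)
      fix x
      have "q x powr (DIM('a) / 2) \<le> d powr (DIM('a) / 2 - r) * q x powr r" if "q x > d"
      proof -
        have "q x powr (DIM('a) / 2) = q x powr (DIM('a) / 2 - r) * q x powr r" using that d by (simp flip: powr_add)
        also have "q x powr (DIM('a) / 2 - r) \<le> d powr (DIM('a) / 2 - r)" using that d r by (intro powr_mono2') auto
        finally show ?thesis by (simp add: mult_right_mono)
      qed
      then show "norm (indicator {d<..} (q x) * q x powr (DIM('a) / 2)) \<le> norm (d powr (DIM('a) / 2 - r) * q x powr r)"
        by (auto simp: indicator_def)
    qed
  qed simp
qed (use q in auto)

lemma sobolev_exponent_conj:
  assumes "N \<ge> 3"
  shows "1 / (real N / 2) + 1 / (sobolev_exponent N / 2) = 1" "sobolev_exponent N / 2 > 1" "sobolev_exponent N > 2"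
    "(sobolev_exponent N - 2) * (real N / 2) = sobolev_exponent N" using assms by (auto simp: sobolev_exponent_def field_simps)

lemma
  fixes q u :: "'a::euclidean_space \<Rightarrow> real"
  assumes N3: "DIM('a) \<ge> 3" and [measurable]: "q \<in> borel_measurable borel" and q: "\<And>x. q x \<ge> 0"
    and i: "integrable lborel (\<lambda>x. q x powr (DIM('a) / 2))" and S: "sob u G"
  shows Holder_sobolev_integrable: "integrable lborel (\<lambda>x. q x * (u x)\<^sup>2)"
    and Holder_sobolev: "(LBINT x. q x * (u x)\<^sup>2) \<le> (LBINT x. q x powr (DIM('a) / 2)) powr (2 / DIM('a)) *
      sobolev_const TYPE('a) powr (2 / sobolev_exponent DIM('a)) * l2sq G"
proof -
  let ?p = "sobolev_exponent DIM('a)"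
  note c = sobolev_exponent_conj[OF N3]
  note [measurable] = l2_measurable[OF sob_l2(1)[OF S]]
  have e: "((u x)\<^sup>2) powr (?p / 2) = \<bar>u x\<bar> powr ?p" for x
  proof -
    have "(u x)\<^sup>2 = \<bar>u x\<bar> powr 2" by (simp add: powr_numeral)
    then show ?thesis by (simp only: powr_powr) simp
  qed
  have iu: "integrable lborel (\<lambda>x. ((u x)\<^sup>2) powr (?p / 2))" unfolding e by (rule sobolev_integrable[OF N3 S])
  have a: "real DIM('a) / 2 > 1" using N3 by simp
  show "integrable lborel (\<lambda>x. q x * (u x)\<^sup>2)" by (rule Holder_integrable[OF _ _ q _ a c(2) c(1) i iu]) auto
  have "(LBINT x. q x * (u x)\<^sup>2) \<le> (LBINT x. q x powr (DIM('a) / 2)) powr (1 / (DIM('a) / 2)) *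
      (LBINT x. ((u x)\<^sup>2) powr (?p / 2)) powr (1 / (?p / 2))" by (rule Holder_inequality[OF _ _ q _ a c(2) c(1) i iu]) auto
  also have "... \<le> (LBINT x. q x powr (DIM('a) / 2)) powr (1 / (DIM('a) / 2)) *
      (sobolev_const TYPE('a) * l2sq G powr (?p / 2)) powr (1 / (?p / 2))"
    using sobolev_inequality[OF N3 S] c unfolding e by (intro mult_left_mono powr_mono2) auto
  also have "... = (LBINT x. q x powr (DIM('a) / 2)) powr (2 / DIM('a)) *
      sobolev_const TYPE('a) powr (2 / ?p) * l2sq G" using c sobolev_const_nonneg[where 'a='a] by (simp add: powr_mult powr_powr)
  finally show "(LBINT x. q x * (u x)\<^sup>2) \<le> (LBINT x. q x powr (DIM('a) / 2)) powr (2 / DIM('a)) *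
      sobolev_const TYPE('a) powr (2 / ?p) * l2sq G" .
qed

text \<open>The weight is split into a part below e, a bounded part on a ball, and a remainder small
  in L^{N/2}; Hoelder and Sobolev turn the remainder into a small multiple of the Dirichlet
  integral. One number \<open>K\<close> serves as coefficient and as radius.\<close>

theorem admissible_bound:
  fixes q :: "'a::euclidean_space \<Rightarrow> real"
  assumes N3: "DIM('a) \<ge> 3" and ad: "admissible q" and e: "e > 0"
  shows "\<exists>K\<ge>0. \<forall>u G. sob u G \<longrightarrow> integrable lborel (\<lambda>x. q x * (u x)\<^sup>2) \<and>
    (LBINT x. q x * (u x)\<^sup>2) \<le> e * l2sq G + e * l2sq u + K * loc_sq K u"
proof -
  have mq[measurable]: "q \<in> borel_measurable borel" and q0: "\<And>x. q x \<ge> 0"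
    and qi: "\<And>d. d > 0 \<Longrightarrow> integrable lborel (\<lambda>x. indicator {d<..} (q x) * q x powr (DIM('a) / 2))"
    using ad by (auto simp: admissible_def)
  define S where "S = sobolev_const TYPE('a) powr (2 / sobolev_exponent DIM('a))"
  \<comment> \<open>The part of q that is either far out or very large. It decreases to 0 pointwise,
    so its L^{N/2} norm tends to 0 by dominated convergence.\<close>
  define h where "h n x = (if q x > e \<and> (q x > real n \<or> norm x > real n) then q x else 0)" for n x
  have mh[measurable]: "h n \<in> borel_measurable borel" for n unfolding h_def[abs_def] by measurable
  have h0: "h n x \<ge> 0" for n x using q0 by (simp add: h_def)
  have hi: "integrable lborel (\<lambda>x. h n x powr (DIM('a) / 2))" for n
    by (rule Bochner_Integration.integrable_bound[OF qi[OF e]]) (auto simp: h_def indicator_def)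
  have "(\<lambda>n. LBINT x. h n x powr (DIM('a) / 2)) \<longlonglongrightarrow> (LINT x|(lborel::'a measure). (0::real))"
  proof (rule integral_dominated_convergence[where w="\<lambda>x. indicator {e<..} (q x) * q x powr (DIM('a) / 2)"])
    show "AE x in lborel. (\<lambda>n. h n x powr (DIM('a) / 2)) \<longlonglongrightarrow> 0"
    proof (rule AE_I2)
      fix x
      have "\<forall>\<^sub>F n in sequentially. h n x powr (DIM('a) / 2) = 0" using eventually_ge_at_top[of "nat \<lceil>max (q x) (norm x)\<rceil>"]
      proof eventually_elim
        case (elim n)
        then have "max (q x) (norm x) \<le> real n" using real_nat_ceiling_ge[of "max (q x) (norm x)"] by linarith
        then show ?case by (simp add: h_def)
      qed
      then show "(\<lambda>n. h n x powr (DIM('a) / 2)) \<longlonglongrightarrow> 0" by (rule tendsto_eventually)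
    qed
    show "AE x in lborel. norm (h n x powr (DIM('a) / 2)) \<le> indicator {e<..} (q x) * q x powr (DIM('a) / 2)" for n
      by (auto simp: h_def indicator_def)
  qed (use qi[OF e] in auto)
  then have "(\<lambda>n. (LBINT x. h n x powr (DIM('a) / 2)) powr (2 / DIM('a)) * S) \<longlonglongrightarrow> 0 powr (2 / DIM('a)) * S"
    by (intro tendsto_mult_right tendsto_powr2[OF _ tendsto_const]) auto
  from order_tendstoD(2)[OF this[simplified] e]
  obtain n where n: "(LBINT x. h n x powr (DIM('a) / 2)) powr (2 / DIM('a)) * S < e" by (auto simp: eventually_sequentially)
  have qle: "q x \<le> e + h n x + real n * indicator (cball 0 (real n)) x" for x using q0[of x] e by (auto simp: h_def indicator_def not_less)
  have bound: "integrable lborel (\<lambda>x. q x * (u x)\<^sup>2) \<and> (LBINT x. q x * (u x)\<^sup>2) \<le> e * l2sq G + e * l2sq u + real n * loc_sq (real n) u"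
    if sob: "sob u G" for u G
  proof -
    note lu = sob_l2(1)[OF sob]
    note [measurable] = l2_measurable[OF lu]
    note hs = Holder_sobolev_integrable[OF N3 mh h0 hi sob, of n] Holder_sobolev[OF N3 mh h0 hi sob, of n]
    have iu: "integrable lborel (\<lambda>x. (u x)\<^sup>2)" using l2_square_integrable[OF lu] by simp
    define w where "w x = e * (u x)\<^sup>2 + h n x * (u x)\<^sup>2 + real n * (indicator (cball 0 (real n)) x * (u x)\<^sup>2)" for x
    have iw: "integrable lborel w" unfolding w_def[abs_def] using iu hs(1) loc_sq_integrable[OF lu, of "real n"] by auto
    have le: "q x * (u x)\<^sup>2 \<le> w x" for x using mult_right_mono[OF qle[of x], of "(u x)\<^sup>2"] by (simp add: w_def algebra_simps)
    have i: "integrable lborel (\<lambda>x. q x * (u x)\<^sup>2)" by (rule Bochner_Integration.integrable_bound[OF iw])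
        (auto simp: q0 intro!: AE_I2 order_trans[OF le abs_ge_self])
    have "(LBINT x. q x * (u x)\<^sup>2) \<le> (LBINT x. w x)" by (intro integral_mono i iw le)
    also have "... = e * l2sq u + (LBINT x. h n x * (u x)\<^sup>2) + real n * loc_sq (real n) u"
      unfolding w_def loc_sq_def l2sq_def using iu hs(1) loc_sq_integrable[OF lu, of "real n"] by simp
    also have "(LBINT x. h n x * (u x)\<^sup>2) \<le> e * l2sq G"
      using hs(2) mult_right_mono[OF less_imp_le[OF n], of "l2sq G"] by (simp add: S_def mult.assoc)
    finally show ?thesis using i by simp
  qed
  show ?thesis by (rule exI[of _ "real n"]) (use bound in auto)
qed

corollary admissible_integrable:
  fixes q :: "'a::euclidean_space \<Rightarrow> real"
  assumes "DIM('a) \<ge> 3" "admissible q" "sob u G" shows "integrable lborel (\<lambda>x. q x * (u x)\<^sup>2)"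
  using admissible_bound[OF assms(1,2) zero_less_one] assms(3) by auto

corollary admissible_bound_global:
  fixes q :: "'a::euclidean_space \<Rightarrow> real"
  assumes "DIM('a) \<ge> 3" "admissible q" "e > 0"
  obtains C where "C > 0" "\<And>u G. sob u G \<Longrightarrow> (LBINT x. q x * (u x)\<^sup>2) \<le> e * l2sq G + C * l2sq u"
proof -
  obtain K where K: "K \<ge> 0" and K': "\<forall>u G. sob u G \<longrightarrow> integrable lborel (\<lambda>x. q x * (u x)\<^sup>2) \<and>
    (LBINT x. q x * (u x)\<^sup>2) \<le> e * l2sq G + e * l2sq u + K * loc_sq K u" using admissible_bound[OF assms] by auto
  have K2: "(LBINT x. q x * (u x)\<^sup>2) \<le> e * l2sq G + e * l2sq u + K * loc_sq K u" if "sob u G" for u G using K' that by simp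
  have "(LBINT x. q x * (u x)\<^sup>2) \<le> e * l2sq G + (e + K) * l2sq u" if S: "sob u G" for u G
    using K2[OF S] mult_left_mono[OF loc_sq_le[OF sob_l2(1)[OF S], of K] K] by (simp add: algebra_simps)
  then show ?thesis using that[of "e + K"] K assms(3) by simp
qed

section \<open>Local compactness\<close>

definition ball_sum :: "('a::euclidean_space \<Rightarrow> real) \<Rightarrow> real \<Rightarrow> 'a \<Rightarrow> real" where
  "ball_sum f r x = (LBINT y. indicator (cball 0 r) y * f (x + y))"

lemma indicator_cball_l2: "l2 (indicator (cball 0 r) :: 'a::euclidean_space \<Rightarrow> real)"
proof -
  have "(\<lambda>x::'a. (norm (indicator (cball 0 r) x :: real))\<^sup>2) = indicator (cball 0 r)" by (auto simp: indicator_def fun_eq_iff)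
  then show ?thesis using integrable_indicator_cball[of r, where 'a='a] by (simp add: l2_def)
qed

lemma l2sq_indicator_cball: "l2sq (indicator (cball 0 r) :: 'a::euclidean_space \<Rightarrow> real) = measure lborel (cball (0::'a) r)"
proof -
  have "(\<lambda>x::'a. (norm (indicator (cball 0 r) x :: real))\<^sup>2) = indicator (cball 0 r)" by (auto simp: indicator_def fun_eq_iff)
  then show ?thesis by (simp add: l2sq_def)
qed

lemma ball_sum_integrable:
  fixes f :: "'a::euclidean_space \<Rightarrow> real"
  assumes "l2 f" shows "integrable lborel (\<lambda>y. indicator (cball 0 r) y * f (x + y))"
  using l2_real_mult_integrable[OF indicator_cball_l2 l2_translate[OF assms, of x]] by (simp add: add.commute)

lemma ball_sum_bound:
  fixes f :: "'a::euclidean_space \<Rightarrow> real"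
  assumes "l2 f" shows "\<bar>ball_sum f r x\<bar> \<le> sqrt (measure lborel (cball (0::'a) r)) * sqrt (l2sq f)"
  using l2_inner_bound[OF indicator_cball_l2 l2_translate[OF assms, of x], of r] l2sq_translate[OF assms, of x]
  by (simp add: ball_sum_def l2sq_indicator_cball add.commute)

lemma ball_sum_diff:
  fixes f g :: "'a::euclidean_space \<Rightarrow> real"
  assumes "l2 f" "l2 g" shows "ball_sum (\<lambda>x. f x - g x) r x = ball_sum f r x - ball_sum g r x"
  unfolding ball_sum_def using ball_sum_integrable[OF assms(1)] ball_sum_integrable[OF assms(2)] by (simp add: right_diff_distrib)

lemma ball_sum_Lipschitz:
  fixes u :: "'a::euclidean_space \<Rightarrow> real"
  assumes S: "sob u G"
  shows "\<bar>ball_sum u r x - ball_sum u r y\<bar> \<le> sqrt (measure lborel (cball (0::'a) r)) * (norm (x - y) * sqrt (l2sq G))"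
proof -
  note lu = sob_l2(1)[OF S]
  have "ball_sum u r x - ball_sum u r y = ball_sum (\<lambda>z. u (z + (x - y)) - u z) r y"
    using ball_sum_diff[OF l2_translate[OF lu, of "x - y"] lu, of r y] by (simp add: ball_sum_def algebra_simps)
  also have "\<bar>...\<bar> \<le> sqrt (measure lborel (cball (0::'a) r)) * sqrt (l2sq (\<lambda>z. u (z + (x - y)) - u z))"
    by (intro ball_sum_bound l2_diff l2_translate lu)
  also have "... \<le> sqrt (measure lborel (cball (0::'a) r)) * sqrt ((norm (x - y))\<^sup>2 * l2sq G)"
    by (intro mult_left_mono real_sqrt_le_mono translation_estimate[OF S]) auto
  finally show ?thesis by (simp add: real_sqrt_mult)
qed

lemma ball_sum_measurable[measurable]:
  fixes f :: "'a::euclidean_space \<Rightarrow> real"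
  assumes [measurable]: "f \<in> borel_measurable borel" shows "ball_sum f r \<in> borel_measurable borel"
proof -
  have [measurable]: "cball (0::'a) r \<in> sets borel" by simp
  have "(\<lambda>(x, y). indicator (cball 0 r) y * f (x + y)) \<in> borel_measurable (lborel \<Otimes>\<^sub>M (lborel :: 'a measure))"
    unfolding lborel_prod case_prod_beta' by measurable
  from lborel.borel_measurable_lebesgue_integral[OF this] show ?thesis by (simp add: ball_sum_def[abs_def])
qed

text \<open>The squared deviation from the mean over a ball is at most the mean of squared
  increments; after exchanging integrals each increment is controlled by
  \<open>translation_estimate\<close>.\<close>

lemma ball_average_close:
  fixes u :: "'a::euclidean_space \<Rightarrow> real"
  assumes S: "sob u G" and r: "r > 0"
  defines "V \<equiv> measure lborel (cball (0::'a) r)"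
  shows "integrable lborel (\<lambda>x. (ball_sum u r x / V - u x)\<^sup>2)"
    and "(LBINT x. (ball_sum u r x / V - u x)\<^sup>2) \<le> r\<^sup>2 * l2sq G"
proof -
  note lu = sob_l2(1)[OF S]
  note [measurable] = l2_measurable[OF lu]
  let ?B = "cball (0::'a) r"
  have [measurable]: "?B \<in> sets borel" by simp
  have V: "V > 0" unfolding V_def using r by (simp add: content_cball)
  have eV: "emeasure lborel ?B = ennreal V"
    unfolding V_def using emeasure_lborel_cball_finite[of "0::'a" r] by (simp add: emeasure_eq_ennreal_measure)
  have pt: "ennreal ((ball_sum u r x / V - u x)\<^sup>2) \<le> ennreal (1 / V) * (\<integral>\<^sup>+y. indicator ?B y * ennreal ((u (x + y) - u x)\<^sup>2) \<partial>lborel)" for x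
  proof -
    define f where "f y = indicator ?B y * (u (x + y) - u x)" for y
    have [measurable]: "f \<in> borel_measurable borel" unfolding f_def[abs_def] by measurable
    have lf: "l2 f"
    proof -
      have "l2 (\<lambda>y. indicator ?B y * u (y + x) + - u x * indicator ?B y)"
      proof (rule l2_add)
        show "l2 (\<lambda>y. indicator ?B y * u (y + x))"
          unfolding l2_def using integrable_mult_indicator[OF _ l2_square_integrable[OF l2_translate[OF lu, of x]], of ?B]
          by (auto elim!: Bochner_Integration.integrable_bound intro!: AE_I2 simp: indicator_def)
        show "l2 (\<lambda>y. - u x * indicator ?B y)" by (intro l2_cmult indicator_cball_l2)
      qed
      moreover have "(\<lambda>y. indicator ?B y * u (y + x) + - u x * indicator ?B y) = f" by (auto simp: f_def fun_eq_iff algebra_simps)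
      ultimately show ?thesis by simp
    qed
    have iB: "integrable lborel (\<lambda>y. indicator ?B y * f y)" using l2_real_mult_integrable[OF indicator_cball_l2 lf] .
    have if': "indicator ?B y * f y = f y" for y by (simp add: f_def indicator_def)
    have "(LBINT y. f y) = ball_sum u r x - V * u x"
    proof -
      have "f = (\<lambda>y. indicator ?B y * u (x + y) - u x * indicator ?B y)" by (auto simp: f_def fun_eq_iff algebra_simps)
      then show ?thesis using ball_sum_integrable[OF lu, of r x] integrable_indicator_cball[of r, where 'a='a] by (simp add: ball_sum_def V_def)
    qed
    moreover have "(LBINT y. f y)\<^sup>2 \<le> V * l2sq f"
    proof -
      have "\<bar>LBINT y. f y\<bar> \<le> sqrt V * sqrt (l2sq f)"
        using l2_inner_bound[OF indicator_cball_l2 lf, of r] by (simp add: if' l2sq_indicator_cball V_def)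
      from power_mono[OF this, where n=2] show ?thesis using V by (simp add: power_mult_distrib)
    qed
    ultimately have "(V * (ball_sum u r x / V - u x))\<^sup>2 \<le> V * l2sq f" using V by (simp add: right_diff_distrib)
    then have "V * (V * (ball_sum u r x / V - u x)\<^sup>2) \<le> V * l2sq f" by (simp add: power_mult_distrib power2_eq_square mult_ac)
    then have "(ball_sum u r x / V - u x)\<^sup>2 \<le> 1 / V * l2sq f" using V by (simp add: pos_le_divide_eq mult.commute)
    then have "ennreal ((ball_sum u r x / V - u x)\<^sup>2) \<le> ennreal (1 / V) * ennreal (l2sq f)"
      using V by (simp add: ennreal_mult[symmetric] ennreal_leI)
    also have "ennreal (l2sq f) = (\<integral>\<^sup>+y. indicator ?B y * ennreal ((u (x + y) - u x)\<^sup>2) \<partial>lborel)"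
      unfolding ennreal_l2sq[OF lf] by (intro nn_integral_cong) (auto simp: f_def indicator_def)
    finally show ?thesis .
  qed
  have m2: "(\<lambda>(y, x). indicator ?B y * ennreal ((u (x + y) - u x)\<^sup>2)) \<in> borel_measurable (lborel \<Otimes>\<^sub>M lborel)"
  proof -
    have ms: "(\<lambda>p. indicator ?B (fst p) :: ennreal) \<in> borel_measurable (lborel \<Otimes>\<^sub>M (lborel :: 'a measure))" by measurable
    show ?thesis using borel_measurable_times_ennreal[OF ms meas_osc_pair[of u]] by (simp add: case_prod_beta')
  qed
  have m3: "(\<lambda>x. \<integral>\<^sup>+y. indicator ?B y * ennreal ((u (x + y) - u x)\<^sup>2) \<partial>lborel) \<in> borel_measurable lborel"
    using lborel.borel_measurable_nn_integral[OF m2[THEN measurable_pair_swap]] by simp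
  have "(\<integral>\<^sup>+x. ennreal ((ball_sum u r x / V - u x)\<^sup>2) \<partial>lborel) \<le>
      (\<integral>\<^sup>+x. ennreal (1 / V) * (\<integral>\<^sup>+y. indicator ?B y * ennreal ((u (x + y) - u x)\<^sup>2) \<partial>lborel) \<partial>lborel)"
    by (intro nn_integral_mono pt)
  also have "... = ennreal (1 / V) * (\<integral>\<^sup>+x. \<integral>\<^sup>+y. indicator ?B y * ennreal ((u (x + y) - u x)\<^sup>2) \<partial>lborel \<partial>lborel)"
    by (rule nn_integral_cmult[OF m3])
  also have "(\<integral>\<^sup>+x. \<integral>\<^sup>+y. indicator ?B y * ennreal ((u (x + y) - u x)\<^sup>2) \<partial>lborel \<partial>lborel) =
      (\<integral>\<^sup>+y. indicator ?B y * osc u y \<partial>lborel)" using lborel_pair.Fubini'[OF m2] unfolding osc_def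
    by (simp add: nn_integral_cmult[symmetric])
  also have "... \<le> (\<integral>\<^sup>+y. ennreal (r\<^sup>2 * l2sq G) * indicator ?B y \<partial>lborel)"
  proof (rule nn_integral_mono)
    fix y :: 'a
    have "osc u y \<le> ennreal (r\<^sup>2 * l2sq G)" if "norm y \<le> r"
    proof -
      have "l2sq (\<lambda>x. u (x + y) - u x) \<le> r\<^sup>2 * l2sq G"
        using translation_estimate[OF S, of y] mult_right_mono[OF power_mono[OF that, of 2], of "l2sq G"] by simp
      then show ?thesis by (simp add: osc_l2[OF lu] ennreal_leI)
    qed
    then show "indicator ?B y * osc u y \<le> ennreal (r\<^sup>2 * l2sq G) * indicator ?B y" by (auto simp: indicator_def)
  qed
  also have "... = ennreal (r\<^sup>2 * l2sq G) * ennreal V" by (simp add: nn_integral_cmult eV)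
  finally have le: "(\<integral>\<^sup>+x. ennreal ((ball_sum u r x / V - u x)\<^sup>2) \<partial>lborel) \<le> ennreal (r\<^sup>2 * l2sq G)"
    using V by (simp add: mult_left_mono ennreal_mult[symmetric])
  then show i: "integrable lborel (\<lambda>x. (ball_sum u r x / V - u x)\<^sup>2)" by (auto simp: integrable_iff_bounded intro: le_less_trans)
  show "(LBINT x. (ball_sum u r x / V - u x)\<^sup>2) \<le> r\<^sup>2 * l2sq G"
    using le by (subst (asm) nn_integral_eq_integral[OF i]) (auto simp: ennreal_le_iff)
qed

text \<open>A product of compact intervals over a countable index set is compact and metrizable,
  hence sequentially compact. This replaces a diagonal argument.\<close>

lemma bounded_family_subsequence:
  fixes f :: "nat \<Rightarrow> 'i::countable \<Rightarrow> real"
  assumes "\<And>n i. \<bar>f n i\<bar> \<le> c i"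
  obtains s l where "strict_mono s" "\<And>i. (\<lambda>n. f (s n) i) \<longlonglongrightarrow> l i"
proof -
  have "compactin (product_topology (\<lambda>i. euclidean) UNIV) (PiE UNIV (\<lambda>i. cball (0::real) (c i)))" by (subst compactin_PiE) auto
  then have "compact (PiE UNIV (\<lambda>i. cball (0::real) (c i)) :: ('i \<Rightarrow> real) set)" by (simp add: euclidean_product_topology)
  then have "seq_compact (PiE UNIV (\<lambda>i. cball (0::real) (c i)) :: ('i \<Rightarrow> real) set)" by (simp add: compact_eq_seq_compact_metric)
  moreover have "\<forall>n. f n \<in> PiE UNIV (\<lambda>i. cball (0::real) (c i))" using assms by (auto simp: dist_real_def)
  ultimately obtain l s where s: "strict_mono s" "(f \<circ> s) \<longlonglongrightarrow> l" by (rule seq_compactE) blast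
  have "(\<lambda>n. f (s n) i) \<longlonglongrightarrow> l i" for i
  proof -
    have "continuous_on UNIV (\<lambda>g::'i \<Rightarrow> real. g i)" by (rule continuous_on_product_then_coordinatewise) (rule continuous_on_id)
    then have "isCont (\<lambda>g::'i \<Rightarrow> real. g i) l" unfolding continuous_on_eq_continuous_at[OF open_UNIV] by blast
    from isCont_tendsto_compose[OF this s(2)] show ?thesis by (simp add: comp_def)
  qed
  then show ?thesis using that s(1) by blast
qed

text \<open>Ball averages at countably many centres and radii converge along one subsequence. For
  fixed radius they are equi-Lipschitz, so they converge at every centre, and boundedly; averages at
  a small radius are uniformly close to the functions in L^2. The Cauchy form needs no limit
  function.\<close>

theorem Rellich:
  fixes u :: "nat \<Rightarrow> 'a::euclidean_space \<Rightarrow> real"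
  assumes S: "\<And>n. sob (u n) (G n)" and M: "\<And>n. l2sq (u n) \<le> M" "\<And>n. l2sq (G n) \<le> M"
  shows "\<exists>s :: nat \<Rightarrow> nat. strict_mono s \<and>
    (\<forall>R. \<forall>e>0. \<exists>N. \<forall>m\<ge>N. \<forall>n\<ge>N. loc_sq R (\<lambda>x. u (s m) x - u (s n) x) < e)"
proof -
  have lu: "l2 (u n)" for n by (rule sob_l2(1)[OF S])
  have [measurable]: "u n \<in> borel_measurable borel" for n by (rule l2_measurable[OF lu])
  have M0: "M \<ge> 0" using M(1)[of 0] l2sq_nonneg[of "u 0"] by linarith
  obtain D :: "'a set" where D: "countable D" "\<And>X. open X \<Longrightarrow> X \<noteq> {} \<Longrightarrow> \<exists>d\<in>D. d \<in> X"
    using countable_dense_setE by blast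
  have "D \<noteq> {}" using D(2)[of UNIV] by auto
  define V where "V i = measure lborel (cball (0::'a) (step i))" for i
  have V: "V i > 0" for i unfolding V_def by (simp add: content_cball less_imp_le)
  have V0: "V i \<ge> 0" for i using V[of i] by simp
  define f where "f n = (\<lambda>(i, j). ball_sum (u n) (step i) (from_nat_into D j))" for n
  have fb: "\<bar>f n p\<bar> \<le> sqrt (V (fst p)) * sqrt M" for n p
  proof -
    have "\<bar>f n p\<bar> \<le> sqrt (V (fst p)) * sqrt (l2sq (u n))" unfolding f_def V_def case_prod_beta' by (rule ball_sum_bound[OF lu])
    also have "... \<le> sqrt (V (fst p)) * sqrt M" using M V0 by (intro mult_left_mono) auto
    finally show ?thesis .
  qed
  obtain s l where s: "strict_mono s" and l: "\<And>p. (\<lambda>n. f (s n) p) \<longlonglongrightarrow> l p"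
    using bounded_family_subsequence[of f "\<lambda>p. sqrt (V (fst p)) * sqrt M", OF fb] by metis
  have cau: "Cauchy (\<lambda>n. ball_sum (u (s n)) (step i) x)" for i x
  proof (rule metric_CauchyI)
    fix e :: real assume e: "e > 0"
    \<comment> \<open>A common Lipschitz constant of the averages; the summand 1 keeps it positive
      when M = 0.\<close>
    define L where "L = sqrt (V i) * sqrt M + 1"
    have L: "L > 0" using V0 M0 by (simp add: L_def add_nonneg_pos)
    have "e / (3 * L) > 0" using e L by simp
    then have "ball x (e / (3 * L)) \<noteq> {}" by simp
    from D(2)[OF open_ball this] obtain d where d: "d \<in> D" "norm (x - d) < e / (3 * L)" by (auto simp: dist_norm)
    obtain j where j: "d = from_nat_into D j" using from_nat_into_surj[OF D(1) d(1)] by metis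
    have "(\<lambda>n. ball_sum (u (s n)) (step i) d) \<longlonglongrightarrow> l (i, j)" using l[of "(i, j)"] by (simp add: f_def j)
    then have "Cauchy (\<lambda>n. ball_sum (u (s n)) (step i) d)" by (rule LIMSEQ_imp_Cauchy)
    from metric_CauchyD[OF this, of "e / 3"] e obtain N where
      N: "\<And>m n. m \<ge> N \<Longrightarrow> n \<ge> N \<Longrightarrow> dist (ball_sum (u (s m)) (step i) d) (ball_sum (u (s n)) (step i) d) < e / 3"
      by auto
    have Lip: "\<bar>ball_sum (u n) (step i) x - ball_sum (u n) (step i) d\<bar> < e / 3" for n
    proof -
      have "\<bar>ball_sum (u n) (step i) x - ball_sum (u n) (step i) d\<bar> \<le> sqrt (V i) * (norm (x - d) * sqrt (l2sq (G n)))"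
        unfolding V_def by (rule ball_sum_Lipschitz[OF S])
      also have "... \<le> sqrt (V i) * (norm (x - d) * sqrt M)" using M(2) V0 by (intro mult_left_mono) auto
      also have "... \<le> L * norm (x - d)" by (simp add: L_def algebra_simps)
      also have "... < L * (e / (3 * L))" using d(2) L by (intro mult_strict_left_mono)
      also have "... = e / 3" using L by simp
      finally show ?thesis .
    qed
    have "dist (ball_sum (u (s m)) (step i) x) (ball_sum (u (s n)) (step i) x) < e" if "m \<ge> N" "n \<ge> N" for m n
      using N[OF that] Lip[of "s m"] Lip[of "s n"] unfolding dist_real_def by linarith
    then show "\<exists>N. \<forall>m\<ge>N. \<forall>n\<ge>N. dist (ball_sum (u (s m)) (step i) x) (ball_sum (u (s n)) (step i) x) < e" by blast
  qed
  show ?thesis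
  proof (intro exI[of _ s] conjI allI impI)
    show "strict_mono s" by (rule s)
    fix R e :: real assume e: "e > 0"
    have [measurable]: "cball (0::'a) R \<in> sets borel" by simp
    \<comment> \<open>Half of e is reserved for the two averaging errors, each with factor 3. The
      other half goes to two limit errors with factor 6, each below e/24.\<close>
    have "(\<lambda>i. 6 * (step i)\<^sup>2 * M) \<longlonglongrightarrow> 6 * 0\<^sup>2 * M" by (intro tendsto_intros step_tendsto)
    from order_tendstoD(2)[OF this[simplified], of "e / 2"] e
    obtain i where i: "6 * (step i)\<^sup>2 * M < e / 2" by (auto simp: eventually_sequentially)
    define \<beta> where "\<beta> n x = ball_sum (u (s n)) (step i) x / V i" for n x
    have [measurable]: "\<beta> n \<in> borel_measurable borel" for n unfolding \<beta>_def[abs_def] by measurable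
    define \<gamma> where "\<gamma> x = lim (\<lambda>n. \<beta> n x)" for x
    have \<beta>lim: "(\<lambda>n. \<beta> n x) \<longlonglongrightarrow> \<gamma> x" for x
    proof -
      obtain b where "(\<lambda>n. ball_sum (u (s n)) (step i) x) \<longlonglongrightarrow> b" using cau Cauchy_convergent convergent_def by blast
      from tendsto_divide[OF this tendsto_const, of "V i"] V[of i]
      have "convergent (\<lambda>n. \<beta> n x)" unfolding \<beta>_def convergent_def by auto
      then show ?thesis by (simp add: \<gamma>_def convergent_LIMSEQ_iff)
    qed
    have [measurable]: "\<gamma> \<in> borel_measurable borel" unfolding \<gamma>_def[abs_def] by (rule borel_measurable_lim_metric) simp
    define B where "B = sqrt (V i) * sqrt M / V i"
    have \<beta>B: "\<bar>\<beta> n x\<bar> \<le> B" for n x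
    proof -
      have "\<bar>ball_sum (u (s n)) (step i) x\<bar> \<le> sqrt (V i) * sqrt (l2sq (u (s n)))" unfolding V_def by (rule ball_sum_bound[OF lu])
      also have "... \<le> sqrt (V i) * sqrt M" using M(1) V0 by (intro mult_left_mono) auto
      finally show ?thesis unfolding \<beta>_def B_def using V[of i] by (simp add: divide_right_mono)
    qed
    have \<gamma>B: "\<bar>\<gamma> x\<bar> \<le> B" for x by (rule LIMSEQ_le_const2[OF tendsto_rabs[OF \<beta>lim]]) (use \<beta>B in auto)
    have int: "integrable lborel (\<lambda>x. indicator (cball 0 R) x * (g x)\<^sup>2)"
      if [measurable]: "g \<in> borel_measurable borel" and g: "\<And>x. \<bar>g x\<bar> \<le> C" for g :: "'a \<Rightarrow> real" and C
    proof (rule Bochner_Integration.integrable_bound[OF integrable_mult_right[OF integrable_indicator_cball[of R], of "C\<^sup>2"]])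
      have "(g x)\<^sup>2 \<le> C\<^sup>2" for x using power_mono[OF g[of x], of 2] by simp
      then show "AE x in lborel. norm (indicator (cball 0 R) x * (g x)\<^sup>2) \<le> norm (C\<^sup>2 * indicator (cball 0 R) x)"
        by (intro AE_I2) (auto simp: indicator_def)
    qed measurable
    have bd2: "\<bar>\<beta> n x - \<gamma> x\<bar> \<le> 2 * B" for n x using \<beta>B[of n x] \<gamma>B[of x] by linarith
    have "(\<lambda>n. LBINT x. indicator (cball 0 R) x * (\<beta> n x - \<gamma> x)\<^sup>2) \<longlonglongrightarrow> (LINT x|(lborel::'a measure). (0::real))"
    proof (rule integral_dominated_convergence[where w="\<lambda>x. (2 * B)\<^sup>2 * indicator (cball 0 R) x"])
      show "AE x in lborel. (\<lambda>n. indicator (cball 0 R) x * (\<beta> n x - \<gamma> x)\<^sup>2) \<longlonglongrightarrow> 0"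
      proof (rule AE_I2)
        fix x
        have "(\<lambda>n. indicator (cball 0 R) x * (\<beta> n x - \<gamma> x)\<^sup>2) \<longlonglongrightarrow> indicator (cball 0 R) x * (\<gamma> x - \<gamma> x)\<^sup>2"
          by (intro tendsto_intros \<beta>lim)
        then show "(\<lambda>n. indicator (cball 0 R) x * (\<beta> n x - \<gamma> x)\<^sup>2) \<longlonglongrightarrow> 0" by simp
      qed
      show "AE x in lborel. norm (indicator (cball 0 R) x * (\<beta> n x - \<gamma> x)\<^sup>2) \<le> (2 * B)\<^sup>2 * indicator (cball 0 R) x" for n
      proof (rule AE_I2)
        fix x
        have "(\<beta> n x - \<gamma> x)\<^sup>2 \<le> (2 * B)\<^sup>2" using power_mono[OF bd2[of n x], of 2] by simp
        then show "norm (indicator (cball 0 R) x * (\<beta> n x - \<gamma> x)\<^sup>2) \<le> (2 * B)\<^sup>2 * indicator (cball 0 R) x"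
          by (auto simp: indicator_def)
      qed
      show "integrable lborel (\<lambda>x. (2 * B)\<^sup>2 * indicator (cball (0::'a) R) x)"
        by (intro integrable_mult_right integrable_indicator_cball)
    qed measurable
    from order_tendstoD(2)[OF this[simplified], of "e / 24"] e
    obtain N where N: "\<And>n. n \<ge> N \<Longrightarrow> (LBINT x. indicator (cball 0 R) x * (\<beta> n x - \<gamma> x)\<^sup>2) < e / 24"
      by (auto simp: eventually_sequentially)
    have "loc_sq R (\<lambda>x. u (s m) x - u (s n) x) < e" if mn: "m \<ge> N" "n \<ge> N" for m n
    proof -
      define a where "a n x = (\<beta> n x - u (s n) x)\<^sup>2" for n x
      define b where "b n x = indicator (cball 0 R) x * (\<beta> n x - \<gamma> x)\<^sup>2" for n x
      have ia: "integrable lborel (a n)" "(LBINT x. a n x) \<le> (step i)\<^sup>2 * M" for n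
      proof -
        show "integrable lborel (a n)" unfolding a_def[abs_def] \<beta>_def V_def by (rule ball_average_close(1)[OF S step_pos])
        have "(LBINT x. a n x) \<le> (step i)\<^sup>2 * l2sq (G (s n))"
          unfolding a_def \<beta>_def V_def by (rule ball_average_close(2)[OF S step_pos])
        also have "... \<le> (step i)\<^sup>2 * M" by (intro mult_left_mono M) auto
        finally show "(LBINT x. a n x) \<le> (step i)\<^sup>2 * M" .
      qed
      have ib: "integrable lborel (b n)" for n unfolding b_def[abs_def] by (rule int[OF _ bd2]) measurable
      have "loc_sq R (\<lambda>x. u (s m) x - u (s n) x) \<le> (LBINT x. 3 * a m x + 3 * a n x + 6 * b m x + 6 * b n x)" unfolding loc_sq_def
      proof (rule integral_mono)
        show "integrable lborel (\<lambda>x. indicator (cball 0 R) x * (u (s m) x - u (s n) x)\<^sup>2)" by (intro loc_sq_integrable l2_diff lu)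
        show "integrable lborel (\<lambda>x. 3 * a m x + 3 * a n x + 6 * b m x + 6 * b n x)" using ia ib by auto
        fix x
        have sq3: "(p + q + r)\<^sup>2 \<le> 3 * p\<^sup>2 + 3 * q\<^sup>2 + 3 * r\<^sup>2" for p q r :: real
          using zero_le_power2[of "p - q"] zero_le_power2[of "q - r"] zero_le_power2[of "p - r"] by (simp add: power2_eq_square algebra_simps)
        have sq2: "(p - q)\<^sup>2 \<le> 2 * p\<^sup>2 + 2 * q\<^sup>2" for p q :: real
          using zero_le_power2[of "p + q"] by (simp add: power2_eq_square algebra_simps)
        have "(u (s m) x - u (s n) x)\<^sup>2 = ((u (s m) x - \<beta> m x) + (\<beta> n x - u (s n) x) + (\<beta> m x - \<beta> n x))\<^sup>2" by simp
        also have "... \<le> 3 * (u (s m) x - \<beta> m x)\<^sup>2 + 3 * (\<beta> n x - u (s n) x)\<^sup>2 + 3 * (\<beta> m x - \<beta> n x)\<^sup>2" by (rule sq3)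
        also have "... = 3 * a m x + 3 * a n x + 3 * (\<beta> m x - \<beta> n x)\<^sup>2" by (simp add: a_def power2_commute)
        finally have 1: "(u (s m) x - u (s n) x)\<^sup>2 \<le> 3 * a m x + 3 * a n x + 3 * (\<beta> m x - \<beta> n x)\<^sup>2" .
        have 2: "(\<beta> m x - \<beta> n x)\<^sup>2 \<le> 2 * (\<beta> m x - \<gamma> x)\<^sup>2 + 2 * (\<beta> n x - \<gamma> x)\<^sup>2"
          using sq2[of "\<beta> m x - \<gamma> x" "\<beta> n x - \<gamma> x"] by simp
        have "0 \<le> a k x" "0 \<le> b k x" for k by (auto simp: a_def b_def)
        then show "indicator (cball 0 R) x * (u (s m) x - u (s n) x)\<^sup>2 \<le> 3 * a m x + 3 * a n x + 6 * b m x + 6 * b n x"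
          using 1 2 by (cases "x \<in> cball 0 R") (auto simp: b_def)
      qed
      also have "... = 3 * (LBINT x. a m x) + 3 * (LBINT x. a n x) + 6 * (LBINT x. b m x) + 6 * (LBINT x. b n x)" using ia ib by simp
      also have "... < e" using ia(2)[of m] ia(2)[of n] N[OF mn(1)] N[OF mn(2)] i unfolding b_def[symmetric] by linarith
      finally show ?thesis .
    qed
    then show "\<exists>N. \<forall>m\<ge>N. \<forall>n\<ge>N. loc_sq R (\<lambda>x. u (s m) x - u (s n) x) < e" by blast
  qed
qed

section \<open>The energy functional\<close>

lemma sob_add: "sob u G \<Longrightarrow> sob v H \<Longrightarrow> sob (\<lambda>x. u x + v x) (\<lambda>x. G x + H x)"
  for u v :: "'a::euclidean_space \<Rightarrow> real" unfolding sob_def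
  by (auto simp: l2_add distrib_right inner_add_left integrable_l2_bump pdiff_bumps l2_inner)

lemma sob_scale: "sob u G \<Longrightarrow> sob (\<lambda>x. c * u x) (\<lambda>x. c *\<^sub>R G x)"
  for u :: "'a::euclidean_space \<Rightarrow> real" unfolding sob_def by (auto simp: l2_cmult l2_scale mult.assoc)

lemma sob_minus: "sob u G \<Longrightarrow> sob (\<lambda>x. - u x) (\<lambda>x. - G x)"
  for u :: "'a::euclidean_space \<Rightarrow> real" using sob_scale[of u G "-1"] by simp

lemma sob_diff: "sob u G \<Longrightarrow> sob v H \<Longrightarrow> sob (\<lambda>x. u x - v x) (\<lambda>x. G x - H x)"
  for u v :: "'a::euclidean_space \<Rightarrow> real" using sob_add[OF _ sob_minus, of u G v H] by simp

definition power_nl :: "real \<Rightarrow> real \<Rightarrow> real" where "power_nl p a = \<bar>a\<bar> powr (p - 2) * a"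

lemma power_nl_mult_self: "power_nl p a * a = \<bar>a\<bar> powr p"
proof -
  have "\<bar>a\<bar> powr 2 = a * a" by (cases "a = 0") (auto simp: powr_numeral power2_eq_square)
  moreover have "\<bar>a\<bar> powr (p - 2) * \<bar>a\<bar> powr 2 = \<bar>a\<bar> powr p" by (subst powr_add[symmetric]) simp
  ultimately show ?thesis by (simp add: power_nl_def)
qed

lemma DERIV_power_nl:
  assumes "p > 2" shows "DERIV (power_nl p) a :> (p - 1) * \<bar>a\<bar> powr (p - 2)"
proof (cases "a = 0")
  case False
  have "(abs has_real_derivative sgn a) (at a)"
    using GDERIV_norm[OF False] by (simp add: gderiv_def has_field_derivative_def real_norm_def[abs_def] mult.commute)
  from DERIV_mult[OF DERIV_fun_powr[OF this, of "p - 2"] DERIV_ident, folded power_nl_def] False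
  have "DERIV (power_nl p) a :> (p - 2) * \<bar>a\<bar> powr (p - 2 - of_nat 1) * sgn a * a + 1 * \<bar>a\<bar> powr (p - 2)" by simp
  moreover have "\<bar>a\<bar> powr (p - 2 - of_nat 1) * (sgn a * a) = \<bar>a\<bar> powr (p - 2)"
    using False powr_add[of "\<bar>a\<bar>" "p - 2 - 1" 1] by (simp add: sgn_if)
  ultimately show ?thesis by (simp add: mult.assoc left_diff_distrib)
next
  case True
  have "((\<lambda>h. (power_nl p (0 + h) - power_nl p 0) / h) \<longlongrightarrow> 0) (at 0)"
  proof (rule Lim_null_comparison)
    show "\<forall>\<^sub>F h in at 0. norm ((power_nl p (0 + h) - power_nl p 0) / h) \<le> \<bar>h\<bar> powr (p - 2)"
      unfolding eventually_at_filter by (rule always_eventually) (simp add: power_nl_def abs_mult)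
    have "((\<lambda>h::real. \<bar>h\<bar> powr (p - 2)) \<longlongrightarrow> \<bar>0\<bar> powr (p - 2)) (at 0)"
      using assms by (intro tendsto_powr2 tendsto_intros) auto
    then show "((\<lambda>h::real. \<bar>h\<bar> powr (p - 2)) \<longlongrightarrow> 0) (at 0)" by simp
  qed
  then show ?thesis using True assms by (simp add: DERIV_def)
qed

lemma DERIV_abs_powr:
  assumes "p > 2" shows "DERIV (\<lambda>a. \<bar>a\<bar> powr p / p) a :> power_nl p a"
  using DERIV_cdivide[OF DERIV_mult[OF DERIV_power_nl[OF assms] DERIV_ident], of p a] assms
  by (simp add: power_nl_mult_self) (simp add: power_nl_def field_simps)

lemma MVT_any:
  fixes f f' :: "real \<Rightarrow> real"
  assumes "\<And>x. DERIV f x :> f' x"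
  shows "\<exists>\<xi>. \<bar>\<xi> - a\<bar> \<le> \<bar>d\<bar> \<and> f (a + d) - f a = d * f' \<xi>"
proof -
  consider "d > 0" | "d < 0" | "d = 0" by linarith
  then show ?thesis
  proof cases
    case 1
    then obtain z where "a < z" "z < a + d" "f (a + d) - f a = (a + d - a) * f' z" using MVT2[of a "a + d" f f'] assms by auto
    then show ?thesis using 1 by (intro exI[of _ z]) auto
  next
    case 2
    then obtain z where "a + d < z" "z < a" "f a - f (a + d) = (a - (a + d)) * f' z" using MVT2[of "a + d" a f f'] assms by auto
    then show ?thesis using 2 by (intro exI[of _ z]) auto
  qed (auto intro: exI[of _ a])
qed

text \<open>The mean value theorem is applied twice, first to |a|^p / p and then to its derivative.
  Both intermediate points stay within |d| of a, which gives the common weight.\<close>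

lemma power_nl_expansion:
  assumes p: "p > 2"
  shows "\<bar>\<bar>a + d\<bar> powr p / p - \<bar>a\<bar> powr p / p - power_nl p a * d\<bar> \<le> (p - 1) * ((\<bar>a\<bar> + \<bar>d\<bar>) powr (p - 2) * d\<^sup>2)"
proof -
  obtain \<xi> where x: "\<bar>\<xi> - a\<bar> \<le> \<bar>d\<bar>" "\<bar>a + d\<bar> powr p / p - \<bar>a\<bar> powr p / p = d * power_nl p \<xi>"
    using MVT_any[OF DERIV_abs_powr[OF p]] by metis
  obtain \<eta> where e: "\<bar>\<eta> - a\<bar> \<le> \<bar>\<xi> - a\<bar>" "power_nl p (a + (\<xi> - a)) - power_nl p a = (\<xi> - a) * ((p - 1) * \<bar>\<eta>\<bar> powr (p - 2))"
    using MVT_any[OF DERIV_power_nl[OF p]] by metis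
  have "\<bar>a + d\<bar> powr p / p - \<bar>a\<bar> powr p / p - power_nl p a * d = d * ((\<xi> - a) * ((p - 1) * \<bar>\<eta>\<bar> powr (p - 2)))"
  proof -
    have "\<bar>a + d\<bar> powr p / p - \<bar>a\<bar> powr p / p - power_nl p a * d = d * (power_nl p \<xi> - power_nl p a)"
      unfolding x(2) by (simp add: algebra_simps)
    also have "power_nl p \<xi> - power_nl p a = (\<xi> - a) * ((p - 1) * \<bar>\<eta>\<bar> powr (p - 2))" using e(2) by simp
    finally show ?thesis .
  qed
  also have "\<bar>...\<bar> = \<bar>d\<bar> * (\<bar>\<xi> - a\<bar> * ((p - 1) * \<bar>\<eta>\<bar> powr (p - 2)))" using p by (simp add: abs_mult)
  also have "... \<le> \<bar>d\<bar> * (\<bar>d\<bar> * ((p - 1) * (\<bar>a\<bar> + \<bar>d\<bar>) powr (p - 2)))"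
    using x(1) e(1) p by (intro mult_left_mono mult_mono powr_mono2) auto
  also have "... = (p - 1) * ((\<bar>a\<bar> + \<bar>d\<bar>) powr (p - 2) * d\<^sup>2)" by (simp add: power2_eq_square mult_ac flip: abs_mult)
  finally show ?thesis .
qed

text \<open>Expanding around the midpoint in both directions cancels the first-order terms.\<close>

lemma power_midpoint:
  fixes a b :: real
  assumes p: "p > 2"
  shows "(\<bar>a\<bar> powr p / p + \<bar>b\<bar> powr p / p) / 2 - \<bar>(a + b) / 2\<bar> powr p / p \<le> (p - 1) / 4 * ((\<bar>a\<bar> + \<bar>b\<bar>) powr (p - 2) * (a - b)\<^sup>2)"
proof -
  define c d where "c = (a + b) / 2" and "d = (a - b) / 2"
  have cd: "c + d = a" "c + - d = b" by (auto simp: c_def d_def field_simps)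
  have "\<bar>c\<bar> + \<bar>d\<bar> \<le> \<bar>a\<bar> + \<bar>b\<bar>" 
    using abs_triangle_ineq[of a b] abs_triangle_ineq4[of a b] by (simp add: c_def d_def)
  then have m: "(\<bar>c\<bar> + \<bar>d\<bar>) powr (p - 2) * d\<^sup>2 \<le> (\<bar>a\<bar> + \<bar>b\<bar>) powr (p - 2) * d\<^sup>2"
    using p by (intro mult_right_mono powr_mono2) auto
  have "\<bar>a\<bar> powr p / p + \<bar>b\<bar> powr p / p - 2 * (\<bar>c\<bar> powr p / p) \<le> 2 * ((p - 1) * ((\<bar>c\<bar> + \<bar>d\<bar>) powr (p - 2) * d\<^sup>2))"
    using power_nl_expansion[OF p, of c d] power_nl_expansion[OF p, of c "- d"] unfolding cd by simp linarith
  also have "... \<le> 2 * ((p - 1) * ((\<bar>a\<bar> + \<bar>b\<bar>) powr (p - 2) * d\<^sup>2))" using m p by (intro mult_left_mono) auto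
  finally show ?thesis by (simp add: c_def d_def power_divide field_simps)
qed

lemma add_powr_le: "a \<ge> 0 \<Longrightarrow> b \<ge> 0 \<Longrightarrow> p > 0 \<Longrightarrow> (a + b) powr p \<le> 2 powr p * (a powr p + b powr p)" for a b p :: real
proof -
  assume ab: "a \<ge> 0" "b \<ge> 0" "p > 0"
  have "(a + b) powr p \<le> (2 * max a b) powr p" using ab by (intro powr_mono2) auto
  also have "... = 2 powr p * max a b powr p" using ab by (simp add: powr_mult)
  also have "... \<le> 2 powr p * (a powr p + b powr p)" by (intro mult_left_mono) (auto simp: max_def)
  finally show ?thesis .
qed

locale dim3 =
  fixes T :: "'a::euclidean_space itself" and p :: real
  assumes N3: "DIM('a) \<ge> 3" and p_def: "p = sobolev_exponent DIM('a)"
begin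

lemma p2: "p > 2" and p_conj: "(p - 2) * (DIM('a) / 2) = p"
  using sobolev_exponent_conj[OF N3] by (auto simp: p_def)

definition PP :: "('a \<Rightarrow> real) \<Rightarrow> real" where "PP u = (LBINT x. \<bar>u x\<bar> powr p)"

lemma PP_nonneg: "0 \<le> PP u" by (simp add: PP_def)

lemma PP_integrable: "sob u G \<Longrightarrow> integrable lborel (\<lambda>x. \<bar>u x\<bar> powr p)" for u :: "'a \<Rightarrow> real"
  using sobolev_integrable[OF N3, of u G] by (simp flip: p_def)

lemma PP_le: "sob u G \<Longrightarrow> PP u \<le> sobolev_const TYPE('a) * l2sq G powr (p / 2)" for u :: "'a \<Rightarrow> real"
  using sobolev_inequality[OF N3, of u G] by (simp add: PP_def flip: p_def)

text \<open>The last factor comes from Sobolev applied to the function under the weight. The first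
  is the L^{N/2} norm of the weight: 2^p splits the p-th power of a sum, and each of the two
  summands costs one Sobolev constant.\<close>

definition PK :: real where "PK = (2 powr p * (2 * sobolev_const TYPE('a))) powr (2 / DIM('a)) * sobolev_const TYPE('a) powr (2 / p)"

lemma PK_nonneg: "PK \<ge> 0" by (simp add: PK_def)

text \<open>The weight lies in L^{N/2} precisely because (p - 2) N / 2 = p. Its norm scales like a
  positive power of the Dirichlet integrals of u and v, and this smallness is what the choice of
  \<open>R0\<close> exploits.\<close>

lemma
  fixes u v w :: "'a \<Rightarrow> real"
  assumes S: "sob u G" "sob v H" "sob w K"
  shows power_form_integrable: "integrable lborel (\<lambda>x. (\<bar>u x\<bar> + \<bar>v x\<bar>) powr (p - 2) * (w x)\<^sup>2)"
    and power_form_bound: "(LBINT x. (\<bar>u x\<bar> + \<bar>v x\<bar>) powr (p - 2) * (w x)\<^sup>2) \<le>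
      PK * (l2sq G + l2sq H) powr (p / DIM('a)) * l2sq K"
proof -
  note [measurable] = l2_measurable[OF sob_l2(1)[OF S(1)]] l2_measurable[OF sob_l2(1)[OF S(2)]]
  define q where "q x = (\<bar>u x\<bar> + \<bar>v x\<bar>) powr (p - 2)" for x
  have mq[measurable]: "q \<in> borel_measurable borel" unfolding q_def[abs_def] by measurable
  have q0: "q x \<ge> 0" for x by (simp add: q_def)
  have qp: "q x powr (DIM('a) / 2) = (\<bar>u x\<bar> + \<bar>v x\<bar>) powr p" for x by (simp only: q_def powr_powr p_conj)
  have le: "(\<bar>u x\<bar> + \<bar>v x\<bar>) powr p \<le> 2 powr p * (\<bar>u x\<bar> powr p + \<bar>v x\<bar> powr p)" for x
    using p2 by (intro add_powr_le) auto
  have ib: "integrable lborel (\<lambda>x. 2 powr p * (\<bar>u x\<bar> powr p + \<bar>v x\<bar> powr p))"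
    using PP_integrable[OF S(1)] PP_integrable[OF S(2)] by auto
  have iq: "integrable lborel (\<lambda>x. q x powr (DIM('a) / 2))" unfolding qp by (rule Bochner_Integration.integrable_bound[OF ib])
      (auto intro!: AE_I2 le)
  show "integrable lborel (\<lambda>x. (\<bar>u x\<bar> + \<bar>v x\<bar>) powr (p - 2) * (w x)\<^sup>2)"
    using Holder_sobolev_integrable[OF N3 mq q0 iq S(3)] by (simp add: q_def)
  define A where "A = l2sq G + l2sq H"
  have A: "A \<ge> 0" "l2sq G \<le> A" "l2sq H \<le> A" by (auto simp: A_def)
  define C where "C = 2 powr p * (2 * sobolev_const TYPE('a))"
  have C0: "C \<ge> 0" using sobolev_const_nonneg[where 'a='a] by (simp add: C_def)
  have Q: "(LBINT x. q x powr (DIM('a) / 2)) \<le> C * A powr (p / 2)"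
  proof -
    have "(LBINT x. q x powr (DIM('a) / 2)) \<le> (LBINT x. 2 powr p * (\<bar>u x\<bar> powr p + \<bar>v x\<bar> powr p))"
      unfolding qp by (rule integral_mono[OF iq[unfolded qp] ib]) (rule le)
    also have "... = 2 powr p * (PP u + PP v)" unfolding PP_def using PP_integrable[OF S(1)] PP_integrable[OF S(2)] by simp
    also have "... \<le> 2 powr p * (sobolev_const TYPE('a) * A powr (p / 2) + sobolev_const TYPE('a) * A powr (p / 2))"
    proof (intro mult_left_mono add_mono)
      have "l2sq G powr (p / 2) \<le> A powr (p / 2)" "l2sq H powr (p / 2) \<le> A powr (p / 2)" using A p2 by (auto intro!: powr_mono2)
      then show "PP u \<le> sobolev_const TYPE('a) * A powr (p / 2)" "PP v \<le> sobolev_const TYPE('a) * A powr (p / 2)"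
        using PP_le[OF S(1)] PP_le[OF S(2)] sobolev_const_nonneg[where 'a='a] by (auto intro: order_trans mult_left_mono)
    qed auto
    finally show ?thesis by (simp add: C_def)
  qed
  have "(LBINT x. q x * (w x)\<^sup>2) \<le> (LBINT x. q x powr (DIM('a) / 2)) powr (2 / DIM('a)) *
      sobolev_const TYPE('a) powr (2 / p) * l2sq K" using Holder_sobolev[OF N3 mq q0 iq S(3)] by (simp flip: p_def)
  also have "... \<le> (C * A powr (p / 2)) powr (2 / DIM('a)) * sobolev_const TYPE('a) powr (2 / p) * l2sq K"
    using Q by (intro mult_right_mono powr_mono2) auto
  also have "(C * A powr (p / 2)) powr (2 / DIM('a)) = C powr (2 / DIM('a)) * A powr (p / DIM('a))" using C0 by (simp add: powr_mult powr_powr)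
  finally show "(LBINT x. (\<bar>u x\<bar> + \<bar>v x\<bar>) powr (p - 2) * (w x)\<^sup>2) \<le> PK * (l2sq G + l2sq H) powr (p / DIM('a)) * l2sq K"
    by (simp add: q_def PK_def C_def A_def mult_ac)
qed

end

lemma sob_zero: "sob (\<lambda>x. 0) (\<lambda>x. 0)"
  by (simp add: sob_def l2_def)

lemma l2sq_zero[simp]: "l2sq (\<lambda>x::'a::euclidean_space. 0::'b::euclidean_space) = 0"
  by (simp add: l2sq_def)

lemma l2sq_add_eq:
  fixes f g :: "'a::euclidean_space \<Rightarrow> 'b::euclidean_space"
  assumes "l2 f" "l2 g"
  shows "l2sq (\<lambda>x. f x + g x) = l2sq f + 2 * (LBINT x. f x \<bullet> g x) + l2sq g"
proof -
  have "l2sq (\<lambda>x. f x + g x) = (LBINT x. (norm (f x))\<^sup>2 + 2 * (f x \<bullet> g x) + (norm (g x))\<^sup>2)"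
    unfolding l2sq_def by (intro Bochner_Integration.integral_cong refl) (simp add: power2_norm_eq_inner inner_add_left inner_add_right inner_commute)
  also have "... = l2sq f + 2 * (LBINT x. f x \<bullet> g x) + l2sq g"
    unfolding l2sq_def using l2_square_integrable[OF assms(1)] l2_square_integrable[OF assms(2)] l2_inner_integrable[OF assms] by simp
  finally show ?thesis .
qed

lemma l2sq_parallelogram:
  fixes f g :: "'a::euclidean_space \<Rightarrow> 'b::euclidean_space"
  assumes "l2 f" "l2 g"
  shows "l2sq (\<lambda>x. (1/2) *\<^sub>R (f x + g x)) = (l2sq f + l2sq g) / 2 - l2sq (\<lambda>x. f x - g x) / 4"
proof -
  have "l2sq (\<lambda>x. f x - g x) = l2sq f - 2 * (LBINT x. f x \<bullet> g x) + l2sq g"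
    using l2sq_add_eq[OF assms(1) l2_minus[OF assms(2)]] by (simp add: l2sq_minus)
  then show ?thesis using l2sq_add_eq[OF assms] unfolding l2sq_scale by (simp add: power2_eq_square field_simps)
qed

locale schrod = dim3 T p for T :: "'a::euclidean_space itself" and p :: real +
  fixes V :: "'a \<Rightarrow> real"
  assumes mV: "V \<in> borel_measurable borel" and adV: "admissible (\<lambda>x. \<bar>V x\<bar>)"
begin

definition absV :: "('a \<Rightarrow> real) \<Rightarrow> real" where "absV u = (LBINT x. \<bar>V x\<bar> * (u x)\<^sup>2)"
definition QV :: "('a \<Rightarrow> real) \<Rightarrow> ('a \<Rightarrow> real) \<Rightarrow> real" where "QV u v = (LBINT x. V x * u x * v x)"
definition NL :: "('a \<Rightarrow> real) \<Rightarrow> ('a \<Rightarrow> real) \<Rightarrow> real" where "NL u v = (LBINT x. power_nl p (u x) * v x)"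
definition EE :: "('a \<Rightarrow> real) \<Rightarrow> ('a \<Rightarrow> 'a) \<Rightarrow> real" where "EE u G = l2sq G / 2 + QV u u / 2 - PP u / p"
definition dE :: "('a \<Rightarrow> real) \<Rightarrow> ('a \<Rightarrow> 'a) \<Rightarrow> ('a \<Rightarrow> real) \<Rightarrow> ('a \<Rightarrow> 'a) \<Rightarrow> real" where
  "dE u G v H = (LBINT x. G x \<bullet> H x) + QV u v - NL u v"

lemma absV_nonneg: "0 \<le> absV u" by (simp add: absV_def)

lemma absV_integrable: "sob u G \<Longrightarrow> integrable lborel (\<lambda>x. \<bar>V x\<bar> * (u x)\<^sup>2)"
  by (rule admissible_integrable[OF N3 adV])

lemma absV_local: "e > 0 \<Longrightarrow> \<exists>K\<ge>0. \<forall>u G. sob u G \<longrightarrow> absV u \<le> e * l2sq G + e * l2sq u + K * loc_sq K u"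
  using admissible_bound[OF N3 adV, of e] unfolding absV_def by meson

lemma absV_bound: "e > 0 \<Longrightarrow> \<exists>C>0. \<forall>u G. sob u G \<longrightarrow> absV u \<le> e * l2sq G + C * l2sq u"
proof -
  assume e: "e > 0"
  obtain K where K: "K \<ge> 0" "\<forall>u G. sob u G \<longrightarrow> absV u \<le> e * l2sq G + e * l2sq u + K * loc_sq K u"
    using absV_local[OF e] by auto
  have "absV u \<le> e * l2sq G + (e + K) * l2sq u" if S: "sob u G" for u G
  proof -
    have "absV u \<le> e * l2sq G + e * l2sq u + K * loc_sq K u" using K(2) S by simp
    then show ?thesis using mult_left_mono[OF loc_sq_le[OF sob_l2(1)[OF S], of K] K(1)] by (simp add: algebra_simps)
  qed
  then show ?thesis using e K(1) by (intro exI[of _ "e + K"]) auto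
qed

lemma
  assumes S: "sob u G" "sob v H"
  shows QV_integrable: "integrable lborel (\<lambda>x. V x * u x * v x)"
    and QV_bound: "\<bar>QV u v\<bar> \<le> sqrt (absV u) * sqrt (absV v)"
proof -
  note [measurable] = mV l2_measurable[OF sob_l2(1)[OF S(1)]] l2_measurable[OF sob_l2(1)[OF S(2)]]
  define f where "f x = sqrt \<bar>V x\<bar> * \<bar>u x\<bar>" for x
  define g where "g x = sqrt \<bar>V x\<bar> * \<bar>v x\<bar>" for x
  have fg: "(f x)\<^sup>2 = \<bar>V x\<bar> * (u x)\<^sup>2" "(g x)\<^sup>2 = \<bar>V x\<bar> * (v x)\<^sup>2" "f x * g x = \<bar>V x * u x * v x\<bar>" for x
  proof -
    show "(f x)\<^sup>2 = \<bar>V x\<bar> * (u x)\<^sup>2" "(g x)\<^sup>2 = \<bar>V x\<bar> * (v x)\<^sup>2" by (auto simp: f_def g_def power_mult_distrib)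
    have "f x * g x = (sqrt \<bar>V x\<bar> * sqrt \<bar>V x\<bar>) * (\<bar>u x\<bar> * \<bar>v x\<bar>)" by (simp only: f_def g_def mult_ac)
    then show "f x * g x = \<bar>V x * u x * v x\<bar>" by (simp add: abs_mult)
  qed
  have m[measurable]: "f \<in> borel_measurable borel" "g \<in> borel_measurable borel" unfolding f_def[abs_def] g_def[abs_def] by auto
  have i: "integrable lborel (\<lambda>x. (f x)\<^sup>2)" "integrable lborel (\<lambda>x. (g x)\<^sup>2)"
    unfolding fg by (rule absV_integrable[OF S(1)], rule absV_integrable[OF S(2)])
  have ifg: "integrable lborel (\<lambda>x. f x * g x)" by (rule integrable_mult_square) (use i in auto)
  then show iV: "integrable lborel (\<lambda>x. V x * u x * v x)" unfolding fg by (subst (asm) integrable_abs_iff) auto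
  have "\<bar>QV u v\<bar> \<le> (LBINT x. f x * g x)" unfolding QV_def fg(3) by (rule integral_abs_bound)
  also have "... \<le> sqrt ((LBINT x. (f x)\<^sup>2) * (LBINT x. (g x)\<^sup>2))" by (intro real_le_rsqrt Cauchy_Schwarz_integral) (use i in auto)
  finally show "\<bar>QV u v\<bar> \<le> sqrt (absV u) * sqrt (absV v)" by (simp add: fg absV_def real_sqrt_mult)
qed

lemma QV_self_le: "sob u G \<Longrightarrow> \<bar>QV u u\<bar> \<le> absV u"
  using QV_bound[of u G u G] absV_nonneg[of u] by simp

lemma absV_add_le: "sob u G \<Longrightarrow> sob v H \<Longrightarrow> absV (\<lambda>x. u x + v x) \<le> 2 * absV u + 2 * absV v"
proof -
  assume S: "sob u G" "sob v H"
  have "absV (\<lambda>x. u x + v x) \<le> (LBINT x. 2 * (\<bar>V x\<bar> * (u x)\<^sup>2) + 2 * (\<bar>V x\<bar> * (v x)\<^sup>2))"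
    unfolding absV_def
  proof (rule integral_mono)
    show "integrable lborel (\<lambda>x. \<bar>V x\<bar> * (u x + v x)\<^sup>2)" using absV_integrable[OF sob_add[OF S]] .
    show "integrable lborel (\<lambda>x. 2 * (\<bar>V x\<bar> * (u x)\<^sup>2) + 2 * (\<bar>V x\<bar> * (v x)\<^sup>2))"
      using absV_integrable[OF S(1)] absV_integrable[OF S(2)] by auto
    fix x
    have "(u x + v x)\<^sup>2 \<le> 2 * (u x)\<^sup>2 + 2 * (v x)\<^sup>2"
      using zero_le_power2[of "u x - v x"] by (simp add: power2_eq_square algebra_simps)
    from mult_left_mono[OF this, of "\<bar>V x\<bar>"]
    show "\<bar>V x\<bar> * (u x + v x)\<^sup>2 \<le> 2 * (\<bar>V x\<bar> * (u x)\<^sup>2) + 2 * (\<bar>V x\<bar> * (v x)\<^sup>2)"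
      by (simp add: algebra_simps)
  qed
  then show ?thesis using absV_integrable[OF S(1)] absV_integrable[OF S(2)] by (simp add: absV_def)
qed

lemma QV_add_right: "sob u G \<Longrightarrow> sob v H \<Longrightarrow> sob w K \<Longrightarrow> QV u (\<lambda>x. v x + w x) = QV u v + QV u w"
  unfolding QV_def using QV_integrable[of u G v H] QV_integrable[of u G w K] by (simp add: distrib_left)

lemma QV_commute: "QV u v = QV v u"
  unfolding QV_def by (simp add: mult_ac)

lemma QV_scale: "QV u (\<lambda>x. c * v x) = c * QV u v"
  unfolding QV_def by (simp flip: integral_mult_right_zero add: mult_ac)

lemma QV_square_add: "sob u G \<Longrightarrow> sob v H \<Longrightarrow> QV (\<lambda>x. u x + v x) (\<lambda>x. u x + v x) = QV u u + 2 * QV u v + QV v v"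
proof -
  assume S: "sob u G" "sob v H"
  show ?thesis using QV_add_right[OF sob_add[OF S] S] QV_add_right[OF S(1) S] QV_add_right[OF S(2) S]
      QV_commute[of "\<lambda>x. u x + v x" u] QV_commute[of "\<lambda>x. u x + v x" v] QV_commute[of v u] by simp
qed

lemma power_single_integrable: "sob u G \<Longrightarrow> sob v H \<Longrightarrow> integrable lborel (\<lambda>x. \<bar>u x\<bar> powr (p - 2) * (v x)\<^sup>2)"
  for u v :: "'a \<Rightarrow> real" using power_form_integrable[OF _ sob_zero, of u G v H] by simp

lemma
  fixes u v :: "'a \<Rightarrow> real"
  assumes S: "sob u G" "sob v H"
  shows NL_integrable: "integrable lborel (\<lambda>x. power_nl p (u x) * v x)"
    and NL_bound: "\<bar>NL u v\<bar> \<le> sqrt (PP u) * sqrt (PK * l2sq G powr (p / DIM('a)) * l2sq H)"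
proof -
  note [measurable] = l2_measurable[OF sob_l2(1)[OF S(1)]] l2_measurable[OF sob_l2(1)[OF S(2)]]
  define f where "f x = \<bar>u x\<bar> powr ((p - 2) / 2) * \<bar>u x\<bar>" for x
  define g where "g x = \<bar>u x\<bar> powr ((p - 2) / 2) * \<bar>v x\<bar>" for x
  have h: "(\<bar>a\<bar> powr ((p - 2) / 2))\<^sup>2 = \<bar>a\<bar> powr (p - 2)" for a by (simp add: power2_eq_square flip: powr_add)
  have up: "\<bar>a\<bar> powr (p - 2) * a\<^sup>2 = \<bar>a\<bar> powr p" for a
    using powr_add[of "\<bar>a\<bar>" "p - 2" 2] by (simp add: powr_numeral)
  have fg: "(f x)\<^sup>2 = \<bar>u x\<bar> powr p" "(g x)\<^sup>2 = \<bar>u x\<bar> powr (p - 2) * (v x)\<^sup>2" "f x * g x = \<bar>power_nl p (u x) * v x\<bar>" for x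
  proof -
    show "(f x)\<^sup>2 = \<bar>u x\<bar> powr p" unfolding f_def power_mult_distrib h by (simp add: up)
    show "(g x)\<^sup>2 = \<bar>u x\<bar> powr (p - 2) * (v x)\<^sup>2" unfolding g_def power_mult_distrib h by simp
    have "f x * g x = (\<bar>u x\<bar> powr ((p - 2) / 2))\<^sup>2 * (\<bar>u x\<bar> * \<bar>v x\<bar>)" by (simp only: f_def g_def mult_ac power2_eq_square)
    then show "f x * g x = \<bar>power_nl p (u x) * v x\<bar>" unfolding h by (simp add: power_nl_def abs_mult)
  qed
  have m[measurable]: "f \<in> borel_measurable borel" "g \<in> borel_measurable borel" unfolding f_def[abs_def] g_def[abs_def] by auto
  have i: "integrable lborel (\<lambda>x. (f x)\<^sup>2)" "integrable lborel (\<lambda>x. (g x)\<^sup>2)"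
    unfolding fg by (rule PP_integrable[OF S(1)], rule power_single_integrable[OF S])
  have ifg: "integrable lborel (\<lambda>x. f x * g x)" by (rule integrable_mult_square) (use i in auto)
  then show "integrable lborel (\<lambda>x. power_nl p (u x) * v x)" unfolding fg by (subst (asm) integrable_abs_iff) (auto simp: power_nl_def)
  have "\<bar>NL u v\<bar> \<le> (LBINT x. f x * g x)" unfolding NL_def fg(3) by (rule integral_abs_bound)
  also have "... \<le> sqrt ((LBINT x. (f x)\<^sup>2) * (LBINT x. (g x)\<^sup>2))" by (intro real_le_rsqrt Cauchy_Schwarz_integral) (use i in auto)
  also have "... \<le> sqrt (PP u * (PK * l2sq G powr (p / DIM('a)) * l2sq H))" using power_form_bound[OF S(1) sob_zero S(2)] PP_nonneg
    by (intro real_sqrt_le_mono) (simp add: fg PP_def mult_left_mono)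
  finally show "\<bar>NL u v\<bar> \<le> sqrt (PP u) * sqrt (PK * l2sq G powr (p / DIM('a)) * l2sq H)" by (simp add: real_sqrt_mult)
qed

lemma NL_add: "sob u G \<Longrightarrow> sob v H \<Longrightarrow> sob w K \<Longrightarrow> NL u (\<lambda>x. v x + w x) = NL u v + NL u w"
  unfolding NL_def using NL_integrable[of u G v H] NL_integrable[of u G w K] by (simp add: distrib_left)

lemma NL_scale: "NL u (\<lambda>x. c * v x) = c * NL u v"
  unfolding NL_def by (simp flip: integral_mult_right_zero add: mult_ac)

lemma NL_self: "NL u u = PP u"
  by (simp add: NL_def PP_def power_nl_mult_self)

lemma dE_add: "sob u G \<Longrightarrow> sob v H \<Longrightarrow> sob w K \<Longrightarrow>
    dE u G (\<lambda>x. v x + w x) (\<lambda>x. H x + K x) = dE u G v H + dE u G w K"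
  using QV_add_right[of u G v H w K] NL_add[of u G v H w K] l2_inner_integrable[OF sob_l2(2) sob_l2(2), of u G v H]
    l2_inner_integrable[OF sob_l2(2) sob_l2(2), of u G w K] by (simp add: dE_def inner_add_right)

lemma dE_scale: "dE u G (\<lambda>x. c * v x) (\<lambda>x. c *\<^sub>R H x) = c * dE u G v H"
  by (simp add: dE_def QV_scale NL_scale algebra_simps)

lemma energy_expansion:
  assumes S: "sob u G" "sob v H"
  shows "\<bar>EE (\<lambda>x. u x + v x) (\<lambda>x. G x + H x) - EE u G - dE u G v H\<bar> \<le>
    l2sq H / 2 + absV v / 2 + (p - 1) * (PK * (l2sq G + l2sq H) powr (p / DIM('a)) * l2sq H)"
proof -
  define R where "R x = \<bar>u x + v x\<bar> powr p / p - \<bar>u x\<bar> powr p / p - power_nl p (u x) * v x" for x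
  note i = PP_integrable[OF sob_add[OF S]] PP_integrable[OF S(1)] NL_integrable[OF S]
  have iR: "integrable lborel R" unfolding R_def[abs_def] using i by (intro Bochner_Integration.integrable_diff integrable_divide)
  have eR: "(LBINT x. R x) = PP (\<lambda>x. u x + v x) / p - PP u / p - NL u v" unfolding R_def PP_def NL_def using i by simp
  have "EE (\<lambda>x. u x + v x) (\<lambda>x. G x + H x) - EE u G - dE u G v H = l2sq H / 2 + QV v v / 2 - (LBINT x. R x)"
    unfolding EE_def dE_def eR QV_square_add[OF S] l2sq_add_eq[OF sob_l2(2)[OF S(1)] sob_l2(2)[OF S(2)]] by (simp add: field_simps)
  moreover have "\<bar>LBINT x. R x\<bar> \<le> (p - 1) * (PK * (l2sq G + l2sq H) powr (p / DIM('a)) * l2sq H)"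
  proof -
    have "\<bar>LBINT x. R x\<bar> \<le> (LBINT x. \<bar>R x\<bar>)" by (rule integral_abs_bound)
    also have "... \<le> (LBINT x. (p - 1) * ((\<bar>u x\<bar> + \<bar>v x\<bar>) powr (p - 2) * (v x)\<^sup>2))"
    proof (rule integral_mono)
      show "integrable lborel (\<lambda>x. \<bar>R x\<bar>)" using iR by simp
      show "integrable lborel (\<lambda>x. (p - 1) * ((\<bar>u x\<bar> + \<bar>v x\<bar>) powr (p - 2) * (v x)\<^sup>2))"
        by (intro integrable_mult_right power_form_integrable[OF S S(2)])
      show "\<bar>R x\<bar> \<le> (p - 1) * ((\<bar>u x\<bar> + \<bar>v x\<bar>) powr (p - 2) * (v x)\<^sup>2)" for x
        unfolding R_def by (rule power_nl_expansion[OF p2])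
    qed
    also have "... = (p - 1) * (LBINT x. (\<bar>u x\<bar> + \<bar>v x\<bar>) powr (p - 2) * (v x)\<^sup>2)" by simp
    also have "... \<le> (p - 1) * (PK * (l2sq G + l2sq H) powr (p / DIM('a)) * l2sq H)"
      using p2 by (intro mult_left_mono power_form_bound[OF S S(2)]) auto
    finally show ?thesis .
  qed
  ultimately show ?thesis using QV_self_le[OF S(2)] l2sq_nonneg[of H] by linarith
qed

text \<open>The Dirichlet part is a quadratic form and gains an eighth of the squared gradient
  distance; the remaining two terms bound how far the potential and the power can spoil this
  convexity.\<close>

lemma energy_midpoint:
  assumes S: "sob u G" "sob v H"
  shows "EE (\<lambda>x. (1/2) * (u x + v x)) (\<lambda>x. (1/2) *\<^sub>R (G x + H x)) \<le> (EE u G + EE v H) / 2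
    - l2sq (\<lambda>x. G x - H x) / 8 + absV (\<lambda>x. u x - v x) / 8
    + (p - 1) / 4 * (PK * (l2sq G + l2sq H) powr (p / DIM('a)) * l2sq (\<lambda>x. G x - H x))"
proof -
  define w where "w x = (1/2) * (u x + v x)" for x
  have Sw: "sob w (\<lambda>x. (1/2) *\<^sub>R (G x + H x))" unfolding w_def[abs_def] by (intro sob_scale sob_add S)
  note Sd = sob_diff[OF S]
  define R where "R x = (\<bar>u x\<bar> powr p / p + \<bar>v x\<bar> powr p / p) / 2 - \<bar>w x\<bar> powr p / p" for x
  note i = PP_integrable[OF Sw] PP_integrable[OF S(1)] PP_integrable[OF S(2)]
  have iR: "integrable lborel R"
    unfolding R_def[abs_def] using i by (intro Bochner_Integration.integrable_diff Bochner_Integration.integrable_add integrable_divide)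
  have eR: "(LBINT x. R x) = (PP u / p + PP v / p) / 2 - PP w / p" unfolding R_def PP_def using i by simp
  have "(LBINT x. R x) \<le> (LBINT x. (p - 1) / 4 * ((\<bar>u x\<bar> + \<bar>v x\<bar>) powr (p - 2) * (u x - v x)\<^sup>2))"
  proof (rule integral_mono[OF iR])
    show "integrable lborel (\<lambda>x. (p - 1) / 4 * ((\<bar>u x\<bar> + \<bar>v x\<bar>) powr (p - 2) * (u x - v x)\<^sup>2))"
      by (intro integrable_mult_right power_form_integrable[OF S Sd])
    show "R x \<le> (p - 1) / 4 * ((\<bar>u x\<bar> + \<bar>v x\<bar>) powr (p - 2) * (u x - v x)\<^sup>2)" for x
      using power_midpoint[OF p2, of "u x" "v x"] by (simp add: R_def w_def)
  qed
  also have "... = (p - 1) / 4 * (LBINT x. (\<bar>u x\<bar> + \<bar>v x\<bar>) powr (p - 2) * (u x - v x)\<^sup>2)" by simp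
  also have "... \<le> (p - 1) / 4 * (PK * (l2sq G + l2sq H) powr (p / DIM('a)) * l2sq (\<lambda>x. G x - H x))"
    using p2 by (intro mult_left_mono power_form_bound[OF S Sd]) auto
  finally have R: "(PP u / p + PP v / p) / 2 - PP w / p \<le> (p - 1) / 4 * (PK * (l2sq G + l2sq H) powr (p / DIM('a)) * l2sq (\<lambda>x. G x - H x))"
    unfolding eR .
  have Qw: "QV w w = (QV u u + 2 * QV u v + QV v v) / 4"
  proof -
    have "QV w w = (1/2) * ((1/2) * QV (\<lambda>x. u x + v x) (\<lambda>x. u x + v x))"
      unfolding w_def[abs_def] QV_scale by (subst QV_commute) (simp only: QV_scale)
    then show ?thesis using QV_square_add[OF S] by simp
  qed
  have Qd: "QV (\<lambda>x. u x - v x) (\<lambda>x. u x - v x) = QV u u - 2 * QV u v + QV v v"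
    using QV_square_add[OF S(1) sob_minus[OF S(2)]] QV_scale[of u "-1" v] QV_scale[of "\<lambda>x. - v x" "-1" v]
      QV_scale[of v "-1" v] QV_commute[of "\<lambda>x. - v x" v] by simp
  \<comment> \<open>The arithmetic is isolated over plain reals, since the integrals involved are
    opaque to the simplifier.\<close>
  have lin: "(((a + b) / 2 - d / 4) / 2 + qw / 2 - w') \<le> (a / 2 + qu / 2 - u' + (b / 2 + qv / 2 - v')) / 2 - d / 8 + e / 8 + X"
    if "(u' + v') / 2 - w' \<le> X" "qw = (qu + 2 * quv + qv) / 4" "qd = qu - 2 * quv + qv" "\<bar>qd\<bar> \<le> e"
    for a b d qw w' qu u' qv v' e X quv qd :: real
  proof -
    have "- qd \<le> e" using that(4) by simp
    with that(1-3) show ?thesis by (simp add: field_simps)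
  qed
  show ?thesis unfolding EE_def w_def[symmetric] l2sq_parallelogram[OF sob_l2(2)[OF S(1)] sob_l2(2)[OF S(2)]]
    by (rule lin[OF R Qw Qd QV_self_le[OF Sd]])
qed

text \<open>As p > 2 and s \<ge> 1, the negative power term grows at least as fast as the quadratic
  part.\<close>

lemma energy_scale:
  assumes "sob u G" "s \<ge> 1"
  shows "EE (\<lambda>x. s * u x) (\<lambda>x. s *\<^sub>R G x) \<le> s\<^sup>2 * EE u G"
proof -
  have P: "PP (\<lambda>x. s * u x) = s powr p * PP u" using assms(2) by (simp add: PP_def abs_mult powr_mult)
  have "s powr 2 \<le> s powr p" using assms(2) p2 by (intro powr_mono) auto
  then have "s\<^sup>2 * PP u \<le> s powr p * PP u" using assms(2) PP_nonneg by (intro mult_right_mono) (auto simp: powr_numeral)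
  then have "s\<^sup>2 * PP u / p \<le> s powr p * PP u / p" using p2 by (intro divide_right_mono) auto
  moreover have "QV (\<lambda>x. s * u x) (\<lambda>x. s * u x) = s * (s * QV u u)" unfolding QV_scale by (subst QV_commute) (simp only: QV_scale)
  ultimately show ?thesis unfolding EE_def P l2sq_scale by (simp add: power2_eq_square algebra_simps)
qed

end

section \<open>Existence of a minimizer\<close>

lemma step_nonneg[simp]: "0 \<le> step n" by (simp add: less_imp_le)

lemma l2sq_tendsto:
  fixes f :: "nat \<Rightarrow> 'a::euclidean_space \<Rightarrow> 'b::euclidean_space"
  assumes f: "\<And>n. l2 (f n)" and g: "l2 g" and lim: "(\<lambda>n. l2sq (\<lambda>x. f n x - g x)) \<longlonglongrightarrow> 0"
  shows "(\<lambda>n. l2sq (f n)) \<longlonglongrightarrow> l2sq g"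
proof -
  have "(\<lambda>n. sqrt (l2sq (f n)) - sqrt (l2sq g)) \<longlonglongrightarrow> 0"
  proof (rule Lim_null_comparison)
    show "(\<lambda>n. sqrt (l2sq (\<lambda>x. f n x - g x))) \<longlonglongrightarrow> 0" using tendsto_real_sqrt[OF lim] by simp
    show "\<forall>\<^sub>F n in sequentially. norm (sqrt (l2sq (f n)) - sqrt (l2sq g)) \<le> sqrt (l2sq (\<lambda>x. f n x - g x))"
    proof (intro always_eventually allI)
      fix n
      have "sqrt (l2sq (f n)) \<le> sqrt (l2sq (\<lambda>x. f n x - g x)) + sqrt (l2sq g)" using l2sq_add[OF l2_diff[OF f g] g, of n] by simp
      moreover have "sqrt (l2sq g) \<le> sqrt (l2sq (\<lambda>x. g x - f n x)) + sqrt (l2sq (f n))"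
        using l2sq_add[OF l2_diff[OF g f] f, of n n] by simp
      then have "sqrt (l2sq g) \<le> sqrt (l2sq (\<lambda>x. f n x - g x)) + sqrt (l2sq (f n))" by (subst l2sq_commute)
      ultimately show "norm (sqrt (l2sq (f n)) - sqrt (l2sq g)) \<le> sqrt (l2sq (\<lambda>x. f n x - g x))" by (simp add: abs_le_iff)
    qed
  qed
  then have "(\<lambda>n. sqrt (l2sq (f n))) \<longlonglongrightarrow> sqrt (l2sq g)" by (rule LIM_zero_cancel)
  from tendsto_power[OF this, of 2] show ?thesis by simp
qed

context schrod
begin

text \<open>The last condition bounds the loss of the power term in \<open>energy_midpoint\<close>
  by 1/16 of the squared gradient distance, half of the gain 1/8.\<close>

definition region :: "real \<Rightarrow> real \<Rightarrow> bool" where "region R0 C0 \<longleftrightarrow> R0 > 0 \<and> C0 > 0 \<and>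
     (\<forall>u G. sob u G \<longrightarrow> l2sq G \<le> R0 \<longrightarrow> l2sq G / 4 - C0 / 4 * l2sq u \<le> EE u G) \<and>
     (p - 1) * PK * (2 * R0) powr (p / DIM('a)) \<le> 1 / 4"

lemma region_exists: "\<exists>R0 C0. region R0 C0"
proof -
  obtain C where C: "C > 0" "\<And>u G. sob u G \<Longrightarrow> absV u \<le> (1/4) * l2sq G + C * l2sq u" using absV_bound[of "1/4"] by auto
  define Sc where "Sc = sobolev_const TYPE('a)"
  have Sc: "Sc \<ge> 0" by (simp add: Sc_def sobolev_const_nonneg)
  have pN: "p / DIM('a) > 0" using p2 by simp
  have "(\<lambda>n. (p - 1) * PK * (2 * step n) powr (p / DIM('a))) \<longlonglongrightarrow> (p - 1) * PK * (2 * 0) powr (p / DIM('a))"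
    using pN by (intro tendsto_mult_left tendsto_powr2 tendsto_const step_tendsto) auto
  then have "(\<lambda>n. (p - 1) * PK * (2 * step n) powr (p / DIM('a))) \<longlonglongrightarrow> 0" by simp
  from order_tendstoD(2)[OF this, of "1/4"]
  have e1: "\<forall>\<^sub>F n in sequentially. (p - 1) * PK * (2 * step n) powr (p / DIM('a)) < 1 / 4" by simp
  have "(\<lambda>n. Sc * step n powr (p / 2 - 1) / p) \<longlonglongrightarrow> Sc * 0 powr (p / 2 - 1) / p"
    using p2 by (intro tendsto_divide tendsto_mult_left tendsto_powr2 tendsto_const step_tendsto) auto
  then have "(\<lambda>n. Sc * step n powr (p / 2 - 1) / p) \<longlonglongrightarrow> 0" by simp
  from order_tendstoD(2)[OF this, of "1/8"]
  have e2: "\<forall>\<^sub>F n in sequentially. Sc * step n powr (p / 2 - 1) / p < 1 / 8" by simp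
  obtain n where n: "(p - 1) * PK * (2 * step n) powr (p / DIM('a)) < 1 / 4" "Sc * step n powr (p / 2 - 1) / p < 1 / 8"
    using eventually_happens'[OF _ eventually_conj[OF e1 e2]] by auto
  have "l2sq G / 4 - (2 * C) / 4 * l2sq u \<le> EE u G" if S: "sob u G" and le: "l2sq G \<le> step n" for u :: "'a \<Rightarrow> real" and G
  proof -
    have "PP u \<le> Sc * l2sq G powr (p / 2)" using PP_le[OF S] by (simp add: Sc_def)
    also have "l2sq G powr (p / 2) = l2sq G powr (p / 2 - 1) * l2sq G" using powr_add[of "l2sq G" "p / 2 - 1" 1] by simp
    also have "Sc * (l2sq G powr (p / 2 - 1) * l2sq G) \<le> Sc * (step n powr (p / 2 - 1) * l2sq G)"
      using Sc le p2 by (intro mult_left_mono mult_right_mono powr_mono2) auto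
    finally have "PP u / p \<le> (Sc * step n powr (p / 2 - 1) / p) * l2sq G" using p2 by (simp add: divide_right_mono)
    also have "... \<le> (1/8) * l2sq G" using n(2) by (intro mult_right_mono) auto
    finally have "PP u / p \<le> l2sq G / 8" by simp
    moreover have "\<bar>QV u u\<bar> \<le> (1/4) * l2sq G + C * l2sq u" using QV_self_le[OF S] C(2)[OF S] by simp
    ultimately show ?thesis unfolding EE_def by linarith
  qed
  \<comment> \<open>From A/2, the potential takes A/8 + C B/2 and the power takes A/8. This leaves
    A/4 - C B/2, so that C0 = 2 C.\<close>
  then have "region (step n) (2 * C)" unfolding region_def using n(1) C(1) by auto
  then show ?thesis by blast
qed

lemma dE_tendsto_0:
  assumes S: "sob u G" and T: "\<And>n. sob (v n) (H n)"
    and v: "(\<lambda>n. l2sq (v n)) \<longlonglongrightarrow> 0" and H: "(\<lambda>n. l2sq (H n)) \<longlonglongrightarrow> 0"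
  shows "(\<lambda>n. dE u G (v n) (H n)) \<longlonglongrightarrow> 0" "(\<lambda>n. absV (v n)) \<longlonglongrightarrow> 0"
proof -
  obtain C where C: "C > 0" "\<And>u G. sob u G \<Longrightarrow> absV u \<le> 1 * l2sq G + C * l2sq u" using absV_bound[of 1] by auto
  show aV: "(\<lambda>n. absV (v n)) \<longlonglongrightarrow> 0"
  proof (rule Lim_null_comparison)
    have "(\<lambda>n. 1 * l2sq (H n) + C * l2sq (v n)) \<longlonglongrightarrow> 1 * 0 + C * 0" by (intro tendsto_intros v H)
    then show "(\<lambda>n. 1 * l2sq (H n) + C * l2sq (v n)) \<longlonglongrightarrow> 0" by simp
    show "\<forall>\<^sub>F n in sequentially. norm (absV (v n)) \<le> 1 * l2sq (H n) + C * l2sq (v n)"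
      using C(2)[OF T] absV_nonneg by (intro always_eventually allI) simp
  qed
  show "(\<lambda>n. dE u G (v n) (H n)) \<longlonglongrightarrow> 0"
  proof (rule Lim_null_comparison)
    define b where "b n = sqrt (l2sq G) * sqrt (l2sq (H n)) + sqrt (absV u) * sqrt (absV (v n)) +
       sqrt (PP u) * sqrt (PK * l2sq G powr (p / DIM('a)) * l2sq (H n))" for n
    have "b \<longlonglongrightarrow> sqrt (l2sq G) * sqrt 0 + sqrt (absV u) * sqrt 0 + sqrt (PP u) * sqrt (PK * l2sq G powr (p / DIM('a)) * 0)"
      unfolding b_def by (intro tendsto_add tendsto_mult_left tendsto_real_sqrt H aV)
    then show "b \<longlonglongrightarrow> 0" by simp
    show "\<forall>\<^sub>F n in sequentially. norm (dE u G (v n) (H n)) \<le> b n"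
    proof (intro always_eventually allI)
      fix n
      show "norm (dE u G (v n) (H n)) \<le> b n"
        using l2_inner_bound[OF sob_l2(2)[OF S] sob_l2(2)[OF T[of n]]] QV_bound[OF S T[of n]] NL_bound[OF S T[of n]]
        unfolding dE_def b_def real_norm_def by linarith
    qed
  qed
qed

lemma energy_tendsto:
  assumes S: "sob u G" and T: "\<And>n. sob (v n) (H n)"
    and v: "(\<lambda>n. l2sq (\<lambda>x. v n x - u x)) \<longlonglongrightarrow> 0" and H: "(\<lambda>n. l2sq (\<lambda>x. H n x - G x)) \<longlonglongrightarrow> 0"
  shows "(\<lambda>n. EE (v n) (H n)) \<longlonglongrightarrow> EE u G"
proof -
  define d where "d n x = v n x - u x" for n x
  define D where "D n x = H n x - G x" for n x
  have SD: "sob (d n) (D n)" for n unfolding d_def[abs_def] D_def[abs_def] by (rule sob_diff[OF T S])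
  have d0: "(\<lambda>n. l2sq (d n)) \<longlonglongrightarrow> 0" and D0: "(\<lambda>n. l2sq (D n)) \<longlonglongrightarrow> 0"
    using v H by (simp_all add: d_def[abs_def] D_def[abs_def])
  note lims = dE_tendsto_0[OF S SD d0 D0]
  have "(\<lambda>n. EE (v n) (H n) - EE u G) \<longlonglongrightarrow> 0"
  proof (rule Lim_null_comparison)
    define b where "b n = l2sq (D n) / 2 + absV (d n) / 2 + (p - 1) * (PK * (l2sq G + l2sq (D n)) powr (p / DIM('a)) * l2sq (D n)) + \<bar>dE u G (d n) (D n)\<bar>" for n
    have "b \<longlonglongrightarrow> 0 / 2 + 0 / 2 + (p - 1) * (PK * (l2sq G + 0) powr (p / DIM('a)) * 0) + \<bar>0\<bar>" unfolding b_def using p2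
      by (intro tendsto_add tendsto_divide tendsto_mult tendsto_powr2 tendsto_rabs tendsto_const D0 lims) (auto intro: add_nonneg_nonneg)
    then show "b \<longlonglongrightarrow> 0" by simp
    show "\<forall>\<^sub>F n in sequentially. norm (EE (v n) (H n) - EE u G) \<le> b n"
    proof (intro always_eventually allI)
      fix n
      have "(\<lambda>x. u x + d n x) = v n" "(\<lambda>x. G x + D n x) = H n" by (auto simp: d_def D_def)
      then show "norm (EE (v n) (H n) - EE u G) \<le> b n" using energy_expansion[OF S SD[of n]] unfolding b_def real_norm_def by simp
    qed
  qed
  then show ?thesis by (rule LIM_zero_cancel)
qed

text \<open>The comparison with all masses up to \<rho>^2 belongs to the definition because the
  variations used for the equation do not stay on the sphere. The bound by \<open>C0\<close>,
  stronger than that by \<open>R0\<close>, expresses that the minimizer is interior.\<close>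

definition minimizer :: "real \<Rightarrow> real \<Rightarrow> real \<Rightarrow> ('a \<Rightarrow> real) \<Rightarrow> ('a \<Rightarrow> 'a) \<Rightarrow> bool" where
  "minimizer R0 C0 \<rho> U G \<longleftrightarrow> sob U G \<and> l2sq U = \<rho>\<^sup>2 \<and> l2sq G \<le> C0 * \<rho>\<^sup>2 \<and> EE U G < 0 \<and>
    (\<forall>w K. sob w K \<longrightarrow> l2sq K \<le> R0 \<longrightarrow> l2sq w \<le> \<rho>\<^sup>2 \<longrightarrow> EE U G * (l2sq w / \<rho>\<^sup>2) \<le> EE w K)"

text \<open>For two states on the sphere the midpoint has mass lower by a quarter of their squared
  L^2 distance. As m < 0, this raises the lower bound for its energy, while
  \<open>energy_midpoint\<close> bounds that energy from above; together they control the H^1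
  distance of almost minimizers, up to a local L^2 term.\<close>

theorem minimizer_exists:
  assumes reg: "region R0 C0" and \<rho>: "\<rho> > 0" "C0 * \<rho>\<^sup>2 < R0"
    and u0: "sob u0 G0" "l2sq u0 = \<rho>\<^sup>2" "l2sq G0 \<le> R0" "EE u0 G0 < 0"
  shows "\<exists>U G. minimizer R0 C0 \<rho> U G"
proof -
  have R0: "R0 > 0" "C0 > 0" and lower: "\<And>u G. sob u G \<Longrightarrow> l2sq G \<le> R0 \<Longrightarrow> l2sq G / 4 - C0 / 4 * l2sq u \<le> EE u G"
    and small: "(p - 1) * PK * (2 * R0) powr (p / DIM('a)) \<le> 1 / 4"
    using reg by (auto simp: region_def)
  define A where "A = {EE u G |u G. sob u G \<and> l2sq u = \<rho>\<^sup>2 \<and> l2sq G \<le> R0}"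
  define m where "m = Inf A"
  have bdd: "bdd_below A"
  proof (rule bdd_belowI)
    fix y assume "y \<in> A"
    then obtain u G where "y = EE u G" "sob u G" "l2sq u = \<rho>\<^sup>2" "l2sq G \<le> R0" by (auto simp: A_def)
    then have "l2sq G / 4 - C0 / 4 * \<rho>\<^sup>2 \<le> y" using lower[of u G] by auto
    then show "- (C0 / 4 * \<rho>\<^sup>2) \<le> y" using l2sq_nonneg[of G] by linarith
  qed
  have mle: "m \<le> EE u G" if "sob u G" "l2sq u = \<rho>\<^sup>2" "l2sq G \<le> R0" for u G
    unfolding m_def using that by (intro cInf_lower bdd) (auto simp: A_def)
  have m0: "m < 0" using mle[OF u0(1-3)] u0(4) by simp
  have \<rho>2: "\<rho>\<^sup>2 > 0" using \<rho> by simp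
  have L1: "m * (l2sq w / \<rho>\<^sup>2) \<le> EE w K" if S: "sob w K" and le: "l2sq K \<le> R0" "l2sq w \<le> \<rho>\<^sup>2" for w K
  proof (cases "EE w K \<ge> 0")
    case True
    have "m * (l2sq w / \<rho>\<^sup>2) \<le> 0" using m0 \<rho>2 by (intro mult_nonpos_nonneg) auto
    then show ?thesis using True by simp
  next
    case False
    have lo: "l2sq K / 4 - C0 / 4 * l2sq w \<le> EE w K" by (rule lower[OF S le(1)])
    have KC: "l2sq K \<le> C0 * l2sq w" using lo False by simp
    have wp: "l2sq w > 0"
    proof (rule ccontr)
      assume "\<not> 0 < l2sq w"
      then have "l2sq w = 0" using l2sq_nonneg[of w] by linarith
      then show False using lo False l2sq_nonneg[of K] by simp
    qed
    \<comment> \<open>Rescaling to mass \<rho>^2 keeps the state in the region: negative energy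
      gives A \<le> C0 B, and C0 \<rho>^2 < R0.\<close>
    define s where "s = \<rho> / sqrt (l2sq w)"
    have s2: "s\<^sup>2 = \<rho>\<^sup>2 / l2sq w" using wp by (simp add: s_def power_divide)
    have "sqrt (l2sq w) \<le> \<rho>" using le(2) \<rho>(1) by (simp add: real_le_lsqrt)
    then have s1: "s \<ge> 1" using wp by (simp add: s_def)
    have "m \<le> EE (\<lambda>x. s * w x) (\<lambda>x. s *\<^sub>R K x)"
    proof (rule mle)
      show "sob (\<lambda>x. s * w x) (\<lambda>x. s *\<^sub>R K x)" by (rule sob_scale[OF S])
      show "l2sq (\<lambda>x. s * w x) = \<rho>\<^sup>2" using wp by (simp add: l2sq_cmult s2)
      have "s\<^sup>2 * l2sq K \<le> s\<^sup>2 * (C0 * l2sq w)" using KC by (intro mult_left_mono) auto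
      also have "... = C0 * \<rho>\<^sup>2" using wp by (simp add: s2)
      finally show "l2sq (\<lambda>x. s *\<^sub>R K x) \<le> R0" using \<rho>(2) by (simp add: l2sq_scale)
    qed
    also have "... \<le> s\<^sup>2 * EE w K" by (rule energy_scale[OF S s1])
    finally have "m * (l2sq w / \<rho>\<^sup>2) \<le> s\<^sup>2 * EE w K * (l2sq w / \<rho>\<^sup>2)" using wp \<rho>2 by (intro mult_right_mono) auto
    also have "... = EE w K" using wp \<rho>2 by (simp add: s2)
    finally show ?thesis .
  qed
  \<comment> \<open>Minus the slope of the lower bound in the mass: losing the mass D0/4 raises the
    bound by \<mu> D0/4.\<close>
  define \<mu> where "\<mu> = \<bar>m\<bar> / \<rho>\<^sup>2"
  have \<mu>: "\<mu> > 0" unfolding \<mu>_def using m0 \<rho>2 by (intro divide_pos_pos) auto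
  \<comment> \<open>With this e the potential consumes at most D1/32 and \<mu> D0/8, apart from its
    local term. What remains is D1/8 - D1/16 - D1/32 = D1/32 and \<mu> D0/4 - \<mu> D0/8 = \<mu>
    D0/8.\<close>
  define e where "e = min (1/4) \<mu>"
  have e: "e > 0" "e \<le> 1/4" "e \<le> \<mu>" using \<mu> by (auto simp: e_def)
  obtain Kc where Kc: "Kc \<ge> 0" "\<And>u G. sob u G \<Longrightarrow> absV u \<le> e * l2sq G + e * l2sq u + Kc * loc_sq Kc u"
    using absV_local[OF e(1)] by auto
  have main: "\<mu> / 8 * l2sq (\<lambda>x. u x - v x) + l2sq (\<lambda>x. G x - H x) / 32 \<le> (EE u G + EE v H) / 2 - m + Kc / 8 * loc_sq Kc (\<lambda>x. u x - v x)"
    if S: "sob u G" "sob v H" and b: "l2sq u = \<rho>\<^sup>2" "l2sq v = \<rho>\<^sup>2" "l2sq G \<le> R0" "l2sq H \<le> R0" for u v G H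
  proof -
    define w where "w x = (1/2) * (u x + v x)" for x
    define K where "K x = (1/2) *\<^sub>R (G x + H x)" for x
    define D0 D1 where "D0 = l2sq (\<lambda>x. u x - v x)" and "D1 = l2sq (\<lambda>x. G x - H x)"
    have D: "D0 \<ge> 0" "D1 \<ge> 0" by (auto simp: D0_def D1_def)
    have Sw: "sob w K" unfolding w_def[abs_def] K_def[abs_def] by (intro sob_scale sob_add S)
    have lw: "l2sq w = \<rho>\<^sup>2 - D0 / 4"
      using l2sq_parallelogram[OF sob_l2(1)[OF S(1)] sob_l2(1)[OF S(2)]] b by (simp add: w_def[abs_def] D0_def)
    have lK: "l2sq K = (l2sq G + l2sq H) / 2 - D1 / 4"
      using l2sq_parallelogram[OF sob_l2(2)[OF S(1)] sob_l2(2)[OF S(2)]] by (simp add: K_def[abs_def] D1_def)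
    have "(l2sq G + l2sq H) / 2 \<le> R0" using b by simp
    moreover have "0 \<le> D1 / 4" "0 \<le> D0 / 4" using D by auto
    ultimately have "l2sq K \<le> R0" "l2sq w \<le> \<rho>\<^sup>2" unfolding lK lw by linarith+
    then have "m * (l2sq w / \<rho>\<^sup>2) \<le> EE w K" by (rule L1[OF Sw])
    moreover have "m * (l2sq w / \<rho>\<^sup>2) = m + \<mu> / 4 * D0" using m0 \<rho>2 by (simp add: lw \<mu>_def field_simps)
    moreover have "EE w K \<le> (EE u G + EE v H) / 2 - D1 / 8 + absV (\<lambda>x. u x - v x) / 8
        + (p - 1) / 4 * (PK * (l2sq G + l2sq H) powr (p / DIM('a)) * D1)"
      using energy_midpoint[OF S] by (simp add: w_def[abs_def] K_def[abs_def] D1_def)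
    moreover have "(p - 1) / 4 * (PK * (l2sq G + l2sq H) powr (p / DIM('a)) * D1) \<le> D1 / 16"
    proof -
      have "(p - 1) * PK * (l2sq G + l2sq H) powr (p / DIM('a)) \<le> (p - 1) * PK * (2 * R0) powr (p / DIM('a))"
        using b p2 PK_nonneg by (intro mult_left_mono powr_mono2) auto
      then have "(p - 1) * PK * (l2sq G + l2sq H) powr (p / DIM('a)) \<le> 1 / 4" using small by simp
      from mult_right_mono[OF this D(2)] show ?thesis by (simp add: mult_ac)
    qed
    moreover have "absV (\<lambda>x. u x - v x) \<le> e * D1 + e * D0 + Kc * loc_sq Kc (\<lambda>x. u x - v x)"
      using Kc(2)[OF sob_diff[OF S]] by (simp add: D0_def D1_def)
    moreover have "e * D1 \<le> (1/4) * D1" by (rule mult_right_mono) (use e D in auto)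
    moreover have "e * D0 \<le> \<mu> * D0" by (rule mult_right_mono) (use e D in auto)
    moreover have "\<mu> / 8 * D0 + D1 / 32 \<le> Ea - m + Kc / 8 * L"
      if "m * q \<le> E" "m * q = m + \<mu> / 4 * D0" "E \<le> Ea - D1 / 8 + aV / 8 + X" "X \<le> D1 / 16"
        "aV \<le> e * D1 + e * D0 + Kc * L" "e * D1 \<le> (1/4) * D1" "e * D0 \<le> \<mu> * D0" for q E Ea aV X L
    proof -
      have "aV / 8 \<le> D1 / 32 + (\<mu> * D0) / 8 + (Kc * L) / 8" using that(5-7) by simp
      then show ?thesis using that(1-4) by simp
    qed
    ultimately have "\<mu> / 8 * D0 + D1 / 32 \<le> (EE u G + EE v H) / 2 - m + Kc / 8 * loc_sq Kc (\<lambda>x. u x - v x)" by blast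
    then show ?thesis by (simp add: D0_def D1_def)
  qed
  have "\<forall>n. \<exists>x. sob (fst x) (snd x) \<and> l2sq (fst x) = \<rho>\<^sup>2 \<and> l2sq (snd x) \<le> R0 \<and> EE (fst x) (snd x) < m + step n"
  proof
    fix n
    have "A \<noteq> {}" using u0 by (auto simp: A_def)
    moreover have "Inf A < m + step n" using step_pos[of n] unfolding m_def by linarith
    ultimately obtain y where "y \<in> A" "y < m + step n" using cInf_lessD by blast
    then show "\<exists>x. sob (fst x) (snd x) \<and> l2sq (fst x) = \<rho>\<^sup>2 \<and> l2sq (snd x) \<le> R0 \<and> EE (fst x) (snd x) < m + step n"
      by (fastforce simp: A_def)
  qed
  from choice[OF this] obtain x where x: "\<And>n. sob (fst (x n)) (snd (x n))" "\<And>n. l2sq (fst (x n)) = \<rho>\<^sup>2"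
    "\<And>n. l2sq (snd (x n)) \<le> R0" "\<And>n. EE (fst (x n)) (snd (x n)) < m + step n" by blast
  have M: "l2sq (fst (x n)) \<le> max (\<rho>\<^sup>2) R0" "l2sq (snd (x n)) \<le> max (\<rho>\<^sup>2) R0" for n using x(2)[of n] x(3)[of n] by auto
  obtain s :: "nat \<Rightarrow> nat" where s: "strict_mono s"
    "\<And>R e. e > 0 \<Longrightarrow> \<exists>N. \<forall>m\<ge>N. \<forall>n\<ge>N. loc_sq R (\<lambda>y. fst (x (s m)) y - fst (x (s n)) y) < e"
    using Rellich[of "\<lambda>n. fst (x n)" "\<lambda>n. snd (x n)", OF x(1) M] by auto
  define u where "u n = fst (x (s n))" for n
  define G where "G n = snd (x (s n))" for n
  have ug: "sob (u n) (G n)" "l2sq (u n) = \<rho>\<^sup>2" "l2sq (G n) \<le> R0" "EE (u n) (G n) < m + step (s n)" for n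
    using x by (auto simp: u_def G_def)
  have Es: "(\<lambda>n. step (s n)) \<longlonglongrightarrow> 0" using filterlim_compose[OF step_tendsto filterlim_subseq[OF s(1)]] .
  have small_diff: "\<exists>N. \<forall>i\<ge>N. \<forall>j\<ge>N. \<mu> / 8 * l2sq (\<lambda>x. u i x - u j x) + l2sq (\<lambda>x. G i x - G j x) / 32 < \<delta>" if \<delta>: "\<delta> > 0" for \<delta>
  proof -
    have "\<forall>\<^sub>F n in sequentially. step (s n) < \<delta> / 2" by (rule order_tendstoD(2)[OF Es]) (use \<delta> in simp)
    then obtain N1 where N1: "\<And>n. n \<ge> N1 \<Longrightarrow> step (s n) < \<delta> / 2" by (auto simp: eventually_sequentially)
    have "\<delta> / (2 * (Kc / 8 + 1)) > 0" using \<delta> Kc(1) by simp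
    from s(2)[OF this, of Kc] obtain N2 where N2: "\<And>i j. i \<ge> N2 \<Longrightarrow> j \<ge> N2 \<Longrightarrow> loc_sq Kc (\<lambda>y. u i y - u j y) < \<delta> / (2 * (Kc / 8 + 1))"
      by (auto simp: u_def)
    have "\<mu> / 8 * l2sq (\<lambda>x. u i x - u j x) + l2sq (\<lambda>x. G i x - G j x) / 32 < \<delta>" if ij: "i \<ge> max N1 N2" "j \<ge> max N1 N2" for i j
    proof -
      have "Kc / 8 * loc_sq Kc (\<lambda>y. u i y - u j y) \<le> (Kc / 8 + 1) * loc_sq Kc (\<lambda>y. u i y - u j y)"
        using loc_sq_nonneg by (intro mult_right_mono) auto
      also have "... \<le> (Kc / 8 + 1) * (\<delta> / (2 * (Kc / 8 + 1)))" using N2[of i j] ij Kc(1) by (intro mult_left_mono) auto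
      also have "... = \<delta> / 2"
      proof -
        have X: "X * (\<delta> / (2 * X)) = \<delta> / 2" if "X > 0" for X :: real using that by simp
        have "Kc / 8 + 1 > 0" using Kc(1) by simp
        from X[OF this] show ?thesis .
      qed
      finally have 1: "Kc / 8 * loc_sq Kc (\<lambda>y. u i y - u j y) \<le> \<delta> / 2" .
      have "step (s i) < \<delta> / 2" "step (s j) < \<delta> / 2" using N1 ij by auto
      then show ?thesis using main[OF ug(1)[of i] ug(1)[of j] ug(2)[of i] ug(2)[of j] ug(3)[of i] ug(3)[of j]] 1 ug(4)[of i] ug(4)[of j]
        unfolding add_divide_distrib by linarith
    qed
    then show ?thesis by blast
  qed
  have cu: "\<exists>N. \<forall>i\<ge>N. \<forall>j\<ge>N. l2sq (\<lambda>x. u i x - u j x) < \<delta>" if \<delta>: "\<delta> > 0" for \<delta>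
  proof -
    obtain N where N: "\<And>i j. i \<ge> N \<Longrightarrow> j \<ge> N \<Longrightarrow> \<mu> / 8 * l2sq (\<lambda>x. u i x - u j x) + l2sq (\<lambda>x. G i x - G j x) / 32 < \<mu> / 8 * \<delta>"
      using small_diff[of "\<mu> / 8 * \<delta>"] \<delta> \<mu> by auto
    have "l2sq (\<lambda>x. u i x - u j x) < \<delta>" if "i \<ge> N" "j \<ge> N" for i j
    proof -
      have "\<mu> / 8 * l2sq (\<lambda>x. u i x - u j x) < \<mu> / 8 * \<delta>"
        using N[OF that] l2sq_nonneg[of "\<lambda>x. G i x - G j x"] by linarith
      then show ?thesis using \<mu> by simp
    qed
    then show ?thesis by blast
  qed
  have cG: "\<exists>N. \<forall>i\<ge>N. \<forall>j\<ge>N. l2sq (\<lambda>x. G i x - G j x) < \<delta>" if \<delta>: "\<delta> > 0" for \<delta>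
  proof -
    obtain N where N: "\<And>i j. i \<ge> N \<Longrightarrow> j \<ge> N \<Longrightarrow> \<mu> / 8 * l2sq (\<lambda>x. u i x - u j x) + l2sq (\<lambda>x. G i x - G j x) / 32 < \<delta> / 32"
      using small_diff[of "\<delta> / 32"] \<delta> by auto
    have "l2sq (\<lambda>x. G i x - G j x) < \<delta>" if "i \<ge> N" "j \<ge> N" for i j
    proof -
      have "0 \<le> \<mu> / 8 * l2sq (\<lambda>x. u i x - u j x)" using \<mu> by simp
      then show ?thesis using N[OF that] by linarith
    qed
    then show ?thesis by blast
  qed
  obtain U where U: "l2 U" "(\<lambda>n. l2sq (\<lambda>x. u n x - U x)) \<longlonglongrightarrow> 0"
    by (rule L2_complete[of u, OF sob_l2(1)[OF ug(1)] cu])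
  obtain D where D: "l2 D" "(\<lambda>n. l2sq (\<lambda>x. G n x - D x)) \<longlonglongrightarrow> 0"
    by (rule L2_complete[of G, OF sob_l2(2)[OF ug(1)] cG])
  have S: "sob U D" by (rule sob_limit[OF ug(1) U(1) D(1) U(2) D(2)])
  have lU: "l2sq U = \<rho>\<^sup>2" using LIMSEQ_unique[OF l2sq_tendsto[OF sob_l2(1)[OF ug(1)] U]] ug(2) by simp
  have lD: "l2sq D \<le> R0" by (rule LIMSEQ_le_const2[OF l2sq_tendsto[OF sob_l2(2)[OF ug(1)] D]]) (use ug(3) in auto)
  have EU: "EE U D = m"
  proof (rule antisym)
    have ml: "(\<lambda>n. m + step (s n)) \<longlonglongrightarrow> m + 0" by (intro tendsto_intros Es)
    have "EE U D \<le> m + 0" by (rule LIMSEQ_le[OF energy_tendsto[OF S ug(1) U(2) D(2)] ml]) (use ug(4) less_imp_le in blast)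
    then show "EE U D \<le> m" by simp
    show "m \<le> EE U D" by (rule mle[OF S lU lD])
  qed
  have "l2sq D \<le> C0 * \<rho>\<^sup>2" using lower[OF S lD] EU m0 lU by simp
  then show ?thesis unfolding minimizer_def using S lU EU m0 L1 by blast
qed

end

section \<open>Chain and product rules\<close>

lemma l2_bounded_mult:
  fixes f :: "'a::euclidean_space \<Rightarrow> real" and g :: "'a \<Rightarrow> 'b::euclidean_space"
  assumes [measurable]: "f \<in> borel_measurable borel" and f: "\<And>x. \<bar>f x\<bar> \<le> M" and g: "l2 g"
  shows "l2 (\<lambda>x. f x *\<^sub>R g x)"
proof -
  note [measurable] = l2_measurable[OF g]
  have "integrable lborel (\<lambda>x. (norm (f x *\<^sub>R g x))\<^sup>2)"
  proof (rule Bochner_Integration.integrable_bound[OF integrable_mult_right[OF l2_square_integrable[OF g], of "M\<^sup>2"]])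
    have "\<bar>f x\<bar>\<^sup>2 * (norm (g x))\<^sup>2 \<le> M\<^sup>2 * (norm (g x))\<^sup>2" for x by (intro mult_right_mono power_mono f) auto
    then show "AE x in lborel. norm ((norm (f x *\<^sub>R g x))\<^sup>2) \<le> norm (M\<^sup>2 * (norm (g x))\<^sup>2)"
      by (simp add: power_mult_distrib)
  qed simp
  then show ?thesis by (simp add: l2_def)
qed

lemma l2_bounded_mult_real:
  fixes f g :: "'a::euclidean_space \<Rightarrow> real"
  assumes "f \<in> borel_measurable borel" "\<And>x. \<bar>f x\<bar> \<le> M" "l2 g"
  shows "l2 (\<lambda>x. f x * g x)"
  using l2_bounded_mult[OF assms] by simp

text \<open>The Taylor bound makes the remainder of the quotient of F(u) at most |C| step q^2, where
  q is the quotient of u. Since q is bounded in L^2, the remainder disappears against bounded test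
  functions. The set \<open>I\<close> admits logarithms and reciprocals of nonnegative
  functions.\<close>

theorem sob_chain_rule:
  fixes u :: "'a::euclidean_space \<Rightarrow> real" and F F' :: "real \<Rightarrow> real"
  assumes S: "sob u G" and I: "\<And>x. u x \<in> I"
    and taylor: "\<And>a b. a \<in> I \<Longrightarrow> b \<in> I \<Longrightarrow> \<bar>F b - F a - F' a * (b - a)\<bar> \<le> C * (b - a)\<^sup>2"
    and bound: "\<And>a. a \<in> I \<Longrightarrow> \<bar>F' a\<bar> \<le> M"
    and Fl2: "l2 (\<lambda>x. F (u x))" and mF'[measurable]: "(\<lambda>x. F' (u x)) \<in> borel_measurable borel"
  shows "sob (\<lambda>x. F (u x)) (\<lambda>x. F' (u x) *\<^sub>R G x)"
proof (rule sobI_difference_quotient[OF Fl2])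
  note lu = sob_l2(1)[OF S] and lG = sob_l2(2)[OF S]
  note [measurable] = l2_measurable[OF lu] l2_measurable[OF lG] l2_measurable[OF Fl2]
  show "l2 (\<lambda>x. F' (u x) *\<^sub>R G x)" by (rule l2_bounded_mult[OF mF' bound[OF I] lG])
  fix \<phi> :: "'a \<Rightarrow> real" and b :: 'a assume \<phi>: "\<phi> \<in> test_functions" and b: "b \<in> Basis"
  obtain R where R: "\<And>x. norm x > R \<Longrightarrow> \<phi> x = 0" using test_function_facts[OF \<phi>] by metis
  obtain B where B: "B > 0" "\<And>x. \<bar>\<phi> x\<bar> \<le> B"
    using continuous_compact_support_bounded[OF test_function_continuous[OF \<phi>] R] by metis
  have l\<phi>: "l2 \<phi>" by (rule test_function_l2[OF \<phi>])
  note [measurable] = l2_measurable[OF l\<phi>]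
  define q where "q n x = (u (x + step n *\<^sub>R b) - u x) / step n" for n x
  have lq: "l2 (q n)" for n unfolding q_def[abs_def] by (rule difference_quotient_l2[OF lu])
  have lGb: "l2 (\<lambda>x. G x \<bullet> b)" by (rule l2_inner[OF lG])
  have q: "(\<lambda>n. l2sq (\<lambda>x. q n x - G x \<bullet> b)) \<longlonglongrightarrow> 0"
    unfolding q_def by (rule difference_quotient_limit[OF S])
  have lg: "l2 (\<lambda>x. F' (u x) * \<phi> x)" by (rule l2_bounded_mult_real[OF mF' bound[OF I] l\<phi>])
  note [measurable] = l2_measurable[OF lq]
  define r where "r n x = (F (u (x + step n *\<^sub>R b)) - F (u x)) / step n - F' (u x) * q n x" for n x
  have lr: "l2 (r n)" for n unfolding r_def[abs_def] by (intro l2_diff difference_quotient_l2[OF Fl2] l2_bounded_mult_real[OF mF' bound[OF I] lq])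
  have C: "C \<ge> 0 \<or> (\<forall>n x. q n x = 0)"
  proof (rule ccontr)
    assume "\<not> (C \<ge> 0 \<or> (\<forall>n x. q n x = 0))"
    then obtain n x where "C < 0" "q n x \<noteq> 0" by auto
    then have "u (x + step n *\<^sub>R b) - u x \<noteq> 0" by (auto simp: q_def)
    then have "C * (u (x + step n *\<^sub>R b) - u x)\<^sup>2 < 0" using \<open>C < 0\<close> by (simp add: mult_neg_pos)
    then show False using taylor[OF I[of x] I[of "x + step n *\<^sub>R b"]] by linarith
  qed
  have rb: "\<bar>r n x\<bar> \<le> \<bar>C\<bar> * step n * (q n x)\<^sup>2" for n x
  proof -
    have "r n x = (F (u (x + step n *\<^sub>R b)) - F (u x) - F' (u x) * (u (x + step n *\<^sub>R b) - u x)) / step n"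
      by (simp only: r_def q_def times_divide_eq_right diff_divide_distrib[symmetric])
    then have "\<bar>r n x\<bar> = \<bar>F (u (x + step n *\<^sub>R b)) - F (u x) - F' (u x) * (u (x + step n *\<^sub>R b) - u x)\<bar> / step n" by simp
    also have "... \<le> (C * (u (x + step n *\<^sub>R b) - u x)\<^sup>2) / step n" by (intro divide_right_mono taylor I) auto
    also have "... = C * step n * (q n x)\<^sup>2" by (simp add: q_def power2_eq_square)
    also have "... \<le> \<bar>C\<bar> * step n * (q n x)\<^sup>2" by (intro mult_right_mono) auto
    finally show ?thesis .
  qed
  have "(\<lambda>n. LBINT x. r n x * \<phi> x) \<longlonglongrightarrow> 0"
  proof (rule Lim_null_comparison)
    have "(\<lambda>n. \<bar>C\<bar> * step n * B * l2sq (q n)) \<longlonglongrightarrow> \<bar>C\<bar> * 0 * B * l2sq (\<lambda>x. G x \<bullet> b)"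
      by (intro tendsto_intros step_tendsto l2sq_tendsto[OF lq lGb q])
    then show "(\<lambda>n. \<bar>C\<bar> * step n * B * l2sq (q n)) \<longlonglongrightarrow> 0" by simp
    show "\<forall>\<^sub>F n in sequentially. norm (LBINT x. r n x * \<phi> x) \<le> \<bar>C\<bar> * step n * B * l2sq (q n)"
    proof (intro always_eventually allI)
      fix n
      have "norm (LBINT x. r n x * \<phi> x) \<le> (LBINT x. \<bar>r n x * \<phi> x\<bar>)" unfolding real_norm_def by (rule integral_abs_bound)
      also have "... \<le> (LBINT x. \<bar>C\<bar> * step n * B * (norm (q n x))\<^sup>2)"
      proof (rule integral_mono)
        show "integrable lborel (\<lambda>x. \<bar>r n x * \<phi> x\<bar>)" using l2_real_mult_integrable[OF lr l\<phi>] by simp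
        show "integrable lborel (\<lambda>x. \<bar>C\<bar> * step n * B * (norm (q n x))\<^sup>2)" using l2_square_integrable[OF lq] by simp
        fix x
        have "\<bar>r n x * \<phi> x\<bar> \<le> (\<bar>C\<bar> * step n * (q n x)\<^sup>2) * B"
          unfolding abs_mult by (rule mult_mono[OF rb B(2)]) auto
        then show "\<bar>r n x * \<phi> x\<bar> \<le> \<bar>C\<bar> * step n * B * (norm (q n x))\<^sup>2" by (simp add: mult_ac)
      qed
      also have "... = \<bar>C\<bar> * step n * B * l2sq (q n)" by (simp add: l2sq_def)
      finally show "norm (LBINT x. r n x * \<phi> x) \<le> \<bar>C\<bar> * step n * B * l2sq (q n)" .
    qed
  qed
  moreover have "(\<lambda>n. LBINT x. q n x \<bullet> (F' (u x) * \<phi> x)) \<longlonglongrightarrow> (LBINT x. (G x \<bullet> b) \<bullet> (F' (u x) * \<phi> x))"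
    by (rule l2_weak_limit[OF lq lGb lg q])
  ultimately have "(\<lambda>n. (LBINT x. r n x * \<phi> x) + (LBINT x. q n x * (F' (u x) * \<phi> x))) \<longlonglongrightarrow>
      0 + (LBINT x. (G x \<bullet> b) * (F' (u x) * \<phi> x))" unfolding inner_real_def by (rule tendsto_add)
  moreover have "(LBINT x. r n x * \<phi> x) + (LBINT x. q n x * (F' (u x) * \<phi> x)) =
      (LBINT x. (F (u (x + step n *\<^sub>R b)) - F (u x)) / step n * \<phi> x)" for n
  proof -
    have "(LBINT x. r n x * \<phi> x) + (LBINT x. q n x * (F' (u x) * \<phi> x)) = (LBINT x. r n x * \<phi> x + q n x * (F' (u x) * \<phi> x))"
      by (rule Bochner_Integration.integral_add[symmetric]) (rule l2_real_mult_integrable[OF lr l\<phi>], rule l2_real_mult_integrable[OF lq lg])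
    also have "... = (LBINT x. (F (u (x + step n *\<^sub>R b)) - F (u x)) / step n * \<phi> x)"
      by (intro Bochner_Integration.integral_cong refl) (simp only: r_def left_diff_distrib right_diff_distrib mult_ac diff_add_cancel)
    finally show ?thesis .
  qed
  ultimately show "(\<lambda>n. LBINT x. (F (u (x + step n *\<^sub>R b)) - F (u x)) / step n * \<phi> x) \<longlonglongrightarrow>
      (LBINT x. ((F' (u x) *\<^sub>R G x) \<bullet> b) * \<phi> x)" by (simp add: mult_ac)
qed

text \<open>For the regularised modulus the remainder is (A B - a b - e^2) / A with A and B the
  lengths of (a,e) and (b,e). Cauchy-Schwarz in the plane gives its sign, and 2 A B \<le> A^2 + B^2
  its size.\<close>

lemma sqrt_taylor:
  assumes e: "e > 0"
  shows "\<bar>(sqrt (b\<^sup>2 + e\<^sup>2) - e) - (sqrt (a\<^sup>2 + e\<^sup>2) - e) - a / sqrt (a\<^sup>2 + e\<^sup>2) * (b - a)\<bar> \<le> 1 / (2 * e) * (b - a)\<^sup>2"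
proof -
  define A B where "A = sqrt (a\<^sup>2 + e\<^sup>2)" and "B = sqrt (b\<^sup>2 + e\<^sup>2)"
  have A2: "A\<^sup>2 = a\<^sup>2 + e\<^sup>2" and B2: "B\<^sup>2 = b\<^sup>2 + e\<^sup>2" by (auto simp: A_def B_def)
  have "sqrt (e\<^sup>2) \<le> A" unfolding A_def by (intro real_sqrt_le_mono) simp
  then have Ae: "A \<ge> e" using e by simp
  have "(a * b + e\<^sup>2)\<^sup>2 \<le> (A * B)\<^sup>2" unfolding power_mult_distrib A2 B2 using zero_le_power2[of "e * (a - b)"]
    by (simp add: power2_eq_square algebra_simps)
  then have lo: "a * b + e\<^sup>2 \<le> A * B" by (rule power2_le_imp_le) (simp add: A_def B_def)
  have "2 * A * B \<le> A\<^sup>2 + B\<^sup>2" by (rule sum_squares_bound)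
  then have hi: "A * B - a * b - e\<^sup>2 \<le> (b - a)\<^sup>2 / 2" unfolding A2 B2 by (simp add: power2_eq_square algebra_simps)
  have eq: "B - A - a / A * (b - a) = (A * B - a * b - e\<^sup>2) / A"
  proof -
    have "(B - A - a / A * (b - a)) * A = A * B - A\<^sup>2 - a * (b - a)" using Ae e by (simp add: field_simps power2_eq_square)
    also have "... = A * B - a * b - e\<^sup>2" unfolding A2 by (simp add: power2_eq_square algebra_simps)
    finally show ?thesis using Ae e by (subst nonzero_eq_divide_eq) auto
  qed
  have "0 \<le> (A * B - a * b - e\<^sup>2) / A" using lo Ae e by simp
  moreover have "(A * B - a * b - e\<^sup>2) / A \<le> ((b - a)\<^sup>2 / 2) / e" using hi Ae e lo by (intro frac_le) auto
  ultimately show ?thesis using eq by (simp add: A_def[symmetric] B_def[symmetric])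
qed

text \<open>The regularised moduli converge together with their gradients, by domination. Their
  derivatives vanish at 0 and tend to \<open>sgn\<close>, so the gradient of the limit is 0 where u
  vanishes.\<close>

theorem sob_abs:
  fixes u :: "'a::euclidean_space \<Rightarrow> real"
  assumes S: "sob u G" shows "sob (\<lambda>x. \<bar>u x\<bar>) (\<lambda>x. sgn (u x) *\<^sub>R G x)"
proof -
  note lu = sob_l2(1)[OF S] and lG = sob_l2(2)[OF S]
  note [measurable] = l2_measurable[OF lu] l2_measurable[OF lG]
  define F where "F n s = sqrt (s\<^sup>2 + (step n)\<^sup>2) - step n" for n s
  define D where "D n s = s / sqrt (s\<^sup>2 + (step n)\<^sup>2)" for n s
  have sq: "\<bar>s\<bar> \<le> sqrt (s\<^sup>2 + (step n)\<^sup>2)" "sqrt (s\<^sup>2 + (step n)\<^sup>2) \<le> \<bar>s\<bar> + step n" "0 < sqrt (s\<^sup>2 + (step n)\<^sup>2)" for n s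
  proof -
    show "\<bar>s\<bar> \<le> sqrt (s\<^sup>2 + (step n)\<^sup>2)" by (rule real_le_rsqrt) simp
    show "sqrt (s\<^sup>2 + (step n)\<^sup>2) \<le> \<bar>s\<bar> + step n" by (rule real_le_lsqrt) (auto simp: power2_sum)
    show "0 < sqrt (s\<^sup>2 + (step n)\<^sup>2)" by (simp add: add_nonneg_pos)
  qed
  have Fb: "\<bar>F n s\<bar> \<le> \<bar>s\<bar>" "\<bar>F n s - \<bar>s\<bar>\<bar> \<le> step n" for n s
  proof -
    have "step n \<le> sqrt (s\<^sup>2 + (step n)\<^sup>2)" by (rule real_le_rsqrt) simp
    then show "\<bar>F n s\<bar> \<le> \<bar>s\<bar>" using sq(2)[of s n] by (simp add: F_def)
    show "\<bar>F n s - \<bar>s\<bar>\<bar> \<le> step n" using sq(1)[of s n] sq(2)[of s n] by (simp add: F_def)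
  qed
  have Db: "\<bar>D n s\<bar> \<le> 1" for n s using sq(1)[of s n] sq(3)[of s n] by (simp add: D_def)
  have lF: "l2 (\<lambda>x. F n (u x))" for n
  proof -
    have "integrable lborel (\<lambda>x. (norm (F n (u x)))\<^sup>2)" by (rule Bochner_Integration.integrable_bound[OF l2_square_integrable[OF lu]])
        (use Fb(1) in \<open>auto simp: F_def intro!: AE_I2 power_mono abs_le_square_iff[THEN iffD1]\<close>)
    then show ?thesis by (simp add: l2_def F_def)
  qed
  have Sn: "sob (\<lambda>x. F n (u x)) (\<lambda>x. D n (u x) *\<^sub>R G x)" for n
    by (rule sob_chain_rule[OF S, where I=UNIV and C="1 / (2 * step n)" and M=1])
      (use lF sqrt_taylor[OF step_pos] Db in \<open>auto simp: F_def D_def\<close>)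
  have la: "l2 (\<lambda>x. \<bar>u x\<bar>)" using lu by (simp add: l2_def)
  have ls: "l2 (\<lambda>x. sgn (u x) *\<^sub>R G x)" by (rule l2_bounded_mult[OF _ _ lG, of _ 1]) (auto simp: sgn_real_def)
  have 1: "(\<lambda>n. l2sq (\<lambda>x. F n (u x) - \<bar>u x\<bar>)) \<longlonglongrightarrow> l2sq (\<lambda>x::'a. 0::real)" unfolding l2sq_def
  proof (rule integral_dominated_convergence[where w="\<lambda>x. 4 * (norm (u x))\<^sup>2"])
    show "AE x in lborel. (\<lambda>n. (norm (F n (u x) - \<bar>u x\<bar>))\<^sup>2) \<longlonglongrightarrow> (norm (0::real))\<^sup>2"
    proof (rule AE_I2)
      fix x
      have "(\<lambda>n. F n (u x) - \<bar>u x\<bar>) \<longlonglongrightarrow> 0"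
        by (rule Lim_null_comparison[OF _ step_tendsto]) (use Fb(2) in auto)
      then show "(\<lambda>n. (norm (F n (u x) - \<bar>u x\<bar>))\<^sup>2) \<longlonglongrightarrow> (norm (0::real))\<^sup>2"
        by (intro tendsto_power tendsto_norm)
    qed
    show "AE x in lborel. norm ((norm (F n (u x) - \<bar>u x\<bar>))\<^sup>2) \<le> 4 * (norm (u x))\<^sup>2" for n
    proof (rule AE_I2)
      fix x
      have "\<bar>F n (u x) - \<bar>u x\<bar>\<bar> \<le> 2 * \<bar>u x\<bar>" using Fb(1)[of n "u x"] by linarith
      from power_mono[OF this, of 2] show "norm ((norm (F n (u x) - \<bar>u x\<bar>))\<^sup>2) \<le> 4 * (norm (u x))\<^sup>2"
        by (simp add: power_mult_distrib)
    qed
    show "integrable lborel (\<lambda>x. 4 * (norm (u x))\<^sup>2)" using l2_square_integrable[OF lu] by simp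
  qed (auto simp: F_def)
  have 2: "(\<lambda>n. l2sq (\<lambda>x. D n (u x) *\<^sub>R G x - sgn (u x) *\<^sub>R G x)) \<longlonglongrightarrow> l2sq (\<lambda>x::'a. 0::'a)"
    unfolding l2sq_def
  proof (rule integral_dominated_convergence[where w="\<lambda>x. 4 * (norm (G x))\<^sup>2"])
    show "AE x in lborel. (\<lambda>n. (norm (D n (u x) *\<^sub>R G x - sgn (u x) *\<^sub>R G x))\<^sup>2) \<longlonglongrightarrow> (norm (0::'a))\<^sup>2"
    proof (rule AE_I2)
      fix x
      have "(\<lambda>n. D n (u x)) \<longlonglongrightarrow> sgn (u x)"
      proof (cases "u x = 0")
        case False
        have "(\<lambda>n. D n (u x)) \<longlonglongrightarrow> u x / sqrt ((u x)\<^sup>2 + 0\<^sup>2)"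
          unfolding D_def by (intro tendsto_intros step_tendsto) (use False in auto)
        then show ?thesis using False by (simp add: real_sgn_eq)
      qed (simp add: D_def)
      then have "(\<lambda>n. (norm (D n (u x) *\<^sub>R G x - sgn (u x) *\<^sub>R G x))\<^sup>2) \<longlonglongrightarrow> (norm (sgn (u x) *\<^sub>R G x - sgn (u x) *\<^sub>R G x))\<^sup>2"
        by (intro tendsto_intros)
      then show "(\<lambda>n. (norm (D n (u x) *\<^sub>R G x - sgn (u x) *\<^sub>R G x))\<^sup>2) \<longlonglongrightarrow> (norm (0::'a))\<^sup>2" by simp
    qed
    show "AE x in lborel. norm ((norm (D n (u x) *\<^sub>R G x - sgn (u x) *\<^sub>R G x))\<^sup>2) \<le> 4 * (norm (G x))\<^sup>2" for n
    proof (rule AE_I2)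
      fix x
      have "\<bar>D n (u x) - sgn (u x)\<bar> \<le> 2" using Db[of n "u x"] by (auto simp: sgn_real_def)
      from power_mono[OF this, of 2] have "(D n (u x) - sgn (u x))\<^sup>2 \<le> 4" by simp
      from mult_right_mono[OF this, of "(norm (G x))\<^sup>2"]
      show "norm ((norm (D n (u x) *\<^sub>R G x - sgn (u x) *\<^sub>R G x))\<^sup>2) \<le> 4 * (norm (G x))\<^sup>2"
        by (simp add: power_mult_distrib flip: scaleR_left_diff_distrib)
    qed
    show "integrable lborel (\<lambda>x. 4 * (norm (G x))\<^sup>2)" using l2_square_integrable[OF lG] by simp
  qed (auto simp: D_def)
  show ?thesis by (rule sob_limit[OF Sn la ls]) (use 1 2 in simp_all)
qed

lemma l2sq_sgn_le:
  assumes S: "sob u G" shows "l2sq (\<lambda>x. sgn (u x) *\<^sub>R G x) \<le> l2sq G"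
  unfolding l2sq_def by (rule integral_mono) (use l2_square_integrable[OF sob_l2(2)[OF sob_abs[OF S]]] l2_square_integrable[OF sob_l2(2)[OF S]] in
      \<open>auto simp: sgn_real_def\<close>)

section \<open>Multiplication by smooth cutoffs\<close>

definition grad :: "('a::euclidean_space \<Rightarrow> real) \<Rightarrow> 'a \<Rightarrow> 'a" where
  "grad \<phi> x = (\<Sum>b\<in>Basis. pdiff \<phi> x b *\<^sub>R b)"

lemma grad_inner_Basis: "b \<in> Basis \<Longrightarrow> grad \<phi> x \<bullet> b = pdiff \<phi> x b"
  by (simp add: grad_def inner_sum_left inner_Basis if_distrib cong: if_cong)

lemma pdiff_bump_mult:
  fixes \<phi> \<psi> :: "'a::euclidean_space \<Rightarrow> real"
  assumes "\<phi> \<in> smooth_class" "\<psi> \<in> smooth_class"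
  shows "pdiff (\<lambda>x. \<phi> x * \<psi> x) x b = \<phi> x * pdiff \<psi> x b + pdiff \<phi> x b * \<psi> x"
  using fun_cong[OF frechet_derivative_at[OF has_derivative_mult[OF has_derivative_pdiff[OF assms(1)] has_derivative_pdiff[OF assms(2)]]], of x b]
  by simp

lemma grad_bump_facts:
  assumes \<phi>: "\<phi> \<in> bumps"
  shows "grad \<phi> \<in> borel_measurable borel" "\<exists>M. \<forall>x. norm (grad \<phi> x) \<le> M" "l2 (grad \<phi>)"
proof -
  have m: "(\<lambda>x. pdiff \<phi> x b) \<in> borel_measurable borel" for b by (rule bumps_measurable[OF pdiff_bumps[OF \<phi>]])
  then show mg: "grad \<phi> \<in> borel_measurable borel" unfolding grad_def[abs_def] by measurable
  have "\<exists>M. \<forall>x. \<bar>pdiff \<phi> x b\<bar> \<le> M" for b using bumps_bounded[OF pdiff_bumps[OF \<phi>]] by metis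
  then obtain M where M: "\<And>b x. \<bar>pdiff \<phi> x b\<bar> \<le> M b" by metis
  have "norm (grad \<phi> x) \<le> (\<Sum>b\<in>Basis. M b)" for x
    unfolding grad_def by (rule order_trans[OF norm_sum]) (use M in \<open>auto intro!: sum_mono\<close>)
  then show "\<exists>M. \<forall>x. norm (grad \<phi> x) \<le> M" by blast
  have lp: "l2 (\<lambda>x. pdiff \<phi> x b)" for b using test_function_l2 pdiff_bumps[OF \<phi>] bumps_test_functions by blast
  have "integrable lborel (\<lambda>x. (\<Sum>b\<in>Basis. (norm (pdiff \<phi> x b))\<^sup>2))"
    using l2_square_integrable[OF lp] by (intro Bochner_Integration.integrable_sum)
  moreover have "(norm (grad \<phi> x))\<^sup>2 = (\<Sum>b\<in>Basis. (norm (pdiff \<phi> x b))\<^sup>2)" for x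
    unfolding power2_norm_eq_inner by (subst euclidean_inner) (simp add: grad_inner_Basis power2_eq_square)
  ultimately show "l2 (grad \<phi>)" using mg by (simp add: l2_def)
qed

text \<open>Obtained by testing the indicator of a ball around the support: steps are at most 1, so
  within the support its difference quotients vanish.\<close>

lemma integral_pdiff_bump:
  fixes \<phi> :: "'a::euclidean_space \<Rightarrow> real"
  assumes \<phi>: "\<phi> \<in> bumps" and b: "b \<in> Basis"
  shows "(LBINT x. pdiff \<phi> x b) = 0"
proof -
  have \<phi>t: "\<phi> \<in> test_functions" using \<phi> bumps_test_functions by auto
  obtain R where R: "R > 0" "\<And>x. norm x > R \<Longrightarrow> \<phi> x = 0" "\<And>x v. norm x > R \<Longrightarrow> pdiff \<phi> x v = 0"
    using test_function_facts[OF \<phi>t] by metis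
  define u where "u = (indicator (cball 0 (R + 1)) :: 'a \<Rightarrow> real)"
  have lu: "l2 u" unfolding u_def by (rule indicator_cball_l2)
  have z: "(u (x + step n *\<^sub>R b) - u x) / step n * \<phi> x = 0" for n x
  proof (cases "norm x > R")
    case False
    have "norm (x + step n *\<^sub>R b) \<le> norm x + step n" using norm_triangle_ineq[of x "step n *\<^sub>R b"] b by simp
    then have "norm (x + step n *\<^sub>R b) \<le> R + 1" using False step_le_1[of n] by linarith
    then show ?thesis using False by (simp add: u_def)
  qed (simp add: R)
  have "(LBINT x. u x * pdiff \<phi> x b) = 0" using test_function_difference_quotient[OF lu \<phi>t b] unfolding z by (simp add: LIMSEQ_const_iff)
  moreover have "u x * pdiff \<phi> x b = pdiff \<phi> x b" for x using R(3)[of x b] by (cases "norm x > R") (auto simp: u_def)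
  ultimately show ?thesis by simp
qed

lemma sob_bump:
  fixes \<phi> :: "'a::euclidean_space \<Rightarrow> real"
  assumes \<phi>: "\<phi> \<in> bumps" shows "sob \<phi> (grad \<phi>)"
  unfolding sob_def
proof (intro conjI ballI)
  have \<phi>t: "\<phi> \<in> test_functions" using \<phi> bumps_test_functions by auto
  show lp: "l2 \<phi>" by (rule test_function_l2[OF \<phi>t])
  show "l2 (grad \<phi>)" by (rule grad_bump_facts(3)[OF \<phi>])
  fix \<psi> :: "'a \<Rightarrow> real" and b :: 'a assume \<psi>: "\<psi> \<in> bumps" and b: "b \<in> Basis"
  have sm: "\<phi> \<in> smooth_class" "\<psi> \<in> smooth_class" using \<phi> \<psi> by (auto simp: bumps_def)
  have lpd: "l2 (\<lambda>x. pdiff \<psi> x b)" "l2 (\<lambda>x. pdiff \<phi> x b)" "l2 \<psi>"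
    using test_function_l2 pdiff_bumps \<phi> \<psi> bumps_test_functions by blast+
  have "(LBINT x. \<phi> x * pdiff \<psi> x b + pdiff \<phi> x b * \<psi> x) = 0"
    using integral_pdiff_bump[OF bumps_mult_left[OF sm(1) \<psi>] b] by (simp add: pdiff_bump_mult[OF sm])
  then show "(LBINT x. \<phi> x * pdiff \<psi> x b) = - (LBINT x. (grad \<phi> x \<bullet> b) * \<psi> x)"
    using l2_real_mult_integrable[OF lp lpd(1)] l2_real_mult_integrable[OF lpd(2,3)] b by (simp add: grad_inner_Basis)
qed

text \<open>The product \<phi> \<psi> is itself a bump and is inserted into the equation for u; the
  product rule is thus needed for smooth functions only.\<close>

lemma sob_mult_bump:
  fixes u \<phi> :: "'a::euclidean_space \<Rightarrow> real"
  assumes S: "sob u G" and \<phi>: "\<phi> \<in> bumps"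
  shows "sob (\<lambda>x. \<phi> x * u x) (\<lambda>x. \<phi> x *\<^sub>R G x + u x *\<^sub>R grad \<phi> x)"
  unfolding sob_def
proof (intro conjI ballI)
  note lu = sob_l2(1)[OF S] and lG = sob_l2(2)[OF S]
  note [measurable] = l2_measurable[OF lu] l2_measurable[OF lG] bumps_measurable[OF \<phi>] grad_bump_facts(1)[OF \<phi>]
  obtain B where B: "\<And>x. \<bar>\<phi> x\<bar> \<le> B" using bumps_bounded[OF \<phi>] by metis
  show "l2 (\<lambda>x. \<phi> x * u x)" by (rule l2_bounded_mult_real[OF bumps_measurable[OF \<phi>] B lu])
  obtain M where M: "\<And>x. norm (grad \<phi> x) \<le> M" using grad_bump_facts(2)[OF \<phi>] by blast
  have lug: "l2 (\<lambda>x. u x *\<^sub>R grad \<phi> x)"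
  proof -
    have "integrable lborel (\<lambda>x. (norm (u x *\<^sub>R grad \<phi> x))\<^sup>2)"
    proof (rule Bochner_Integration.integrable_bound[OF integrable_mult_right[OF l2_square_integrable[OF lu], of "M\<^sup>2"]])
      have "(norm (grad \<phi> x))\<^sup>2 * (u x)\<^sup>2 \<le> M\<^sup>2 * (u x)\<^sup>2" for x by (intro mult_right_mono power_mono M) auto
      then show "AE x in lborel. norm ((norm (u x *\<^sub>R grad \<phi> x))\<^sup>2) \<le> norm (M\<^sup>2 * (norm (u x))\<^sup>2)"
        by (simp add: power_mult_distrib mult.commute)
    qed simp
    then show ?thesis by (simp add: l2_def)
  qed
  have l\<phi>G: "l2 (\<lambda>x. \<phi> x *\<^sub>R G x)" by (rule l2_bounded_mult[OF bumps_measurable[OF \<phi>] B lG])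
  show "l2 (\<lambda>x. \<phi> x *\<^sub>R G x + u x *\<^sub>R grad \<phi> x)" by (rule l2_add[OF l\<phi>G lug])
  fix \<psi> :: "'a \<Rightarrow> real" and b :: 'a assume \<psi>: "\<psi> \<in> bumps" and b: "b \<in> Basis"
  have sm: "\<phi> \<in> smooth_class" "\<psi> \<in> smooth_class" using \<phi> \<psi> by (auto simp: bumps_def)
  have \<phi>\<psi>: "(\<lambda>x. \<phi> x * \<psi> x) \<in> bumps" by (rule bumps_mult_left[OF sm(1) \<psi>])
  have p\<phi>\<psi>: "(\<lambda>x. pdiff \<phi> x b * \<psi> x) \<in> bumps" by (rule bumps_mult_left[OF pdiff_smooth[OF sm(1)] \<psi>])
  have \<phi>p: "(\<lambda>x. \<phi> x * pdiff \<psi> x b) \<in> bumps" by (rule bumps_mult_left[OF sm(1) pdiff_bumps[OF \<psi>]])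
  note i1 = integrable_l2_bump[OF lu p\<phi>\<psi>] and i2 = integrable_l2_bump[OF lu \<phi>p]
    and i3 = integrable_l2_bump[OF l2_inner[OF lG] \<phi>\<psi>, of b]
  have "(LBINT x. u x * pdiff (\<lambda>x. \<phi> x * \<psi> x) x b) = - (LBINT x. (G x \<bullet> b) * (\<phi> x * \<psi> x))"
    using S \<phi>\<psi> b by (simp add: sob_def)
  then have "(LBINT x. u x * (\<phi> x * pdiff \<psi> x b)) + (LBINT x. u x * (pdiff \<phi> x b * \<psi> x)) = - (LBINT x. (G x \<bullet> b) * (\<phi> x * \<psi> x))"
    using i1 i2 by (simp add: pdiff_bump_mult[OF sm] distrib_left)
  moreover have "(LBINT x. ((\<phi> x *\<^sub>R G x + u x *\<^sub>R grad \<phi> x) \<bullet> b) * \<psi> x) =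
      (LBINT x. (G x \<bullet> b) * (\<phi> x * \<psi> x) + u x * (pdiff \<phi> x b * \<psi> x))"
    using b by (intro Bochner_Integration.integral_cong refl) (simp add: inner_add_left grad_inner_Basis algebra_simps)
  moreover have "... = (LBINT x. (G x \<bullet> b) * (\<phi> x * \<psi> x)) + (LBINT x. u x * (pdiff \<phi> x b * \<psi> x))"
    by (rule Bochner_Integration.integral_add[OF i3 i1])
  moreover have "(LBINT x. \<phi> x * u x * pdiff \<psi> x b) = (LBINT x. u x * (\<phi> x * pdiff \<psi> x b))" by (simp add: mult_ac)
  ultimately show "(LBINT x. \<phi> x * u x * pdiff \<psi> x b) = - (LBINT x. ((\<phi> x *\<^sub>R G x + u x *\<^sub>R grad \<phi> x) \<bullet> b) * \<psi> x)"
    by simp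
qed

section \<open>The minimizer is a positive solution\<close>

definition mform :: "('a::euclidean_space \<Rightarrow> real) \<Rightarrow> ('a \<Rightarrow> real) \<Rightarrow> real" where
  "mform u v = (LBINT x. u x * v x)"

lemma mform_add: "l2 u \<Longrightarrow> l2 v \<Longrightarrow> l2 w \<Longrightarrow> mform u (\<lambda>x. v x + w x) = mform u v + mform u w"
  unfolding mform_def using l2_real_mult_integrable[of u v] l2_real_mult_integrable[of u w] by (simp add: distrib_left)

lemma mform_scale: "mform u (\<lambda>x. c * v x) = c * mform u v"
  unfolding mform_def by (simp flip: integral_mult_right_zero add: mult_ac)

lemma mform_self: "mform u u = l2sq u"
  unfolding mform_def l2sq_def by (simp add: power2_eq_square)

context schrod
begin

lemma minimizerD:
  assumes "minimizer R0 C0 \<rho> U G"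
  shows "sob U G" "l2sq U = \<rho>\<^sup>2" "l2sq G \<le> C0 * \<rho>\<^sup>2" "EE U G < 0"
    "sob w K \<Longrightarrow> l2sq K \<le> R0 \<Longrightarrow> l2sq w \<le> \<rho>\<^sup>2 \<Longrightarrow> EE U G * (l2sq w / \<rho>\<^sup>2) \<le> EE w K"
  using assms by (auto simp: minimizer_def)

lemma minimizer_abs:
  assumes "minimizer R0 C0 \<rho> U G"
  shows "minimizer R0 C0 \<rho> (\<lambda>x. \<bar>U x\<bar>) (\<lambda>x. sgn (U x) *\<^sub>R G x)"
proof -
  note S = minimizerD(1)[OF assms] and U = minimizerD(2-4)[OF assms] and min = minimizerD(5)[OF assms]
  have le: "EE (\<lambda>x. \<bar>U x\<bar>) (\<lambda>x. sgn (U x) *\<^sub>R G x) \<le> EE U G"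
  proof -
    have "QV (\<lambda>x. \<bar>U x\<bar>) (\<lambda>x. \<bar>U x\<bar>) = QV U U" by (simp add: QV_def mult.assoc)
    moreover have "PP (\<lambda>x. \<bar>U x\<bar>) = PP U" by (simp add: PP_def)
    ultimately show ?thesis using l2sq_sgn_le[OF S] by (simp add: EE_def)
  qed
  have "EE (\<lambda>x. \<bar>U x\<bar>) (\<lambda>x. sgn (U x) *\<^sub>R G x) * (l2sq w / \<rho>\<^sup>2) \<le> EE w K"
    if "sob w K" "l2sq K \<le> R0" "l2sq w \<le> \<rho>\<^sup>2" for w K
    using min[OF that] mult_right_mono[OF le, of "l2sq w / \<rho>\<^sup>2"] by simp
  moreover have "l2sq (\<lambda>x. \<bar>U x\<bar>) = \<rho>\<^sup>2" using U by (simp add: l2sq_def)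
  ultimately show ?thesis unfolding minimizer_def using sob_abs[OF S] l2sq_sgn_le[OF S] U le by auto
qed

text \<open>The variation U + \<tau> v - \<tau>^2 b U is corrected at second order, just enough to
  keep the mass at most \<rho>^2. The correction does not affect the first variation, and no
  normalisation by a square root occurs.\<close>

lemma minimizer_dE_nonneg:
  assumes M: "minimizer R0 C0 \<rho> U G" and \<rho>: "\<rho> > 0" "C0 * \<rho>\<^sup>2 < R0"
    and T: "sob v H" and orth: "mform U v = 0"
  shows "dE U G v H \<ge> 0"
proof -
  note S = minimizerD(1)[OF M] and U = minimizerD(2-4)[OF M] and min = minimizerD(5)[OF M]
  have \<rho>2: "\<rho>\<^sup>2 > 0" using \<rho> by simp
  note lU = sob_l2(1)[OF S] and lG = sob_l2(2)[OF S] and lv = sob_l2(1)[OF T] and lH = sob_l2(2)[OF T]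
  \<comment> \<open>With s = \<tau>^2 b one has s \<rho>^2 = \<tau>^2 |v|^2, so replacing (1 - s)^2
    by 1 - s in the mass gives exactly \<rho>^2.\<close>
  define b where "b = l2sq v / \<rho>\<^sup>2"
  have b0: "b \<ge> 0" by (simp add: b_def)
  define s where "s n = (step n)\<^sup>2 * b" for n
  define \<psi> where "\<psi> n x = step n * v x + (- s n) * U x" for n x
  define \<Psi> where "\<Psi> n x = step n *\<^sub>R H x + (- s n) *\<^sub>R G x" for n x
  have S\<psi>: "sob (\<psi> n) (\<Psi> n)" for n unfolding \<psi>_def[abs_def] \<Psi>_def[abs_def] by (intro sob_add sob_scale S T)
  define \<Lambda> where "\<Lambda> = 2 * l2sq H + 2 * b\<^sup>2 * l2sq G"
  define \<Lambda>' where "\<Lambda>' = 2 * absV v + 2 * b\<^sup>2 * absV U"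
  have \<Lambda>0: "\<Lambda> \<ge> 0" "\<Lambda>' \<ge> 0" by (auto simp: \<Lambda>_def \<Lambda>'_def absV_nonneg)
  have s2: "(s n)\<^sup>2 \<le> (step n)\<^sup>2 * b\<^sup>2" for n
  proof -
    have "(step n)\<^sup>2 \<le> 1" by (simp add: power_le_one)
    then have "(step n)\<^sup>2 * (step n)\<^sup>2 * b\<^sup>2 \<le> (step n)\<^sup>2 * 1 * b\<^sup>2" by (intro mult_right_mono mult_left_mono) auto
    then show ?thesis by (simp add: s_def power_mult_distrib power2_eq_square mult_ac)
  qed
  have l\<Psi>: "l2sq (\<Psi> n) \<le> (step n)\<^sup>2 * \<Lambda>" for n
  proof -
    have "l2sq (\<Psi> n) \<le> 2 * ((step n)\<^sup>2 * l2sq H) + 2 * ((s n)\<^sup>2 * l2sq G)"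
      unfolding \<Psi>_def[abs_def] using l2sq_diff_le2[OF l2_scale[OF lH, of "step n"] l2_scale[OF lG, of "- s n"]] unfolding l2sq_scale by simp
    also have "... \<le> 2 * ((step n)\<^sup>2 * l2sq H) + 2 * ((step n)\<^sup>2 * b\<^sup>2 * l2sq G)"
      using s2[of n] by (intro add_left_mono mult_left_mono mult_right_mono) auto
    finally show ?thesis by (simp add: \<Lambda>_def algebra_simps)
  qed
  have absV_scale: "absV (\<lambda>x. c * w x) = c\<^sup>2 * absV w" for c w
    by (simp add: absV_def power_mult_distrib mult.left_commute flip: integral_mult_right_zero)
  have a\<psi>: "absV (\<psi> n) \<le> (step n)\<^sup>2 * \<Lambda>'" for n
  proof -
    have "absV (\<psi> n) \<le> 2 * ((step n)\<^sup>2 * absV v) + 2 * ((s n)\<^sup>2 * absV U)"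
      unfolding \<psi>_def[abs_def] using absV_add_le[OF sob_scale[OF T, of "step n"] sob_scale[OF S, of "- s n"]] unfolding absV_scale by simp
    also have "... \<le> 2 * ((step n)\<^sup>2 * absV v) + 2 * ((step n)\<^sup>2 * b\<^sup>2 * absV U)"
      using s2[of n] absV_nonneg by (intro add_left_mono mult_left_mono mult_right_mono) auto
    finally show ?thesis by (simp add: \<Lambda>'_def algebra_simps)
  qed
  define C where "C = \<Lambda> / 2 + \<Lambda>' / 2 + (p - 1) * (PK * (l2sq G + \<Lambda>) powr (p / DIM('a)) * \<Lambda>)"
  have rem: "l2sq (\<Psi> n) / 2 + absV (\<psi> n) / 2 + (p - 1) * (PK * (l2sq G + l2sq (\<Psi> n)) powr (p / DIM('a)) * l2sq (\<Psi> n)) \<le> (step n)\<^sup>2 * C" for n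
  proof -
    have "(step n)\<^sup>2 * \<Lambda> \<le> 1 * \<Lambda>" using \<Lambda>0 by (intro mult_right_mono) (auto simp: power_le_one)
    then have "l2sq (\<Psi> n) \<le> \<Lambda>" using l\<Psi>[of n] by simp
    then have "(l2sq G + l2sq (\<Psi> n)) powr (p / DIM('a)) \<le> (l2sq G + \<Lambda>) powr (p / DIM('a))" using p2 by (intro powr_mono2) auto
    then have "(p - 1) * (PK * (l2sq G + l2sq (\<Psi> n)) powr (p / DIM('a)) * l2sq (\<Psi> n)) \<le>
        (p - 1) * (PK * (l2sq G + \<Lambda>) powr (p / DIM('a)) * ((step n)\<^sup>2 * \<Lambda>))"
      using p2 PK_nonneg l\<Psi>[of n] by (intro mult_left_mono mult_mono) auto
    then show ?thesis using l\<Psi>[of n] a\<psi>[of n] by (simp add: C_def algebra_simps)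
  qed
  have slim: "s \<longlonglongrightarrow> 0"
  proof -
    have "(\<lambda>n. (step n)\<^sup>2 * b) \<longlonglongrightarrow> 0\<^sup>2 * b" by (intro tendsto_intros step_tendsto)
    then show ?thesis by (simp add: s_def[abs_def])
  qed
  have e1: "\<forall>\<^sub>F n in sequentially. s n < 1" by (rule order_tendstoD(2)[OF slim]) simp
  have e2: "\<forall>\<^sub>F n in sequentially. l2sq (\<lambda>x. G x + \<Psi> n x) < R0"
  proof (rule order_tendstoD(2))
    show "(\<lambda>n. l2sq (\<lambda>x. G x + \<Psi> n x)) \<longlonglongrightarrow> l2sq G"
    proof (rule l2sq_tendsto[OF l2_add[OF lG sob_l2(2)[OF S\<psi>]] lG])
      show "(\<lambda>n. l2sq (\<lambda>x. G x + \<Psi> n x - G x)) \<longlonglongrightarrow> 0"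
      proof (rule Lim_null_comparison)
        have "(\<lambda>n. (step n)\<^sup>2 * \<Lambda>) \<longlonglongrightarrow> 0\<^sup>2 * \<Lambda>" by (intro tendsto_intros step_tendsto)
        then show "(\<lambda>n. (step n)\<^sup>2 * \<Lambda>) \<longlonglongrightarrow> 0" by simp
        have "(\<lambda>x. G x + \<Psi> n x - G x) = \<Psi> n" for n by auto
        then show "\<forall>\<^sub>F n in sequentially. norm (l2sq (\<lambda>x. G x + \<Psi> n x - G x)) \<le> (step n)\<^sup>2 * \<Lambda>"
          using l\<Psi> by simp
      qed
    qed
    show "l2sq G < R0" using U(2) \<rho>(2) by simp
  qed
  have ineq: "\<forall>\<^sub>F n in sequentially. 0 \<le> dE U G v H - step n * b * dE U G U G + step n * C" using e1 e2
  proof eventually_elim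
    case (elim n)
    have s0: "s n \<ge> 0" using b0 by (simp add: s_def)
    define w where "w x = U x + \<psi> n x" for x
    have w: "w x = (1 - s n) * U x + step n * v x" for x by (simp add: w_def \<psi>_def algebra_simps)
    have "l2sq w = (1 - s n)\<^sup>2 * \<rho>\<^sup>2 + (step n)\<^sup>2 * l2sq v"
    proof -
      have "l2sq w = l2sq (\<lambda>x. (1 - s n) * U x) + 2 * (LBINT x. ((1 - s n) * U x) \<bullet> (step n * v x)) + l2sq (\<lambda>x. step n * v x)"
        unfolding w[abs_def] by (rule l2sq_add_eq[OF l2_cmult[OF lU] l2_cmult[OF lv]])
      also have "(LBINT x. ((1 - s n) * U x) \<bullet> (step n * v x)) = (1 - s n) * step n * mform U v"
        unfolding mform_def by (simp flip: integral_mult_right_zero add: mult_ac)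
      finally show ?thesis using orth U(1) by (simp add: l2sq_cmult)
    qed
    also have "... \<le> (1 - s n) * \<rho>\<^sup>2 + (step n)\<^sup>2 * l2sq v"
    proof -
      have "(1 - s n) * (1 - s n) \<le> 1 * (1 - s n)" using elim(1) s0 by (intro mult_right_mono) auto
      then have "(1 - s n)\<^sup>2 \<le> 1 - s n" by (simp add: power2_eq_square)
      then show ?thesis by (intro add_right_mono mult_right_mono) auto
    qed
    also have "... = \<rho>\<^sup>2" using \<rho>2 by (simp add: s_def b_def field_simps)
    finally have lw: "l2sq w \<le> \<rho>\<^sup>2" .
    have "EE U G * (l2sq w / \<rho>\<^sup>2) \<le> EE w (\<lambda>x. G x + \<Psi> n x)"
      using elim(2) lw sob_add[OF S S\<psi>[of n]] by (intro min) (auto simp: w_def[abs_def])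
    \<comment> \<open>The energy of U is negative, so falling below the full mass only weakens the
      lower bound in the useful direction.\<close>
    moreover have "EE U G \<le> EE U G * (l2sq w / \<rho>\<^sup>2)"
    proof -
      have "l2sq w / \<rho>\<^sup>2 \<le> 1" using lw \<rho>2 by simp
      from mult_left_mono_neg[OF this, of "EE U G"] U(3) show ?thesis by simp
    qed
    ultimately have "EE U G \<le> EE (\<lambda>x. U x + \<psi> n x) (\<lambda>x. G x + \<Psi> n x)" by (simp add: w_def[abs_def])
    then have "0 \<le> dE U G (\<psi> n) (\<Psi> n) + (step n)\<^sup>2 * C" using energy_expansion[OF S S\<psi>[of n]] rem[of n] by linarith
    also have "dE U G (\<psi> n) (\<Psi> n) = step n * dE U G v H + (- s n) * dE U G U G" unfolding \<psi>_def[abs_def] \<Psi>_def[abs_def]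
      by (subst dE_add[OF S sob_scale[OF T] sob_scale[OF S]]) (simp only: dE_scale)
    finally have "0 \<le> step n * (dE U G v H - step n * b * dE U G U G + step n * C)" by (simp add: s_def power2_eq_square algebra_simps)
    then show ?case by (simp add: zero_le_mult_iff not_le[symmetric] flip: step_pos) (meson step_pos not_le)
  qed
  have "(\<lambda>n. dE U G v H - step n * b * dE U G U G + step n * C) \<longlonglongrightarrow> dE U G v H - 0 * b * dE U G U G + 0 * C"
    by (intro tendsto_intros step_tendsto)
  from tendsto_lowerbound[OF this ineq] show ?thesis by simp
qed

text \<open>A direction minus its component along U is tangent, and the derivative vanishes on
  tangent directions.\<close>

lemma Lagrange_multiplier:
  assumes S: "sob U G" and U: "l2sq U > 0"
    and zero: "\<And>v H. sob v H \<Longrightarrow> mform U v = 0 \<Longrightarrow> dE U G v H = 0" and T: "sob v H"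
  shows "dE U G v H = dE U G U G / l2sq U * mform U v"
proof -
  define c where "c = - (mform U v / l2sq U)"
  note Sc = sob_scale[OF S, of c]
  have "mform U (\<lambda>x. v x + c * U x) = 0" unfolding mform_add[OF sob_l2(1)[OF S] sob_l2(1)[OF T] sob_l2(1)[OF Sc]] mform_scale mform_self
    using U by (simp add: c_def)
  from zero[OF sob_add[OF T Sc] this] have "dE U G v H + c * dE U G U G = 0" by (simp only: dE_add[OF S T Sc] dE_scale)
  then show ?thesis by (simp add: c_def)
qed

theorem minimizer_critical:
  assumes M: "minimizer R0 C0 \<rho> U G" and \<rho>: "\<rho> > 0" "C0 * \<rho>\<^sup>2 < R0"
  shows "\<exists>lam<0. \<forall>v H. sob v H \<longrightarrow> dE U G v H = lam * mform U v"
proof -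
  have S: "sob U G" and U: "l2sq U = \<rho>\<^sup>2" "EE U G < 0" using M by (auto simp: minimizer_def)
  have \<rho>2: "\<rho>\<^sup>2 > 0" using \<rho> by simp
  have zero: "dE U G v H = 0" if T: "sob v H" and o: "mform U v = 0" for v H
  proof -
    have "dE U G (\<lambda>x. (-1) * v x) (\<lambda>x. (-1) *\<^sub>R H x) \<ge> 0"
      by (rule minimizer_dE_nonneg[OF M \<rho> sob_scale[OF T]]) (simp only: mform_scale o)
    then show ?thesis using minimizer_dE_nonneg[OF M \<rho> T o] unfolding dE_scale by simp
  qed
  define lam where "lam = dE U G U G / l2sq U"
  have "dE U G v H = lam * mform U v" if "sob v H" for v H using Lagrange_multiplier[OF S _ zero that] \<rho>2 by (simp add: lam_def U)
  moreover have "lam < 0"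
  proof -
    have "dE U G U G = l2sq G + QV U U - PP U" by (simp add: dE_def NL_self l2sq_def power2_norm_eq_inner)
    \<comment> \<open>The sign of the multiplier: twice the energy is negative, and p > 2 makes the
      other term nonpositive.\<close>
    also have "... = 2 * EE U G - (1 - 2 / p) * PP U" by (simp add: EE_def algebra_simps)
    also have "... < 0"
    proof -
      have "0 \<le> (1 - 2 / p) * PP U" using p2 PP_nonneg by (intro mult_nonneg_nonneg) auto
      then show ?thesis using U(2) by linarith
    qed
    finally show ?thesis using \<rho>2 by (simp add: lam_def U divide_neg_pos)
  qed
  ultimately show ?thesis by blast
qed

text \<open>Testing the equation with \<open>\<zeta>\<^sup>2 / (U + e)\<close> bounds the gradient of
  \<open>ln (1 + U / e)\<close> locally, uniformly in \<open>e\<close>.\<close>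

lemma log_gradient_bound:
  assumes S: "sob U G" and nn: "\<And>x. U x \<ge> 0" and e: "e > 0" and \<zeta>: "\<zeta> \<in> bumps"
    and crit: "\<And>v H. sob v H \<Longrightarrow> dE U G v H = lam * mform U v"
  shows "sob (\<lambda>x. ln (1 + U x / e)) (\<lambda>x. (1 / (U x + e)) *\<^sub>R G x)"
    and "l2sq (\<lambda>x. \<zeta> x *\<^sub>R ((1 / (U x + e)) *\<^sub>R G x)) \<le> 4 * l2sq (grad \<zeta>) + 2 * absV \<zeta> + 2 * \<bar>lam\<bar> * l2sq \<zeta>"
proof -
  note [measurable] = mV l2_measurable[OF sob_l2(1)[OF S]] l2_measurable[OF sob_l2(2)[OF S]]
    bumps_measurable[OF \<zeta>] grad_bump_facts(1)[OF \<zeta>]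
  have I: "U x \<in> {0..}" for x using nn by simp
  have inv_le: "1 / (a + e) \<le> 1 / e" if "a \<ge> 0" for a using that e by (intro divide_left_mono) auto
  show "sob (\<lambda>x. ln (1 + U x / e)) (\<lambda>x. (1 / (U x + e)) *\<^sub>R G x)"
  proof (rule sob_chain_rule[OF S I, where C = "1 / e\<^sup>2" and M = "1 / e"])
    fix a b :: real assume ab: "a \<in> {0..}" "b \<in> {0..}"
    define x where "x = (b + e) / (a + e)"
    have x: "x > 0" using ab e by (simp add: x_def)
    have "1 + b / e = (b + e) / e" "1 + a / e = (a + e) / e" using e by (auto simp: field_simps)
    then have eq: "ln (1 + b / e) - ln (1 + a / e) = ln x" using ab e by (simp add: x_def ln_div)
    have x1: "x - 1 = (1 / (a + e)) * (b - a)" using ab e by (simp add: x_def field_simps)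
    have up: "ln x \<le> x - 1" using x by (rule ln_le_minus_one)
    have "- ln x \<le> 1 / x - 1" using ln_le_minus_one[of "1 / x"] x by (simp add: ln_div)
    moreover have "1 / x - 1 + (x - 1) = (b - a)\<^sup>2 * (1 / (a + e) * (1 / (b + e)))" using ab e by (simp add: x_def field_simps power2_eq_square)
    moreover have "1 / (a + e) * (1 / (b + e)) \<le> 1 / e * (1 / e)" using ab e by (intro mult_mono inv_le) auto
    then have "(b - a)\<^sup>2 * (1 / (a + e) * (1 / (b + e))) \<le> (b - a)\<^sup>2 * (1 / e * (1 / e))" by (intro mult_left_mono) auto
    moreover have "(b - a)\<^sup>2 * (1 / e * (1 / e)) = 1 / e\<^sup>2 * (b - a)\<^sup>2" by (simp add: power2_eq_square)
    ultimately show "\<bar>ln (1 + b / e) - ln (1 + a / e) - (1 / (a + e)) * (b - a)\<bar> \<le> 1 / e\<^sup>2 * (b - a)\<^sup>2"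
      unfolding eq x1[symmetric] using up by linarith
  next
    fix a :: real assume "a \<in> {0..}"
    then show "\<bar>1 / (a + e)\<bar> \<le> 1 / e" using inv_le[of a] e by simp
  next
    show "l2 (\<lambda>x. ln (1 + U x / e))" unfolding l2_def
    proof (intro conjI)
      show "integrable lborel (\<lambda>x. (norm (ln (1 + U x / e)))\<^sup>2)"
      proof (rule Bochner_Integration.integrable_bound)
        show "integrable lborel (\<lambda>x. (norm ((1 / e) * U x))\<^sup>2)" by (rule l2_square_integrable[OF l2_cmult[OF sob_l2(1)[OF S]]])
        have "\<bar>ln (1 + U x / e)\<bar> \<le> \<bar>(1 / e) * U x\<bar>" for x
        proof -
          have "0 \<le> ln (1 + U x / e)" "ln (1 + U x / e) \<le> U x / e"
            using nn[of x] e ln_le_minus_one[of "1 + U x / e"] by (auto simp: add_pos_nonneg)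
          then show ?thesis using nn[of x] e by simp
        qed
        then have "(ln (1 + U x / e))\<^sup>2 \<le> ((1 / e) * U x)\<^sup>2" for x by (simp only: abs_le_square_iff)
        then show "AE x in lborel. norm ((norm (ln (1 + U x / e)))\<^sup>2) \<le> norm ((norm ((1 / e) * U x))\<^sup>2)"
          by (simp only: norm_power real_norm_def abs_abs power2_abs) simp
      qed measurable
    qed measurable
  qed measurable
  \<comment> \<open>1/(U + e) alone is not in L^2. Subtracting its value 1/e at U = 0 gives a
    function dominated by a multiple of U, and the constant is restored after multiplication with
    the cutoff.\<close>
  define \<psi> where "\<psi> x = \<zeta> x * \<zeta> x * (1 / (U x + e) - 1 / e) + (1 / e) * (\<zeta> x * \<zeta> x)" for x
  define \<Psi> where "\<Psi> x = (\<zeta> x * \<zeta> x) *\<^sub>R ((- (1 / (U x + e)\<^sup>2)) *\<^sub>R G x) + (1 / (U x + e) - 1 / e) *\<^sub>R grad (\<lambda>x. \<zeta> x * \<zeta> x) x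
    + (1 / e) *\<^sub>R grad (\<lambda>x. \<zeta> x * \<zeta> x) x" for x
  have \<zeta>s: "\<zeta> \<in> smooth_class" using \<zeta> by (simp add: bumps_def)
  have \<zeta>2: "(\<lambda>x. \<zeta> x * \<zeta> x) \<in> bumps" by (rule bumps_mult_left[OF \<zeta>s \<zeta>])
  have "sob (\<lambda>x. 1 / (U x + e) - 1 / e) (\<lambda>x. (- (1 / (U x + e)\<^sup>2)) *\<^sub>R G x)"
  proof (rule sob_chain_rule[OF S I, where C = "1 / e ^ 3" and M = "1 / e\<^sup>2"])
    fix a b :: real assume ab: "a \<in> {0..}" "b \<in> {0..}"
    then have ab': "a + e > 0" "b + e > 0" using e by auto
    have "1 / (b + e) - 1 / e - (1 / (a + e) - 1 / e) - (- (1 / (a + e)\<^sup>2)) * (b - a) = (1 / (a + e) * (1 / (a + e)) * (1 / (b + e))) * (b - a)\<^sup>2"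
      using ab' by (simp add: divide_simps) (simp add: algebra_simps power2_eq_square)
    moreover have "1 / (a + e) * (1 / (a + e)) * (1 / (b + e)) \<le> 1 / e * (1 / e) * (1 / e)" using ab e by (intro mult_mono inv_le) auto
    then have "(1 / (a + e) * (1 / (a + e)) * (1 / (b + e))) * (b - a)\<^sup>2 \<le> 1 / e ^ 3 * (b - a)\<^sup>2"
      by (intro mult_right_mono) (auto simp: power3_eq_cube)
    moreover have "0 \<le> (1 / (a + e) * (1 / (a + e)) * (1 / (b + e))) * (b - a)\<^sup>2" using ab' by simp
    ultimately show "\<bar>1 / (b + e) - 1 / e - (1 / (a + e) - 1 / e) - (- (1 / (a + e)\<^sup>2)) * (b - a)\<bar> \<le> 1 / e ^ 3 * (b - a)\<^sup>2"
      by linarith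
  next
    fix a :: real assume "a \<in> {0..}"
    then have "(1 / (a + e))\<^sup>2 \<le> (1 / e)\<^sup>2" using inv_le[of a] e by (intro power_mono) auto
    then show "\<bar>- (1 / (a + e)\<^sup>2)\<bar> \<le> 1 / e\<^sup>2" by (simp add: power_divide)
  next
    have "1 / (U x + e) - 1 / e = (- (1 / (U x + e)) * (1 / e)) * U x" for x using nn[of x] e by (simp add: field_simps)
    moreover have "l2 (\<lambda>x. (- (1 / (U x + e)) * (1 / e)) * U x)"
    proof (rule l2_bounded_mult_real[OF _ _ sob_l2(1)[OF S]])
      show "\<bar>- (1 / (U x + e)) * (1 / e)\<bar> \<le> 1 / e * (1 / e)" for x
      proof -
        have "1 / (U x + e) * (1 / e) \<le> 1 / e * (1 / e)" using e by (intro mult_right_mono inv_le nn) auto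
        then show ?thesis using nn[of x] e by simp
      qed
    qed measurable
    ultimately show "l2 (\<lambda>x. 1 / (U x + e) - 1 / e)" by simp
  qed measurable
  from sob_add[OF sob_mult_bump[OF this \<zeta>2] sob_scale[OF sob_bump[OF \<zeta>2], of "1 / e"]]
  have S\<psi>: "sob \<psi> \<Psi>" unfolding \<psi>_def[abs_def] \<Psi>_def[abs_def] .
  have \<psi>: "\<psi> x = (\<zeta> x)\<^sup>2 / (U x + e)" for x unfolding \<psi>_def by (simp add: algebra_simps power2_eq_square)
  define J where "J x = \<zeta> x *\<^sub>R ((1 / (U x + e)) *\<^sub>R G x)" for x
  have lJ: "l2 J"
  proof -
    have "l2 (\<lambda>x. (\<zeta> x * (1 / (U x + e))) *\<^sub>R G x)"
    proof -
      obtain B where B: "\<And>x. \<bar>\<zeta> x\<bar> \<le> B" "B > 0" using bumps_bounded[OF \<zeta>] by metis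
      show ?thesis
      proof (rule l2_bounded_mult[OF _ _ sob_l2(2)[OF S]])
        show "\<bar>\<zeta> x * (1 / (U x + e))\<bar> \<le> B * (1 / e)" for x
          unfolding abs_mult using B inv_le[OF nn[of x]] nn[of x] e by (intro mult_mono) auto
      qed measurable
    qed
    then show ?thesis by (simp add: J_def[abs_def])
  qed
  have g2: "grad (\<lambda>x. \<zeta> x * \<zeta> x) x = (2 * \<zeta> x) *\<^sub>R grad \<zeta> x" for x
    by (simp add: grad_def pdiff_bump_mult[OF \<zeta>s \<zeta>s] scaleR_sum_right algebra_simps)
  \<comment> \<open>G.\<Psi> equals -|J|^2 + 2 J.grad \<zeta>; completing the square keeps half of
    the good term.\<close>
  have pt: "G x \<bullet> \<Psi> x \<le> - ((norm (J x))\<^sup>2 / 2) + 2 * (norm (grad \<zeta> x))\<^sup>2" for x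
  proof -
    have "G x \<bullet> \<Psi> x = - (J x \<bullet> J x) + 2 * (J x \<bullet> grad \<zeta> x)"
      by (simp add: \<Psi>_def J_def g2 inner_add_right power2_eq_square inner_commute algebra_simps)
    moreover have "0 \<le> (norm (J x - 2 *\<^sub>R grad \<zeta> x))\<^sup>2" by simp
    ultimately show ?thesis unfolding power2_norm_eq_inner by (simp add: inner_diff_left inner_diff_right inner_commute)
  qed
  have "(LBINT x. G x \<bullet> \<Psi> x) \<le> (LBINT x. - ((norm (J x))\<^sup>2 / 2) + 2 * (norm (grad \<zeta> x))\<^sup>2)"
    using pt l2_square_integrable[OF lJ] l2_square_integrable[OF grad_bump_facts(3)[OF \<zeta>]]
    by (intro integral_mono l2_inner_integrable[OF sob_l2(2)[OF S] sob_l2(2)[OF S\<psi>]]) auto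
  also have "... = - (l2sq J / 2) + 2 * l2sq (grad \<zeta>)"
    unfolding l2sq_def using l2_square_integrable[OF lJ] l2_square_integrable[OF grad_bump_facts(3)[OF \<zeta>]] by simp
  finally have 1: "(LBINT x. G x \<bullet> \<Psi> x) \<le> - (l2sq J / 2) + 2 * l2sq (grad \<zeta>)" .
  have l\<zeta>: "l2 \<zeta>" using sob_l2(1)[OF sob_bump[OF \<zeta>]] .
  have frac: "0 \<le> U x * \<psi> x" "U x * \<psi> x \<le> (\<zeta> x)\<^sup>2" "\<psi> x \<ge> 0" for x
  proof -
    have "U x / (U x + e) * (\<zeta> x)\<^sup>2 \<le> 1 * (\<zeta> x)\<^sup>2" using nn[of x] e by (intro mult_right_mono) auto
    then show "U x * \<psi> x \<le> (\<zeta> x)\<^sup>2" by (simp add: \<psi>)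
    show "0 \<le> U x * \<psi> x" "\<psi> x \<ge> 0" using nn[of x] e by (auto simp: \<psi>)
  qed
  have 2: "QV U \<psi> \<le> absV \<zeta>" unfolding QV_def absV_def
  proof (rule integral_mono[OF QV_integrable[OF S S\<psi>] absV_integrable[OF sob_bump[OF \<zeta>]]])
    fix x
    have "V x * (U x * \<psi> x) \<le> \<bar>V x\<bar> * (U x * \<psi> x)" using frac by (intro mult_right_mono) auto
    also have "... \<le> \<bar>V x\<bar> * (\<zeta> x)\<^sup>2" using frac by (intro mult_left_mono) auto
    finally show "V x * U x * \<psi> x \<le> \<bar>V x\<bar> * (\<zeta> x)\<^sup>2" by (simp add: mult_ac)
  qed
  \<comment> \<open>The power term has a favourable sign, so no bound on U is needed.\<close>
  have 3: "NL U \<psi> \<ge> 0" unfolding NL_def power_nl_def using frac nn by (intro integral_nonneg_AE AE_I2 mult_nonneg_nonneg) auto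
  have m: "0 \<le> mform U \<psi>" unfolding mform_def using frac by (intro integral_nonneg_AE AE_I2) auto
  have m': "mform U \<psi> \<le> l2sq \<zeta>" unfolding mform_def l2sq_def
    using frac l2_real_mult_integrable[OF sob_l2(1)[OF S] sob_l2(1)[OF S\<psi>]] l2_square_integrable[OF l\<zeta>] by (intro integral_mono) auto
  have "- (lam * mform U \<psi>) \<le> \<bar>lam\<bar> * mform U \<psi>" using m mult_right_mono[of "- lam" "\<bar>lam\<bar>" "mform U \<psi>"] by simp
  also have "... \<le> \<bar>lam\<bar> * l2sq \<zeta>" using m' by (intro mult_left_mono) auto
  finally have 4: "- (lam * mform U \<psi>) \<le> \<bar>lam\<bar> * l2sq \<zeta>" .
  have "(LBINT x. G x \<bullet> \<Psi> x) + QV U \<psi> - NL U \<psi> = lam * mform U \<psi>" using crit[OF S\<psi>] by (simp add: dE_def)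
  then have "l2sq J / 2 \<le> 2 * l2sq (grad \<zeta>) + absV \<zeta> + \<bar>lam\<bar> * l2sq \<zeta>" using 1 2 3 4 by linarith
  then show "l2sq (\<lambda>x. \<zeta> x *\<^sub>R ((1 / (U x + e)) *\<^sub>R G x)) \<le> 4 * l2sq (grad \<zeta>) + 2 * absV \<zeta> + 2 * \<bar>lam\<bar> * l2sq \<zeta>"
    unfolding J_def by simp
qed

text \<open>The logarithm is 0 on the zero set and at least ln(1 + \<delta>/e) where U \<ge>
  \<delta>. Integrating its squared increments over pairs of such points is bounded through its
  local gradient, uniformly in e. As e tends to 0 the logarithm is unbounded, so one of the two sets
  is null.\<close>

lemma zero_set_level_set:
  assumes S: "sob U G" and nn: "\<And>x. U x \<ge> 0" and R: "R > 0" and \<delta>: "\<delta> > 0"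
    and crit: "\<And>v H. sob v H \<Longrightarrow> dE U G v H = lam * mform U v"
  shows "emeasure lborel {x\<in>cball 0 R. U x = 0} * emeasure lborel {x\<in>cball 0 R. U x \<ge> \<delta>} = 0"
proof -
  note [measurable] = l2_measurable[OF sob_l2(1)[OF S]] l2_measurable[OF sob_l2(2)[OF S]]
  define Z where "Z = {x\<in>cball 0 R. U x = 0}"
  define W where "W = {x\<in>cball 0 R. U x \<ge> \<delta>}"
  have [measurable]: "Z \<in> sets borel" "W \<in> sets borel" by (auto simp: Z_def W_def)
  have [measurable]: "cball (0::'a) r \<in> sets borel" for r by simp
  \<comment> \<open>Positive on the ball of radius 3R: segments that start in the R-ball with
    displacement at most 2R stay there.\<close>
  define \<zeta> :: "'a \<Rightarrow> real" where "\<zeta> = box_bump 0 (- ((4 * R) *\<^sub>R One)) ((4 * R) *\<^sub>R One)"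
  have \<zeta>: "\<zeta> \<in> bumps" unfolding \<zeta>_def by (rule box_bump_bumps)
  have \<zeta>s: "\<zeta> \<in> smooth_class" using \<zeta> by (simp add: bumps_def)
  have pos: "\<zeta> x > 0" if "x \<in> cball 0 (3 * R)" for x
  proof -
    have "x \<in> box (- ((4 * R) *\<^sub>R One)) ((4 * R) *\<^sub>R One)" unfolding mem_box
    proof
      fix b :: 'a assume b: "b \<in> Basis"
      have "\<bar>x \<bullet> b\<bar> \<le> 3 * R" using that Basis_le_norm[OF b, of x] by simp
      then show "- ((4 * R) *\<^sub>R One) \<bullet> b < x \<bullet> b \<and> x \<bullet> b < ((4 * R) *\<^sub>R One) \<bullet> b" using b R by auto
    qed
    then have "\<zeta> x \<noteq> 0" by (simp add: \<zeta>_def box_bump_nonzero_iff)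
    then show ?thesis using box_bump_nonneg[of 0 "- ((4 * R) *\<^sub>R One)" "(4 * R) *\<^sub>R One" x] by (simp add: \<zeta>_def)
  qed
  obtain x0 where x0: "x0 \<in> cball 0 (3 * R)" "\<And>x. x \<in> cball 0 (3 * R) \<Longrightarrow> \<zeta> x0 \<le> \<zeta> x"
  proof -
    have "continuous_on (cball 0 (3 * R)) \<zeta>" using continuous_on_subset[OF smooth_class_continuous[OF \<zeta>s]] by blast
    from continuous_attains_inf[OF compact_cball _ this] that show ?thesis using R by (auto simp del: mem_cball)
  qed
  define c where "c = \<zeta> x0"
  have c: "c > 0" using pos x0(1) by (simp add: c_def)
  define K where "K = 4 * l2sq (grad \<zeta>) + 2 * absV \<zeta> + 2 * \<bar>lam\<bar> * l2sq \<zeta>"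
  have K0: "K \<ge> 0" by (auto simp: K_def absV_nonneg)
  define B where "B = ennreal ((2 * R)\<^sup>2 * (K / c\<^sup>2)) * emeasure lborel (cball (0::'a) (2 * R))"
  have Bfin: "B < \<infinity>" using emeasure_bounded_finite[of "cball (0::'a) (2 * R)"] by (simp add: B_def ennreal_mult_less_top less_top)
  define mm where "mm = emeasure lborel Z * emeasure lborel W"
  have main: "ennreal ((ln (1 + \<delta> / e))\<^sup>2) * mm \<le> B" if e: "e > 0" for e
  proof -
    define w where "w x = ln (1 + U x / e)" for x
    define H where "H x = (1 / (U x + e)) *\<^sub>R G x" for x
    have Sw: "sob w H" unfolding w_def[abs_def] H_def[abs_def] by (rule log_gradient_bound(1)[OF S nn e \<zeta> crit])
    note [measurable] = l2_measurable[OF sob_l2(1)[OF Sw]] l2_measurable[OF sob_l2(2)[OF Sw]]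
    have HD: "(\<integral>\<^sup>+x. indicator (cball 0 (3 * R)) x * ennreal ((norm (H x))\<^sup>2) \<partial>lborel) \<le> ennreal (K / c\<^sup>2)"
    proof -
      have lJ: "l2 (\<lambda>x. \<zeta> x *\<^sub>R H x)"
      proof -
        obtain M where "\<And>x. \<bar>\<zeta> x\<bar> \<le> M" using bumps_bounded[OF \<zeta>] by metis
        then show ?thesis by (intro l2_bounded_mult[OF bumps_measurable[OF \<zeta>] _ sob_l2(2)[OF Sw]])
      qed
      have "indicator (cball 0 (3 * R)) x * ennreal ((norm (H x))\<^sup>2) \<le> ennreal (1 / c\<^sup>2) * ennreal ((norm (\<zeta> x *\<^sub>R H x))\<^sup>2)" for x
      proof (cases "x \<in> cball 0 (3 * R)")
        case True
        have "c\<^sup>2 * (norm (H x))\<^sup>2 \<le> (\<zeta> x)\<^sup>2 * (norm (H x))\<^sup>2"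
          using x0(2)[OF True] c by (intro mult_right_mono power_mono) (auto simp: c_def)
        then have "(norm (H x))\<^sup>2 \<le> 1 / c\<^sup>2 * (norm (\<zeta> x *\<^sub>R H x))\<^sup>2"
          using c by (simp add: field_simps power_mult_distrib)
        then show ?thesis using True by (simp flip: ennreal_mult add: ennreal_leI)
      qed simp
      then have "(\<integral>\<^sup>+x. indicator (cball 0 (3 * R)) x * ennreal ((norm (H x))\<^sup>2) \<partial>lborel) \<le>
          (\<integral>\<^sup>+x. ennreal (1 / c\<^sup>2) * ennreal ((norm (\<zeta> x *\<^sub>R H x))\<^sup>2) \<partial>lborel)"
        by (intro nn_integral_mono)
      also have "... = ennreal (1 / c\<^sup>2) * ennreal (l2sq (\<lambda>x. \<zeta> x *\<^sub>R H x))"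
        unfolding ennreal_l2sq[OF lJ] by (intro nn_integral_cmult) (use bumps_measurable[OF \<zeta>] in simp)
      also have "... \<le> ennreal (1 / c\<^sup>2) * ennreal K" using log_gradient_bound(2)[OF S nn e \<zeta> crit]
        by (intro mult_left_mono ennreal_leI) (auto simp: K_def H_def)
      also have "... = ennreal (K / c\<^sup>2)" using K0 by (simp flip: ennreal_mult)
      finally show ?thesis .
    qed
    have pt: "ennreal ((ln (1 + \<delta> / e))\<^sup>2) * (indicator Z x * indicator W (x + h)) \<le>
        indicator (cball 0 (2 * R)) h * (indicator (cball 0 R) x * ennreal ((w (x + h) - w x)\<^sup>2))" for x h :: 'a
    proof (cases "x \<in> Z \<and> x + h \<in> W")
      case True
      have xR: "norm x \<le> R" and hR: "norm (x + h) \<le> R" using True by (auto simp: Z_def W_def)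
      have "norm h \<le> norm (x + h) + norm x" using norm_triangle_ineq4[of "x + h" x] by simp
      then have h: "norm h \<le> 2 * R" using xR hR by simp
      have "\<delta> / e \<le> U (x + h) / e" using True e by (intro divide_right_mono) (auto simp: W_def)
      then have "ln (1 + \<delta> / e) \<le> w (x + h)" using \<delta> e nn[of "x + h"] unfolding w_def by (subst ln_le_cancel_iff) (auto intro!: add_pos_nonneg)
      moreover have "0 \<le> ln (1 + \<delta> / e)" using \<delta> e by simp
      ultimately have "(ln (1 + \<delta> / e))\<^sup>2 \<le> (w (x + h))\<^sup>2" by (intro power_mono)
      moreover have "w x = 0" using True by (simp add: w_def Z_def)
      ultimately show ?thesis using True xR h by (simp add: ennreal_leI)
    qed auto
    have "ennreal ((ln (1 + \<delta> / e))\<^sup>2) * mm =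
        ennreal ((ln (1 + \<delta> / e))\<^sup>2) * (\<integral>\<^sup>+x. indicator Z x * (\<integral>\<^sup>+h. indicator W (x + h) \<partial>lborel) \<partial>lborel)"
    proof -
      have "(\<integral>\<^sup>+h. indicator W (x + h) \<partial>lborel) = emeasure lborel W" for x :: 'a
      proof -
        have "(\<integral>\<^sup>+y. indicator W y \<partial>(lborel::'a measure)) = (\<integral>\<^sup>+h. indicator W (x + h) \<partial>lborel)"
          by (subst lborel_distr_plus[symmetric, of x], subst nn_integral_distr) auto
        then show ?thesis by simp
      qed
      then show ?thesis by (simp add: mm_def nn_integral_multc)
    qed
    also have "... = (\<integral>\<^sup>+x. (\<integral>\<^sup>+h. ennreal ((ln (1 + \<delta> / e))\<^sup>2) * (indicator Z x * indicator W (x + h)) \<partial>lborel) \<partial>lborel)"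
      by (simp add: nn_integral_cmult)
    also have "... \<le> (\<integral>\<^sup>+x. (\<integral>\<^sup>+h. indicator (cball 0 (2 * R)) h * (indicator (cball 0 R) x * ennreal ((w (x + h) - w x)\<^sup>2)) \<partial>lborel) \<partial>lborel)"
      by (intro nn_integral_mono pt)
    also have "... = (\<integral>\<^sup>+h. (\<integral>\<^sup>+x. indicator (cball 0 (2 * R)) h * (indicator (cball 0 R) x * ennreal ((w (x + h) - w x)\<^sup>2)) \<partial>lborel) \<partial>lborel)"
      by (rule lborel_pair.Fubini') measurable
    also have "... = (\<integral>\<^sup>+h. indicator (cball 0 (2 * R)) h * (\<integral>\<^sup>+x. indicator (cball 0 R) x * ennreal ((w (x + h) - w x)\<^sup>2) \<partial>lborel) \<partial>lborel)"
      by (intro nn_integral_cong) (simp add: nn_integral_cmult)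
    also have "... \<le> (\<integral>\<^sup>+h. indicator (cball (0::'a) (2 * R)) h * ennreal ((2 * R)\<^sup>2 * (K / c\<^sup>2)) \<partial>lborel)"
    proof (rule nn_integral_mono)
      fix h :: 'a
      show "indicator (cball 0 (2 * R)) h * (\<integral>\<^sup>+x. indicator (cball 0 R) x * ennreal ((w (x + h) - w x)\<^sup>2) \<partial>lborel) \<le>
          indicator (cball (0::'a) (2 * R)) h * ennreal ((2 * R)\<^sup>2 * (K / c\<^sup>2))"
      proof (cases "h \<in> cball 0 (2 * R)")
        case True
        have "(\<integral>\<^sup>+x. indicator (cball 0 R) x * ennreal ((w (x + h) - w x)\<^sup>2) \<partial>lborel) \<le>
            ennreal ((norm h)\<^sup>2) * (\<integral>\<^sup>+x. indicator (cball 0 (3 * R)) x * ennreal ((norm (H x))\<^sup>2) \<partial>lborel)"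
        proof (rule translation_estimate_on[OF Sw])
          fix x :: 'a and s :: real assume xs: "x \<in> cball 0 R" "s \<in> {0..1}"
          have "norm (x + s *\<^sub>R h) \<le> norm x + \<bar>s\<bar> * norm h" using norm_triangle_ineq[of x "s *\<^sub>R h"] by simp
          moreover have "\<bar>s\<bar> * norm h \<le> 1 * (2 * R)" using xs True by (intro mult_mono) auto
          ultimately show "x + s *\<^sub>R h \<in> cball 0 (3 * R)" using xs by simp
        qed auto
        also have "... \<le> ennreal ((2 * R)\<^sup>2) * ennreal (K / c\<^sup>2)" using True by (intro mult_mono HD ennreal_leI power_mono) auto
        also have "... = ennreal ((2 * R)\<^sup>2 * (K / c\<^sup>2))" using K0 by (simp flip: ennreal_mult)
        finally show ?thesis using True by simp
      qed simp
    qed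
    also have "... = B" by (simp add: B_def nn_integral_multc mult.commute)
    finally show ?thesis .
  qed
  have "mm = 0"
  proof (rule ccontr)
    assume mm: "mm \<noteq> 0"
    have mfin: "mm < \<infinity>" using main[of 1] Bfin \<delta> by (auto simp: ennreal_mult_eq_top_iff top_unique less_top[symmetric])
    obtain m where m: "mm = ennreal m" "m > 0" using mm mfin by (cases mm) (auto simp: less_le)
    obtain b where b: "B = ennreal b" "b \<ge> 0" using Bfin by (cases B) auto
    \<comment> \<open>Any value with L^2 m > b contradicts the bound, and e is then chosen to make
      the logarithm equal to L.\<close>
    define L where "L = sqrt (b / m) + 1"
    have L: "L > 0" using m b by (auto simp: L_def intro!: add_nonneg_pos)
    define e where "e = \<delta> / (exp L - 1)"
    have e: "e > 0" using \<delta> L by (simp add: e_def)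
    have "ln (1 + \<delta> / e) = L" using \<delta> L by (simp add: e_def)
    with main[OF e] have "ennreal (L\<^sup>2 * m) \<le> ennreal b" using m b by (simp add: ennreal_mult)
    then have "L\<^sup>2 * m \<le> b" using b by simp
    then have "L\<^sup>2 \<le> b / m" using m by (simp add: field_simps)
    moreover have "(sqrt (b / m))\<^sup>2 < L\<^sup>2" using m b by (intro power_strict_mono) (auto simp: L_def)
    ultimately show False using m b by simp
  qed
  then show ?thesis by (simp add: mm_def Z_def W_def)
qed

text \<open>As U is not null, some level set in some ball has positive measure. The same holds in
  every larger ball, so the zero set is null in each of them.\<close>

theorem critical_positive:
  assumes S: "sob U G" and nn: "\<And>x. U x \<ge> 0" and nz: "l2sq U > 0"
    and crit: "\<And>v H. sob v H \<Longrightarrow> dE U G v H = lam * mform U v"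
  shows "AE x in lborel. U x > 0"
proof -
  note [measurable] = l2_measurable[OF sob_l2(1)[OF S]]
  have "\<exists>n. emeasure lborel {x\<in>cball 0 (real (Suc n)). U x \<ge> 1 / real (Suc n)} \<noteq> 0"
  proof (rule ccontr)
    assume "\<nexists>n. emeasure lborel {x\<in>cball 0 (real (Suc n)). U x \<ge> 1 / real (Suc n)} \<noteq> 0"
    then have "{x\<in>cball 0 (real (Suc n)). U x \<ge> 1 / real (Suc n)} \<in> null_sets lborel" for n by (auto simp: null_sets_def)
    from AE_not_in[OF this] have "AE x in lborel. \<forall>n. \<not> (x \<in> cball 0 (real (Suc n)) \<and> U x \<ge> 1 / real (Suc n))"
      unfolding AE_all_countable by auto
    then have "AE x in lborel. U x = 0"
    proof eventually_elim
      case (elim x)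
      show ?case
      proof (rule ccontr)
        assume "U x \<noteq> 0"
        then have "U x > 0" using nn[of x] by simp
        obtain n :: nat where n: "max (norm x) (1 / U x) < real n" using reals_Archimedean2 by blast
        then have "1 / U x < real (Suc n)" by simp
        then have "1 / real (Suc n) \<le> U x" using \<open>U x > 0\<close> by (simp add: field_simps)
        moreover have "norm x \<le> real (Suc n)" using n by simp
        ultimately show False using elim by auto
      qed
    qed
    then have "l2sq U = 0" unfolding l2sq_def by (intro integral_eq_zero_AE) auto
    then show False using nz by simp
  qed
  then obtain n where n: "emeasure lborel {x\<in>cball 0 (real (Suc n)). U x \<ge> 1 / real (Suc n)} \<noteq> 0" by blast
  have "{x\<in>cball 0 (real (Suc n) + real k). U x = 0} \<in> null_sets lborel" for k
  proof -
    have "emeasure lborel {x\<in>cball 0 (real (Suc n)). U x \<ge> 1 / real (Suc n)} \<le>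
        emeasure lborel {x\<in>cball 0 (real (Suc n) + real k). U x \<ge> 1 / real (Suc n)}" by (intro emeasure_mono) auto
    then have "emeasure lborel {x\<in>cball 0 (real (Suc n) + real k). U x \<ge> 1 / real (Suc n)} \<noteq> 0" using n by auto
    then have "emeasure lborel {x\<in>cball 0 (real (Suc n) + real k). U x = 0} = 0"
      using zero_set_level_set[OF S nn _ _ crit, of "real (Suc n) + real k" "1 / real (Suc n)"] by auto
    then show ?thesis by (auto simp: null_sets_def)
  qed
  from AE_not_in[OF this] have "AE x in lborel. \<forall>k. \<not> (x \<in> cball 0 (real (Suc n) + real k) \<and> U x = 0)"
    unfolding AE_all_countable by auto
  then show ?thesis
  proof eventually_elim
    case (elim x)
    obtain k :: nat where "norm x < real k" using reals_Archimedean2 by blast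
    then have "x \<in> cball 0 (real (Suc n) + real k)" by simp
    then have "U x \<noteq> 0" using elim by blast
    then show ?case using nn[of x] by simp
  qed
qed

end

section \<open>A priori bound for critical points of negative energy\<close>

lemma sob_dilate:
  fixes u :: "'a::euclidean_space \<Rightarrow> real"
  assumes S: "sob u G" and t: "t > 0"
  shows "sob (\<lambda>x. u (t *\<^sub>R x)) (\<lambda>x. t *\<^sub>R G (t *\<^sub>R x))"
  unfolding sob_def
proof (intro conjI ballI)
  have t0: "t \<noteq> 0" using t by simp
  show "l2 (\<lambda>x. u (t *\<^sub>R x))" using l2_affine[OF sob_l2(1)[OF S] t0, of 0] by simp
  show "l2 (\<lambda>x. t *\<^sub>R G (t *\<^sub>R x))" using l2_scale[OF l2_affine[OF sob_l2(2)[OF S] t0, of 0]] by simp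
  fix \<phi> :: "'a \<Rightarrow> real" and b :: 'a assume \<phi>: "\<phi> \<in> bumps" and b: "b \<in> Basis"
  note [measurable] = l2_measurable[OF sob_l2(1)[OF S]] l2_measurable[OF sob_l2(2)[OF S]]
    bumps_measurable[OF \<phi>] bumps_measurable[OF pdiff_bumps[OF \<phi>, of b]]
  define \<psi> where "\<psi> x = \<phi> ((1 / t) *\<^sub>R x)" for x
  have \<psi>: "\<psi> \<in> bumps" using bumps_affine[OF \<phi>, of "1 / t" 0] t by (simp add: \<psi>_def[abs_def])
  have \<phi>s: "\<phi> \<in> smooth_class" using \<phi> by (simp add: bumps_def)
  have pd: "pdiff \<psi> x b = (1 / t) * pdiff \<phi> ((1 / t) *\<^sub>R x) b" for x
  proof -
    have 1: "((\<lambda>x. (1 / t) *\<^sub>R x) has_derivative (\<lambda>x. (1 / t) *\<^sub>R x)) (at x)" by (auto intro!: derivative_eq_intros)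
    have D: "(\<psi> has_derivative (\<lambda>v. pdiff \<phi> ((1 / t) *\<^sub>R x) ((1 / t) *\<^sub>R v))) (at x)"
      unfolding \<psi>_def[abs_def] by (rule has_derivative_compose[OF 1 has_derivative_pdiff[OF \<phi>s]])
    have "linear (\<lambda>v. pdiff \<phi> ((1 / t) *\<^sub>R x) v)" using has_derivative_pdiff[OF \<phi>s] by (rule has_derivative_linear)
    then show ?thesis using fun_cong[OF frechet_derivative_at[OF D], of b] by (simp add: linear_scale)
  qed
  have "(LBINT x. u x * pdiff \<psi> x b) = - (LBINT x. (G x \<bullet> b) * \<psi> x)" using S \<psi> b by (simp add: sob_def)
  also have "(LBINT x. u x * pdiff \<psi> x b) = t ^ DIM('a) * (LBINT x. u (t *\<^sub>R x) * ((1 / t) * pdiff \<phi> x b))"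
    unfolding pd using integral_lborel_affine[OF t0, of "\<lambda>x. u x * ((1 / t) * pdiff \<phi> ((1 / t) *\<^sub>R x) b)" 0] t by simp
  also have "(LBINT x. (G x \<bullet> b) * \<psi> x) = t ^ DIM('a) * (LBINT x. (G (t *\<^sub>R x) \<bullet> b) * \<phi> x)"
    unfolding \<psi>_def using integral_lborel_affine[OF t0, of "\<lambda>x. (G x \<bullet> b) * \<phi> ((1 / t) *\<^sub>R x)" 0] t by simp
  finally have *: "t ^ DIM('a) * (LBINT x. u (t *\<^sub>R x) * ((1 / t) * pdiff \<phi> x b)) = - (t ^ DIM('a) * (LBINT x. (G (t *\<^sub>R x) \<bullet> b) * \<phi> x))" .
  have cancel: "a = - b" if "c * a = - (c * b)" "c \<noteq> 0" for a b c :: real using that by (metis mult_cancel_left mult_minus_right)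
  have "(LBINT x. u (t *\<^sub>R x) * ((1 / t) * pdiff \<phi> x b)) = - (LBINT x. (G (t *\<^sub>R x) \<bullet> b) * \<phi> x)"
    by (rule cancel[OF *]) (use t in simp)
  moreover have "(LBINT x. u (t *\<^sub>R x) * ((1 / t) * pdiff \<phi> x b)) = (1 / t) * (LBINT x. u (t *\<^sub>R x) * pdiff \<phi> x b)"
    by (simp only: mult.left_commute[of _ "1 / t"] integral_mult_right_zero)
  moreover have "(LBINT x. ((t *\<^sub>R G (t *\<^sub>R x)) \<bullet> b) * \<phi> x) = t * (LBINT x. (G (t *\<^sub>R x) \<bullet> b) * \<phi> x)"
    by (simp add: mult.assoc)
  ultimately show "(LBINT x. u (t *\<^sub>R x) * pdiff \<phi> x b) = - (LBINT x. ((t *\<^sub>R G (t *\<^sub>R x)) \<bullet> b) * \<phi> x)"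
    using t by (simp add: field_simps)
qed

text \<open>The dilation normalised to preserve the L^2 norm, so that comparison states remain on
  the mass sphere.\<close>

definition dil :: "real \<Rightarrow> ('a::euclidean_space \<Rightarrow> 'b::real_vector) \<Rightarrow> 'a \<Rightarrow> 'b" where
  "dil t f x = (t powr (DIM('a) / 2)) *\<^sub>R f (t *\<^sub>R x)"

lemma dil_factor: "t > 0 \<Longrightarrow> (t powr (DIM('a::euclidean_space) / 2))\<^sup>2 = t ^ DIM('a)"
  by (simp add: powr_power powr_realpow)

lemma sob_dil: "sob u G \<Longrightarrow> t > 0 \<Longrightarrow> sob (dil t u) (\<lambda>x. t *\<^sub>R dil t G x)"
  for u :: "'a::euclidean_space \<Rightarrow> real"
  using sob_scale[OF sob_dilate, of u G t "t powr (DIM('a) / 2)"] by (simp add: dil_def[abs_def] mult.commute)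

lemma l2sq_dil:
  fixes f :: "'a::euclidean_space \<Rightarrow> 'b::euclidean_space"
  assumes "l2 f" "t > 0" shows "l2sq (dil t f) = l2sq f"
proof -
  note [measurable] = l2_measurable[OF assms(1)]
  have "l2sq f = t ^ DIM('a) * (LBINT x. (norm (f (t *\<^sub>R x)))\<^sup>2)"
    unfolding l2sq_def using integral_lborel_affine[of t "\<lambda>x. (norm (f x))\<^sup>2" 0] assms(2) by simp
  then show ?thesis using dil_factor[OF assms(2), where 'a='a] unfolding l2sq_def dil_def by (simp add: power_mult_distrib)
qed

lemma dil_inverse: "t > 0 \<Longrightarrow> dil t (dil (1 / t) f) = f"
  by (auto simp: dil_def powr_divide fun_eq_iff)

text \<open>For t \<le> 1 the dilation moves mass outward: the ball of radius R receives only the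
  mass from radius t R.\<close>

lemma loc_sq_dil_le:
  fixes u :: "'a::euclidean_space \<Rightarrow> real"
  assumes u: "l2 u" and t: "0 < t" "t \<le> 1" and R: "R \<ge> 0"
  shows "loc_sq R (dil t u) \<le> loc_sq R u"
proof -
  note [measurable] = l2_measurable[OF u]
  have [measurable]: "cball (0::'a) r \<in> sets borel" for r by simp
  have "(LBINT x. indicator (cball 0 (t * R)) x * (u x)\<^sup>2) = t ^ DIM('a) * (LBINT x. indicator (cball 0 (t * R)) (t *\<^sub>R x) * (u (t *\<^sub>R x))\<^sup>2)"
    using integral_lborel_affine[of t "\<lambda>x. indicator (cball 0 (t * R)) x * (u x)\<^sup>2" 0] t by simp
  also have "... = (LBINT x. indicator (cball 0 R) x * (dil t u x)\<^sup>2)" using t dil_factor[OF t(1), where 'a='a]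
    by (simp flip: integral_mult_right_zero add: dil_def power_mult_distrib mult_ac indicator_def)
  finally have "loc_sq R (dil t u) = loc_sq (t * R) u" by (simp add: loc_sq_def)
  also have "... \<le> loc_sq R u" unfolding loc_sq_def
  proof (intro integral_mono loc_sq_integrable u)
    fix x :: 'a
    have "t * R \<le> 1 * R" using t R by (intro mult_right_mono) auto
    then show "indicator (cball 0 (t * R)) x * (u x)\<^sup>2 \<le> indicator (cball 0 R) x * (u x)\<^sup>2" by (auto simp: indicator_def)
  qed
  finally show ?thesis .
qed

lemma power_le_affine: "0 \<le> \<tau> \<Longrightarrow> \<tau> \<le> 1 \<Longrightarrow> (1 + \<tau>) ^ n \<le> 1 + (2 ^ n - 1) * \<tau>" for \<tau> :: real
proof (induction n)
  case (Suc n)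
  have "(1 + \<tau>) ^ Suc n \<le> (1 + \<tau>) * (1 + (2 ^ n - 1) * \<tau>)" using Suc by simp
  also have "... = 1 + 2 ^ n * \<tau> + (2 ^ n - 1) * \<tau> * \<tau>" by (simp add: algebra_simps)
  also have "(2 ^ n - 1) * \<tau> * \<tau> \<le> (2 ^ n - 1) * \<tau> * 1" using Suc.prems by (intro mult_left_mono) auto
  finally show ?case by (simp add: algebra_simps)
qed simp

lemma dilation_factor_bounds:
  fixes \<tau> :: real assumes "0 < \<tau>" "\<tau> \<le> 1"
  shows "1 \<le> (1 + \<tau>) powr (real n / 2)" "(1 + \<tau>) powr (real n / 2) \<le> 2 ^ n" "(1 + \<tau>) powr (real n / 2) - 1 \<le> 2 ^ n * \<tau>"
proof -
  show "1 \<le> (1 + \<tau>) powr (real n / 2)" using assms by (intro ge_one_powr_ge_zero) auto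
  have "(1 + \<tau>) powr (real n / 2) \<le> (1 + \<tau>) powr real n" using assms by (intro powr_mono) auto
  also have "... = (1 + \<tau>) ^ n" using assms by (simp add: powr_realpow)
  finally have le: "(1 + \<tau>) powr (real n / 2) \<le> (1 + \<tau>) ^ n" .
  also have "(1 + \<tau>) ^ n \<le> 2 ^ n" using assms by (intro power_mono) auto
  finally show "(1 + \<tau>) powr (real n / 2) \<le> 2 ^ n" .
  show "(1 + \<tau>) powr (real n / 2) - 1 \<le> 2 ^ n * \<tau>" using le power_le_affine[of \<tau> n] assms by (simp add: algebra_simps)
qed

lemma powr_Bernoulli:
  fixes \<tau> :: real assumes "\<tau> \<ge> 0" "p \<ge> 1" shows "1 + p * \<tau> \<le> (1 + \<tau>) powr p"
proof -
  have "ln (1 + \<tau>) \<ge> 0" using assms by simp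
  have d: "((\<lambda>s. (1 + s) powr p - p * s) has_real_derivative (p * (1 + s) powr (p - 1) - p)) (at s)" if "s \<ge> 0" for s
    using that by (auto intro!: derivative_eq_intros)
  have "(1 + 0) powr p - p * 0 \<le> (1 + \<tau>) powr p - p * \<tau>"
  proof (rule DERIV_nonneg_imp_nondecreasing[OF assms(1)])
    fix s :: real assume s: "0 \<le> s" "s \<le> \<tau>"
    have "p * 1 \<le> p * (1 + s) powr (p - 1)" using s assms by (intro mult_left_mono ge_one_powr_ge_zero) auto
    then show "\<exists>y. ((\<lambda>s. (1 + s) powr p - p * s) has_real_derivative y) (at s) \<and> 0 \<le> y" using d[OF s(1)] by auto
  qed
  then show ?thesis by simp
qed

context dim3
begin

lemma power_form_dil:
  fixes u v :: "'a \<Rightarrow> real"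
  assumes [measurable]: "u \<in> borel_measurable borel" "v \<in> borel_measurable borel" and t: "t > 0"
  shows "(LBINT x. \<bar>dil t u x\<bar> powr (p - 2) * (dil t v x)\<^sup>2) = t powr p * (LBINT x. \<bar>u x\<bar> powr (p - 2) * (v x)\<^sup>2)"
proof -
  have "\<bar>dil t u x\<bar> powr (p - 2) * (dil t v x)\<^sup>2 = t powr p * (t ^ DIM('a) * (\<bar>u (t *\<^sub>R x)\<bar> powr (p - 2) * (v (t *\<^sub>R x))\<^sup>2))" for x
  proof -
    have "\<bar>dil t u x\<bar> powr (p - 2) = (t powr (DIM('a) / 2)) powr (p - 2) * \<bar>u (t *\<^sub>R x)\<bar> powr (p - 2)"
      by (simp add: dil_def abs_mult powr_mult)
    also have "(t powr (DIM('a) / 2)) powr (p - 2) = t powr p" using p_conj by (simp add: powr_powr mult.commute)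
    finally show ?thesis using dil_factor[OF t, where 'a='a] by (simp add: dil_def power_mult_distrib mult_ac)
  qed
  then have "(LBINT x. \<bar>dil t u x\<bar> powr (p - 2) * (dil t v x)\<^sup>2) =
      t powr p * (t ^ DIM('a) * (LBINT x. \<bar>u (t *\<^sub>R x)\<bar> powr (p - 2) * (v (t *\<^sub>R x))\<^sup>2))" by simp
  then show ?thesis using integral_lborel_affine[of t "\<lambda>x. \<bar>u x\<bar> powr (p - 2) * (v x)\<^sup>2" 0] t by simp
qed

lemma power_form_self: "(LBINT x. \<bar>u x\<bar> powr (p - 2) * (u x)\<^sup>2) = PP u" for u :: "'a \<Rightarrow> real"
proof -
  have "\<bar>a\<bar> powr (p - 2) * a\<^sup>2 = power_nl p a * a" for a by (simp add: power_nl_def power2_eq_square)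
  then show ?thesis by (simp add: PP_def power_nl_mult_self)
qed

lemma PP_dil: "u \<in> borel_measurable borel \<Longrightarrow> t > 0 \<Longrightarrow> PP (dil t u) = t powr p * PP u" for u :: "'a \<Rightarrow> real"
  using power_form_dil[of u u t] by (simp add: power_form_self)

text \<open>Replaces the weight of the Taylor remainder by weights at the two endpoints, each of
  which is tractable: one directly, the other after dilating back.\<close>

lemma sum_powr_le: "(\<bar>a\<bar> + \<bar>b - a\<bar>) powr (p - 2) \<le> 3 powr (p - 2) * (\<bar>a\<bar> powr (p - 2) + \<bar>b\<bar> powr (p - 2))"
proof -
  have "(\<bar>a\<bar> + \<bar>b - a\<bar>) powr (p - 2) \<le> (3 * max \<bar>a\<bar> \<bar>b\<bar>) powr (p - 2)" using p2 by (intro powr_mono2) auto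
  also have "... = 3 powr (p - 2) * max \<bar>a\<bar> \<bar>b\<bar> powr (p - 2)" by (simp add: powr_mult)
  also have "... \<le> 3 powr (p - 2) * (\<bar>a\<bar> powr (p - 2) + \<bar>b\<bar> powr (p - 2))" by (intro mult_left_mono) (auto simp: max_def)
  finally show ?thesis .
qed

end

lemma dilation_weighted:
  assumes S: "sob u G" and t: "t \<ge> 1"
  shows "integrable lborel (\<lambda>x. ((u (t *\<^sub>R x) - u x) / norm x)\<^sup>2)"
    and "(LBINT x. ((u (t *\<^sub>R x) - u x) / norm x)\<^sup>2) \<le> (t - 1)\<^sup>2 * l2sq G"
proof -
  note [measurable] = l2_measurable[OF sob_l2(1)[OF S]]
  have le: "(\<integral>\<^sup>+x. ennreal (((u (t *\<^sub>R x) - u x) / norm x)\<^sup>2) \<partial>lborel) \<le> ennreal ((t - 1)\<^sup>2 * l2sq G)"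
    using dilation_estimate[OF S t] by (simp add: power_divide)
  show i: "integrable lborel (\<lambda>x. ((u (t *\<^sub>R x) - u x) / norm x)\<^sup>2)"
    by (rule integrableI_nonneg) (use le in \<open>auto intro: le_less_trans simp: ennreal_less_top\<close>)
  show "(LBINT x. ((u (t *\<^sub>R x) - u x) / norm x)\<^sup>2) \<le> (t - 1)\<^sup>2 * l2sq G"
    using le by (subst (asm) nn_integral_eq_integral[OF i]) (auto simp: integral_nonneg_AE)
qed

context schrod
begin

definition WW :: "('a \<Rightarrow> real) \<Rightarrow> real" where "WW u = (LBINT x. (V x * norm x)\<^sup>2 * (u x)\<^sup>2)"

text \<open>The increment is c E + (c - 1) Z with E = Z(t x) - Z(x), and c - 1 is of order \<tau>.
  By \<open>dilation_estimate\<close>, E/|x| has L^2 norm of order \<tau>: on a ball |x| is bounded,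
  and in the potential term V Z E = (V |x| Z)(E/|x|), which is where W enters.\<close>

lemma dilation_difference_bounds:
  assumes adW: "admissible (\<lambda>x. (V x * norm x)\<^sup>2)" and S: "sob Z K" and \<tau>: "0 < \<tau>" "\<tau> \<le> 1"
  shows "L \<ge> 0 \<Longrightarrow> loc_sq L (\<lambda>x. dil (1 + \<tau>) Z x - Z x) \<le> \<tau>\<^sup>2 * (2 * (2 ^ DIM('a))\<^sup>2 * (L\<^sup>2 * l2sq K + l2sq Z))"
    and "QV Z (\<lambda>x. dil (1 + \<tau>) Z x - Z x) \<le> \<tau> * (2 ^ DIM('a) * (sqrt (WW Z) * sqrt (l2sq K) + absV Z))"
proof -
  note [measurable] = mV l2_measurable[OF sob_l2(1)[OF S]]
  define t where "t = 1 + \<tau>"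
  have t: "t \<ge> 1" "t > 0" using \<tau> by (auto simp: t_def)
  define c where "c = t powr (DIM('a) / 2)"
  note cb = dilation_factor_bounds[OF \<tau>, of "DIM('a)", folded t_def, folded c_def]
  define E where "E x = Z (t *\<^sub>R x) - Z x" for x
  have SE: "sob E (\<lambda>x. t *\<^sub>R K (t *\<^sub>R x) - K x)" unfolding E_def[abs_def] by (rule sob_diff[OF sob_dilate[OF S t(2)] S])
  have D: "dil (1 + \<tau>) Z x - Z x = c * E x + (c - 1) * Z x" for x by (simp add: dil_def E_def c_def t_def algebra_simps)
  note [measurable] = l2_measurable[OF sob_l2(1)[OF SE]]
  note F = dilation_weighted[OF S t(1), folded E_def]
  have "t - 1 = \<tau>" by (simp add: t_def)
  note F2 = F(2)[unfolded this]
  show "loc_sq L (\<lambda>x. dil (1 + \<tau>) Z x - Z x) \<le> \<tau>\<^sup>2 * (2 * (2 ^ DIM('a))\<^sup>2 * (L\<^sup>2 * l2sq K + l2sq Z))" if L: "L \<ge> 0"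
  proof -
    have pt: "indicator (cball 0 L) x * (c * E x + (c - 1) * Z x)\<^sup>2 \<le> 2 * c\<^sup>2 * L\<^sup>2 * (E x / norm x)\<^sup>2 + 2 * (c - 1)\<^sup>2 * (norm (Z x))\<^sup>2" for x
    proof (cases "x \<in> cball 0 L")
      case True
      have "(E x)\<^sup>2 \<le> L\<^sup>2 * (E x / norm x)\<^sup>2"
      proof (cases "x = 0")
        case False
        have "(norm x)\<^sup>2 * (E x / norm x)\<^sup>2 \<le> L\<^sup>2 * (E x / norm x)\<^sup>2"
          using True by (intro mult_right_mono power_mono) auto
        then show ?thesis using False by (simp add: power_divide)
      qed (simp add: E_def)
      then have "2 * c\<^sup>2 * (E x)\<^sup>2 \<le> 2 * c\<^sup>2 * (L\<^sup>2 * (E x / norm x)\<^sup>2)" by (intro mult_left_mono) auto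
      moreover have "(a + b)\<^sup>2 \<le> 2 * a\<^sup>2 + 2 * b\<^sup>2" for a b :: real using sum_squares_bound[of a b] by (simp add: power2_sum)
      from this[of "c * E x" "(c - 1) * Z x"]
      have "(c * E x + (c - 1) * Z x)\<^sup>2 \<le> 2 * c\<^sup>2 * (E x)\<^sup>2 + 2 * (c - 1)\<^sup>2 * (Z x)\<^sup>2" by (simp add: power_mult_distrib)
      ultimately show ?thesis using True by simp
    qed simp
    have "loc_sq L (\<lambda>x. dil (1 + \<tau>) Z x - Z x) \<le> (LBINT x. 2 * c\<^sup>2 * L\<^sup>2 * (E x / norm x)\<^sup>2 + 2 * (c - 1)\<^sup>2 * (norm (Z x))\<^sup>2)"
      unfolding loc_sq_def D
    proof (rule integral_mono)
      show "integrable lborel (\<lambda>x. indicator (cball 0 L) x * (c * E x + (c - 1) * Z x)\<^sup>2)"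
        by (rule loc_sq_integrable[OF l2_add[OF l2_cmult[OF sob_l2(1)[OF SE]] l2_cmult[OF sob_l2(1)[OF S]]]])
      show "integrable lborel (\<lambda>x. 2 * c\<^sup>2 * L\<^sup>2 * (E x / norm x)\<^sup>2 + 2 * (c - 1)\<^sup>2 * (norm (Z x))\<^sup>2)"
        using F(1) l2_square_integrable[OF sob_l2(1)[OF S]] by auto
    qed (rule pt)
    also have "... = 2 * c\<^sup>2 * L\<^sup>2 * (LBINT x. (E x / norm x)\<^sup>2) + 2 * (c - 1)\<^sup>2 * l2sq Z"
      unfolding l2sq_def using F(1) l2_square_integrable[OF sob_l2(1)[OF S]] by simp
    also have "... \<le> 2 * (2 ^ DIM('a))\<^sup>2 * L\<^sup>2 * (\<tau>\<^sup>2 * l2sq K) + 2 * (2 ^ DIM('a) * \<tau>)\<^sup>2 * l2sq Z"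
      using cb F2 L by (intro add_mono mult_mono power_mono) (auto intro!: integral_nonneg_AE)
    also have "... = \<tau>\<^sup>2 * (2 * (2 ^ DIM('a))\<^sup>2 * (L\<^sup>2 * l2sq K + l2sq Z))" by (simp add: power_mult_distrib algebra_simps)
    finally show ?thesis .
  qed
  have QE: "QV Z E \<le> sqrt (WW Z) * (\<tau> * sqrt (l2sq K))"
  proof -
    define f where "f x = V x * norm x * Z x" for x
    define g where "g x = E x / norm x" for x
    have i: "integrable lborel (\<lambda>x. (f x)\<^sup>2)" using admissible_integrable[OF N3 adW S] by (simp add: f_def power_mult_distrib)
    have fg: "V x * Z x * E x = f x * g x" for x by (cases "x = 0") (auto simp: f_def g_def E_def)
    have "(QV Z E)\<^sup>2 \<le> (LBINT x. (f x)\<^sup>2) * (LBINT x. (g x)\<^sup>2)"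
      unfolding QV_def fg using i F(1) by (intro Cauchy_Schwarz_integral) (auto simp: f_def g_def)
    also have "(LBINT x. (f x)\<^sup>2) = WW Z" by (simp add: f_def WW_def power_mult_distrib)
    also have "WW Z * (LBINT x. (g x)\<^sup>2) \<le> WW Z * (\<tau>\<^sup>2 * l2sq K)"
      using F2 by (intro mult_left_mono) (auto simp: g_def WW_def intro!: integral_nonneg_AE)
    finally have "\<bar>QV Z E\<bar> \<le> sqrt (WW Z * (\<tau>\<^sup>2 * l2sq K))" by (intro real_le_rsqrt) simp
    then show ?thesis using \<tau> by (simp add: real_sqrt_mult)
  qed
  have WW0: "WW Z \<ge> 0" unfolding WW_def by (intro integral_nonneg_AE AE_I2) simp
  have "QV Z (\<lambda>x. dil (1 + \<tau>) Z x - Z x) = c * QV Z E + (c - 1) * QV Z Z"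
    unfolding D QV_add_right[OF S sob_scale[OF SE] sob_scale[OF S]] QV_scale ..
  also have "... \<le> c * (sqrt (WW Z) * (\<tau> * sqrt (l2sq K))) + (c - 1) * absV Z"
    using QE QV_self_le[OF S] cb by (intro add_mono mult_left_mono) auto
  also have "... \<le> 2 ^ DIM('a) * (sqrt (WW Z) * (\<tau> * sqrt (l2sq K))) + (2 ^ DIM('a) * \<tau>) * absV Z"
    using cb \<tau> WW0 absV_nonneg by (intro add_mono mult_right_mono) auto
  finally show "QV Z (\<lambda>x. dil (1 + \<tau>) Z x - Z x) \<le> \<tau> * (2 ^ DIM('a) * (sqrt (WW Z) * sqrt (l2sq K) + absV Z))"
    by (simp add: algebra_simps)
qed

text \<open>A one-sided Pohozaev identity. No regularity of the solution is available, so the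
  equation is tested with the difference of the solution and its dilation; the error terms are
  quadratic in this difference and are absorbed by its Dirichlet integral and by \<open>lam < 0\<close>.\<close>

lemma Pohozaev_inequality:
  assumes adW: "admissible (\<lambda>x. (V x * norm x)\<^sup>2)" and S: "sob Z K" and lam: "lam < 0"
    and crit: "\<And>v H. sob v H \<Longrightarrow> dE Z K v H = lam * mform Z v"
  shows "PP Z \<le> l2sq K + 2 ^ DIM('a) * (sqrt (WW Z) * sqrt (l2sq K) + absV Z)"
proof -
  note lZ = sob_l2(1)[OF S] and lK = sob_l2(2)[OF S]
  note [measurable] = l2_measurable[OF lZ]
  define q where "q x = \<bar>Z x\<bar> powr (p - 2)" for x
  have adq: "admissible q"
  proof (rule admissible_powr[where r = "DIM('a) / 2"])
    have "q x powr (DIM('a) / 2) = \<bar>Z x\<bar> powr p" for x using p_conj by (simp add: q_def powr_powr)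
    then show "integrable lborel (\<lambda>x. q x powr (DIM('a) / 2))" using PP_integrable[OF S] by simp
  qed (auto simp: q_def[abs_def])
  \<comment> \<open>Collects p - 1 from the Taylor remainder, 3^(p-2) from splitting its weight, and
    1 + 2^p from the two endpoints, as t^p \<le> 2^p.\<close>
  define M where "M = (p - 1) * (3 powr (p - 2) * (1 + 2 powr p))"
  have M: "M > 0" unfolding M_def using p2 by (intro mult_pos_pos add_pos_pos) auto
  \<comment> \<open>Chosen so that M e is below both favourable coefficients, 1/2 of the Dirichlet
    integral of the increment and -lam/2 of its mass. The constant L depends on e but not on
    \<tau>.\<close>
  define e where "e = min (1 / 2) (- lam / 2) / M"
  have e: "e > 0" "M * e \<le> 1 / 2" "M * e \<le> - lam / 2" using M lam by (auto simp: e_def)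
  obtain L where L: "L \<ge> 0" and Lb: "\<And>u G. sob u G \<Longrightarrow> integrable lborel (\<lambda>x. q x * (u x)\<^sup>2) \<and>
      (LBINT x. q x * (u x)\<^sup>2) \<le> e * l2sq G + e * l2sq u + L * loc_sq L u" using admissible_bound[OF N3 adq e(1)] by auto
  define C where "C = l2sq K / 2 + M * (L * (2 * (2 ^ DIM('a))\<^sup>2 * (L\<^sup>2 * l2sq K + l2sq Z)))"
  define X where "X = l2sq K + 2 ^ DIM('a) * (sqrt (WW Z) * sqrt (l2sq K) + absV Z)"
  have main: "PP Z \<le> X + \<tau> * C" if \<tau>: "0 < \<tau>" "\<tau> \<le> 1" for \<tau>
  proof -
    define t where "t = 1 + \<tau>"
    have t: "t > 0" "t \<ge> 1" "t \<le> 2" using \<tau> by (auto simp: t_def)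
    define D where "D x = dil t Z x - Z x" for x
    define H where "H x = t *\<^sub>R dil t K x - K x" for x
    note SZt = sob_dil[OF S t(1)]
    have SD: "sob D H" unfolding D_def[abs_def] H_def[abs_def] by (rule sob_diff[OF SZt S])
    note lD = sob_l2(1)[OF SD] and lH = sob_l2(2)[OF SD]
    have DZ: "(\<lambda>x. Z x + D x) = dil t Z" "(\<lambda>x. K x + H x) = (\<lambda>x. t *\<^sub>R dil t K x)" by (auto simp: D_def H_def)
    \<comment> \<open>The masses of Z and of its dilation coincide, so the increment is orthogonal
      to Z up to second order.\<close>
    have mD: "mform Z D = - (l2sq D / 2)" using l2sq_add_eq[OF lZ lD] unfolding DZ l2sq_dil[OF lZ t(1)] by (simp add: mform_def)
    have KH: "(LBINT x. K x \<bullet> H x) = ((t\<^sup>2 - 1) * l2sq K - l2sq H) / 2"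
      using l2sq_add_eq[OF lK lH] unfolding DZ l2sq_scale l2sq_dil[OF lK t(1)] by (simp add: algebra_simps)
    \<comment> \<open>The quadratic terms in H and D are both nonpositive here, the second because
      lam < 0; they pay for the Taylor remainder.\<close>
    have I1: "NL Z D = ((t\<^sup>2 - 1) * l2sq K - l2sq H) / 2 + QV Z D + lam / 2 * l2sq D" using crit[OF SD] unfolding dE_def KH mD by simp
    \<comment> \<open>Dilating back turns the weight |dil t Z|^(p-2) into q, so the bound for this
      one weight holds uniformly in \<tau>.\<close>
    define D' where "D' = dil (1 / t) D"
    have SD': "sob D' (\<lambda>x. (1 / t) *\<^sub>R dil (1 / t) H x)" unfolding D'_def using t by (intro sob_dil[OF SD]) auto
    have lD': "l2sq D' = l2sq D" unfolding D'_def using t by (intro l2sq_dil[OF lD]) auto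
    have lH': "l2sq (\<lambda>x. (1 / t) *\<^sub>R dil (1 / t) H x) \<le> l2sq H"
    proof -
      have "(1 / t)\<^sup>2 * l2sq H \<le> 1 * l2sq H" using t by (intro mult_right_mono power_le_one) auto
      then show ?thesis unfolding l2sq_scale using l2sq_dil[OF lH, of "1 / t"] t by simp
    qed
    have locD': "loc_sq L D' \<le> loc_sq L D" unfolding D'_def using t L by (intro loc_sq_dil_le lD) auto
    define \<Lambda> where "\<Lambda> = e * l2sq H + e * l2sq D + L * loc_sq L D"
    have qD: "(LBINT x. q x * (D x)\<^sup>2) \<le> \<Lambda>" using Lb[OF SD] by (simp add: \<Lambda>_def)
    have qD': "(LBINT x. q x * (D' x)\<^sup>2) \<le> \<Lambda>"
    proof -
      have "(LBINT x. q x * (D' x)\<^sup>2) \<le> e * l2sq (\<lambda>x. (1 / t) *\<^sub>R dil (1 / t) H x) + e * l2sq D + L * loc_sq L D'"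
        using Lb[OF SD'] lD' by simp
      also have "... \<le> \<Lambda>" unfolding \<Lambda>_def using lH' locD' e L by (intro add_mono mult_left_mono) auto
      finally show ?thesis .
    qed
    define q' where "q' x = \<bar>dil t Z x\<bar> powr (p - 2)" for x
    have q'D: "(LBINT x. q' x * (D x)\<^sup>2) = t powr p * (LBINT x. q x * (D' x)\<^sup>2)"
      using power_form_dil[of Z D' t] l2_measurable[OF sob_l2(1)[OF SD']] t by (simp add: q'_def q_def D'_def dil_inverse)
    have iq': "integrable lborel (\<lambda>x. q' x * (D x)\<^sup>2)" unfolding q'_def by (rule power_single_integrable[OF SZt SD])
    have "t powr p \<le> 2 powr p" using t p2 by (intro powr_mono2) auto
    then have qq: "(LBINT x. q' x * (D x)\<^sup>2) \<le> 2 powr p * \<Lambda>"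
      unfolding q'D using qD' by (intro mult_mono) (auto simp: q_def intro!: integral_nonneg_AE)
    have I2: "(t powr p - 1) * (PP Z / p) \<le> NL Z D + M * \<Lambda>"
    proof -
      define r where "r x = (\<bar>Z x\<bar> + \<bar>D x\<bar>) powr (p - 2) * (D x)\<^sup>2" for x
      have ir: "integrable lborel r" unfolding r_def[abs_def] by (rule power_form_integrable[OF S SD SD])
      have "(LBINT x. r x) \<le> (LBINT x. 3 powr (p - 2) * (q x * (D x)\<^sup>2 + q' x * (D x)\<^sup>2))"
      proof (rule integral_mono[OF ir])
        show "integrable lborel (\<lambda>x. 3 powr (p - 2) * (q x * (D x)\<^sup>2 + q' x * (D x)\<^sup>2))" using iq' Lb[OF SD] by auto
        fix x
        show "r x \<le> 3 powr (p - 2) * (q x * (D x)\<^sup>2 + q' x * (D x)\<^sup>2)"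
          using mult_right_mono[OF sum_powr_le[of "Z x" "dil t Z x"], of "(D x)\<^sup>2"] by (simp add: r_def D_def q_def q'_def algebra_simps)
      qed
      also have "... = 3 powr (p - 2) * ((LBINT x. q x * (D x)\<^sup>2) + (LBINT x. q' x * (D x)\<^sup>2))" using iq' Lb[OF SD] by simp
      also have "... \<le> 3 powr (p - 2) * (\<Lambda> + 2 powr p * \<Lambda>)" using qD qq by (intro mult_left_mono add_mono) auto
      finally have "(p - 1) * (LBINT x. r x) \<le> (p - 1) * (3 powr (p - 2) * (\<Lambda> + 2 powr p * \<Lambda>))"
        using p2 by (intro mult_left_mono) auto
      then have r: "(p - 1) * (LBINT x. r x) \<le> M * \<Lambda>" by (simp add: M_def algebra_simps)
      note i = PP_integrable[OF SZt] PP_integrable[OF S] NL_integrable[OF S SD]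
      have "(LBINT x. \<bar>dil t Z x\<bar> powr p / p - \<bar>Z x\<bar> powr p / p) \<le> (LBINT x. power_nl p (Z x) * D x + (p - 1) * r x)"
      proof (rule integral_mono)
        show "integrable lborel (\<lambda>x. \<bar>dil t Z x\<bar> powr p / p - \<bar>Z x\<bar> powr p / p)" using i by auto
        show "integrable lborel (\<lambda>x. power_nl p (Z x) * D x + (p - 1) * r x)" using i ir by auto
        fix x
        show "\<bar>dil t Z x\<bar> powr p / p - \<bar>Z x\<bar> powr p / p \<le> power_nl p (Z x) * D x + (p - 1) * r x"
          using power_nl_expansion[OF p2, of "Z x" "D x"] by (simp add: r_def D_def abs_le_iff)
      qed
      also have "(LBINT x. power_nl p (Z x) * D x + (p - 1) * r x) = NL Z D + (p - 1) * (LBINT x. r x)" using i ir by (simp add: NL_def)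
      also have "(LBINT x. \<bar>dil t Z x\<bar> powr p / p - \<bar>Z x\<bar> powr p / p) = PP (dil t Z) / p - PP Z / p" using i by (simp add: PP_def)
      also have "... = (t powr p - 1) * (PP Z / p)" unfolding PP_dil[OF l2_measurable[OF lZ] t(1)] by (simp add: algebra_simps diff_divide_distrib)
      finally show ?thesis using r by linarith
    qed
    have I4: "M * \<Lambda> \<le> l2sq H / 2 - lam / 2 * l2sq D + M * (L * loc_sq L D)"
      using mult_right_mono[OF e(2), of "l2sq H"] mult_right_mono[OF e(3), of "l2sq D"] by (simp add: \<Lambda>_def algebra_simps)
    have "L * loc_sq L D \<le> L * (\<tau>\<^sup>2 * (2 * (2 ^ DIM('a))\<^sup>2 * (L\<^sup>2 * l2sq K + l2sq Z)))"
      using dilation_difference_bounds(1)[OF adW S \<tau> L] L unfolding D_def t_def by (intro mult_left_mono) auto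
    from mult_left_mono[OF this, of M] M
    have I5: "M * (L * loc_sq L D) \<le> \<tau>\<^sup>2 * (M * (L * (2 * (2 ^ DIM('a))\<^sup>2 * (L\<^sup>2 * l2sq K + l2sq Z))))" by (simp add: mult_ac)
    have I6: "QV Z D \<le> \<tau> * (2 ^ DIM('a) * (sqrt (WW Z) * sqrt (l2sq K) + absV Z))"
      using dilation_difference_bounds(2)[OF adW S \<tau>] unfolding D_def t_def .
    have "p * \<tau> * (PP Z / p) \<le> (t powr p - 1) * (PP Z / p)"
      using powr_Bernoulli[of \<tau> p] \<tau> p2 PP_nonneg unfolding t_def by (intro mult_right_mono) auto
    then have I7: "\<tau> * PP Z \<le> (t powr p - 1) * (PP Z / p)" using p2 by simp
    have t2: "(t\<^sup>2 - 1) * l2sq K / 2 = \<tau> * l2sq K + \<tau>\<^sup>2 * (l2sq K / 2)" by (simp add: t_def power2_eq_square field_simps)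
    have "\<tau> * PP Z \<le> (t\<^sup>2 - 1) * l2sq K / 2 + QV Z D + M * (L * loc_sq L D)"
      using I7 I2 I1 I4 unfolding diff_divide_distrib by linarith
    also have "... \<le> \<tau> * X + \<tau>\<^sup>2 * C" using I5 I6 unfolding t2 X_def C_def by (simp only: distrib_left)
    finally have "\<tau> * PP Z \<le> \<tau> * (X + \<tau> * C)" by (simp add: power2_eq_square algebra_simps)
    then show ?thesis using \<tau> by simp
  qed
  have "PP Z \<le> X"
  proof (rule tendsto_lowerbound)
    have "(\<lambda>n. X + step n * C) \<longlonglongrightarrow> X + 0 * C" by (intro tendsto_intros step_tendsto)
    then show "(\<lambda>n. X + step n * C) \<longlonglongrightarrow> X" by simp
    show "\<forall>\<^sub>F n in sequentially. PP Z \<le> X + step n * C" using main step_pos step_le_1 by simp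
  qed simp
  then show ?thesis by (simp add: X_def)
qed

text \<open>For lam < 0, negative energy bounds PP/p from below and the Pohozaev inequality bounds
  it from above by A/p plus absorbable terms, leaving (1/2 - 1/p) A. For lam \<ge> 0, testing with
  the solution gives PP \<le> A + QV, and negative energy then makes A + QV negative.\<close>

theorem critical_gradient_bound:
  assumes adW: "admissible (\<lambda>x. (V x * norm x)\<^sup>2)"
  shows "\<exists>C>0. \<forall>Z K lam. sob Z K \<longrightarrow> (\<forall>v H. sob v H \<longrightarrow> dE Z K v H = lam * mform Z v) \<longrightarrow> EE Z K < 0 \<longrightarrow>
    l2sq K \<le> C * l2sq Z"
proof -
  define m :: real where "m = 2 ^ DIM('a)"
  have m: "m \<ge> 1" by (simp add: m_def)
  define \<theta> where "\<theta> = 1 / 2 - 1 / p"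
  have \<theta>: "\<theta> > 0" using p2 by (simp add: \<theta>_def field_simps)
  \<comment> \<open>The three constants are tuned so that each of three error terms costs \<theta>
    A/8; the remaining 5 \<theta>/8 explains the factor 8/(5 \<theta>) in the final
    constant.\<close>
  define e2 where "e2 = \<theta> / (8 * m)"
  define cW where "cW = 2 * m\<^sup>2 / \<theta>"
  define e1 where "e1 = \<theta> / (8 * cW)"
  have pos: "e2 > 0" "cW > 0" "e1 > 0" using \<theta> m by (auto simp: e2_def cW_def e1_def)
  obtain C2 where C2: "C2 > 0" "\<And>u G. sob u G \<Longrightarrow> absV u \<le> e2 * l2sq G + C2 * l2sq u" using absV_bound[OF pos(1)] by auto
  obtain C1 where C1: "C1 > 0" "\<And>u G. sob u G \<Longrightarrow> WW u \<le> e1 * l2sq G + C1 * l2sq u"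
    by (rule admissible_bound_global[OF N3 adW pos(3)]) (simp add: WW_def)
  obtain C3 where C3: "C3 > 0" "\<And>u G. sob u G \<Longrightarrow> absV u \<le> 1/2 * l2sq G + C3 * l2sq u" using absV_bound[of "1/2"] by auto
  define C where "C = (cW * C1 + m * C2) * (8 / (5 * \<theta>)) + 2 * C3"
  have "l2sq K \<le> C * l2sq Z"
    if S: "sob Z K" and crit: "\<And>v H. sob v H \<Longrightarrow> dE Z K v H = lam * mform Z v" and neg: "EE Z K < 0" for Z K lam
  proof -
    define A where "A = l2sq K"
    define B where "B = l2sq Z"
    have A0: "A \<ge> 0" "B \<ge> 0" by (auto simp: A_def B_def)
    have neg': "A / 2 + QV Z Z / 2 < PP Z / p" using neg by (simp add: EE_def A_def)
    show ?thesis
    proof (cases "lam < 0")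
      case True
      have "PP Z \<le> A + m * (sqrt (WW Z) * sqrt A + absV Z)" using Pohozaev_inequality[OF adW S True crit] by (simp add: A_def m_def)
      then have "PP Z / p \<le> A / p + m * (sqrt (WW Z) * sqrt A + absV Z) / p" using p2 by (simp add: divide_right_mono flip: add_divide_distrib)
      moreover have W0: "WW Z \<ge> 0" unfolding WW_def by (intro integral_nonneg_AE AE_I2) simp
      have s0: "0 \<le> m * (sqrt (WW Z) * sqrt A + absV Z)" using m W0 A0 absV_nonneg by simp
      have "m * (sqrt (WW Z) * sqrt A + absV Z) / p \<le> m * (sqrt (WW Z) * sqrt A + absV Z) / 2" using s0 p2 by (intro divide_left_mono) auto
      moreover have "- QV Z Z / 2 \<le> m * absV Z / 2" using QV_self_le[OF S] mult_right_mono[OF m, of "absV Z"] absV_nonneg[of Z] by simp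
      moreover have th: "\<theta> * A = A / 2 - A / p" by (simp add: \<theta>_def algebra_simps)
      ultimately have "\<theta> * A < m * absV Z + m * (sqrt (WW Z) * sqrt A) / 2" using neg' unfolding distrib_left add_divide_distrib by linarith
      moreover have "m * (sqrt (WW Z) * sqrt A) \<le> \<theta> / 8 * A + cW * WW Z"
      proof -
        \<comment> \<open>Young's inequality for the mixed term, written as a square whose cross
          term is \<theta>/2 times the product to be bounded.\<close>
        have "0 \<le> (\<theta> / 4 * sqrt A - m * sqrt (WW Z))\<^sup>2" by simp
        also have "... = (\<theta> / 4)\<^sup>2 * A + m\<^sup>2 * WW Z - \<theta> / 2 * (m * (sqrt (WW Z) * sqrt A))"
        proof -
          have "(\<theta> / 4 * x - m * y)\<^sup>2 = (\<theta> / 4)\<^sup>2 * x\<^sup>2 + m\<^sup>2 * y\<^sup>2 - \<theta> / 2 * (m * (y * x))" for x y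
            by (simp add: power2_eq_square algebra_simps)
          from this[of "sqrt A" "sqrt (WW Z)"] show ?thesis using A0 W0 by simp
        qed
        finally have "\<theta> / 2 * (m * (sqrt (WW Z) * sqrt A)) \<le> \<theta> / 2 * (\<theta> / 8 * A + cW * WW Z)"
          using \<theta> by (simp add: cW_def power2_eq_square algebra_simps)
        then show ?thesis using \<theta> by simp
      qed
      moreover have "0 \<le> m * (sqrt (WW Z) * sqrt A)" using m W0 A0 by simp
      moreover have "cW * WW Z \<le> \<theta> / 8 * A + cW * C1 * B"
        using mult_left_mono[OF C1(2)[OF S], of cW] pos by (simp add: e1_def A_def B_def algebra_simps)
      moreover have "m * absV Z \<le> \<theta> / 8 * A + m * C2 * B"
        using mult_left_mono[OF C2(2)[OF S], of m] m by (simp add: e2_def A_def B_def algebra_simps)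
      ultimately have "5 * \<theta> / 8 * A \<le> (cW * C1 + m * C2) * B" by (simp add: algebra_simps)
      then have "A \<le> (cW * C1 + m * C2) * (8 / (5 * \<theta>)) * B" using \<theta> by (simp add: field_simps)
      also have "... \<le> C * B" unfolding C_def using A0 C3 by (intro mult_right_mono) auto
      finally show ?thesis by (simp add: A_def B_def)
    next
      case False
      have "A + QV Z Z - PP Z = lam * B" using crit[OF S] by (simp add: dE_def NL_self mform_self A_def B_def l2sq_def power2_norm_eq_inner)
      moreover have "0 \<le> lam * B" using False A0 by simp
      ultimately have "PP Z / p \<le> (A + QV Z Z) / p" using p2 by (simp add: divide_right_mono)
      then have "\<theta> * (A + QV Z Z) < 0" using neg' by (simp add: \<theta>_def algebra_simps add_divide_distrib)
      then have "A + QV Z Z < 0" using \<theta> by (simp add: mult_less_0_iff)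
      then have "A \<le> 2 * C3 * B" using QV_self_le[OF S] C3(2)[OF S] by (simp add: A_def B_def)
      also have "... \<le> C * B" unfolding C_def using A0 C1 C2 pos m \<theta> by (intro mult_right_mono) auto
      finally show ?thesis by (simp add: A_def B_def)
    qed
  qed
  moreover have "C > 0" unfolding C_def using C1 C2 C3 pos m \<theta> by (intro add_pos_pos mult_pos_pos) auto
  ultimately show ?thesis by blast
qed

end

section \<open>From Borel representatives to Sobolev functions\<close>

text \<open>The dictionary between H^1 of the statement and \<open>sob\<close>. Nothing is said
  about \<open>weak_gradient U\<close>, since uniqueness identifies it with G almost
  everywhere.\<close>

definition rep :: "('a::euclidean_space \<Rightarrow> real) \<Rightarrow> ('a \<Rightarrow> real) \<Rightarrow> ('a \<Rightarrow> 'a) \<Rightarrow> bool" where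
  "rep U u G \<longleftrightarrow> sob u G \<and> (AE x in lebesgue. U x = u x)"

lemma rep_exists: "U \<in> H1 \<Longrightarrow> \<exists>u G. rep U u G"
  by (metis H1_representative rep_def)

lemma rep_sob: "rep U u G \<Longrightarrow> sob u G"
  by (simp add: rep_def)

lemma sob_rep: "sob u G \<Longrightarrow> rep u u G"
  by (simp add: rep_def)

lemma rep_H1: "rep U u G \<Longrightarrow> U \<in> H1"
  by (auto simp: rep_def intro: sob_H1)

lemma rep_AE: "rep U u G \<Longrightarrow> AE x in lebesgue. U x = u x \<and> weak_gradient U x = G x"
  using sob_weak_gradient[of u G U] by (auto simp: rep_def)

lemma rep_measurable:
  "rep U u G \<Longrightarrow> u \<in> borel_measurable borel" "rep U u G \<Longrightarrow> G \<in> borel_measurable borel"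
  using sob_l2 l2_measurable unfolding rep_def by blast+

lemma rep_add: "rep U u G \<Longrightarrow> rep W w H \<Longrightarrow> rep (\<lambda>x. U x + W x) (\<lambda>x. u x + w x) (\<lambda>x. G x + H x)"
  by (auto simp: rep_def intro: sob_add elim: eventually_elim2)

lemma rep_scale: "rep U u G \<Longrightarrow> rep (\<lambda>x. c * U x) (\<lambda>x. c * u x) (\<lambda>x. c *\<^sub>R G x)"
  by (auto simp: rep_def intro: sob_scale elim: eventually_mono)

lemma rep_diff: "rep U u G \<Longrightarrow> rep W w H \<Longrightarrow> rep (\<lambda>x. U x - W x) (\<lambda>x. u x - w x) (\<lambda>x. G x - H x)"
  by (auto simp: rep_def intro: sob_diff elim: eventually_elim2)

lemma rep_square:
  assumes r: "rep U u G" shows "(LINT x|lebesgue. (U x)\<^sup>2) = l2sq u"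
  unfolding l2sq_def
proof (rule lebesgue_borel_integral(1))
  show "(\<lambda>x. (norm (u x))\<^sup>2) \<in> borel_measurable borel" using rep_measurable[OF r] by simp
  show "AE x in lebesgue. (U x)\<^sup>2 = (norm (u x))\<^sup>2" using rep_AE[OF r] by eventually_elim simp
qed

lemma rep_grad_square:
  assumes r: "rep U u G" shows "(LINT x|lebesgue. (norm (weak_gradient U x))\<^sup>2) = l2sq G"
  unfolding l2sq_def
proof (rule lebesgue_borel_integral(1))
  show "(\<lambda>x. (norm (G x))\<^sup>2) \<in> borel_measurable borel" using rep_measurable[OF r] by simp
  show "AE x in lebesgue. (norm (weak_gradient U x))\<^sup>2 = (norm (G x))\<^sup>2" using rep_AE[OF r] by eventually_elim simp
qed

lemma rep_H1_norm: "rep U u G \<Longrightarrow> H1_norm U = sqrt (l2sq G + l2sq u)"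
  by (simp add: H1_norm_def rep_square rep_grad_square)

lemma rep_mform:
  assumes "rep U u G" "rep W w H" shows "(LINT x|lebesgue. U x * W x) = mform u w"
  unfolding mform_def
proof (rule lebesgue_borel_integral(1))
  note [measurable] = rep_measurable[OF assms(1)] rep_measurable[OF assms(2)]
  show "(\<lambda>x. u x * w x) \<in> borel_measurable borel" by measurable
  show "AE x in lebesgue. U x * W x = u x * w x" using rep_AE[OF assms(1)] rep_AE[OF assms(2)] by eventually_elim simp
qed

lemma rep_mass_sphere: "rep U u G \<Longrightarrow> U \<in> mass_sphere \<rho> \<longleftrightarrow> l2sq u = \<rho>\<^sup>2"
  by (simp add: mass_sphere_def rep_H1 rep_square)

context schrod
begin

lemma dE_bound:
  assumes S: "sob u G"
  shows "\<exists>C>0. \<forall>v H. sob v H \<longrightarrow> \<bar>dE u G v H\<bar> \<le> C * sqrt (l2sq H + l2sq v)"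
proof -
  obtain C1 where C1: "C1 > 0" "\<And>v H. sob v H \<Longrightarrow> absV v \<le> 1 * l2sq H + C1 * l2sq v" using absV_bound[of 1] by auto
  define C where "C = sqrt (l2sq G) + sqrt (absV u) * sqrt (1 + C1) + sqrt (PP u) * sqrt (PK * l2sq G powr (p / DIM('a))) + 1"
  have "\<bar>dE u G v H\<bar> \<le> C * sqrt (l2sq H + l2sq v)" if T: "sob v H" for v H
  proof -
    define n where "n = sqrt (l2sq H + l2sq v)"
    have n0: "n \<ge> 0" by (simp add: n_def)
    have H: "sqrt (l2sq H) \<le> n" by (simp add: n_def)
    have "absV v \<le> (1 + C1) * (l2sq H + l2sq v)"
      using C1(2)[OF T] C1(1) mult_nonneg_nonneg[OF less_imp_le[OF C1(1)] l2sq_nonneg[of H]] l2sq_nonneg[of v]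
      unfolding distrib_left distrib_right mult_1 by linarith
    then have A: "sqrt (absV v) \<le> sqrt (1 + C1) * n" by (simp add: n_def flip: real_sqrt_mult)
    have 1: "\<bar>LBINT x. G x \<bullet> H x\<bar> \<le> sqrt (l2sq G) * n"
      using l2_inner_bound[OF sob_l2(2)[OF S] sob_l2(2)[OF T]] mult_left_mono[OF H, of "sqrt (l2sq G)"] by simp
    have 2: "\<bar>QV u v\<bar> \<le> sqrt (absV u) * sqrt (1 + C1) * n"
      using QV_bound[OF S T] mult_left_mono[OF A, of "sqrt (absV u)"] absV_nonneg[of u] by (simp add: mult_ac)
    have 3: "\<bar>NL u v\<bar> \<le> sqrt (PP u) * sqrt (PK * l2sq G powr (p / DIM('a))) * n"
    proof -
      have "\<bar>NL u v\<bar> \<le> sqrt (PP u) * sqrt (PK * l2sq G powr (p / DIM('a))) * sqrt (l2sq H)"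
        using NL_bound[OF S T] by (simp add: real_sqrt_mult mult_ac)
      also have "... \<le> sqrt (PP u) * sqrt (PK * l2sq G powr (p / DIM('a))) * n" using PK_nonneg PP_nonneg by (intro mult_left_mono H) auto
      finally show ?thesis .
    qed
    have "\<bar>dE u G v H\<bar> \<le> sqrt (l2sq G) * n + sqrt (absV u) * sqrt (1 + C1) * n + sqrt (PP u) * sqrt (PK * l2sq G powr (p / DIM('a))) * n + n"
      unfolding dE_def using 1 2 3 n0 by linarith
    then show ?thesis by (simp add: C_def n_def distrib_right)
  qed
  moreover have "C > 0" unfolding C_def using C1 absV_nonneg PP_nonneg PK_nonneg by (intro add_nonneg_pos add_nonneg_nonneg mult_nonneg_nonneg) auto
  ultimately show ?thesis by blast
qed

lemma energy_remainder:
  assumes S: "sob u G"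
  shows "\<exists>C>0. \<forall>v H. sob v H \<longrightarrow> l2sq H + l2sq v \<le> 1 \<longrightarrow>
    \<bar>EE (\<lambda>x. u x + v x) (\<lambda>x. G x + H x) - EE u G - dE u G v H\<bar> \<le> C * (l2sq H + l2sq v)"
proof -
  obtain C1 where C1: "C1 > 0" "\<And>v H. sob v H \<Longrightarrow> absV v \<le> 1 * l2sq H + C1 * l2sq v" using absV_bound[of 1] by auto
  define M where "M = (p - 1) * (PK * (l2sq G + 1) powr (p / DIM('a)))"
  have M0: "M \<ge> 0" unfolding M_def using p2 PK_nonneg by simp
  define C where "C = 1 + C1 + M"
  have "\<bar>EE (\<lambda>x. u x + v x) (\<lambda>x. G x + H x) - EE u G - dE u G v H\<bar> \<le> C * (l2sq H + l2sq v)"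
    if T: "sob v H" and n: "l2sq H + l2sq v \<le> 1" for v H
  proof -
    have "l2sq H \<le> 1" using n l2sq_nonneg[of v] by linarith
    then have "(l2sq G + l2sq H) powr (p / DIM('a)) \<le> (l2sq G + 1) powr (p / DIM('a))" using p2 by (intro powr_mono2) auto
    then have "(p - 1) * (PK * (l2sq G + l2sq H) powr (p / DIM('a)) * l2sq H) \<le> (p - 1) * (PK * (l2sq G + 1) powr (p / DIM('a)) * l2sq H)"
      using p2 PK_nonneg by (intro mult_left_mono mult_right_mono) auto
    also have "... = M * l2sq H" by (simp add: M_def)
    finally have "\<bar>EE (\<lambda>x. u x + v x) (\<lambda>x. G x + H x) - EE u G - dE u G v H\<bar> \<le> l2sq H / 2 + absV v / 2 + M * l2sq H"
      using energy_expansion[OF S T] by linarith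
    moreover have "0 \<le> C1 * l2sq H" "0 \<le> C1 * l2sq v" "0 \<le> M * l2sq v" using C1 M0 by auto
    moreover have "0 \<le> l2sq H" "0 \<le> l2sq v" by auto
    ultimately show ?thesis using C1(2)[OF T] unfolding C_def distrib_left distrib_right mult_1 by linarith
  qed
  moreover have "C > 0" using C1 M0 by (simp add: C_def)
  ultimately show ?thesis by blast
qed

end

section \<open>Transfer to the functional of the statement\<close>

text \<open>\<open>VV\<close> is the given Lebesgue measurable potential and \<open>V\<close> its
  Borel representative; all integrals agree.\<close>

locale schrod_H1 = schrod T p V for T :: "'a::euclidean_space itself" and p :: real and V :: "'a \<Rightarrow> real" +
  fixes VV :: "'a \<Rightarrow> real"
  assumes VV: "AE x in lebesgue. VV x = V x"
begin

lemma rep_QV: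
  assumes "rep U u G" "rep W w H" shows "(LINT x|lebesgue. VV x * U x * W x) = QV u w"
  unfolding QV_def
proof (rule lebesgue_borel_integral(1))
  note [measurable] = mV rep_measurable[OF assms(1)] rep_measurable[OF assms(2)]
  show "(\<lambda>x. V x * u x * w x) \<in> borel_measurable borel" by measurable
  show "AE x in lebesgue. VV x * U x * W x = V x * u x * w x" using rep_AE[OF assms(1)] rep_AE[OF assms(2)] VV by eventually_elim simp
qed

lemma rep_energy: assumes r: "rep U u G" shows "energy VV U = EE u G"
proof -
  have "(LINT x|lebesgue. \<bar>U x\<bar> powr p) = PP u" unfolding PP_def using rep_measurable[OF r] rep_AE[OF r]
    by (intro lebesgue_borel_integral(1)) (auto elim: eventually_mono)
  moreover have "(LINT x|lebesgue. VV x * (U x)\<^sup>2) = QV u u" using rep_QV[OF r r] by (simp add: power2_eq_square mult.assoc)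
  ultimately show ?thesis by (simp add: energy_def EE_def rep_grad_square[OF r] flip: p_def)
qed

definition dEl :: "('a \<Rightarrow> real) \<Rightarrow> ('a \<Rightarrow> real) \<Rightarrow> real" where
  "dEl U W = (LINT x|lebesgue. weak_gradient U x \<bullet> weak_gradient W x) + (LINT x|lebesgue. VV x * U x * W x)
     - (LINT x|lebesgue. \<bar>U x\<bar> powr (p - 2) * U x * W x)"

lemma rep_dEl: assumes r: "rep U u G" "rep W w H" shows "dEl U W = dE u G w H"
proof -
  note [measurable] = rep_measurable[OF r(1)] rep_measurable[OF r(2)]
  have "(LINT x|lebesgue. weak_gradient U x \<bullet> weak_gradient W x) = (LBINT x. G x \<bullet> H x)"
  proof (rule lebesgue_borel_integral(1))
    show "AE x in lebesgue. weak_gradient U x \<bullet> weak_gradient W x = G x \<bullet> H x"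
      using rep_AE[OF r(1)] rep_AE[OF r(2)] by eventually_elim simp
  qed measurable
  moreover have "(LINT x|lebesgue. \<bar>U x\<bar> powr (p - 2) * U x * W x) = NL u w" unfolding NL_def power_nl_def
  proof (rule lebesgue_borel_integral(1))
    show "AE x in lebesgue. \<bar>U x\<bar> powr (p - 2) * U x * W x = \<bar>u x\<bar> powr (p - 2) * u x * w x"
      using rep_AE[OF r(1)] rep_AE[OF r(2)] by eventually_elim simp
  qed measurable
  ultimately show ?thesis by (simp add: dEl_def dE_def rep_QV[OF r])
qed

lemma weak_solutionI:
  assumes r: "rep U u G" and crit: "\<And>v H. sob v H \<Longrightarrow> dE u G v H = lam * mform u v"
  shows "weak_solution VV lam U"
  unfolding weak_solution_def
proof (intro conjI ballI)
  show "U \<in> H1" by (rule rep_H1[OF r])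
  fix \<phi> :: "'a \<Rightarrow> real" assume "\<phi> \<in> H1"
  then obtain v H where v: "rep \<phi> v H" using rep_exists by blast
  have "dEl U \<phi> = lam * (LINT x|lebesgue. U x * \<phi> x)" using crit[OF rep_sob[OF v]] rep_dEl[OF r v] rep_mform[OF r v] by simp
  then show "(LINT x|lebesgue. weak_gradient U x \<bullet> weak_gradient \<phi> x) + (LINT x|lebesgue. VV x * U x * \<phi> x) =
      lam * (LINT x|lebesgue. U x * \<phi> x) + (LINT x|lebesgue. \<bar>U x\<bar> powr (sobolev_exponent DIM('a) - 2) * U x * \<phi> x)"
    by (simp add: dEl_def flip: p_def)
qed

lemma energy_has_derivative_dEl:
  assumes r: "rep U u G" shows "energy_has_derivative VV U (dEl U)"
  unfolding energy_has_derivative_def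
proof (intro conjI ballI allI impI)
  note S = rep_sob[OF r]
  fix \<phi> \<psi> :: "'a \<Rightarrow> real" assume "\<phi> \<in> H1" "\<psi> \<in> H1"
  then obtain v H w K where v: "rep \<phi> v H" and w: "rep \<psi> w K" using rep_exists by meson
  show "dEl U (\<lambda>x. \<phi> x + \<psi> x) = dEl U \<phi> + dEl U \<psi>" unfolding rep_dEl[OF r rep_add[OF v w]] rep_dEl[OF r v] rep_dEl[OF r w]
    by (rule dE_add[OF S rep_sob[OF v] rep_sob[OF w]])
next
  fix \<phi> :: "'a \<Rightarrow> real" and c assume "\<phi> \<in> H1"
  then obtain v H where v: "rep \<phi> v H" using rep_exists by meson
  show "dEl U (\<lambda>x. c * \<phi> x) = c * dEl U \<phi>" unfolding rep_dEl[OF r rep_scale[OF v]] rep_dEl[OF r v] by (rule dE_scale)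
next
  obtain C where C: "C > 0" "\<And>v H. sob v H \<Longrightarrow> \<bar>dE u G v H\<bar> \<le> C * sqrt (l2sq H + l2sq v)"
    using dE_bound[OF rep_sob[OF r]] by auto
  show "\<exists>C. \<forall>\<phi>\<in>H1. \<bar>dEl U \<phi>\<bar> \<le> C * H1_norm \<phi>"
  proof (intro exI ballI)
    fix \<phi> :: "'a \<Rightarrow> real" assume "\<phi> \<in> H1"
    then obtain v H where v: "rep \<phi> v H" using rep_exists by meson
    show "\<bar>dEl U \<phi>\<bar> \<le> C * H1_norm \<phi>" unfolding rep_dEl[OF r v] rep_H1_norm[OF v] by (rule C(2)[OF rep_sob[OF v]])
  qed
next
  fix \<epsilon> :: real assume \<epsilon>: "\<epsilon> > 0"
  obtain C where C: "C > 0" "\<And>v H. sob v H \<Longrightarrow> l2sq H + l2sq v \<le> 1 \<Longrightarrow>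
      \<bar>EE (\<lambda>x. u x + v x) (\<lambda>x. G x + H x) - EE u G - dE u G v H\<bar> \<le> C * (l2sq H + l2sq v)"
    using energy_remainder[OF rep_sob[OF r]] by auto
  show "\<exists>\<delta>>0. \<forall>\<phi>\<in>H1. H1_norm \<phi> < \<delta> \<longrightarrow> \<bar>energy VV (\<lambda>x. U x + \<phi> x) - energy VV U - dEl U \<phi>\<bar> \<le> \<epsilon> * H1_norm \<phi>"
  \<comment> \<open>The bound 1 is the range of \<open>energy_remainder\<close>; below \<epsilon>/C
    its quadratic bound C n^2 is at most \<epsilon> n.\<close>
  proof (intro exI[of _ "min 1 (\<epsilon> / C)"] conjI ballI impI)
    show "0 < min 1 (\<epsilon> / C)" using \<epsilon> C by simp
    fix \<phi> :: "'a \<Rightarrow> real" assume "\<phi> \<in> H1" and small: "H1_norm \<phi> < min 1 (\<epsilon> / C)"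
    then obtain v H where v: "rep \<phi> v H" using rep_exists by meson
    define n where "n = H1_norm \<phi>"
    have n: "0 \<le> n" "n < 1" "n < \<epsilon> / C" using small by (auto simp: n_def rep_H1_norm[OF v])
    have n2: "l2sq H + l2sq v = n\<^sup>2" by (simp add: n_def rep_H1_norm[OF v])
    have "\<bar>EE (\<lambda>x. u x + v x) (\<lambda>x. G x + H x) - EE u G - dE u G v H\<bar> \<le> C * n\<^sup>2"
      using C(2)[OF rep_sob[OF v]] n unfolding n2 by (simp add: power_le_one)
    also have "... = C * n * n" by (simp add: power2_eq_square)
    also have "... \<le> \<epsilon> * n" using n C by (intro mult_right_mono) (auto simp: field_simps)
    finally show "\<bar>energy VV (\<lambda>x. U x + \<phi> x) - energy VV U - dEl U \<phi>\<bar> \<le> \<epsilon> * H1_norm \<phi>"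
      unfolding rep_energy[OF rep_add[OF r v]] rep_energy[OF r] rep_dEl[OF r v] n_def .
  qed
qed

text \<open>A critical point comes with some Frechet derivative L, not with the explicit one. Along
  s v with v tangent, L vanishes; comparing the two expansions, dividing by s and letting s and then
  \<epsilon> tend to 0 shows that the explicit derivative vanishes too.\<close>

lemma constrained_critical_multiplier:
  assumes r: "rep Z z K" and \<rho>: "\<rho> > 0" and crit: "constrained_critical_point VV \<rho> Z"
  shows "l2sq z = \<rho>\<^sup>2" and "\<exists>lam. \<forall>v H. sob v H \<longrightarrow> dE z K v H = lam * mform z v"
proof -
  obtain L where m: "Z \<in> mass_sphere \<rho>" and L: "energy_has_derivative VV Z L"
    and tangent: "\<And>\<phi>. \<phi> \<in> H1 \<Longrightarrow> (LINT x|lebesgue. Z x * \<phi> x) = 0 \<Longrightarrow> L \<phi> = 0"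
    using crit by (auto simp: constrained_critical_point_def)
  show z: "l2sq z = \<rho>\<^sup>2" using m rep_mass_sphere[OF r] by simp
  note S = rep_sob[OF r]
  have zero: "dE z K v H = 0" if T: "sob v H" and o: "mform z v = 0" for v H
  proof -
    define n where "n = sqrt (l2sq H + l2sq v)"
    have n0: "n \<ge> 0" by (simp add: n_def)
    have n2: "l2sq H + l2sq v = n\<^sup>2" by (simp add: n_def)
    obtain C where C: "C > 0" "\<And>v H. sob v H \<Longrightarrow> l2sq H + l2sq v \<le> 1 \<Longrightarrow>
        \<bar>EE (\<lambda>x. z x + v x) (\<lambda>x. K x + H x) - EE z K - dE z K v H\<bar> \<le> C * (l2sq H + l2sq v)"
      using energy_remainder[OF S] by auto
    have "\<bar>dE z K v H\<bar> \<le> \<epsilon> * n" if \<epsilon>: "\<epsilon> > 0" for \<epsilon>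
    proof -
      obtain \<delta> where \<delta>: "\<delta> > 0" "\<And>\<phi>. \<phi> \<in> H1 \<Longrightarrow> H1_norm \<phi> < \<delta> \<Longrightarrow>
          \<bar>energy VV (\<lambda>x. Z x + \<phi> x) - energy VV Z - L \<phi>\<bar> \<le> \<epsilon> * H1_norm \<phi>"
        using L \<epsilon> unfolding energy_has_derivative_def by blast
      have nlim: "(\<lambda>k. step k * n) \<longlonglongrightarrow> 0" using tendsto_mult_right[OF step_tendsto, of n] by simp
      have "\<forall>\<^sub>F k in sequentially. \<bar>dE z K v H\<bar> \<le> \<epsilon> * n + step k * (C * n\<^sup>2)"
        using order_tendstoD(2)[OF nlim \<delta>(1)] order_tendstoD(2)[OF nlim zero_less_one]
      proof eventually_elim
        case (elim k)
        define s where "s = step k"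
        have s: "s > 0" by (simp add: s_def)
        note rs = rep_scale[OF sob_rep[OF T], of s]
        have nn: "l2sq (\<lambda>x. s *\<^sub>R H x) + l2sq (\<lambda>x. s * v x) = (s * n)\<^sup>2"
          unfolding l2sq_scale l2sq_cmult power_mult_distrib n2[symmetric] by (simp add: algebra_simps)
        have hn: "H1_norm (\<lambda>x. s * v x) = s * n" unfolding rep_H1_norm[OF rs] nn using s n0 by simp
        have "(s * n)\<^sup>2 \<le> 1" using elim s n0 unfolding s_def by (intro power_le_one) auto
        then have 1: "\<bar>EE (\<lambda>x. z x + s * v x) (\<lambda>x. K x + s *\<^sub>R H x) - EE z K - s * dE z K v H\<bar> \<le> C * (s * n)\<^sup>2"
          using C(2)[OF rep_sob[OF rs]] unfolding nn dE_scale by simp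
        have "(LINT x|lebesgue. Z x * (s * v x)) = 0" unfolding rep_mform[OF r rs] mform_scale o by simp
        from tangent[OF rep_H1[OF rs] this] have "L (\<lambda>x. s * v x) = 0" .
        then have 2: "\<bar>EE (\<lambda>x. z x + s * v x) (\<lambda>x. K x + s *\<^sub>R H x) - EE z K\<bar> \<le> \<epsilon> * (s * n)"
          using \<delta>(2)[OF rep_H1[OF rs]] elim(1)[folded s_def] unfolding hn rep_energy[OF rep_add[OF r rs]] rep_energy[OF r] by simp
        have "\<bar>s * dE z K v H\<bar> \<le> \<epsilon> * (s * n) + C * (s * n)\<^sup>2" using 1 2 by linarith
        then have "s * \<bar>dE z K v H\<bar> \<le> s * (\<epsilon> * n + s * (C * n\<^sup>2))"
          using s by (simp add: abs_mult power_mult_distrib power2_eq_square algebra_simps)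
        then show ?case using s by (simp add: s_def)
      qed
      moreover have "(\<lambda>k. \<epsilon> * n + step k * (C * n\<^sup>2)) \<longlonglongrightarrow> \<epsilon> * n + 0 * (C * n\<^sup>2)"
        by (intro tendsto_intros step_tendsto)
      ultimately show ?thesis using tendsto_lowerbound[of _ "\<epsilon> * n" sequentially "\<bar>dE z K v H\<bar>"] by simp
    qed
    note le = this
    have "\<bar>dE z K v H\<bar> \<le> 0 + e" if e: "e > 0" for e
    proof -
      have "\<bar>dE z K v H\<bar> \<le> e / (n + 1) * n" using e n0 by (intro le divide_pos_pos) auto
      also have "... \<le> e" using e n0 by (simp add: field_simps)
      finally show ?thesis by simp
    qed
    from field_le_epsilon[OF this] show ?thesis by simp
  qed
  show "\<exists>lam. \<forall>v H. sob v H \<longrightarrow> dE z K v H = lam * mform z v"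
  proof (intro exI allI impI)
    fix v :: "'a \<Rightarrow> real" and H assume "sob v H"
    then show "dE z K v H = dE z K z K / l2sq z * mform z v" using z \<rho> by (intro Lagrange_multiplier[OF S _ zero]) auto
  qed
qed

theorem normalized_solutions:
  assumes adW: "admissible (\<lambda>x. (V x * norm x)\<^sup>2)" and f: "sob f F" "l2sq f = 1" "l2sq F + QV f f < 0"
  shows "\<exists>\<rho>\<^sub>1>0. \<forall>\<rho>. 0 < \<rho> \<and> \<rho> < \<rho>\<^sub>1 \<longrightarrow> (\<exists>U lam. U \<in> mass_sphere \<rho> \<and> weak_solution VV lam U \<and>
    local_minimizer VV \<rho> U \<and> energy VV U < 0 \<and> lam < 0 \<and> (AE x in lebesgue. U x > 0) \<and> normalized_ground_state VV \<rho> U)"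
proof -
  obtain R0 C0 where reg: "region R0 C0" using region_exists by blast
  then have R0: "R0 > 0" "C0 > 0" by (auto simp: region_def)
  obtain C where C: "C > 0" and Cb: "\<And>Z K lam. sob Z K \<Longrightarrow> (\<And>v H. sob v H \<Longrightarrow> dE Z K v H = lam * mform Z v) \<Longrightarrow>
      EE Z K < 0 \<Longrightarrow> l2sq K \<le> C * l2sq Z" using critical_gradient_bound[OF adW] by metis
  \<comment> \<open>Three smallness conditions on \<rho>^2: the minimizer is interior, the scaled
    negative direction \<open>f\<close> lies in the region, and critical points of negative energy
    lie in the region.\<close>
  define m where "m = min (R0 / C0) (min (R0 / (l2sq F + 1)) (R0 / C))"
  have F1: "l2sq F + 1 > 0" using l2sq_nonneg[of F] by linarith
  have m: "m > 0" using R0 C F1 by (simp add: m_def)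
  show ?thesis
  proof (intro exI[of _ "sqrt m"] conjI allI impI)
    show "0 < sqrt m" using m by simp
    fix \<rho> :: real assume "0 < \<rho> \<and> \<rho> < sqrt m"
    then have \<rho>: "\<rho> > 0" and "\<rho>\<^sup>2 < m" using real_less_rsqrt real_sqrt_less_iff[of "\<rho>\<^sup>2" m] by auto
    then have "\<rho>\<^sup>2 < R0 / C0" "\<rho>\<^sup>2 < R0 / (l2sq F + 1)" "\<rho>\<^sup>2 < R0 / C" by (auto simp: m_def)
    then have s: "C0 * \<rho>\<^sup>2 < R0" "\<rho>\<^sup>2 * (l2sq F + 1) < R0" "C * \<rho>\<^sup>2 < R0" using R0 C F1 by (auto simp: field_simps)
    have \<rho>2: "\<rho>\<^sup>2 > 0" using \<rho> by simp
    have "EE (\<lambda>x. \<rho> * f x) (\<lambda>x. \<rho> *\<^sub>R F x) < 0"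
    proof -
      have "QV (\<lambda>x. \<rho> * f x) (\<lambda>x. \<rho> * f x) = \<rho>\<^sup>2 * QV f f"
        by (simp add: QV_def power2_eq_square mult_ac flip: integral_mult_right_zero)
      moreover have "\<rho>\<^sup>2 * (l2sq F + QV f f) < 0" using f(3) \<rho>2 by (simp add: mult_pos_neg)
      moreover have "PP (\<lambda>x. \<rho> * f x) / p \<ge> 0" using PP_nonneg p2 by simp
      ultimately show ?thesis by (simp add: EE_def l2sq_scale algebra_simps)
    qed
    moreover have "l2sq (\<lambda>x. \<rho> *\<^sub>R F x) \<le> R0" using s(2) \<rho>2 unfolding l2sq_scale distrib_left by linarith
    ultimately obtain U0 G0 where "minimizer R0 C0 \<rho> U0 G0" using minimizer_exists[OF reg \<rho> s(1) sob_scale[OF f(1), of \<rho>]] f(2)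
      unfolding l2sq_cmult by auto
    from minimizer_abs[OF this] obtain U G where M: "minimizer R0 C0 \<rho> U G" and nn: "\<And>x. U x \<ge> 0" by force
    note S = minimizerD(1)[OF M] and U = minimizerD(2-4)[OF M]
    have min: "\<And>w K. sob w K \<Longrightarrow> l2sq K \<le> R0 \<Longrightarrow> l2sq w = \<rho>\<^sup>2 \<Longrightarrow> EE U G \<le> EE w K"
      using minimizerD(5)[OF M] \<rho> by (metis div_self mult.right_neutral order.refl power_not_zero less_irrefl)
    obtain lam where lam: "lam < 0" and crit: "\<And>v H. sob v H \<Longrightarrow> dE U G v H = lam * mform U v"
      using minimizer_critical[OF M \<rho> s(1)] by blast
    note r = sob_rep[OF S]
    have mass: "U \<in> mass_sphere \<rho>" using rep_mass_sphere[OF r] U by simp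
    have "local_minimizer VV \<rho> U" unfolding local_minimizer_def
    \<comment> \<open>The distance in gradient norm from the a priori bound of U to the boundary of
      the region, so this H^1 neighbourhood stays in the region.\<close>
    proof (intro conjI exI[of _ "sqrt R0 - sqrt (C0 * \<rho>\<^sup>2)"] ballI impI)
      show "sqrt R0 - sqrt (C0 * \<rho>\<^sup>2) > 0" using s(1) by simp
      fix Z :: "'a \<Rightarrow> real" assume Z: "Z \<in> mass_sphere \<rho>" and d: "H1_norm (\<lambda>x. Z x - U x) < sqrt R0 - sqrt (C0 * \<rho>\<^sup>2)"
      obtain z K where z: "rep Z z K" using rep_exists[of Z] Z unfolding mass_sphere_def by blast
      have "sqrt (l2sq (\<lambda>x. K x - G x)) \<le> H1_norm (\<lambda>x. Z x - U x)" unfolding rep_H1_norm[OF rep_diff[OF z r]] by simp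
      moreover have "sqrt (l2sq K) \<le> sqrt (l2sq (\<lambda>x. K x - G x)) + sqrt (l2sq G)"
        using l2sq_add[OF l2_diff[OF sob_l2(2)[OF rep_sob[OF z]] sob_l2(2)[OF S]] sob_l2(2)[OF S]] by simp
      moreover have "sqrt (l2sq G) \<le> sqrt (C0 * \<rho>\<^sup>2)" using U by simp
      ultimately have "sqrt (l2sq K) \<le> sqrt R0" using d by linarith
      then show "energy VV U \<le> energy VV Z"
        unfolding rep_energy[OF z] rep_energy[OF r] using Z rep_mass_sphere[OF z] by (intro min rep_sob[OF z]) auto
    qed (rule mass)
    moreover have "normalized_ground_state VV \<rho> U" unfolding normalized_ground_state_def
    proof
      show c: "constrained_critical_point VV \<rho> U" unfolding constrained_critical_point_def
      proof (intro conjI exI[of _ "dEl U"] ballI impI mass energy_has_derivative_dEl[OF r])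
        fix \<phi> :: "'a \<Rightarrow> real" assume "\<phi> \<in> H1" and o: "(LINT x|lebesgue. U x * \<phi> x) = 0"
        then obtain v H where v: "rep \<phi> v H" using rep_exists by meson
        show "dEl U \<phi> = 0" using crit[OF rep_sob[OF v]] o unfolding rep_dEl[OF r v] rep_mform[OF r v] by simp
      qed
      have "energy VV U \<le> energy VV Z" if Z: "constrained_critical_point VV \<rho> Z" for Z
      proof -
        have "Z \<in> H1" using Z by (simp add: constrained_critical_point_def mass_sphere_def)
        then obtain z K where z: "rep Z z K" using rep_exists by meson
        obtain \<mu> where \<mu>: "\<And>v H. sob v H \<Longrightarrow> dE z K v H = \<mu> * mform z v"
          using constrained_critical_multiplier(2)[OF z \<rho> Z] by blast
        note zm = constrained_critical_multiplier(1)[OF z \<rho> Z]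
        show ?thesis
        \<comment> \<open>Critical points of nonnegative energy lie above U, whose energy is
          negative; only the others need the a priori bound.\<close>
        proof (cases "EE z K < 0")
          case True
          then have "l2sq K \<le> R0" using Cb[OF rep_sob[OF z] \<mu>] s(3) zm by simp
          then show ?thesis unfolding rep_energy[OF z] rep_energy[OF r] by (intro min rep_sob[OF z] zm)
        qed (use U in \<open>simp add: rep_energy[OF z] rep_energy[OF r]\<close>)
      qed
      then show "ereal (energy VV U) = (INF Z\<in>{Z. constrained_critical_point VV \<rho> Z}. ereal (energy VV Z))"
        using c by (intro antisym INF_greatest INF_lower) auto
    qed
    moreover have "AE x in lebesgue. U x > 0" using AE_completion[OF critical_positive[OF S nn _ crit]] U \<rho>2 by simp
    moreover have "energy VV U < 0" using U by (simp add: rep_energy[OF r])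
    ultimately show "\<exists>U lam. U \<in> mass_sphere \<rho> \<and> weak_solution VV lam U \<and>
        local_minimizer VV \<rho> U \<and> energy VV U < 0 \<and> lam < 0 \<and> (AE x in lebesgue. U x > 0) \<and> normalized_ground_state VV \<rho> U"
      using mass weak_solutionI[OF r crit] lam by blast
  qed
qed

end

theorem corollary1p5:
  fixes V :: "'a::euclidean_space \<Rightarrow> real" and r1 r2 :: real
  assumes "DIM('a) \<ge> 3"
    and "real DIM('a) / 2 < r1" and "V \<in> Lp r1"
    and "real DIM('a) < r2" and "(\<lambda>x. V x * norm x) \<in> Lp r2"
    and "(INF \<phi>\<in>{\<phi> \<in> H1. (LINT x|lebesgue. (\<phi> x)\<^sup>2) = 1}.
            ereal (LINT x|lebesgue. (norm (weak_gradient \<phi> x))\<^sup>2 + V x * (\<phi> x)\<^sup>2)) < 0"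
  shows "\<exists>\<rho>\<^sub>1 \<rho>\<^sub>2. 0 < \<rho>\<^sub>2 \<and> \<rho>\<^sub>2 \<le> \<rho>\<^sub>1 \<and>
    (\<forall>\<rho>. 0 < \<rho> \<and> \<rho> < \<rho>\<^sub>1 \<longrightarrow>
      (\<exists>U lam. U \<in> mass_sphere \<rho> \<and> weak_solution V lam U \<and>
         local_minimizer V \<rho> U \<and> energy V U < 0 \<and> lam < 0 \<and>
         (AE x in lebesgue. U x > 0) \<and>
         (\<rho> < \<rho>\<^sub>2 \<longrightarrow> normalized_ground_state V \<rho> U)))"
proof -
  obtain V0 where mV0[measurable]: "V0 \<in> borel_measurable borel" and V0: "AE x in lebesgue. V x = V0 x"
    using borel_representative[of V] assms(3) unfolding Lp_def by blast
  have adV: "admissible (\<lambda>x. \<bar>V0 x\<bar>)"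
  proof (rule admissible_powr[where r = r1])
    have "AE x in lebesgue. norm (V x) powr r1 = \<bar>V0 x\<bar> powr r1" using V0 by eventually_elim simp
    from lebesgue_borel_integral(2)[OF _ this] show "integrable lborel (\<lambda>x. \<bar>V0 x\<bar> powr r1)" using assms(3) by (simp add: Lp_def)
  qed (use assms(2) in auto)
  \<comment> \<open>W enters through its square, so the admissible exponent is r2/2, which exceeds
    N/2.\<close>
  have adW: "admissible (\<lambda>x. (V0 x * norm x)\<^sup>2)"
  proof (rule admissible_powr[where r = "r2 / 2"])
    have sq: "(a\<^sup>2) powr (r2 / 2) = \<bar>a\<bar> powr r2" for a :: real
    proof (cases "a = 0")
      case False
      then have "a\<^sup>2 = \<bar>a\<bar> powr 2" by (simp add: powr_numeral)
      then show ?thesis by (simp only: powr_powr) simp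
    qed simp
    have "AE x in lebesgue. norm (V x * norm x) powr r2 = ((V0 x * norm x)\<^sup>2) powr (r2 / 2)" unfolding sq using V0 by eventually_elim simp
    from lebesgue_borel_integral(2)[OF _ this] show "integrable lborel (\<lambda>x. ((V0 x * norm x)\<^sup>2) powr (r2 / 2))"
      using assms(5) by (simp add: Lp_def)
  qed (use assms(4) in auto)
  interpret schrod_H1 "TYPE('a)" "sobolev_exponent DIM('a)" V0 V by standard (use assms(1) adV V0 in auto)
  \<comment> \<open>A negative infimum gives one function with negative quadratic form; it supplies
    a comparison state for every small mass.\<close>
  from assms(6) obtain \<phi> where \<phi>: "\<phi> \<in> H1" "(LINT x|lebesgue. (\<phi> x)\<^sup>2) = 1"
      "(LINT x|lebesgue. (norm (weak_gradient \<phi> x))\<^sup>2 + V x * (\<phi> x)\<^sup>2) < 0" unfolding INF_less_iff by auto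
  obtain f F where f: "rep \<phi> f F" using rep_exists[OF \<phi>(1)] by blast
  note S = rep_sob[OF f]
  have "(LINT x|lebesgue. (norm (weak_gradient \<phi> x))\<^sup>2 + V x * (\<phi> x)\<^sup>2) = (LBINT x. (norm (F x))\<^sup>2 + V0 x * f x * f x)"
  proof (rule lebesgue_borel_integral(1))
    show "(\<lambda>x. (norm (F x))\<^sup>2 + V0 x * f x * f x) \<in> borel_measurable borel" using rep_measurable[OF f] by simp
    show "AE x in lebesgue. (norm (weak_gradient \<phi> x))\<^sup>2 + V x * (\<phi> x)\<^sup>2 = (norm (F x))\<^sup>2 + V0 x * f x * f x"
      using rep_AE[OF f] V0 by eventually_elim (simp add: power2_eq_square)
  qed
  also have "... = l2sq F + QV f f" unfolding l2sq_def QV_def using l2_square_integrable[OF sob_l2(2)[OF S]] QV_integrable[OF S S] by simp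
  finally have neg: "l2sq F + QV f f < 0" using \<phi>(3) by simp
  have "l2sq f = 1" using \<phi>(2) rep_square[OF f] by simp
  from normalized_solutions[OF adW S this neg] show ?thesis
  proof (elim exE conjE)
    fix \<rho>\<^sub>1 :: real
    assume "\<rho>\<^sub>1 > 0" and "\<forall>\<rho>. 0 < \<rho> \<and> \<rho> < \<rho>\<^sub>1 \<longrightarrow> (\<exists>U lam. U \<in> mass_sphere \<rho> \<and> weak_solution V lam U \<and>
      local_minimizer V \<rho> U \<and> energy V U < 0 \<and> lam < 0 \<and> (AE x in lebesgue. U x > 0) \<and> normalized_ground_state V \<rho> U)"
    \<comment> \<open>Both thresholds are taken equal, because the minimizers obtained are already
      ground states.\<close>
    then show ?thesis by (intro exI[of _ \<rho>\<^sub>1]) blast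
  qed
qed

end
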